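(* Fix integers $q\ge 4$ and $L>q$. There exists $n_0=n_0(q,L)$ such that, for every $n\ge n_0$, \[ \operatorname{ex}\bigl(n,C_q,\mathcal C_{\ge L+1}\bigr)=N\bigl(C_q,H(n,L)\bigr). \] Moreover, the same equality holds (for all sufficiently large $n$) when $q\ge 6$ is even and $L=q$.
   Context: All graphs are finite and simple. $C_\ell$ is the cycle with $\ell$ vertices. For graphs $T,G$, $N(T,G)$ is the number of unlabeled copies of $T$ in $G$, i.e. the number of subgraphs of $G$ isomorphic to $T$. For a family $\mathcal F$ of graphs, $\operatorname{ex}(n,T,\mathcal F)$ is the maximum of $N(T,G)$ over all $n$-vertex graphs $G$ that contain no subgraph isomorphic to a member of $\mathcal F$. Put $\mathcal C_{\ge L}=\{C_\ell:\ell\ge L\}$; so a graph is $\mathcal C_{\ge L+1}$-free if and only if it has no cycle of length at least $L+1$ (circumference at most $L$). For $L\ge 2$ put $a=\lfloor L/2\rfloor$ and define \[ H(n,L)=\begin{cases}K_a\vee\overline{K}_{n-a},&L=2a,\\ K_a\vee(\overline{K}_{n-a}+e),&L=2a+1,\end{cases} \] where $\vee$ denotes the join, $\overline{K}_{m}$ is the edgeless graph on $m$ vertices, and $\overline{K}_{n-a}+e$ is $\overline{K}_{n-a}$ with one edge $e$ added. *)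

theory Defs
  imports Main
begin

datatype 'a sgraph = SGraph (verts: "'a set") (edges: "'a set set")

definition simple_graph :: "'a sgraph \<Rightarrow> bool" where
  "simple_graph G \<longleftrightarrow> finite (verts G) \<and> (\<forall>e\<in>edges G. e \<subseteq> verts G \<and> card e = 2)"

definition subgraph :: "'a sgraph \<Rightarrow> 'a sgraph \<Rightarrow> bool" where
  "subgraph S G \<longleftrightarrow> simple_graph S \<and> verts S \<subseteq> verts G \<and> edges S \<subseteq> edges G"

definition isomorphic :: "'a sgraph \<Rightarrow> 'b sgraph \<Rightarrow> bool" where
  "isomorphic G H \<longleftrightarrow>
     (\<exists>f. bij_betw f (verts G) (verts H) \<and>
          (\<forall>u\<in>verts G. \<forall>v\<in>verts G. {u, v} \<in> edges G \<longleftrightarrow> {f u, f v} \<in> edges H))"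

definition copies :: "'t sgraph \<Rightarrow> 'a sgraph \<Rightarrow> 'a sgraph set" where
  "copies T G = {S. subgraph S G \<and> isomorphic S T}"

definition num_copies :: "'t sgraph \<Rightarrow> 'a sgraph \<Rightarrow> nat" where
  "num_copies T G = card (copies T G)"

definition family_free :: "'f sgraph set \<Rightarrow> 'a sgraph \<Rightarrow> bool" where
  "family_free \<F> G \<longleftrightarrow> (\<forall>F\<in>\<F>. copies F G = {})"

(* Every finite graph has an isomorphic copy on natural numbers, so taking host
   graphs of type nat sgraph is no restriction. *)
definition gen_ex :: "nat \<Rightarrow> 't sgraph \<Rightarrow> 'f sgraph set \<Rightarrow> nat" where
  "gen_ex n T \<F> =
     Max {num_copies T G | G :: nat sgraph.
            simple_graph G \<and> card (verts G) = n \<and> family_free \<F> G}"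

(* The cycle C_l; meaningful for l >= 3 only. *)
definition cycle_graph :: "nat \<Rightarrow> nat sgraph" where
  "cycle_graph l = SGraph {..<l} {{i, Suc i mod l} | i. i < l}"

definition cycles_ge :: "nat \<Rightarrow> nat sgraph set" where
  "cycles_ge L = {cycle_graph l | l. L \<le> l}"

definition complete_graph :: "nat \<Rightarrow> nat sgraph" where
  "complete_graph m = SGraph {..<m} {e. e \<subseteq> {..<m} \<and> card e = 2}"

definition empty_graph :: "nat \<Rightarrow> nat sgraph" where
  "empty_graph m = SGraph {..<m} {}"

definition add_edge :: "'a sgraph \<Rightarrow> 'a \<Rightarrow> 'a \<Rightarrow> 'a sgraph" where
  "add_edge G u v = SGraph (verts G) (insert {u, v} (edges G))"

definition join :: "'a sgraph \<Rightarrow> 'b sgraph \<Rightarrow> ('a + 'b) sgraph" where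
  "join G H = SGraph (verts G <+> verts H)
     ((`) Inl ` edges G \<union> (`) Inr ` edges H \<union>
      {{Inl u, Inr v} | u v. u \<in> verts G \<and> v \<in> verts H})"

(* The intended range is n >= L div 2 for even L and n >= L div 2 + 2 for odd L;
   for smaller n the added edge {0, 1} has no room. *)
definition extremal_graph :: "nat \<Rightarrow> nat \<Rightarrow> (nat + nat) sgraph" where
  "extremal_graph n L =
     (let a = L div 2 in
      if even L then join (complete_graph a) (empty_graph (n - a))
      else join (complete_graph a) (add_edge (empty_graph (n - a)) 0 1))"

lemma simple_graph_extremal_graph:
  assumes "L div 2 + 2 \<le> n"
  shows "simple_graph (extremal_graph n L)" and "card (verts (extremal_graph n L)) = n"
proof -
  have inl: "card (Inl ` e :: (nat + nat) set) = card e" for e by (simp add: card_image)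
  show "simple_graph (extremal_graph n L)"
    using assms
    by (auto simp: simple_graph_def extremal_graph_def join_def complete_graph_def
        empty_graph_def add_edge_def Let_def inl)
  show "card (verts (extremal_graph n L)) = n"
    using assms
    by (simp add: extremal_graph_def join_def complete_graph_def empty_graph_def
        add_edge_def Let_def card_Plus)
qed

lemma simple_graph_cycle_graph:
  assumes "3 \<le> l"
  shows "simple_graph (cycle_graph l)"
proof -
  have "Suc i mod l \<noteq> i" if "i < l" for i
    using that assms by (cases "Suc i = l") auto
  then have "card {i, Suc i mod l} = 2" if "i < l" for i
    using that by (metis card_2_iff)
  then show ?thesis
    using assms by (fastforce simp: simple_graph_def cycle_graph_def)
qed

(* The maximum defining gen_ex n T F is taken over a finite set; for F = cycles_ge L
   with L >= 3 the set is moreover nonempty. *)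
lemma finite_gen_ex_set:
  "finite {num_copies T G | G :: nat sgraph.
            simple_graph G \<and> card (verts G) = n \<and> family_free \<F> G}"
proof (rule finite_subset)
  show "{num_copies T G | G :: nat sgraph.
            simple_graph G \<and> card (verts G) = n \<and> family_free \<F> G} \<subseteq> {..2 ^ n * 2 ^ 2 ^ n}"
  proof clarsimp
    fix G :: "nat sgraph"
    assume G: "simple_graph G" "n = card (verts G)"
    let ?A = "Pow (verts G) \<times> Pow (Pow (verts G))"
    have fin: "finite (verts G)" using G by (simp add: simple_graph_def)
    have sub: "copies T G \<subseteq> (\<lambda>(V, E). SGraph V E) ` ?A"
    proof
      fix S assume "S \<in> copies T G"
      then have "(verts S, edges S) \<in> ?A"
        by (auto simp: copies_def subgraph_def simple_graph_def)
      then have "(\<lambda>(V, E). SGraph V E) (verts S, edges S) \<in> (\<lambda>(V, E). SGraph V E) ` ?A"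
        by (rule imageI)
      then show "S \<in> (\<lambda>(V, E). SGraph V E) ` ?A" by simp
    qed
    have "num_copies T G \<le> card ((\<lambda>(V, E). SGraph V E) ` ?A)"
      unfolding num_copies_def using sub fin by (intro card_mono) auto
    also have "\<dots> \<le> card ?A" using fin by (intro card_image_le) auto
    also have "\<dots> = 2 ^ card (verts G) * 2 ^ 2 ^ card (verts G)"
      using fin by (simp add: card_cartesian_product card_Pow)
    finally show "num_copies T G \<le> 2 ^ card (verts G) * 2 ^ 2 ^ card (verts G)" .
  qed
qed simp

lemma family_free_empty_graph:
  assumes "3 \<le> L"
  shows "family_free (cycles_ge L) (empty_graph n)"
  unfolding family_free_def cycles_ge_def
proof clarify
  fix l assume l: "L \<le> l"
  show "copies (cycle_graph l) (empty_graph n) = {}"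
  proof (rule equals0I)
    fix S assume "S \<in> copies (cycle_graph l) (empty_graph n)"
    then have E: "edges S = {}" and "isomorphic S (cycle_graph l)"
      by (simp_all add: copies_def subgraph_def empty_graph_def)
    then obtain f where f: "bij_betw f (verts S) (verts (cycle_graph l))"
      and iso: "\<forall>u\<in>verts S. \<forall>v\<in>verts S. {u, v} \<in> edges S \<longleftrightarrow> {f u, f v} \<in> edges (cycle_graph l)"
      unfolding isomorphic_def by blast
    have "f ` verts S = {..<l}" using f by (simp add: bij_betw_def cycle_graph_def)
    then have "0 \<in> f ` verts S" "1 \<in> f ` verts S"
      using l assms by simp_all
    then obtain u v where uv: "u \<in> verts S" "v \<in> verts S" "f u = 0" "f v = 1" by auto
    have "{0, 1} \<in> edges (cycle_graph l)"
      using l assms by (force simp: cycle_graph_def)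
    then show False using iso uv E by (metis empty_iff)
  qed
qed

end

theory Submission
  imports Defs Complex_Main
begin

text \<open>
  A copy of \<open>C\<^sub>q\<close> is counted through the closed lists that run around it: every copy carries the same number
  of rooted and directed lists \<open>v\<^sub>0, \<dots>, v\<^bsub>q-1\<^esub>\<close> with consecutive entries adjacent (\<open>num_copies_cycs\<close>), so the
  claim is that a graph of circumference at most \<open>L\<close> on many vertices has at most as many closed lists as
  \<open>H(n,L)\<close> (\<open>gen_ex_eq\<close>). Write \<open>a = L div 2\<close> and \<open>q = 2r\<close> or \<open>q = 2r + 1\<close>; then \<open>H(n,L)\<close> has
  order \<open>n\<^sup>r\<close> closed lists, with a leading constant that comes from the lists alternating between the
  \<open>a\<close> dominating vertices and the rest. The proof is a stability argument followed by an exact comparison.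

  Stability. A longest-path argument shows that bounded circumference forces bounded degeneracy, so there are
  only linearly many edges and, for fixed \<open>m\<close>, only boundedly many vertices of degree at least \<open>n/m\<close>, the
  big ones. Ordering the vertices along the degeneracy order, one sees that all but a small fraction of
  \<open>n\<^sup>r\<close> closed lists step from big to small vertices \<open>r\<close> times (\<open>card_few_transitions\<close>), hence look like
  \<open>A B A B \<dots> A B\<close>, with one more entry if \<open>q\<close> is odd (\<open>card_cycs_le_pat\<close>). Fix the small vertices
  \<open>xs\<close> at all places but the last. Up to boundedly many exceptions, every \<open>x\<close> in \<open>xs\<close> has many twins, that is,
  small vertices with the same big neighbours, so the big neighbours of \<open>x\<close> can be joined to each other
  through fresh vertices as if they formed a clique. A chain of such cliques can be traversed completely,
  visiting every vertex of its union \<open>U\<close>, and closes with a further path outside to a cycle of length about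
  \<open>2|U|\<close> (\<open>close_chain\<close>). This limits \<open>U\<close> and the further paths, and leads to the bound that the number
  of completions of \<open>xs\<close> is at most that in \<open>H(n,L)\<close>, up to lower order terms, with equality only if \<open>U\<close> has
  \<open>a\<close> elements and almost every vertex is adjacent to all of \<open>U\<close> (\<open>even_stability\<close>, \<open>odd_stability\<close>).
  Averaging over \<open>xs\<close>, a graph with as many closed lists as \<open>H(n,L)\<close> contains a set \<open>S\<close> of \<open>a\<close> vertices to
  which almost all others are completely joined (\<open>stability\<close>).

  Comparison. Let \<open>W\<close> be the set of vertices outside \<open>S\<close> that are adjacent to all of \<open>S\<close>, let \<open>R\<close> be the rest,
  and let \<open>t = |R|\<close>. Since \<open>W\<close> is large, a path outside \<open>S\<close> between neighbours of different vertices of \<open>S\<close>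
  has at most one vertex, or two if \<open>L\<close> is odd (\<open>short_path\<close>). Identify \<open>S\<close> with the core of \<open>H(n,L)\<close> and,
  for odd \<open>L\<close>, its extra edge with an edge that forms such a path, if there is one. Every vertex of \<open>R\<close> misses a
  vertex of \<open>S\<close>, and this gives a family \<open>base\<close> of order \<open>t n\<^bsup>r-1\<^esup>\<close> of closed lists of \<open>H(n,L)\<close> that
  are absent from the graph. The lists of the graph that are absent from \<open>H(n,L)\<close> are of three kinds.
  Those meeting \<open>S\<close> in at most one vertex live on \<open>O(t)\<close> vertices, so there are only \<open>O(t\<^sup>r)\<close> of them
  (\<open>card_E1\<close>). The others use an exceptional edge outside \<open>S\<close>; there are \<open>O(t)\<close> such edges because each has an
  end in \<open>R\<close> that lies on no other one (\<open>outer_pairs_pendant\<close>). All but one type of these lists have at most \<open>r - 2\<close>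
  further free places (\<open>card_Zf\<close>). In the remaining type, exactly \<open>r\<close> vertices of \<open>S\<close> are used and \<open>q\<close> is odd;
  then replacing one end of the exceptional edge by an unused vertex of \<open>S\<close> maps such lists injectively to lists
  of \<open>H(n,L)\<close> that are absent from the graph and not in \<open>base\<close> (\<open>inj_\<Phi>\<close>, \<open>gains\<close>). As \<open>t\<close> is
  small compared with \<open>n\<close>, the losses outweigh the gains.
\<close>

section \<open>Closed lists and copies of cycles\<close>

text \<open>A cycle of a graph as a list: rooted and directed, so that each cycle of length \<open>q\<close> appears \<open>2q\<close> times.\<close>

definition cyc :: "('a \<Rightarrow> 'a \<Rightarrow> bool) \<Rightarrow> 'a list \<Rightarrow> bool" where
  "cyc adj vs \<longleftrightarrow> 3 \<le> length vs \<and> distinct vs \<and> successively adj vs \<and> adj (last vs) (hd vs)"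

definition cycs :: "nat \<Rightarrow> ('a \<Rightarrow> 'a \<Rightarrow> bool) \<Rightarrow> 'a list set" where
  "cycs q adj = {vs. cyc adj vs \<and> length vs = q}"

definition gadj :: "'a sgraph \<Rightarrow> 'a \<Rightarrow> 'a \<Rightarrow> bool" where
  "gadj G u v \<longleftrightarrow> {u, v} \<in> edges G"

lemma cyc_nth:
  "cyc adj vs \<longleftrightarrow> 3 \<le> length vs \<and> distinct vs \<and>
     (\<forall>i<length vs. adj (vs ! i) (vs ! (Suc i mod length vs)))"
proof (cases "3 \<le> length vs")
  case True
  then have ne: "vs \<noteq> []" by auto
  have "(\<forall>i<length vs. adj (vs ! i) (vs ! (Suc i mod length vs))) \<longleftrightarrow>
     (\<forall>i. Suc i < length vs \<longrightarrow> adj (vs ! i) (vs ! Suc i)) \<and> adj (vs ! (length vs - 1)) (vs ! 0)"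
    (is "?l \<longleftrightarrow> ?r")
  proof
    assume l: ?l
    have "adj (vs ! i) (vs ! Suc i)" if "Suc i < length vs" for i
    proof -
      have "Suc i mod length vs = Suc i" using that by simp
      then show ?thesis using l that by (metis Suc_lessD)
    qed
    moreover have "adj (vs ! (length vs - 1)) (vs ! 0)"
      using l[rule_format, of "length vs - 1"] True
      by (metis One_nat_def Suc_diff_1 diff_less length_greater_0_conv mod_self ne zero_less_one)
    ultimately show ?r by blast
  next
    assume r: ?r
    show ?l
    proof (intro allI impI)
      fix i assume i: "i < length vs"
      show "adj (vs ! i) (vs ! (Suc i mod length vs))"
      proof (cases "Suc i < length vs")
        case True then show ?thesis using r by simp
      next
        case False
        then have "Suc i = length vs" "i = length vs - 1" using i by simp_all
        then show ?thesis using r by simp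
      qed
    qed
  qed
  then show ?thesis using ne
    by (auto simp: cyc_def successively_conv_nth last_conv_nth hd_conv_nth)
qed (auto simp: cyc_def)

lemma cyc_map:
  assumes "inj_on f (set vs)" "\<And>u v. u \<in> set vs \<Longrightarrow> v \<in> set vs \<Longrightarrow> adj u v \<Longrightarrow> adj' (f u) (f v)" "cyc adj vs"
  shows "cyc adj' (map f vs)"
proof -
  have l: "0 < length vs" using assms(3) by (auto simp: cyc_def)
  have "adj' (map f vs ! i) (map f vs ! (Suc i mod length (map f vs)))" if i: "i < length vs" for i
  proof -
    have m: "Suc i mod length vs < length vs" using l by simp
    then have "adj' (f (vs ! i)) (f (vs ! (Suc i mod length vs)))"
      using assms(2,3) i by (simp add: cyc_nth)
    then show ?thesis using i m by simp
  qed
  then show ?thesis using assms unfolding cyc_nth by (simp add: distinct_map)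
qed

lemma card_cycs_eq:
  assumes "bij_betw f V V'"
    and adj: "\<And>u v. u \<in> V \<Longrightarrow> v \<in> V \<Longrightarrow> adj u v \<longleftrightarrow> adj' (f u) (f v)"
    and in1: "\<And>u v. adj u v \<Longrightarrow> u \<in> V \<and> v \<in> V" and in2: "\<And>u v. adj' u v \<Longrightarrow> u \<in> V' \<and> v \<in> V'"
  shows "card (cycs q adj) = card (cycs q adj')"
proof -
  have sub: "set vs \<subseteq> V" if "cyc adj vs" for vs
  proof
    fix x assume "x \<in> set vs"
    then obtain i where "i < length vs" "x = vs ! i" by (metis in_set_conv_nth)
    then show "x \<in> V" using that in1 unfolding cyc_nth by metis
  qed
  have sub': "set vs \<subseteq> V'" if "cyc adj' vs" for vs
  proof
    fix x assume "x \<in> set vs"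
    then obtain i where "i < length vs" "x = vs ! i" by (metis in_set_conv_nth)
    then show "x \<in> V'" using that in2 unfolding cyc_nth by metis
  qed
  have fi: "inj_on f V" and fV: "f ` V = V'" using assms(1) by (auto simp: bij_betw_def)
  define g where "g = inv_into V f"
  have gf: "f (g y) = y" "g y \<in> V" if "y \<in> V'" for y
    using that fV unfolding g_def by (auto simp: f_inv_into_f inv_into_into)
  have "bij_betw (map f) (cycs q adj) (cycs q adj')"
  proof (rule bij_betw_imageI)
    show "inj_on (map f) (cycs q adj)"
    proof (rule inj_onI)
      fix xs ys assume a: "xs \<in> cycs q adj" "ys \<in> cycs q adj" "map f xs = map f ys"
      then have "set xs \<union> set ys \<subseteq> V" using sub unfolding cycs_def by blast
      then have "inj_on f (set xs \<union> set ys)" using fi inj_on_subset by blast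
      then show "xs = ys" using a(3) map_inj_on by blast
    qed
    show "map f ` cycs q adj = cycs q adj'"
    proof
      show "map f ` cycs q adj \<subseteq> cycs q adj'"
      proof
        fix ys assume "ys \<in> map f ` cycs q adj"
        then obtain xs where xs: "cyc adj xs" "length xs = q" "ys = map f xs" by (auto simp: cycs_def)
        have "cyc adj' (map f xs)" 
          apply (rule cyc_map[OF _ _ xs(1)])
          using sub[OF xs(1)] fi adj inj_on_subset by blast+
        then show "ys \<in> cycs q adj'" using xs by (simp add: cycs_def)
      qed
      show "cycs q adj' \<subseteq> map f ` cycs q adj"
      proof
        fix ys assume "ys \<in> cycs q adj'"
        then have ys: "cyc adj' ys" "length ys = q" by (auto simp: cycs_def)
        have gi: "inj_on g (set ys)" using gf sub'[OF ys(1)] by (metis inj_onI subsetD)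
        have "cyc adj (map g ys)"
          apply (rule cyc_map[OF gi _ ys(1)])
          using sub'[OF ys(1)] adj gf by (metis subsetD)
        moreover have "map f (map g ys) = ys" using sub'[OF ys(1)] gf by (simp add: map_idI subset_iff)
        ultimately show "ys \<in> map f ` cycs q adj" using ys by (metis (mono_tags, lifting) cycs_def image_eqI length_map mem_Collect_eq)
      qed
    qed
  qed
  then show ?thesis by (rule bij_betw_same_card)
qed

definition cedges :: "'a list \<Rightarrow> 'a set set" where
  "cedges vs = (\<lambda>i. {vs ! i, vs ! (Suc i mod length vs)}) ` {..<length vs}"

lemma cedges_upt: "cycle_graph q = SGraph (set [0..<q]) (cedges [0..<q])"
proof -
  have "{{i, Suc i mod q} | i. i < q} = (\<lambda>i. {i, Suc i mod q}) ` {..<q}" by auto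
  also have "\<dots> = cedges [0..<q]"
    unfolding cedges_def by (rule image_cong) auto
  finally show ?thesis by (simp add: cycle_graph_def atLeast_upt)
qed

lemma card_cedges:
  assumes "distinct vs" "3 \<le> length vs"
  shows "card (cedges vs) = length vs"
proof -
  let ?n = "length vs"
  have "inj_on (\<lambda>i. {vs ! i, vs ! (Suc i mod ?n)}) {..<?n}"
  proof (rule inj_onI)
    fix i j assume ij: "i \<in> {..<?n}" "j \<in> {..<?n}"
      "{vs ! i, vs ! (Suc i mod ?n)} = {vs ! j, vs ! (Suc j mod ?n)}"
    have "0 < ?n" using assms(2) by linarith
    then have m: "Suc i mod ?n < ?n" "Suc j mod ?n < ?n" by simp_all
    from ij have "{i, Suc i mod ?n} = {j, Suc j mod ?n}"
      using m assms(1) by (auto simp: doubleton_eq_iff nth_eq_iff_index_eq)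
    then show "i = j"
    proof (cases "i = j")
      case False
      have "i = Suc j mod ?n \<and> j = Suc i mod ?n"
        using False \<open>{i, Suc i mod ?n} = {j, Suc j mod ?n}\<close>
        unfolding doubleton_eq_iff by (elim disjE conjE) simp_all
      then have e: "i = Suc j mod ?n" "j = Suc i mod ?n" by blast+
      have ij': "i < ?n" "j < ?n" using ij by auto
      show ?thesis
      proof (cases "Suc i < ?n")
        case True
        then have "Suc i mod ?n = Suc i" by (rule mod_less)
        then have j: "j = Suc i" using e(2) by linarith
        show ?thesis
        proof (cases "Suc j < ?n")
          case True
          then have "Suc j mod ?n = Suc j" by (rule mod_less)
          then show ?thesis using e(1) j by linarith
        next
          case False
          then have n: "Suc j = ?n" using ij' by simp
          then have "i = 0" using e(1) by (metis mod_self)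
          then show ?thesis using n j assms(2) by linarith
        qed
      next
        case False
        then have n: "Suc i = ?n" using ij' by simp
        then have j: "j = 0" using e(2) by (metis mod_self)
        then have "i = Suc 0 mod ?n" using e(1) by blast
        also have "\<dots> = 1" using assms(2) by simp
        finally show ?thesis using n assms(2) by linarith
      qed
    qed
  qed
  then show ?thesis unfolding cedges_def by (simp add: card_image)
qed

lemma simple_graph_gadj:
  assumes "simple_graph G" "gadj G u v"
  shows "u \<in> verts G" "v \<in> verts G" "u \<noteq> v"
  using assms unfolding simple_graph_def gadj_def by fastforce+

lemma gadj_sym: "gadj G u v \<longleftrightarrow> gadj G v u"
  by (simp add: gadj_def insert_commute)

lemma cyc_gadj_iff:
  "cyc (gadj G) vs \<longleftrightarrow> 3 \<le> length vs \<and> distinct vs \<and> cedges vs \<subseteq> edges G"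
  unfolding cyc_nth gadj_def cedges_def by auto

lemma card_cycs_iso:
  assumes "simple_graph G" "simple_graph H" "isomorphic G H"
  shows "card (cycs q (gadj G)) = card (cycs q (gadj H))"
proof -
  obtain f where f: "bij_betw f (verts G) (verts H)"
    "\<forall>u\<in>verts G. \<forall>v\<in>verts G. {u, v} \<in> edges G \<longleftrightarrow> {f u, f v} \<in> edges H"
    using assms(3) unfolding isomorphic_def by blast
  show ?thesis
  proof (rule card_cycs_eq[OF f(1)])
    show "gadj G u v \<longleftrightarrow> gadj H (f u) (f v)" if "u \<in> verts G" "v \<in> verts G" for u v
      using f(2) that by (simp add: gadj_def)
    show "gadj G u v \<Longrightarrow> u \<in> verts G \<and> v \<in> verts G" for u v
      using simple_graph_gadj(1,2)[OF assms(1)] by blast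
    show "gadj H u v \<Longrightarrow> u \<in> verts H \<and> v \<in> verts H" for u v
      using simple_graph_gadj(1,2)[OF assms(2)] by blast
  qed
qed

lemma cyc_copy:
  assumes "simple_graph G" "vs \<in> cycs q (gadj G)"
  shows "SGraph (set vs) (cedges vs) \<in> copies (cycle_graph q) G"
proof -
  have vs: "3 \<le> q" "length vs = q" "distinct vs" "cedges vs \<subseteq> edges G"
    using assms(2) unfolding cycs_def cyc_gadj_iff by auto
  have ed: "\<forall>e\<in>cedges vs. e \<subseteq> set vs"
    using vs unfolding cedges_def by (auto simp: mod_less_divisor)
  have svG: "set vs \<subseteq> verts G"
  proof
    fix x assume "x \<in> set vs"
    then obtain i where i: "i < length vs" "x = vs ! i" by (metis in_set_conv_nth)
    then have "{x, vs ! (Suc i mod length vs)} \<in> edges G" using vs(4) unfolding cedges_def by auto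
    then show "x \<in> verts G" using assms(1) unfolding simple_graph_def by auto
  qed
  have sg: "subgraph (SGraph (set vs) (cedges vs)) G"
    using assms(1) vs ed svG unfolding subgraph_def simple_graph_def by auto
  have bij: "bij_betw ((!) vs) {..<q} (set vs)" using vs bij_betw_nth by blast
  define g where "g = inv_into {..<q} ((!) vs)"
  have gb: "bij_betw g (set vs) {..<q}" unfolding g_def using bij bij_betw_inv_into by blast
  have gv: "g (vs ! i) = i" if "i < q" for i
    unfolding g_def using bij that by (simp add: bij_betw_def inv_into_f_f)
  have "{u, v} \<in> cedges vs \<longleftrightarrow> {g u, g v} \<in> edges (cycle_graph q)" if uv: "u \<in> set vs" "v \<in> set vs" for u v
  proof -
    obtain i j where ij: "i < q" "j < q" "u = vs ! i" "v = vs ! j" using uv vs by (metis in_set_conv_nth)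
    have "{u, v} \<in> cedges vs \<longleftrightarrow> (\<exists>k<q. {vs ! i, vs ! j} = {vs ! k, vs ! (Suc k mod q)})"
      unfolding cedges_def ij using vs(2) by auto
    also have "\<dots> \<longleftrightarrow> (\<exists>k<q. {i, j} = {k, Suc k mod q})"
    proof -
      have "{vs ! i, vs ! j} = {vs ! k, vs ! (Suc k mod q)} \<longleftrightarrow> {i, j} = {k, Suc k mod q}" if "k < q" for k
        using that ij vs by (auto simp: doubleton_eq_iff nth_eq_iff_index_eq mod_less_divisor)
      then show ?thesis by auto
    qed
    also have "\<dots> \<longleftrightarrow> {g u, g v} \<in> edges (cycle_graph q)"
      using ij gv by (auto simp: cycle_graph_def)
    finally show ?thesis .
  qed
  then have "isomorphic (SGraph (set vs) (cedges vs)) (cycle_graph q)"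
    unfolding isomorphic_def using gb by (auto intro!: exI[of _ g] simp: cycle_graph_def)
  then show ?thesis using sg by (simp add: copies_def)
qed

text \<open>All edges of a copy lie on the cycle, because a copy has exactly as many edges as any closed list in it.\<close>

lemma copy_determined:
  assumes "3 \<le> q" "S \<in> copies (cycle_graph q) G" "vs \<in> cycs q (gadj S)"
  shows "S = SGraph (set vs) (cedges vs)"
proof -
  have vs: "length vs = q" "distinct vs" "cedges vs \<subseteq> edges S"
    using assms(3) unfolding cycs_def cyc_gadj_iff by auto
  have sS: "simple_graph S" and iso: "isomorphic S (cycle_graph q)"
    using assms(2) by (auto simp: copies_def subgraph_def)
  obtain f where f: "bij_betw f (verts S) (verts (cycle_graph q))"
    "\<forall>u\<in>verts S. \<forall>v\<in>verts S. {u, v} \<in> edges S \<longleftrightarrow> {f u, f v} \<in> edges (cycle_graph q)"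
    using iso unfolding isomorphic_def by blast
  have cv: "card (verts S) = q" using bij_betw_same_card[OF f(1)] by (simp add: cycle_graph_def)
  have finS: "finite (verts S)" using sS by (simp add: simple_graph_def)
  have svS: "set vs \<subseteq> verts S"
  proof
    fix x assume "x \<in> set vs"
    then obtain i where i: "i < length vs" "x = vs ! i" by (metis in_set_conv_nth)
    then have "{x, vs ! (Suc i mod length vs)} \<in> edges S" using vs unfolding cedges_def by auto
    then show "x \<in> verts S" using sS unfolding simple_graph_def by auto
  qed
  have V: "set vs = verts S"
    using svS cv finS vs distinct_card by (metis card_subset_eq)
  have inj: "inj_on (image f) (edges S)"
  proof (rule inj_onI)
    fix e e' assume "e \<in> edges S" "e' \<in> edges S" "f ` e = f ` e'"
    moreover have "e \<subseteq> verts S" "e' \<subseteq> verts S" using calculation sS by (auto simp: simple_graph_def)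
    moreover have "inj_on f (verts S)" using f(1) by (simp add: bij_betw_def)
    ultimately show "e = e'" by (metis inj_on_image_eq_iff)
  qed
  have im: "image f ` edges S \<subseteq> edges (cycle_graph q)"
  proof
    fix e' assume "e' \<in> image f ` edges S"
    then obtain e where e: "e \<in> edges S" "e' = f ` e" by auto
    have "e \<subseteq> verts S" "card e = 2" using e sS by (auto simp: simple_graph_def)
    then obtain u v where uv: "e = {u, v}" "u \<in> verts S" "v \<in> verts S"
      by (auto simp: card_2_iff)
    then show "e' \<in> edges (cycle_graph q)" using e f(2) by auto
  qed
  have fc: "finite (edges (cycle_graph q))" "card (edges (cycle_graph q)) = q"
    using card_cedges[of "[0..<q]"] assms(1) by (auto simp: cedges_upt cedges_def)
  have "card (edges S) \<le> q" using card_inj_on_le[OF inj im fc(1)] fc(2) by simp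
  moreover have "finite (edges S)" using inj im fc(1) by (meson finite_imageD finite_subset)
  moreover have "card (cedges vs) = q" using card_cedges vs assms(1) by metis
  ultimately have "cedges vs = edges S" using vs(3) by (metis card_seteq)
  then show ?thesis using V by (metis sgraph.collapse)
qed

text \<open>Each closed list spans exactly one copy, and the number of closed lists in a copy does not depend on the copy.\<close>

lemma num_copies_cycs:
  fixes G :: "'a sgraph"
  assumes "simple_graph G" "3 \<le> q"
  shows "num_copies (cycle_graph q) G * card (cycs q (gadj (cycle_graph q))) = card (cycs q (gadj G))"
    and "card (cycs q (gadj (cycle_graph q))) > 0"
proof -
  let ?C = "copies (cycle_graph q) G"
  let ?k = "card (cycs q (gadj (cycle_graph q)))"
  have sc: "simple_graph (cycle_graph q)" using assms(2) by (rule simple_graph_cycle_graph)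
  have finV: "finite (verts G)" using assms(1) by (simp add: simple_graph_def)
  have fcyc: "finite (cycs q (gadj K))" if "simple_graph K" for K :: "'b sgraph"
  proof (rule finite_subset)
    show "cycs q (gadj K) \<subseteq> {vs. set vs \<subseteq> verts K \<and> length vs = q}"
    proof
      fix vs assume a: "vs \<in> cycs q (gadj K)"
      have "x \<in> verts K" if "x \<in> set vs" for x
      proof -
        obtain i where "i < length vs" "x = vs ! i" using \<open>x \<in> set vs\<close> by (auto simp: in_set_conv_nth)
        then have "gadj K x (vs ! (Suc i mod length vs))" using a unfolding cycs_def cyc_nth by auto
        then show ?thesis by (rule simple_graph_gadj(1)[OF \<open>simple_graph K\<close>])
      qed
      then show "vs \<in> {vs. set vs \<subseteq> verts K \<and> length vs = q}" using a by (auto simp: cycs_def)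
    qed
    show "finite {vs. set vs \<subseteq> verts K \<and> length vs = q}"
      using that finite_lists_length_eq[of "verts K" q] by (simp add: simple_graph_def)
  qed
  have S1: "simple_graph S" "isomorphic S (cycle_graph q)" "edges S \<subseteq> edges G" if "S \<in> ?C" for S
    using that by (auto simp: copies_def subgraph_def)
  have finC: "finite ?C"
  proof (rule finite_subset)
    show "?C \<subseteq> (\<lambda>(V, E). SGraph V E) ` (Pow (verts G) \<times> Pow (Pow (verts G)))"
    proof
      fix S assume "S \<in> ?C"
      then have "(verts S, edges S) \<in> Pow (verts G) \<times> Pow (Pow (verts G))"
        by (auto simp: copies_def subgraph_def simple_graph_def)
      then have "(\<lambda>(V, E). SGraph V E) (verts S, edges S) \<in> (\<lambda>(V, E). SGraph V E) ` (Pow (verts G) \<times> Pow (Pow (verts G)))"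
        by (rule imageI)
      then show "S \<in> (\<lambda>(V, E). SGraph V E) ` (Pow (verts G) \<times> Pow (Pow (verts G)))" by simp
    qed
  qed (use finV in simp)
  have U: "cycs q (gadj G) = (\<Union>S\<in>?C. cycs q (gadj S))"
  proof
    show "cycs q (gadj G) \<subseteq> (\<Union>S\<in>?C. cycs q (gadj S))"
    proof
      fix vs assume a: "vs \<in> cycs q (gadj G)"
      then have "vs \<in> cycs q (gadj (SGraph (set vs) (cedges vs)))" by (auto simp: cycs_def cyc_gadj_iff)
      then show "vs \<in> (\<Union>S\<in>?C. cycs q (gadj S))" using cyc_copy[OF assms(1) a] by blast
    qed
    show "(\<Union>S\<in>?C. cycs q (gadj S)) \<subseteq> cycs q (gadj G)"
      using S1(3) by (fastforce simp: cycs_def cyc_gadj_iff)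
  qed
  have "card (cycs q (gadj G)) = (\<Sum>S\<in>?C. card (cycs q (gadj S)))"
    unfolding U
  proof (rule card_UN_disjoint[OF finC])
    show "\<forall>S\<in>?C. finite (cycs q (gadj S))" using fcyc S1 by blast
    show "\<forall>S\<in>?C. \<forall>S'\<in>?C. S \<noteq> S' \<longrightarrow> cycs q (gadj S) \<inter> cycs q (gadj S') = {}"
      using copy_determined[OF assms(2)] by blast
  qed
  also have "\<dots> = (\<Sum>S\<in>?C. ?k)"
    by (rule sum.cong[OF refl]) (use card_cycs_iso S1 sc in blast)
  finally show "num_copies (cycle_graph q) G * ?k = card (cycs q (gadj G))"
    by (simp add: num_copies_def)
  have "[0..<q] \<in> cycs q (gadj (cycle_graph q))"
    using assms(2) by (simp add: cycs_def cyc_gadj_iff cedges_upt)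
  then show "?k > 0" using fcyc[OF sc] by (auto simp: card_gt_0_iff)
qed

lemma family_free_cycles_ge:
  assumes "simple_graph G" "2 \<le> L"
  shows "family_free (cycles_ge (L + 1)) G \<longleftrightarrow> (\<forall>vs. cyc (gadj G) vs \<longrightarrow> length vs \<le> L)"
proof
  assume ff: "family_free (cycles_ge (L + 1)) G"
  show "\<forall>vs. cyc (gadj G) vs \<longrightarrow> length vs \<le> L"
  proof (intro allI impI)
    fix vs assume c: "cyc (gadj G) vs"
    show "length vs \<le> L"
    proof (rule ccontr)
      assume "\<not> length vs \<le> L"
      then have "cycle_graph (length vs) \<in> cycles_ge (L + 1)" by (auto simp: cycles_ge_def)
      then have "copies (cycle_graph (length vs)) G = {}" using ff by (simp add: family_free_def)
      then show False using cyc_copy[OF assms(1), of vs "length vs"] c by (simp add: cycs_def)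
    qed
  qed
next
  assume h: "\<forall>vs. cyc (gadj G) vs \<longrightarrow> length vs \<le> L"
  show "family_free (cycles_ge (L + 1)) G"
    unfolding family_free_def cycles_ge_def
  proof clarify
    fix l assume l: "L + 1 \<le> l"
    have "cycs l (gadj G) = {}" using h l by (auto simp: cycs_def)
    then have "num_copies (cycle_graph l) G = 0"
      using num_copies_cycs[OF assms(1), of l] l assms(2) by simp
    show "copies (cycle_graph l) G = {}"
    proof (rule equals0I)
      fix S assume S: "S \<in> copies (cycle_graph l) G"
      have "card (cycs l (gadj S)) = card (cycs l (gadj (cycle_graph l)))"
        using S l assms(2) by (intro card_cycs_iso simple_graph_cycle_graph) (auto simp: copies_def subgraph_def)
      moreover have "\<dots> > 0" using num_copies_cycs(2)[OF assms(1), of l] l assms(2) by simp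
      ultimately have "cycs l (gadj S) \<noteq> {}" by auto
      then obtain vs where "vs \<in> cycs l (gadj S)" by blast
      then have "vs \<in> cycs l (gadj G)" using S by (fastforce simp: cycs_def cyc_gadj_iff copies_def subgraph_def)
      then show False using \<open>cycs l (gadj G) = {}\<close> by blast
    qed
  qed
qed

section \<open>The extremal graph on an arbitrary vertex set\<close>

text \<open>The adjacency of \<open>H(n,L)\<close> on an arbitrary vertex set \<open>V\<close> with core \<open>S\<close>. The extra edge \<open>e\<close> is empty if there is none.\<close>

definition hadj :: "'a set \<Rightarrow> 'a set \<Rightarrow> 'a set \<Rightarrow> 'a \<Rightarrow> 'a \<Rightarrow> bool" where
  "hadj V S e u v \<longleftrightarrow> u \<in> V \<and> v \<in> V \<and> u \<noteq> v \<and> (u \<in> S \<or> v \<in> S \<or> {u, v} = e)"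

definition extra_edge :: "nat \<Rightarrow> 'a set \<Rightarrow> 'a set \<Rightarrow> bool" where
  "extra_edge L B e \<longleftrightarrow> (if even L then e = {} else e \<subseteq> B \<and> card e = 2)"

lemma extremal_adj:
  assumes "L div 2 + 2 \<le> n"
  shows "gadj (extremal_graph n L) x y \<longleftrightarrow> hadj ({..<L div 2} <+> {..<n - L div 2}) (Inl ` {..<L div 2})
     (if even L then {} else {Inr 0, Inr 1}) x y"
proof -
  have inl: "{x, y} \<in> (`) Inl ` {e. e \<subseteq> A \<and> card e = 2} \<longleftrightarrow>
    (\<exists>u v. x = Inl u \<and> y = Inl v \<and> u \<noteq> v \<and> u \<in> A \<and> v \<in> A)" for A :: "nat set" and x y :: "nat + nat"
  proof
    assume "{x, y} \<in> (`) Inl ` {e. e \<subseteq> A \<and> card e = 2}"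
    then obtain e where "e \<subseteq> A" "card e = 2" "{x, y} = Inl ` e" by auto
    moreover then obtain u v where "e = {u, v}" "u \<noteq> v" by (auto simp: card_2_iff)
    ultimately show "\<exists>u v. x = Inl u \<and> y = Inl v \<and> u \<noteq> v \<and> u \<in> A \<and> v \<in> A"
      by (auto simp: doubleton_eq_iff)
  next
    assume "\<exists>u v. x = Inl u \<and> y = Inl v \<and> u \<noteq> v \<and> u \<in> A \<and> v \<in> A"
    then obtain u v where "x = Inl u" "y = Inl v" "u \<noteq> v" "u \<in> A" "v \<in> A" by blast
    then have "{x, y} = Inl ` {u, v}" "{u, v} \<in> {e. e \<subseteq> A \<and> card e = 2}" by auto
    then show "{x, y} \<in> (`) Inl ` {e. e \<subseteq> A \<and> card e = 2}" by blast
  qed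
  have mixed: "{x, y} \<in> {{Inl u, Inr v} | u v. u \<in> A \<and> v \<in> B} \<longleftrightarrow>
    (\<exists>u v. u \<in> A \<and> v \<in> B \<and> (x = Inl u \<and> y = Inr v \<or> x = Inr v \<and> y = Inl u))" for A B :: "nat set"
    by (auto simp: doubleton_eq_iff)
  show ?thesis
    using assms
    by (cases x; cases y)
      (auto simp: gadj_def extremal_graph_def join_def complete_graph_def empty_graph_def add_edge_def
        Let_def inl mixed hadj_def doubleton_eq_iff)
qed

text \<open>Any bijection that maps core to core and extra edge to extra edge transports closed lists. So the place of the
  core and of the extra edge in \<open>V\<close> can be chosen freely.\<close>

lemma card_cycs_hadj:
  fixes V :: "'a set"
  assumes "finite V" "card V = n" "S \<subseteq> V" "card S = L div 2" "extra_edge L (V - S) e" "L div 2 + 2 \<le> n"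
  shows "card (cycs q (hadj V S e)) = card (cycs q (gadj (extremal_graph n L)))"
proof -
  let ?a = "L div 2" and ?e = "if even L then {} else {Inr 0, Inr 1} :: (nat + nat) set"
  let ?V = "{..<?a} <+> {..<n - ?a}"
  have finS: "finite S" using assms finite_subset by blast
  obtain g where g: "bij_betw g S {..<?a}"
    using finite_same_card_bij[OF finS, of "{..<?a}"] assms(4) by auto
  have cVS: "card (V - S) = n - ?a" using assms finS by (simp add: card_Diff_subset)
  obtain h where h: "bij_betw h (V - S) {..<n - ?a}" "odd L \<Longrightarrow> h ` e = {0, 1}"
  proof (cases "even L")
    case True
    obtain h where "bij_betw h (V - S) {..<n - ?a}"
      using finite_same_card_bij[of "V - S" "{..<n - ?a}"] assms(1) cVS by auto
    then show ?thesis using that True by blast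
  next
    case False
    then have e: "e \<subseteq> V - S" "card e = 2" using assms(5) by (auto simp: extra_edge_def)
    have fe: "finite e" using e(1) assms(1) finite_subset by blast
    obtain h1 where h1: "bij_betw h1 e {0, 1::nat}"
      using finite_same_card_bij[OF fe, of "{0, 1::nat}"] e(2) by auto
    have "card (V - S - e) = n - ?a - 2" using e fe cVS by (simp add: card_Diff_subset)
    then obtain h2 where h2: "bij_betw h2 (V - S - e) {2..<n - ?a}"
      using finite_same_card_bij[of "V - S - e" "{2..<n - ?a}"] assms(1) by auto
    define h where "h = (\<lambda>x. if x \<in> e then h1 x else h2 x)"
    have "bij_betw h e {0, 1}" using h1 by (rule bij_betw_cong[THEN iffD1, rotated]) (simp add: h_def)
    moreover have "bij_betw h (V - S - e) {2..<n - ?a}"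
      using h2 by (rule bij_betw_cong[THEN iffD1, rotated]) (simp add: h_def)
    ultimately have "bij_betw h (e \<union> (V - S - e)) ({0, 1} \<union> {2..<n - ?a})"
      by (rule bij_betw_combine) auto
    moreover have "e \<union> (V - S - e) = V - S" using e by auto
    moreover have "{0, 1} \<union> {2..<n - ?a} = {..<n - ?a}" using assms(6) by auto
    ultimately have "bij_betw h (V - S) {..<n - ?a}" by simp
    moreover have "h ` e = {0, 1}" using \<open>bij_betw h e {0, 1}\<close> by (simp add: bij_betw_def)
    ultimately show ?thesis using that by blast
  qed
  define f where "f = (\<lambda>x. if x \<in> S then Inl (g x) else Inr (h x))"
  have fS: "bij_betw f S (Inl ` {..<?a})"
  proof -
    have "bij_betw (Inl \<circ> g) S (Inl ` {..<?a})" using g by (auto simp: bij_betw_def inj_on_def)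
    then show ?thesis by (rule bij_betw_cong[THEN iffD1, rotated]) (simp add: f_def)
  qed
  have fB: "bij_betw f (V - S) (Inr ` {..<n - ?a})"
  proof -
    have "bij_betw (Inr \<circ> h) (V - S) (Inr ` {..<n - ?a})" using h(1) by (auto simp: bij_betw_def inj_on_def)
    then show ?thesis by (rule bij_betw_cong[THEN iffD1, rotated]) (simp add: f_def)
  qed
  have "bij_betw f (S \<union> (V - S)) (Inl ` {..<?a} \<union> Inr ` {..<n - ?a})"
    by (rule bij_betw_combine[OF fS fB]) auto
  then have f: "bij_betw f V ?V" using assms(3) by (simp add: Un_absorb1 Plus_def)
  have finj: "inj_on f V" using f by (simp add: bij_betw_def)
  have fe: "{u, v} = e \<longleftrightarrow> {f u, f v} = ?e" if "u \<in> V" "v \<in> V" for u v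
  proof (cases "even L")
    case True then show ?thesis using assms(5) by (simp add: extra_edge_def)
  next
    case False
    then have e: "e \<subseteq> V - S" using assms(5) by (auto simp: extra_edge_def)
    then have "f ` e = Inr ` (h ` e)" by (auto simp: f_def image_iff)
    then have fe: "f ` e = {Inr 0, Inr 1}" using h(2) False by simp
    have "{u, v} = e \<longleftrightarrow> f ` {u, v} = f ` e"
      using that e by (intro inj_on_image_eq_iff[OF finj, symmetric]) auto
    then show ?thesis using fe False by simp
  qed
  have "card (cycs q (hadj V S e)) = card (cycs q (hadj ?V (Inl ` {..<?a}) ?e))"
  proof (rule card_cycs_eq[OF f])
    fix u v assume uv: "u \<in> V" "v \<in> V"
    have "f x \<in> Inl ` {..<?a} \<longleftrightarrow> x \<in> S" if "x \<in> V" for x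
      using that g by (auto simp: f_def bij_betw_def)
    moreover have "f u = f v \<longleftrightarrow> u = v" using finj uv by (auto dest: inj_onD)
    moreover have "f u \<in> ?V" "f v \<in> ?V" using f uv by (auto simp: bij_betw_def)
    ultimately show "hadj V S e u v \<longleftrightarrow> hadj ?V (Inl ` {..<?a}) ?e (f u) (f v)"
      unfolding hadj_def using fe[OF uv] uv by blast
  qed (auto simp: hadj_def)
  also have "hadj ?V (Inl ` {..<?a}) ?e = gadj (extremal_graph n L)"
    using extremal_adj[OF assms(6)] by (intro ext) simp
  finally show ?thesis .
qed

text \<open>Each step of a cycle other than the extra edge meets the core, and each core vertex meets only two steps.\<close>

lemma cyc_hadj_length:
  assumes "finite V" "S \<subseteq> V" "card S = L div 2" "extra_edge L (V - S) e" "cyc (hadj V S e) vs"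
  shows "length vs \<le> L"
proof -
  let ?n = "length vs"
  let ?s = "\<lambda>i. Suc i mod ?n"
  have n: "3 \<le> ?n" "distinct vs" "\<And>i. i < ?n \<Longrightarrow> hadj V S e (vs ! i) (vs ! ?s i)"
    using assms(5) by (auto simp: cyc_nth)
  have finS: "finite S" using assms finite_subset by blast
  define P where "P = {i. i < ?n \<and> vs ! i \<in> S}"
  define Q where "Q = {i. i < ?n \<and> vs ! i \<notin> S \<and> vs ! ?s i \<in> S}"
  define R where "R = {i. i < ?n \<and> vs ! i \<notin> S \<and> vs ! ?s i \<notin> S}"
  have fin: "finite P" "finite Q" "finite R" by (auto simp: P_def Q_def R_def)
  have sl: "?s i < ?n" for i using n(1) by (intro mod_less_divisor) linarith
  have sinj: "inj_on ?s {..<?n}"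
  proof (rule inj_onI)
    fix i j assume "i \<in> {..<?n}" "j \<in> {..<?n}" "?s i = ?s j"
    then show "i = j" by (auto simp: mod_Suc split: if_splits)
  qed
  have cP: "card P \<le> L div 2"
  proof -
    have "card P = card ((!) vs ` P)"
      by (rule card_image[symmetric]) (use n in \<open>auto simp: P_def inj_on_def nth_eq_iff_index_eq\<close>)
    also have "\<dots> \<le> card S" by (rule card_mono[OF finS]) (auto simp: P_def)
    finally show ?thesis using assms(3) by simp
  qed
  have cQ: "card Q \<le> card P"
  proof (rule card_inj_on_le[of ?s])
    show "inj_on ?s Q" by (rule inj_on_subset[OF sinj]) (auto simp: Q_def)
    show "?s ` Q \<subseteq> P" using sl by (auto simp: Q_def P_def)
  qed (rule fin)
  have cR: "card R \<le> L mod 2"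
  proof (cases "R = {}")
    case False
    have ed: "{vs ! i, vs ! ?s i} = e" if "i \<in> R" for i
      using n(3)[of i] that by (auto simp: R_def hadj_def)
    have "odd L" using False ed assms(4) by (auto simp: extra_edge_def split: if_splits)
    moreover have "i = j" if ij: "i \<in> R" "j \<in> R" for i j
    proof -
      have "card (cedges vs) = ?n" using card_cedges n by blast
      then have "inj_on (\<lambda>i. {vs ! i, vs ! (Suc i mod ?n)}) {..<?n}"
        unfolding cedges_def by (intro eq_card_imp_inj_on) auto
      then show ?thesis using ed[OF ij(1)] ed[OF ij(2)] ij by (auto simp: R_def dest: inj_onD)
    qed
    then have "card R \<le> 1" by (simp add: card_le_Suc0_iff_eq[OF fin(3)])
    ultimately show ?thesis by (simp add: odd_iff_mod_2_eq_one)
  qed simp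
  have "{..<?n} = P \<union> (Q \<union> R)" by (auto simp: P_def Q_def R_def)
  then have "?n = card (P \<union> (Q \<union> R))" by (metis card_lessThan)
  also have "\<dots> \<le> card P + (card Q + card R)"
    by (metis add_left_mono card_Un_le order_trans)
  also have "\<dots> \<le> L div 2 + (L div 2 + L mod 2)" using cP cQ cR by linarith
  also have "\<dots> = L" by presburger
  finally show ?thesis .
qed

text \<open>Dividing by the common number of closed lists per copy turns a comparison of closed lists into one of copies.\<close>

lemma gen_ex_eq:
  assumes "3 \<le> q" "2 \<le> L" "L div 2 + 2 \<le> n"
    and core: "\<And>G :: nat sgraph. \<lbrakk>simple_graph G; card (verts G) = n; \<And>vs. cyc (gadj G) vs \<Longrightarrow> length vs \<le> L\<rbrakk>
      \<Longrightarrow> card (cycs q (gadj G)) \<le> card (cycs q (gadj (extremal_graph n L)))"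
  shows "gen_ex n (cycle_graph q) (cycles_ge (L + 1)) = num_copies (cycle_graph q) (extremal_graph n L)"
  unfolding gen_ex_def
proof (rule Max_eqI)
  let ?k = "card (cycs q (gadj (cycle_graph q)))"
  have sE: "simple_graph (extremal_graph n L)" by (rule simple_graph_extremal_graph[OF assms(3)])
  have k: "?k > 0" by (rule num_copies_cycs(2)[OF sE assms(1)])
  show "finite {num_copies (cycle_graph q) G | G :: nat sgraph.
            simple_graph G \<and> card (verts G) = n \<and> family_free (cycles_ge (L + 1)) G}" by (rule finite_gen_ex_set)
  show "y \<le> num_copies (cycle_graph q) (extremal_graph n L)"
    if "y \<in> {num_copies (cycle_graph q) G | G :: nat sgraph.
            simple_graph G \<and> card (verts G) = n \<and> family_free (cycles_ge (L + 1)) G}" for y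
  proof -
    obtain G :: "nat sgraph" where G: "y = num_copies (cycle_graph q) G" "simple_graph G" "card (verts G) = n"
      "family_free (cycles_ge (L + 1)) G" using \<open>y \<in> _\<close> by auto
    have "card (cycs q (gadj G)) \<le> card (cycs q (gadj (extremal_graph n L)))"
      using core[OF G(2,3)] G(4) family_free_cycles_ge[OF G(2) assms(2)] by blast
    then have "y * ?k \<le> num_copies (cycle_graph q) (extremal_graph n L) * ?k"
      using num_copies_cycs(1)[OF G(2) assms(1)] num_copies_cycs(1)[OF sE assms(1)] G(1) by simp
    then show ?thesis using k by simp
  qed
  define V where "V = {..<n}"
  define S where "S = {..<L div 2}"
  define e where "e = (if even L then {} else {L div 2, L div 2 + 1})"
  define G where "G = SGraph V {{u, v} | u v. hadj V S e u v}"
  have gG: "gadj G = hadj V S e"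
    unfolding G_def gadj_def by (intro ext) (auto simp: doubleton_eq_iff hadj_def)
  have SV: "S \<subseteq> V" "finite V" "card V = n" "card S = L div 2" using assms(3) by (auto simp: S_def V_def)
  have ee: "extra_edge L (V - S) e" using assms(3) by (auto simp: extra_edge_def e_def V_def S_def)
  have sG: "simple_graph G" unfolding simple_graph_def G_def using SV by (auto simp: hadj_def)
  have ff: "family_free (cycles_ge (L + 1)) G"
    unfolding family_free_cycles_ge[OF sG assms(2)] gG using cyc_hadj_length[OF SV(2,1,4) ee] by blast
  have "num_copies (cycle_graph q) G * ?k = num_copies (cycle_graph q) (extremal_graph n L) * ?k"
    using num_copies_cycs(1)[OF sG assms(1)] num_copies_cycs(1)[OF sE assms(1)]
      card_cycs_hadj[OF SV(2,3,1,4) ee assms(3), of q] gG by simp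
  then have "num_copies (cycle_graph q) (extremal_graph n L) = num_copies (cycle_graph q) G" using k by simp
  moreover have "card (verts G) = n" using SV by (simp add: G_def)
  ultimately show "num_copies (cycle_graph q) (extremal_graph n L) \<in> {num_copies (cycle_graph q) G | G :: nat sgraph.
            simple_graph G \<and> card (verts G) = n \<and> family_free (cycles_ge (L + 1)) G}"
    using sG ff by blast
qed

section \<open>Graphs of bounded circumference are degenerate\<close>

locale ugraph =
  fixes V :: "'a set" and adj :: "'a \<Rightarrow> 'a \<Rightarrow> bool"
  assumes finV: "finite V"
    and adj_sym: "adj u v \<Longrightarrow> adj v u"
    and adj_irrefl: "\<not> adj v v"
    and adj_V: "adj u v \<Longrightarrow> u \<in> V"
begin

lemma adj_V2: "adj u v \<Longrightarrow> v \<in> V"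
  using adj_V adj_sym by blast

definition nb :: "'a \<Rightarrow> 'a set" where "nb v = {w. adj v w}"

lemma nb_sub: "nb v \<subseteq> V" using adj_V2 by (auto simp: nb_def)

lemma fin_nb [simp]: "finite (nb v)" using nb_sub finV finite_subset by blast

lemma cyc_sub: "cyc adj vs \<Longrightarrow> set vs \<subseteq> V"
proof
  fix x assume "cyc adj vs" "x \<in> set vs"
  moreover then obtain i where "i < length vs" "x = vs ! i" by (auto simp: in_set_conv_nth)
  ultimately have "adj x (vs ! (Suc i mod length vs))" by (auto simp: cyc_nth)
  then show "x \<in> V" by (rule adj_V)
qed

lemma fin_cycs: "finite (cycs q adj)"
proof (rule finite_subset)
  show "cycs q adj \<subseteq> {vs. set vs \<subseteq> V \<and> length vs = q}" using cyc_sub by (auto simp: cycs_def)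
qed (rule finite_lists_length_eq[OF finV])

end

locale circ = ugraph +
  fixes L :: nat
  assumes circ: "cyc adj vs \<Longrightarrow> length vs \<le> L"
    and L2: "2 \<le> L"
begin

text \<open>If all degrees in \<open>X\<close> are at least \<open>L\<close>, the first vertex of a longest path has its neighbours on the path, and the
  furthest one closes a cycle with more than \<open>L\<close> vertices.\<close>

lemma low_degree_vertex:
  assumes "X \<subseteq> V" "X \<noteq> {}"
  shows "\<exists>v\<in>X. card {w \<in> X. adj v w} < L"
proof (rule ccontr)
  assume "\<not> ?thesis"
  then have deg: "L \<le> card {w \<in> X. adj v w}" if "v \<in> X" for v using that by (meson not_less)
  let ?P = "\<lambda>p. p \<noteq> [] \<and> distinct p \<and> successively adj p \<and> set p \<subseteq> X"
  have finX: "finite X" using assms(1) finV finite_subset by blast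
  obtain x where x: "x \<in> X" using assms(2) by blast
  have "length p < Suc (card X)" if "?P p" for p
    using that by (metis card_mono distinct_card finX le_imp_less_Suc)
  moreover have "?P [x]" using x by simp
  ultimately obtain p where p: "?P p" and mx: "\<forall>p'. ?P p' \<longrightarrow> length p' \<le> length p"
    using ex_has_greatest_nat[of ?P "[x]" length "Suc (card X)"] by blast
  define I where "I = {i. i < length p \<and> adj (p ! 0) (p ! i)}"
  have hd: "p ! 0 \<in> X" using p by (metis hd_conv_nth hd_in_set subsetD)
  have sub: "{w \<in> X. adj (p ! 0) w} \<subseteq> (!) p ` I"
  proof
    fix w assume w: "w \<in> {w \<in> X. adj (p ! 0) w}"
    have "w \<in> set p"
    proof (rule ccontr)
      assume "w \<notin> set p"
      moreover have "adj w (hd p)" using w p adj_sym by (simp add: hd_conv_nth)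
      ultimately have "?P (w # p)" using w p by (cases p) auto
      then show False using mx by fastforce
    qed
    then show "w \<in> (!) p ` I" using w by (auto simp: I_def in_set_conv_nth)
  qed
  have finI: "finite I" by (simp add: I_def)
  have "L \<le> card ((!) p ` I)" using deg[OF hd] card_mono[OF _ sub] finI by fastforce
  then have LI: "L \<le> card I" using card_image_le[OF finI] le_trans by blast
  then have Ine: "I \<noteq> {}" using L2 by auto
  define j where "j = Max I"
  have jI: "j \<in> I" unfolding j_def using finI Ine by (rule Max_in)
  have "0 \<notin> I" using adj_irrefl by (simp add: I_def)
  then have "I \<subseteq> {1..j}" using finI by (auto simp: j_def Suc_le_eq) (metis gr0I)
  then have "card I \<le> j" using card_mono[of "{1..j}" I] by simp
  then have jL: "L \<le> j" using LI by simp
  have jl: "j < length p" "adj (p ! 0) (p ! j)" using jI by (auto simp: I_def)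
  have "cyc adj (take (Suc j) p)"
    unfolding cyc_def
  proof (intro conjI)
    show "3 \<le> length (take (Suc j) p)" using jl jL L2 by simp
    show "distinct (take (Suc j) p)" using p by simp
    show "successively adj (take (Suc j) p)" using p by (metis append_take_drop_id successively_append_iff)
    have "last (take (Suc j) p) = p ! j" using jl by (simp add: take_Suc_conv_app_nth)
    moreover have "hd (take (Suc j) p) = p ! 0" using p by (simp add: hd_conv_nth)
    ultimately show "adj (last (take (Suc j) p)) (hd (take (Suc j) p))" using jl adj_sym by simp
  qed
  then have "length (take (Suc j) p) \<le> L" by (rule circ)
  then show False using jl jL by simp
qed

text \<open>Vertices of low degree are removed one after the other; a vertex is ranked by the time of its removal.\<close>

lemma rank_exists:
  assumes "X \<subseteq> V"
  shows "\<exists>f :: 'a \<Rightarrow> nat. inj_on f X \<and> (\<forall>v\<in>X. card {w \<in> X. adj v w \<and> f v < f w} \<le> L)"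
  using assms
proof (induction "card X" arbitrary: X)
  case 0
  then have "X = {}" using finV finite_subset by fastforce
  then show ?case by simp
next
  case (Suc k)
  then have "X \<noteq> {}" by auto
  then obtain v where v: "v \<in> X" "card {w \<in> X. adj v w} < L" using low_degree_vertex Suc.prems by blast
  have finX: "finite X" using Suc.prems finV finite_subset by blast
  have "card (X - {v}) = k" using Suc.hyps v finX by simp
  then obtain f :: "'a \<Rightarrow> nat" where f: "inj_on f (X - {v})"
    "\<forall>u\<in>X - {v}. card {w \<in> X - {v}. adj u w \<and> f u < f w} \<le> L"
    using Suc.hyps(1)[of "X - {v}"] Suc.prems by blast
  define g where "g = (\<lambda>u. if u = v then 0 else Suc (f u))"
  have "inj_on g X" using f(1) by (auto simp: g_def inj_on_def)
  moreover have "card {w \<in> X. adj u w \<and> g u < g w} \<le> L" if "u \<in> X" for u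
  proof (cases "u = v")
    case True
    have "card {w \<in> X. adj u w \<and> g u < g w} \<le> card {w \<in> X. adj v w}"
      using finX True by (intro card_mono) auto
    then show ?thesis using v by simp
  next
    case False
    have "{w \<in> X. adj u w \<and> g u < g w} = {w \<in> X - {v}. adj u w \<and> f u < f w}"
      using False by (auto simp: g_def)
    then show ?thesis using f(2) that False by auto
  qed
  ultimately show ?case by blast
qed

text \<open>A degeneracy order: every vertex has at most \<open>L\<close> neighbours of higher rank.\<close>

definition rank :: "'a \<Rightarrow> nat" where
  "rank = (SOME f. inj_on f V \<and> (\<forall>v\<in>V. card {w \<in> V. adj v w \<and> f v < f w} \<le> L))"

definition outn :: "'a \<Rightarrow> 'a set" where "outn v = {w. adj v w \<and> rank v < rank w}"

lemma rank_props: "inj_on rank V" "v \<in> V \<Longrightarrow> card (outn v) \<le> L"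
proof -
  have r: "inj_on rank V \<and> (\<forall>v\<in>V. card {w \<in> V. adj v w \<and> rank v < rank w} \<le> L)"
    unfolding rank_def by (rule someI_ex[OF rank_exists[OF order_refl]])
  then show "inj_on rank V" by blast
  have "outn v = {w \<in> V. adj v w \<and> rank v < rank w}" using adj_V2 by (auto simp: outn_def)
  then show "v \<in> V \<Longrightarrow> card (outn v) \<le> L" using r by auto
qed

lemma outn_sub: "outn v \<subseteq> nb v" by (auto simp: outn_def nb_def)

lemma fin_outn [simp]: "finite (outn v)" using outn_sub fin_nb finite_subset by blast

lemma card_outn: "card (outn v) \<le> L"
proof (cases "v \<in> V")
  case False
  then have "outn v = {}" using adj_V by (auto simp: outn_def)
  then show ?thesis by simp
qed (rule rank_props(2))

lemma rank_neq: "adj u v \<Longrightarrow> rank u \<noteq> rank v"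
  using rank_props(1) adj_V adj_V2 adj_irrefl by (metis inj_onD)

lemma card_arcs:
  shows "finite {(x, y). adj x y}" and "card {(x, y). adj x y} \<le> 2 * L * card V"
proof -
  let ?O = "Sigma V outn"
  have sub: "{(x, y). adj x y} \<subseteq> ?O \<union> prod.swap ` ?O"
  proof
    fix z assume "z \<in> {(x, y). adj x y}"
    then obtain x y where z: "z = (x, y)" and a: "adj x y" by auto
    show "z \<in> ?O \<union> prod.swap ` ?O"
    proof (cases "rank x < rank y")
      case True
      then show ?thesis using a adj_V z by (auto simp: outn_def)
    next
      case False
      then have "rank y < rank x" using rank_neq[OF a] by simp
      then have "(y, x) \<in> ?O" using a adj_sym adj_V2 by (auto simp: outn_def)
      then show ?thesis using z by (metis UnI2 image_eqI swap_simp)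
    qed
  qed
  have fin: "finite ?O" using finV by simp
  then show "finite {(x, y). adj x y}" using sub finite_subset by blast
  have "card ?O = (\<Sum>v\<in>V. card (outn v))" using finV by (intro card_SigmaI) auto
  also have "\<dots> \<le> (\<Sum>v\<in>V. L)" by (rule sum_mono) (rule card_outn)
  finally have O: "card ?O \<le> card V * L" by simp
  have "card {(x, y). adj x y} \<le> card (?O \<union> prod.swap ` ?O)" using fin sub by (intro card_mono) auto
  also have "\<dots> \<le> card ?O + card (prod.swap ` ?O)" by (rule card_Un_le)
  also have "\<dots> \<le> card ?O + card ?O" using card_image_le[OF fin] by simp
  finally have "card {(x, y). adj x y} \<le> card V * L + card V * L" using O by linarith
  then show "card {(x, y). adj x y} \<le> 2 * L * card V" by (simp add: algebra_simps)
qed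

end

section \<open>Counting lists step by step\<close>

text \<open>The number of choices for each entry may be bounded uniformly in the entries before it.\<close>

lemma card_lists_step:
  assumes "\<And>k xs. k < m \<Longrightarrow> length xs = k \<Longrightarrow> finite (S k xs) \<and> card (S k xs) \<le> b k"
  shows "finite {xs. length xs = m \<and> (\<forall>k<m. xs ! k \<in> S k (take k xs))} \<and>
    card {xs. length xs = m \<and> (\<forall>k<m. xs ! k \<in> S k (take k xs))} \<le> (\<Prod>k<m. b k)"
  using assms
proof (induction m)
  case 0
  have "{xs :: 'a list. length xs = 0 \<and> (\<forall>k<0. xs ! k \<in> S k (take k xs))} = {[]}" by auto
  then show ?case by simp
next
  case (Suc m)
  let ?X = "\<lambda>m. {xs. length xs = m \<and> (\<forall>k<m. xs ! k \<in> S k (take k xs))}"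
  have IH: "finite (?X m)" "card (?X m) \<le> (\<Prod>k<m. b k)" using Suc by auto
  have fS: "finite (S m xs)" "card (S m xs) \<le> b m" if "xs \<in> ?X m" for xs using that Suc.prems by auto
  have sub: "?X (Suc m) \<subseteq> (\<lambda>(xs, x). xs @ [x]) ` (Sigma (?X m) (S m))"
  proof
    fix ys assume ys: "ys \<in> ?X (Suc m)"
    have "ys = take m ys @ [ys ! m]" using take_Suc_conv_app_nth[of m ys] ys by simp
    moreover have "take m ys \<in> ?X m" using ys by (auto simp: min_def)
    moreover have "ys ! m \<in> S m (take m ys)" using ys by auto
    ultimately show "ys \<in> (\<lambda>(xs, x). xs @ [x]) ` (Sigma (?X m) (S m))"
      by (intro image_eqI[of _ _ "(take m ys, ys ! m)"]) auto
  qed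
  have fin: "finite (Sigma (?X m) (S m))" using IH(1) fS(1) by (intro finite_SigmaI) auto
  have "card (?X (Suc m)) \<le> card (Sigma (?X m) (S m))"
    by (rule le_trans[OF card_mono[OF finite_imageI[OF fin] sub] card_image_le[OF fin]])
  also have "\<dots> = (\<Sum>xs\<in>?X m. card (S m xs))" using IH(1) fS(1) by (intro card_SigmaI) auto
  also have "\<dots> \<le> (\<Sum>xs\<in>?X m. b m)" by (rule sum_mono) (rule fS(2))
  also have "\<dots> = card (?X m) * b m" by simp
  also have "\<dots> \<le> (\<Prod>k<m. b k) * b m" using IH(2) by simp
  finally have "card (?X (Suc m)) \<le> (\<Prod>k<Suc m. b k)" by simp
  moreover have "finite (?X (Suc m))" by (rule finite_subset[OF sub finite_imageI[OF fin]])
  ultimately show ?case by blast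
qed

text \<open>The typical product in a count of lists: at most \<open>p\<close> places are free, the others have boundedly many choices.\<close>

lemma prod_bound_count:
  fixes b :: "nat \<Rightarrow> nat"
  assumes "finite I" "1 \<le> c" "1 \<le> n" "\<And>k. k \<in> I \<Longrightarrow> b k \<le> c * (if P k then n else 1)" "card {k \<in> I. P k} \<le> p"
  shows "(\<Prod>k\<in>I. b k) \<le> c ^ card I * n ^ p"
proof -
  have "(\<Prod>k\<in>I. b k) \<le> (\<Prod>k\<in>I. c * (if P k then n else 1))" by (rule prod_mono) (use assms in auto)
  also have "\<dots> = c ^ card I * (\<Prod>k\<in>I. if P k then n else 1)" by (simp add: prod.distrib)
  also have "(\<Prod>k\<in>I. if P k then n else 1) = n ^ card {k \<in> I. P k}"
    using assms(1) by (simp add: prod.If_cases Int_def)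
  also have "\<dots> \<le> n ^ p" using assms by (intro power_increasing) auto
  finally show ?thesis by simp
qed

section \<open>Cyclic counting along a closed list\<close>

text \<open>The last entry is followed by the first one.\<close>

definition ecount :: "('a \<Rightarrow> 'a \<Rightarrow> bool) \<Rightarrow> 'a list \<Rightarrow> nat" where
  "ecount Q v = card {i. i < length v \<and> Q (v ! i) (v ! (Suc i mod length v))}"

lemma card_shift:
  assumes "0 < (q::nat)"
  shows "card {i. i < q \<and> P ((k + i) mod q)} = card {i. i < q \<and> P i}"
proof -
  have "bij_betw (\<lambda>i. (k + i) mod q) {..<q} {..<q}"
  proof -
    have inj: "inj_on (\<lambda>i. (k + i) mod q) {..<q}"
    proof (rule inj_onI)
      fix i j assume a: "i \<in> {..<q}" "j \<in> {..<q}" "(k + i) mod q = (k + j) mod q"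
      have "i' = j'" if "i' \<le> j'" "j' < q" "(k + i') mod q = (k + j') mod q" for i' j'
      proof -
        have "q dvd (k + j') - (k + i')" using that by (intro mod_eq_dvd_iff_nat[THEN iffD1]) auto
        then have "q dvd j' - i'" by simp
        moreover have "j' - i' < q" using that by simp
        ultimately have "j' - i' = 0" by (meson dvd_imp_le gr0I not_less)
        then show ?thesis using that by simp
      qed
      then show "i = j" using a by (metis lessThan_iff nat_le_linear)
    qed
    moreover have "(\<lambda>i. (k + i) mod q) ` {..<q} \<subseteq> {..<q}" using assms by auto
    ultimately have "(\<lambda>i. (k + i) mod q) ` {..<q} = {..<q}" by (intro endo_inj_surj) auto
    with inj show ?thesis by (simp add: bij_betw_def)
  qed
  then have inj: "inj_on (\<lambda>i. (k + i) mod q) {..<q}" and im: "(\<lambda>i. (k + i) mod q) ` {..<q} = {..<q}"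
    by (auto simp: bij_betw_def)
  have "{i. i < q \<and> P i} = (\<lambda>i. (k + i) mod q) ` {i. i < q \<and> P ((k + i) mod q)}"
  proof
    show "{i. i < q \<and> P i} \<subseteq> (\<lambda>i. (k + i) mod q) ` {i. i < q \<and> P ((k + i) mod q)}"
    proof
      fix j assume j: "j \<in> {i. i < q \<and> P i}"
      then have "j \<in> (\<lambda>i. (k + i) mod q) ` {..<q}" unfolding im by simp
      then obtain i where "i < q" "j = (k + i) mod q" by auto
      then show "j \<in> (\<lambda>i. (k + i) mod q) ` {i. i < q \<and> P ((k + i) mod q)}" using j by blast
    qed
  qed (use assms in auto)
  moreover have "inj_on (\<lambda>i. (k + i) mod q) {i. i < q \<and> P ((k + i) mod q)}"
    by (rule inj_on_subset[OF inj]) auto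
  ultimately show ?thesis by (simp add: card_image)
qed

lemma ecount_rotate: "ecount Q (rotate k v) = ecount Q v"
proof (cases "v = []")
  case False
  let ?q = "length v"
  have q: "0 < ?q" using False by simp
  have "{i. i < ?q \<and> Q (rotate k v ! i) (rotate k v ! (Suc i mod ?q))} =
     {i. i < ?q \<and> Q (v ! ((k + i) mod ?q)) (v ! (Suc ((k + i) mod ?q) mod ?q))}"
  proof -
    have "rotate k v ! (Suc i mod ?q) = v ! (Suc ((k + i) mod ?q) mod ?q)" for i
    proof -
      have "rotate k v ! (Suc i mod ?q) = v ! ((k + Suc i mod ?q) mod ?q)" using q by (intro nth_rotate) simp
      also have "(k + Suc i mod ?q) mod ?q = Suc ((k + i) mod ?q) mod ?q" by (simp add: mod_simps)
      finally show ?thesis .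
    qed
    then show ?thesis by (auto simp: nth_rotate)
  qed
  then show ?thesis
    using card_shift[OF q, of "\<lambda>i. Q (v ! i) (v ! (Suc i mod ?q))" k] by (simp add: ecount_def)
qed (simp add: ecount_def)

lemma ecount_rev: "ecount Q (rev v) = ecount (\<lambda>x y. Q y x) v"
proof (cases "v = []")
  case False
  let ?q = "length v"
  let ?g = "\<lambda>i. if Suc i < ?q then ?q - 2 - i else ?q - 1"
  have q: "0 < ?q" using False by simp
  have g: "rev v ! i = v ! (Suc (?g i) mod ?q)" "rev v ! (Suc i mod ?q) = v ! ?g i" "?g i < ?q" "?g (?g i) = i"
    if "i < ?q" for i
  proof -
    have "rev v ! i = v ! (?q - Suc i)" using that by (simp add: rev_nth)
    moreover have "Suc (?g i) mod ?q = ?q - Suc i"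
    proof (cases "Suc i < ?q")
      case True
      then have "Suc (?g i) = ?q - Suc i" by simp
      then show ?thesis using True by simp
    next
      case False
      then have "?q = Suc i" using that by simp
      then show ?thesis by simp
    qed
    ultimately show "rev v ! i = v ! (Suc (?g i) mod ?q)" by simp
    show "rev v ! (Suc i mod ?q) = v ! ?g i"
    proof (cases "Suc i < ?q")
      case True
      then show ?thesis by (simp add: rev_nth)
    next
      case False
      then have e: "?q = Suc i" using that by simp
      have "rev v ! (Suc i mod ?q) = rev v ! 0" using e by (metis mod_self)
      also have "\<dots> = v ! (?q - 1)" using q by (simp add: rev_nth)
      finally show ?thesis using False by simp
    qed
    show "?g i < ?q" "?g (?g i) = i" using that by auto
  qed
  define A where "A = {i. i < ?q \<and> Q (rev v ! i) (rev v ! (Suc i mod ?q))}"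
  define B where "B = {i. i < ?q \<and> Q (v ! (Suc i mod ?q)) (v ! i)}"
  define h where "h = ?g"
  have h: "rev v ! i = v ! (Suc (h i) mod ?q)" "rev v ! (Suc i mod ?q) = v ! h i" "h i < ?q" "h (h i) = i"
    if "i < ?q" for i unfolding h_def by (fact g[OF that])+
  have hA: "h i \<in> B" if "i \<in> A" for i
  proof -
    have i: "i < ?q" "Q (rev v ! i) (rev v ! (Suc i mod ?q))" using that by (auto simp: A_def)
    then have "Q (v ! (Suc (h i) mod ?q)) (v ! h i)" unfolding h(1,2)[OF i(1)] by blast
    then show ?thesis using h(3)[OF i(1)] by (simp add: B_def)
  qed
  have hB: "h i \<in> A" if "i \<in> B" for i
  proof -
    have i: "i < ?q" "Q (v ! (Suc i mod ?q)) (v ! i)" using that by (auto simp: B_def)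
    then have "Q (rev v ! h i) (rev v ! (Suc (h i) mod ?q))"
      using h(1,2)[OF h(3)[OF i(1)]] h(4)[OF i(1)] by simp
    then show ?thesis using h(3)[OF i(1)] by (simp add: A_def)
  qed
  have "bij_betw h A B"
  proof (rule bij_betw_byWitness[where f' = h])
    show "\<forall>a\<in>A. h (h a) = a" "\<forall>a\<in>B. h (h a) = a" using h(4) by (auto simp: A_def B_def)
  qed (use hA hB in blast)+
  then have "card A = card B" by (rule bij_betw_same_card)
  then have "card {i. i < ?q \<and> Q (rev v ! i) (rev v ! (Suc i mod ?q))} =
     card {i. i < ?q \<and> Q (v ! (Suc i mod ?q)) (v ! i)}" unfolding A_def B_def .
  then show ?thesis by (simp add: ecount_def)
qed (simp add: ecount_def)

text \<open>Around a cycle, a set is entered as often as it is left.\<close>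

lemma ecount_transitions: "ecount (\<lambda>x y. x \<in> A \<and> y \<notin> A) v = ecount (\<lambda>x y. x \<notin> A \<and> y \<in> A) v"
proof (cases "v = []")
  case False
  let ?q = "length v"
  let ?s = "\<lambda>i. Suc i mod ?q"
  let ?N = "\<lambda>P. card {i. i < ?q \<and> P i}"
  have q: "0 < ?q" using False by simp
  have split: "?N P = ?N (\<lambda>i. P i \<and> R i) + ?N (\<lambda>i. P i \<and> \<not> R i)" for P R
  proof -
    have "{i. i < ?q \<and> P i} = {i. i < ?q \<and> P i \<and> R i} \<union> {i. i < ?q \<and> P i \<and> \<not> R i}" by auto
    moreover have "card ({i. i < ?q \<and> P i \<and> R i} \<union> {i. i < ?q \<and> P i \<and> \<not> R i}) =
       ?N (\<lambda>i. P i \<and> R i) + ?N (\<lambda>i. P i \<and> \<not> R i)" by (rule card_Un_disjoint) auto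
    ultimately show ?thesis by simp
  qed
  have "?N (\<lambda>i. v ! ?s i \<in> A) = ?N (\<lambda>i. v ! i \<in> A)"
    using card_shift[OF q, of "\<lambda>i. v ! i \<in> A" 1] by simp
  moreover have "?N (\<lambda>i. v ! ?s i \<in> A) = ?N (\<lambda>i. v ! ?s i \<in> A \<and> v ! i \<in> A) + ?N (\<lambda>i. v ! ?s i \<in> A \<and> v ! i \<notin> A)"
    by (rule split)
  moreover have "?N (\<lambda>i. v ! i \<in> A) = ?N (\<lambda>i. v ! i \<in> A \<and> v ! ?s i \<in> A) + ?N (\<lambda>i. v ! i \<in> A \<and> v ! ?s i \<notin> A)"
    by (rule split)
  moreover have "?N (\<lambda>i. v ! ?s i \<in> A \<and> v ! i \<in> A) = ?N (\<lambda>i. v ! i \<in> A \<and> v ! ?s i \<in> A)"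
    by (rule arg_cong[where f = card]) auto
  moreover have "?N (\<lambda>i. v ! ?s i \<in> A \<and> v ! i \<notin> A) = ?N (\<lambda>i. v ! i \<notin> A \<and> v ! ?s i \<in> A)"
    by (rule arg_cong[where f = card]) auto
  ultimately show ?thesis unfolding ecount_def by linarith
qed (simp add: ecount_def)

lemma cyc_rotate: "cyc adj (rotate k v) \<longleftrightarrow> cyc adj v"
proof -
  have e: "cyc adj v \<longleftrightarrow> 3 \<le> length v \<and> distinct v \<and> ecount adj v = length v" for v :: "'a list"
  proof -
    have "(\<forall>i<length v. adj (v ! i) (v ! (Suc i mod length v))) \<longleftrightarrow> ecount adj v = length v"
    proof
      assume "\<forall>i<length v. adj (v ! i) (v ! (Suc i mod length v))"
      then have "{i. i < length v \<and> adj (v ! i) (v ! (Suc i mod length v))} = {..<length v}" by auto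
      then show "ecount adj v = length v" by (simp add: ecount_def)
    next
      assume "ecount adj v = length v"
      then have "{i. i < length v \<and> adj (v ! i) (v ! (Suc i mod length v))} = {..<length v}"
        unfolding ecount_def by (intro card_subset_eq) auto
      then show "\<forall>i<length v. adj (v ! i) (v ! (Suc i mod length v))" by auto
    qed
    then show ?thesis by (simp add: cyc_nth)
  qed
  show ?thesis by (simp add: e ecount_rotate)
qed

lemma cyc_rev:
  assumes "\<And>x y. adj x y \<Longrightarrow> adj y x"
  shows "cyc adj (rev v) \<longleftrightarrow> cyc adj v"
proof -
  have "adj x y \<longleftrightarrow> adj y x" for x y using assms by blast
  then show ?thesis
    by (cases "v = []") (auto simp: cyc_def last_rev hd_rev)
qed

section \<open>Almost all closed lists alternate with vertices of large degree\<close>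

lemma last_take_nth: "0 < k \<Longrightarrow> k < length v \<Longrightarrow> last (take k v) = v ! (k - 1)"
  by (cases k) (simp_all add: take_Suc_conv_app_nth)

lemma rotate_back:
  assumes "k \<le> length v"
  shows "rotate (length v - k) (rotate k v) = v"
  using assms by (simp add: rotate_rotate rotate_id)

context ugraph
begin

definition big :: "nat \<Rightarrow> 'a set" where "big m = {v \<in> V. card V \<le> m * card (nb v)}"

lemma fin_big [simp]: "finite (big m)" using finV by (simp add: big_def)

lemma big_sub: "big m \<subseteq> V" by (auto simp: big_def)

lemma card_nb_small:
  assumes "v \<in> V" "v \<notin> big m" "0 < m"
  shows "card (nb v) \<le> card V div m"
  using assms by (auto simp: big_def less_eq_div_iff_mult_less_eq mult.commute)

text \<open>If \<open>q = 2r + 1\<close>, the last entry is arbitrary.\<close>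

definition pat :: "nat \<Rightarrow> nat \<Rightarrow> nat \<Rightarrow> 'a list set" where
  "pat q r m = {v \<in> cycs q adj. \<forall>i<2 * r. v ! i \<in> big m \<longleftrightarrow> even i}"

lemma fin_pat: "finite (pat q r m)" unfolding pat_def using fin_cycs by simp

end

context circ
begin

lemma card_big: "0 < card V \<Longrightarrow> card (big m) \<le> 2 * L * m"
proof -
  assume V: "0 < card V"
  have "Sigma V nb = {(x, y). adj x y}" using adj_V by (auto simp: nb_def)
  then have "(\<Sum>v\<in>V. card (nb v)) = card {(x, y). adj x y}"
    using card_SigmaI[OF finV, of nb] by simp
  then have s: "(\<Sum>v\<in>V. card (nb v)) \<le> 2 * L * card V" using card_arcs by simp
  have "card (big m) * card V = (\<Sum>v\<in>big m. card V)" by simp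
  also have "\<dots> \<le> (\<Sum>v\<in>big m. m * card (nb v))" by (rule sum_mono) (auto simp: big_def)
  also have "\<dots> \<le> (\<Sum>v\<in>V. m * card (nb v))" by (rule sum_mono2[OF finV big_sub]) simp
  also have "\<dots> = m * (\<Sum>v\<in>V. card (nb v))" by (simp add: sum_distrib_left)
  also have "\<dots> \<le> m * (2 * L * card V)" using s by simp
  finally have "card (big m) * card V \<le> (2 * L * m) * card V" by (simp add: algebra_simps)
  then show ?thesis using V by simp
qed

abbreviation "instep x y \<equiv> rank y < rank x"

text \<open>A step to a lower rank, here called an in-step, is the expensive kind: in the other direction there are at most \<open>L\<close>
  choices. In \<open>slow_instep\<close> one of the in-steps starts at a vertex of small degree, so that it has only \<open>n div m\<close>
  choices.\<close>

definition slow_instep :: "nat \<Rightarrow> nat \<Rightarrow> nat \<Rightarrow> 'a list set" where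
  "slow_instep q m p = {v \<in> cycs q adj. card {k. k < q - 1 \<and> instep (v ! k) (v ! Suc k)} \<le> p \<and>
     (\<exists>k<q - 1. instep (v ! k) (v ! Suc k) \<and> v ! k \<notin> big m)}"

definition no_instep :: "nat \<Rightarrow> 'a list set" where
  "no_instep q = {v \<in> cycs q adj. \<forall>k<q - 1. \<not> instep (v ! k) (v ! Suc k)}"

text \<open>All in-steps start at big vertices. As there are boundedly many big vertices, many choices are left only for small
  entries that follow a big one, and possibly for the first entry.\<close>

definition few_entries :: "nat \<Rightarrow> nat \<Rightarrow> nat \<Rightarrow> 'a list set" where
  "few_entries q m p = {v \<in> cycs q adj. (v ! 0 \<in> big m \<or> (\<forall>k<q. v ! k \<notin> big m)) \<and>
     (\<forall>k<q - 1. v ! k \<notin> big m \<longrightarrow> \<not> instep (v ! k) (v ! Suc k)) \<and>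
     ecount (\<lambda>x y. x \<in> big m \<and> y \<notin> big m) v \<le> p}"

lemma cycsD:
  assumes "v \<in> cycs q adj"
  shows "length v = q" "3 \<le> q" "distinct v" "\<And>k. k < q \<Longrightarrow> v ! k \<in> V" "\<And>k. k < q - 1 \<Longrightarrow> adj (v ! k) (v ! Suc k)"
    "\<And>k. k < q - 1 \<Longrightarrow> \<not> instep (v ! k) (v ! Suc k) \<Longrightarrow> v ! Suc k \<in> outn (v ! k)"
proof -
  have v: "cyc adj v" "length v = q" using assms by (auto simp: cycs_def)
  show l: "length v = q" "3 \<le> q" "distinct v" using v by (auto simp: cyc_def)
  show "v ! k \<in> V" if "k < q" for k using cyc_sub[OF v(1)] that v(2) by (meson nth_mem subsetD)
  show a: "adj (v ! k) (v ! Suc k)" if "k < q - 1" for k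
  proof -
    have "Suc k < length v" using that l by simp
    moreover have "successively adj v" using v(1) by (simp add: cyc_def)
    ultimately show ?thesis by (simp add: successively_conv_nth)
  qed
  show "v ! Suc k \<in> outn (v ! k)" if "k < q - 1" "\<not> instep (v ! k) (v ! Suc k)" for k
    using a[OF that(1)] rank_neq[OF a[OF that(1)]] that(2) by (auto simp: outn_def)
qed

lemma V_pos: "v \<in> cycs q adj \<Longrightarrow> 0 < card V"
  using cycsD(2,4)[of v q] finV by (metis card_gt_0_iff empty_iff less_le_trans zero_less_numeral)

text \<open>The first entry and at most \<open>p - 1\<close> in-steps have \<open>n\<close> choices each, the in-step from a small vertex has \<open>n div m\<close>, and
  all other entries have at most \<open>L\<close>.\<close>

lemma card_slow_instep:
  assumes "0 < m" "0 < card V"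
  shows "card (slow_instep q m p) \<le> 2 ^ q * q * (L ^ q * (card V ^ p * (card V div m)))"
proof -
  let ?n = "card V"
  define S where "S = (\<lambda>(I :: nat set, k0) k xs. if k = 0 then V else if k - 1 = k0 then (if last xs \<in> V - big m then nb (last xs) else {})
     else if k - 1 \<in> I then V else outn (last xs))"
  define X where "X = (\<lambda>z. {xs. length xs = q \<and> (\<forall>k<q. xs ! k \<in> S z k (take k xs))})"
  define Z where "Z = {(I, k0). I \<subseteq> {..<q - 1} \<and> k0 \<in> I \<and> card I \<le> p}"
  have Zs: "Z \<subseteq> Pow {..<q - 1} \<times> {..<q - 1}" by (auto simp: Z_def)
  have finZ: "finite Z" by (rule finite_subset[OF Zs]) simp
  have cZ: "card Z \<le> 2 ^ q * q"
  proof -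
    have "card Z \<le> card (Pow {..<q - 1} \<times> {..<q - 1})" by (rule card_mono[OF _ Zs]) simp
    also have "\<dots> = 2 ^ (q - 1) * (q - 1)" by (simp add: card_cartesian_product card_Pow)
    also have "\<dots> \<le> 2 ^ q * q" by (intro mult_mono power_increasing) auto
    finally show ?thesis .
  qed
  have XZ: "finite (X z) \<and> card (X z) \<le> L ^ q * (?n ^ p * (?n div m))" if "z \<in> Z" for z
  proof -
    obtain I k0 where z: "z = (I, k0)" "I \<subseteq> {..<q - 1}" "k0 \<in> I" "card I \<le> p"
      using \<open>z \<in> Z\<close> unfolding Z_def by (cases z) blast
    have finI: "finite I" using z(2) finite_subset by blast
    define b where "b = (\<lambda>k. if k = 0 then ?n else if k - 1 = k0 then ?n div m else if k - 1 \<in> I then ?n else L)"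
    have "finite (S z k xs) \<and> card (S z k xs) \<le> b k" for k xs
      unfolding S_def b_def z using finV card_outn card_nb_small assms(1) by auto
    then have X: "finite (X z) \<and> card (X z) \<le> (\<Prod>k<q. b k)"
      unfolding X_def by (intro card_lists_step) auto
    have k0: "Suc k0 \<in> {..<q}" using z by auto
    have "(\<Prod>k<q. b k) = b (Suc k0) * (\<Prod>k\<in>{..<q} - {Suc k0}. b k)"
      by (rule prod.remove) (use k0 in auto)
    also have "\<dots> \<le> (?n div m) * (L ^ card ({..<q} - {Suc k0}) * ?n ^ p)"
    proof (rule mult_mono)
      have "{k \<in> {..<q} - {Suc k0}. k = 0 \<or> k - 1 \<in> I} \<subseteq> insert 0 (Suc ` (I - {k0}))"
      proof
        fix k assume "k \<in> {k \<in> {..<q} - {Suc k0}. k = 0 \<or> k - 1 \<in> I}"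
        then show "k \<in> insert 0 (Suc ` (I - {k0}))" by (cases k) auto
      qed
      then have "card {k \<in> {..<q} - {Suc k0}. k = 0 \<or> k - 1 \<in> I} \<le> card (insert 0 (Suc ` (I - {k0})))"
        using finI by (intro card_mono) auto
      also have "\<dots> \<le> Suc (card (Suc ` (I - {k0})))" by (rule card_insert_le_m1) auto
      also have "\<dots> = Suc (card I - 1)" using z(3) finI by (simp add: card_image)
      also have "\<dots> \<le> p" using z(3,4) finI card_gt_0_iff[of I] by auto
      finally have c: "card {k \<in> {..<q} - {Suc k0}. k = 0 \<or> k - 1 \<in> I} \<le> p" .
      show "(\<Prod>k\<in>{..<q} - {Suc k0}. b k) \<le> L ^ card ({..<q} - {Suc k0}) * ?n ^ p"
      proof (rule prod_bound_count[where P = "\<lambda>k. k = 0 \<or> k - 1 \<in> I"])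
        fix k assume k: "k \<in> {..<q} - {Suc k0}"
        then have "k = 0 \<or> k - 1 \<noteq> k0" by auto
        then show "b k \<le> L * (if k = 0 \<or> k - 1 \<in> I then ?n else 1)"
          using L2 by (auto simp: b_def)
      qed (use L2 assms c in auto)
    qed (auto simp: b_def)
    also have "\<dots> \<le> (?n div m) * (L ^ q * ?n ^ p)"
    proof -
      have "L ^ card ({..<q} - {Suc k0}) \<le> L ^ q"
        using L2 by (intro power_increasing) (auto intro: order_trans[OF card_mono[of "{..<q}"]])
      then show ?thesis by (intro mult_le_mono) auto
    qed
    finally show ?thesis using X by (simp add: algebra_simps)
  qed
  have sub: "slow_instep q m p \<subseteq> (\<Union>z\<in>Z. X z)"
  proof
    fix v assume v: "v \<in> slow_instep q m p"
    then have vc: "v \<in> cycs q adj" by (simp add: slow_instep_def)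
    note D = cycsD[OF vc]
    define I where "I = {k. k < q - 1 \<and> instep (v ! k) (v ! Suc k)}"
    obtain k0 where k0: "k0 < q - 1" "instep (v ! k0) (v ! Suc k0)" "v ! k0 \<notin> big m"
      using v by (auto simp: slow_instep_def)
    have "(I, k0) \<in> Z" using v k0 by (auto simp: Z_def I_def slow_instep_def)
    moreover have "v \<in> X (I, k0)"
      unfolding X_def
    proof (intro CollectI conjI allI impI)
      show "length v = q" by (rule D(1))
      fix k assume k: "k < q"
      show "v ! k \<in> S (I, k0) k (take k v)"
      proof (cases k)
        case 0
        then show ?thesis using D(4)[OF k] by (simp add: S_def)
      next
        case (Suc j)
        have lt: "last (take k v) = v ! j" using last_take_nth[of k v] k D(1) Suc by simp
        have j: "j < q - 1" using k Suc by simp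
        have "j \<notin> I \<Longrightarrow> v ! Suc j \<in> outn (v ! j)" using D(6)[OF j] j by (auto simp: I_def)
        moreover have "v ! Suc j \<in> nb (v ! j)" using D(5)[OF j] by (simp add: nb_def)
        moreover have "v ! k0 \<in> V" using D(4)[of k0] k0(1) by simp
        ultimately show ?thesis using k0(3) D(4)[OF k] unfolding S_def Suc using lt Suc by auto
      qed
    qed
    ultimately show "v \<in> (\<Union>z\<in>Z. X z)" by blast
  qed
  have "card (slow_instep q m p) \<le> card (\<Union>z\<in>Z. X z)"
    by (rule card_mono[OF _ sub]) (use finZ XZ in blast)
  also have "\<dots> \<le> (\<Sum>z\<in>Z. card (X z))" by (rule card_UN_le[OF finZ])
  also have "\<dots> \<le> (\<Sum>z\<in>Z. L ^ q * (?n ^ p * (?n div m)))" by (rule sum_mono) (use XZ in blast)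
  also have "\<dots> = card Z * (L ^ q * (?n ^ p * (?n div m)))" by simp
  also have "\<dots> \<le> (2 ^ q * q) * (L ^ q * (?n ^ p * (?n div m)))" by (rule mult_right_mono[OF cZ]) simp
  finally show ?thesis .
qed

lemma card_no_instep:
  assumes "0 < card V"
  shows "card (no_instep q) \<le> L ^ q * card V"
proof -
  let ?n = "card V"
  define S where "S = (\<lambda>k xs. if k = (0::nat) then V else outn (last xs))"
  define X where "X = {xs. length xs = q \<and> (\<forall>k<q. xs ! k \<in> S k (take k xs))}"
  define b where "b = (\<lambda>k. if k = (0::nat) then ?n else L)"
  have "finite (S k xs) \<and> card (S k xs) \<le> b k" for k xs
    unfolding S_def b_def using finV card_outn by auto
  then have X: "finite X \<and> card X \<le> (\<Prod>k<q. b k)"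
    unfolding X_def by (intro card_lists_step) auto
  have "(\<Prod>k<q. b k) \<le> L ^ card {..<q} * ?n ^ 1"
  proof (rule prod_bound_count[where P = "\<lambda>k. k = 0"])
    show "card {k \<in> {..<q}. k = 0} \<le> 1"
      by (rule order_trans[OF card_mono[of "{0}"]]) auto
  qed (use L2 assms in \<open>auto simp: b_def\<close>)
  moreover have "no_instep q \<subseteq> X"
  proof
    fix v assume v: "v \<in> no_instep q"
    then have vc: "v \<in> cycs q adj" by (simp add: no_instep_def)
    note D = cycsD[OF vc]
    show "v \<in> X"
      unfolding X_def
    proof (intro CollectI conjI allI impI)
      show "length v = q" by (rule D(1))
      fix k assume k: "k < q"
      show "v ! k \<in> S k (take k v)"
      proof (cases k)
        case 0
        then show ?thesis using D(4)[OF k] by (simp add: S_def)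
      next
        case (Suc j)
        have lt: "last (take k v) = v ! j" using last_take_nth[of k v] k D(1) Suc by simp
        have j: "j < q - 1" using k Suc by simp
        then have "v ! Suc j \<in> outn (v ! j)" using D(6)[OF j] v by (auto simp: no_instep_def)
        then show ?thesis unfolding S_def using lt Suc by auto
      qed
    qed
  qed
  ultimately show ?thesis using X card_mono[of X "no_instep q"] by simp
qed

lemma card_few_entries:
  assumes "0 < card V" "card (big m) \<le> K" "1 \<le> p"
  shows "card (few_entries q m p) \<le> 2 ^ q * (((K + 1) * L) ^ q * card V ^ p)"
proof -
  let ?n = "card V" and ?A = "big m"
  define S where "S = (\<lambda>(J :: nat set) k xs. if k \<in> J then ?A else if k = 0 \<or> k - 1 \<in> J then V else outn (last xs))"
  define X where "X = (\<lambda>z. {xs. length xs = q \<and> (\<forall>k<q. xs ! k \<in> S z k (take k xs))})"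
  define Z where "Z = {J. J \<subseteq> {..<q} \<and> card {k \<in> {..<q}. k \<notin> J \<and> (k = 0 \<or> k - 1 \<in> J)} \<le> p}"
  have finZ: "finite Z" by (rule finite_subset[of _ "Pow {..<q}"]) (auto simp: Z_def)
  have cZ: "card Z \<le> 2 ^ q"
  proof -
    have "card Z \<le> card (Pow {..<q})" by (rule card_mono) (auto simp: Z_def)
    then show ?thesis by (simp add: card_Pow)
  qed
  have XZ: "finite (X J) \<and> card (X J) \<le> ((K + 1) * L) ^ q * ?n ^ p" if "J \<in> Z" for J
  proof -
    define b where "b = (\<lambda>k. if k \<in> J then K else if k = 0 \<or> k - 1 \<in> J then ?n else L)"
    have "finite (S J k xs) \<and> card (S J k xs) \<le> b k" for k xs
      unfolding S_def b_def using finV card_outn assms by auto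
    then have X: "finite (X J) \<and> card (X J) \<le> (\<Prod>k<q. b k)"
      unfolding X_def by (intro card_lists_step) auto
    have "(\<Prod>k<q. b k) \<le> ((K + 1) * L) ^ card {..<q} * ?n ^ p"
    proof (rule prod_bound_count[where P = "\<lambda>k. k \<notin> J \<and> (k = 0 \<or> k - 1 \<in> J)"])
      have "K * 1 \<le> (K + 1) * L" by (rule mult_le_mono) (use L2 in auto)
      then have "K \<le> (K + 1) * L" "L \<le> (K + 1) * L" "1 \<le> (K + 1) * L" using L2 by auto
      then show "b k \<le> (K + 1) * L * (if k \<notin> J \<and> (k = 0 \<or> k - 1 \<in> J) then ?n else 1)" "1 \<le> (K + 1) * L" for k
        by (auto simp: b_def intro: order_trans[of _ "1 * ?n"] mult_right_mono)
      show "card {k \<in> {..<q}. k \<notin> J \<and> (k = 0 \<or> k - 1 \<in> J)} \<le> p" using that by (simp add: Z_def)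
    qed (use assms in auto)
    then show ?thesis using X by simp
  qed
  have sub: "few_entries q m p \<subseteq> (\<Union>J\<in>Z. X J)"
  proof
    fix v assume v: "v \<in> few_entries q m p"
    then have vc: "v \<in> cycs q adj" by (simp add: few_entries_def)
    note D = cycsD[OF vc]
    define J where "J = {k. k < q \<and> v ! k \<in> ?A}"
    define R where "R = {k \<in> {..<q}. k \<notin> J \<and> (k = 0 \<or> k - 1 \<in> J)}"
    have "card R \<le> p"
    proof (cases "v ! 0 \<in> ?A")
      case True
      have "inj_on (\<lambda>k. k - 1) R"
      proof (rule inj_onI)
        fix x y assume "x \<in> R" "y \<in> R" "x - 1 = y - 1"
        moreover have "0 \<notin> R" using True D(2) by (auto simp: R_def J_def)
        ultimately show "x = y" by (metis Suc_pred' gr0I)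
      qed
      moreover have "(\<lambda>k. k - 1) ` R \<subseteq> {i. i < length v \<and> v ! i \<in> ?A \<and> v ! (Suc i mod length v) \<notin> ?A}"
      proof
        fix j assume "j \<in> (\<lambda>k. k - 1) ` R"
        then obtain k where k: "k \<in> R" "j = k - 1" by blast
        then have "k \<noteq> 0" using True D(2) by (metis (no_types, lifting) J_def R_def k(1) lessThan_iff mem_Collect_eq)
        then have "k = Suc j" using k by simp
        then show "j \<in> {i. i < length v \<and> v ! i \<in> ?A \<and> v ! (Suc i mod length v) \<notin> ?A}"
          using k D(1) by (auto simp: R_def J_def)
      qed
      ultimately have "card R \<le> ecount (\<lambda>x y. x \<in> ?A \<and> y \<notin> ?A) v"
        unfolding ecount_def by (intro card_inj_on_le) auto
      then show ?thesis using v by (simp add: few_entries_def)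
    next
      case False
      then have "J = {}" using v by (auto simp: few_entries_def J_def)
      then have "R \<subseteq> {0}" by (auto simp: R_def)
      then have "card R \<le> 1" using card_mono[of "{0}" R] by simp
      then show ?thesis using assms(3) by simp
    qed
    then have "J \<in> Z" by (auto simp: Z_def R_def J_def)
    moreover have "v \<in> X J"
      unfolding X_def
    proof (intro CollectI conjI allI impI)
      show "length v = q" by (rule D(1))
      fix k assume k: "k < q"
      show "v ! k \<in> S J k (take k v)"
      proof (cases k)
        case 0
        then show ?thesis using D(4)[OF k] k by (auto simp: S_def J_def)
      next
        case (Suc j)
        have lt: "last (take k v) = v ! j" using last_take_nth[of k v] k D(1) Suc by simp
        have j: "j < q - 1" using k Suc by simp
        have "j \<notin> J \<Longrightarrow> v ! Suc j \<in> outn (v ! j)" using D(6)[OF j] j v by (auto simp: J_def few_entries_def)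
        then show ?thesis using D(4)[OF k] k unfolding S_def using lt Suc by (auto simp: J_def)
      qed
    qed
    ultimately show "v \<in> (\<Union>J\<in>Z. X J)" by blast
  qed
  have "card (few_entries q m p) \<le> card (\<Union>z\<in>Z. X z)"
    by (rule card_mono[OF _ sub]) (use finZ XZ in blast)
  also have "\<dots> \<le> (\<Sum>z\<in>Z. card (X z))" by (rule card_UN_le[OF finZ])
  also have "\<dots> \<le> (\<Sum>z\<in>Z. ((K + 1) * L) ^ q * ?n ^ p)" by (rule sum_mono) (use XZ in blast)
  also have "\<dots> = card Z * (((K + 1) * L) ^ q * ?n ^ p)" by simp
  also have "\<dots> \<le> 2 ^ q * (((K + 1) * L) ^ q * ?n ^ p)" by (rule mult_right_mono[OF cZ]) simp
  finally show ?thesis .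
qed


text \<open>Reversing a list exchanges in-steps with the others, so at most \<open>r\<close> of the \<open>q \<le> 2r + 1\<close> steps may be assumed to be
  in-steps; rotating the list makes the first entry absorb one of them.\<close>

lemma few_transitions:
  assumes v: "v \<in> cycs q adj" and q: "q \<le> 2 * r + 1" and r: "2 \<le> r"
    and few: "ecount (\<lambda>x y. x \<in> big m \<and> y \<notin> big m) v \<le> r - 1"
  shows "\<exists>k\<le>q. \<exists>w\<in>slow_instep q m (r - 1) \<union> no_instep q \<union> few_entries q m (r - 1). v = rotate k w \<or> v = rev (rotate k w)"
proof -
  let ?X = "slow_instep q m (r - 1) \<union> no_instep q \<union> few_entries q m (r - 1)"
  have main: "\<exists>k\<le>q. \<exists>w\<in>?X. v = rotate k w"
    if v: "v \<in> cycs q adj" and few: "ecount (\<lambda>x y. x \<in> big m \<and> y \<notin> big m) v \<le> r - 1"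
      and ins: "ecount instep v \<le> r" for v
  proof -
    note D = cycsD[OF v]
    have rot: "rotate k v \<in> cycs q adj" for k using v by (simp add: cycs_def cyc_rotate)
    have bck: "\<exists>k\<le>q. \<exists>w\<in>?X. v = rotate k w" if "rotate k v \<in> ?X" "k \<le> q" for k
      using that rotate_back[of k v] D(1) by (metis diff_le_self)
    have q0: "0 < q" using D(2) by simp
    have count: "card {k. k < q - 1 \<and> instep (w ! k) (w ! Suc k)} + (if instep (w ! (q - 1)) (w ! 0) then 1 else 0) = ecount instep w"
      if w: "length w = q" for w
    proof -
      have e: "{i. i < length w \<and> instep (w ! i) (w ! (Suc i mod length w))} =
        {k. k < q - 1 \<and> instep (w ! k) (w ! Suc k)} \<union> (if instep (w ! (q - 1)) (w ! 0) then {q - 1} else {})"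
      proof -
        have "i < length w \<longleftrightarrow> i < q - 1 \<or> i = q - 1" for i using w q0 by auto
        moreover have "Suc i mod length w = Suc i" if "i < q - 1" for i using that w by simp
        moreover have "Suc (q - 1) mod length w = 0" using w q0 by simp
        ultimately show ?thesis by (auto split: if_splits)
      qed
      show ?thesis unfolding ecount_def e by (subst card_Un_disjoint) auto
    qed
    have idx: "rotate k v ! i = v ! ((k + i) mod q)" if "i < q" for i k using that D(1) by (simp add: nth_rotate)
    show ?thesis
    proof (cases "\<exists>k<q. instep (v ! k) (v ! (Suc k mod q)) \<and> v ! k \<notin> big m")
      case True
      then obtain k where k: "k < q" "instep (v ! k) (v ! (Suc k mod q))" "v ! k \<notin> big m" by blast
      show ?thesis
      proof (cases "\<exists>j<q. j \<noteq> k \<and> instep (v ! j) (v ! (Suc j mod q))")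
        case True
        then obtain j where j: "j < q" "j \<noteq> k" "instep (v ! j) (v ! (Suc j mod q))" by blast
        let ?w = "rotate (Suc j) v"
        have lw: "length ?w = q" using D(1) by simp
        have "?w ! (q - 1) = v ! j" using idx[of "q - 1" "Suc j"] q0 j(1) by simp
        moreover have "?w ! 0 = v ! (Suc j mod q)" using idx[of 0 "Suc j"] q0 by simp
        ultimately have "card {k. k < q - 1 \<and> instep (?w ! k) (?w ! Suc k)} + 1 = ecount instep v"
          using count[OF lw] j(3) ecount_rotate[of instep "Suc j" v] by simp
        then have c: "card {k. k < q - 1 \<and> instep (?w ! k) (?w ! Suc k)} \<le> r - 1" using ins by simp
        define i where "i = (if Suc j \<le> k then k - Suc j else k + q - Suc j)"
        have i: "i < q - 1" "(Suc j + i) mod q = k" "(Suc j + Suc i) mod q = Suc k mod q"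
        proof -
          show "i < q - 1" using k(1) j(1,2) unfolding i_def by auto
          show 2: "(Suc j + i) mod q = k" using k(1) j(1,2) unfolding i_def by auto
          have "(Suc j + Suc i) mod q = Suc ((Suc j + i) mod q) mod q" by (simp add: mod_simps)
          then show "(Suc j + Suc i) mod q = Suc k mod q" using 2 by simp
        qed
        have iq: "i < q" "Suc i < q" using i(1) by auto
        have "?w ! i = v ! k" "?w ! Suc i = v ! (Suc k mod q)"
          using idx[OF iq(1), of "Suc j"] idx[OF iq(2), of "Suc j"] unfolding i(2,3) by blast+
        then have "?w \<in> slow_instep q m (r - 1)" unfolding slow_instep_def using rot[of "Suc j"] c k i(1) by auto
        then show ?thesis using bck[of "Suc j"] j(1) by auto
      next
        case False
        let ?w = "rotate (Suc k) v"
        have "\<not> instep (?w ! i) (?w ! Suc i)" if i: "i < q - 1" for i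
        proof -
          have "?w ! i = v ! ((Suc k + i) mod q)" "?w ! Suc i = v ! (Suc ((Suc k + i) mod q) mod q)"
            using idx[of i "Suc k"] idx[of "Suc i" "Suc k"] i by (auto simp: mod_simps)
          moreover have "(Suc k + i) mod q \<noteq> k"
          proof
            assume e: "(Suc k + i) mod q = k"
            show False
            proof (cases "Suc k + i < q")
              case False
              then have "(Suc k + i) mod q = (Suc k + i - q) mod q" by (simp add: le_mod_geq)
              also have "\<dots> = Suc k + i - q" using i k(1) by (intro mod_less) simp
              finally show False using e i k(1) False by simp
            qed (use e in simp)
          qed
          moreover have "(Suc k + i) mod q < q" using q0 by simp
          ultimately show ?thesis using False by metis
        qed
        then have "?w \<in> no_instep q" using rot[of "Suc k"] by (simp add: no_instep_def)
        then show ?thesis using bck[of "Suc k"] k(1) by auto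
      qed
    next
      case False
      obtain k where k: "k \<le> q" "rotate k v ! 0 \<in> big m \<or> (\<forall>k<q. v ! k \<notin> big m)"
      proof (cases "\<forall>k<q. v ! k \<notin> big m")
        case True then show ?thesis using that[of 0] by simp
      next
        case False
        then obtain k where "k < q" "v ! k \<in> big m" by blast
        then show ?thesis using that[of k] idx[of 0 k] q0 by simp
      qed
      let ?w = "rotate k v"
      have "\<forall>i<q. ?w ! i \<notin> big m" if "\<forall>k<q. v ! k \<notin> big m" using that idx q0 by simp
      moreover have "\<not> instep (?w ! i) (?w ! Suc i)" if i: "i < q - 1" "?w ! i \<notin> big m" for i
      proof -
        have "?w ! i = v ! ((k + i) mod q)" "?w ! Suc i = v ! (Suc ((k + i) mod q) mod q)"
          using idx[of i k] idx[of "Suc i" k] i by (auto simp: mod_simps)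
        moreover have "(k + i) mod q < q" using q0 by simp
        ultimately show ?thesis using False i(2) by metis
      qed
      ultimately have "?w \<in> few_entries q m (r - 1)" unfolding few_entries_def
        using rot[of k] k few ecount_rotate[of "\<lambda>x y. x \<in> big m \<and> y \<notin> big m" k v] by auto
      then show ?thesis using bck k(1) by blast
    qed
  qed
  have D: "length v = q" using cycsD(1)[OF v] .
  have revc: "rev v \<in> cycs q adj" using v adj_sym by (auto simp: cycs_def cyc_rev)
  have sum: "ecount instep v + ecount instep (rev v) = q"
  proof -
    have "{i. i < q \<and> instep (v ! (Suc i mod q)) (v ! i)} = {..<q} - {i. i < q \<and> instep (v ! i) (v ! (Suc i mod q))}"
    proof -
      have "rank (v ! i) \<noteq> rank (v ! (Suc i mod q))" if "i < q" for i
        using v that by (intro rank_neq) (auto simp: cycs_def cyc_nth)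
      then show ?thesis by force
    qed
    then have "card {i. i < q \<and> instep (v ! (Suc i mod q)) (v ! i)} = q - card {i. i < q \<and> instep (v ! i) (v ! (Suc i mod q))}"
      by (simp add: card_Diff_subset subset_iff)
    moreover have "card {i. i < q \<and> instep (v ! i) (v ! (Suc i mod q))} \<le> q"
      by (rule order_trans[OF card_mono[of "{..<q}"]]) auto
    ultimately show ?thesis unfolding ecount_rev unfolding ecount_def D by simp
  qed
  show ?thesis
  proof (cases "ecount instep v \<le> r")
    case True
    then show ?thesis using main[OF v few] by blast
  next
    case False
    then have "ecount instep (rev v) \<le> r" using sum q by simp
    moreover have "ecount (\<lambda>x y. x \<in> big m \<and> y \<notin> big m) (rev v) \<le> r - 1"
      using few ecount_transitions[of "big m" v] by (simp add: ecount_rev conj_commute)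
    ultimately obtain k w where "k \<le> q" "w \<in> ?X" "rev v = rotate k w" using main[OF revc] by blast
    then show ?thesis by (metis rev_rev_ident)
  qed
qed

lemma card_few_transitions:
  assumes q: "q \<le> 2 * r + 1" "2 \<le> r" and m: "0 < m" and n: "0 < card V" and K: "card (big m) \<le> K"
  shows "card {v \<in> cycs q adj. ecount (\<lambda>x y. x \<in> big m \<and> y \<notin> big m) v \<le> r - 1} \<le>
    2 * (q + 1) * (2 ^ q * q * (L ^ q * (card V ^ (r - 1) * (card V div m))) + L ^ q * card V +
      2 ^ q * (((K + 1) * L) ^ q * card V ^ (r - 1)))"
proof -
  let ?X = "slow_instep q m (r - 1) \<union> no_instep q \<union> few_entries q m (r - 1)"
  let ?R = "(\<lambda>(k, w). rotate k w) ` ({..q} \<times> ?X)"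
  have finX: "finite ?X"
    using fin_cycs by (auto simp: slow_instep_def no_instep_def few_entries_def)
  have "{v \<in> cycs q adj. ecount (\<lambda>x y. x \<in> big m \<and> y \<notin> big m) v \<le> r - 1} \<subseteq> ?R \<union> rev ` ?R"
  proof
    fix v assume "v \<in> {v \<in> cycs q adj. ecount (\<lambda>x y. x \<in> big m \<and> y \<notin> big m) v \<le> r - 1}"
    then obtain k w where kw: "k \<le> q" "w \<in> ?X" "v = rotate k w \<or> v = rev (rotate k w)"
      using few_transitions[of v q r m] q by blast
    then have "rotate k w \<in> ?R" by (intro image_eqI[of _ _ "(k, w)"]) auto
    then show "v \<in> ?R \<union> rev ` ?R" using kw(3) by blast
  qed
  then have "card {v \<in> cycs q adj. ecount (\<lambda>x y. x \<in> big m \<and> y \<notin> big m) v \<le> r - 1} \<le> card (?R \<union> rev ` ?R)"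
    using finX by (intro card_mono) auto
  also have "\<dots> \<le> card ?R + card (rev ` ?R)" by (rule card_Un_le)
  also have "\<dots> \<le> card ?R + card ?R" using finX by (intro add_mono card_image_le) auto
  also have "card ?R \<le> card ({..q} \<times> ?X)" using finX by (intro card_image_le) auto
  also have "card ({..q} \<times> ?X) = (q + 1) * card ?X" by (simp add: card_cartesian_product)
  finally have "card {v \<in> cycs q adj. ecount (\<lambda>x y. x \<in> big m \<and> y \<notin> big m) v \<le> r - 1} \<le> 2 * (q + 1) * card ?X"
    by simp
  moreover have "card ?X \<le> card (slow_instep q m (r - 1)) + card (no_instep q) + card (few_entries q m (r - 1))"
    by (meson add_mono card_Un_le le_trans order_refl)
  moreover have "\<dots> \<le> 2 ^ q * q * (L ^ q * (card V ^ (r - 1) * (card V div m))) + L ^ q * card V +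
      2 ^ q * (((K + 1) * L) ^ q * card V ^ (r - 1))"
    using q by (intro add_mono card_slow_instep card_no_instep card_few_entries m n K) auto
  ultimately show ?thesis by (meson le_trans mult_le_mono2)
qed

end

subsection \<open>The alternating pattern\<close>

text \<open>With \<open>r\<close> transitions among at most \<open>2r + 1\<close> places, big and small entries alternate, except that for odd \<open>q\<close> one entry
  is left over; the list is rotated so that it comes last.\<close>

lemma transitions_pattern:
  assumes len: "length v = q" and q: "q = 2 * r \<or> q = 2 * r + 1" and r: "2 \<le> r"
    and tr: "r \<le> ecount (\<lambda>x y. x \<in> A \<and> y \<notin> A) v"
  shows "\<exists>k\<le>(if q = 2 * r then 1 else q). \<forall>i<2 * r. rotate k v ! i \<in> A \<longleftrightarrow> even i"
proof -
  let ?s = "\<lambda>i. Suc i mod q"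
  define X where "X = {i. i < q \<and> v ! i \<in> A \<and> v ! ?s i \<notin> A}"
  have q0: "0 < q" using q r by auto
  have sl: "?s i < q" for i using q0 by simp
  have sinj: "i = j" if "i < q" "j < q" "?s i = ?s j" for i j
    using that by (auto simp: mod_Suc split: if_splits)
  have idx: "rotate k v ! i = v ! ((k + i) mod q)" if "i < q" for i k using that len by (simp add: nth_rotate)
  have finX: "finite X" by (simp add: X_def)
  have cX: "r \<le> card X" using tr by (simp add: ecount_def X_def len)
  have Xq: "i < q" if "i \<in> X" for i using that by (simp add: X_def)
  have "inj_on ?s X"
  proof (rule inj_onI)
    fix i j assume "i \<in> X" "j \<in> X" "?s i = ?s j"
    then show "i = j" using sinj[OF Xq Xq] by blast
  qed
  then have cs: "card (?s ` X) = card X" by (rule card_image)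
  have disj: "X \<inter> ?s ` X = {}" by (auto simp: X_def)
  have cU: "card (X \<union> ?s ` X) = 2 * card X" using card_Un_disjoint[OF finX _ disj] finX cs by simp
  have subU: "X \<union> ?s ` X \<subseteq> {..<q}" using sl by (auto simp: X_def)
  then have "2 * card X \<le> q" using cU card_mono[OF _ subU] by simp
  then have cXr: "card X = r" using cX q by auto
  have inX: "v ! i \<in> A \<longleftrightarrow> i \<in> X" if "i \<in> X \<union> ?s ` X" for i
    using that by (auto simp: X_def)
  have nX: "?s i \<notin> ?s ` X" if "i < q" "i \<notin> X" for i
  proof
    assume "?s i \<in> ?s ` X"
    then obtain j where "j \<in> X" "?s i = ?s j" by blast
    then show False using sinj[OF that(1) Xq] that(2) by blast
  qed
  show ?thesis
  proof (cases "q = 2 * r")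
    case True
    then have U: "X \<union> ?s ` X = {..<q}" using cU cXr subU by (intro card_subset_eq) auto
    have alt: "v ! ?s i \<in> A \<longleftrightarrow> v ! i \<notin> A" if "i < q" for i
    proof -
      have 1: "v ! i \<in> A \<longleftrightarrow> i \<in> X" "v ! ?s i \<in> A \<longleftrightarrow> ?s i \<in> X" using inX U sl that by auto
      have "i \<in> X \<Longrightarrow> ?s i \<notin> X" using disj by blast
      moreover have "i \<notin> X \<Longrightarrow> ?s i \<in> X" using nX[OF that] U sl by blast
      ultimately show ?thesis using 1 by blast
    qed
    have par: "v ! i \<in> A \<longleftrightarrow> (v ! 0 \<in> A \<longleftrightarrow> even i)" if "i < q" for i
      using that
    proof (induction i)
      case (Suc i)
      then have "?s i = Suc i" by simp
      then show ?case using alt[of i] Suc by auto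
    qed simp
    show ?thesis
    proof (cases "v ! 0 \<in> A")
      case in0: True
      then show ?thesis using par True by (intro exI[of _ 0]) auto
    next
      case False
      have "rotate 1 v ! i \<in> A \<longleftrightarrow> even i" if "i < 2 * r" for i
        using that idx[of i 1] alt[of i] par[of i] True False by simp
      then show ?thesis using True by (intro exI[of _ 1]) auto
    qed
  next
    case False
    then have q1: "q = 2 * r + 1" using q by simp
    have "card ({..<q} - (X \<union> ?s ` X)) = 1"
      using cU cXr subU finX q1 by (subst card_Diff_subset) auto
    then obtain e where e: "{..<q} - (X \<union> ?s ` X) = {e}" by (auto simp: card_1_singleton_iff)
    then have eq: "e < q" "e \<notin> X" "e \<notin> ?s ` X" by auto
    define t where "t = (\<lambda>i. (Suc e + i) mod q)"
    have t0: "t 0 = ?s e" by (simp add: t_def)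
    have tS: "t (Suc i) = ?s (t i)" for i by (simp add: t_def mod_simps)
    have tl: "t i < q" for i using q0 by (simp add: t_def)
    have te: "t i \<noteq> e" if "Suc i < q" for i
    proof
      assume "t i = e"
      then have "(Suc e + i) mod q = (e + 0) mod q" using eq by (simp add: t_def)
      then have "q dvd (Suc e + i) - (e + 0)" by (intro mod_eq_dvd_iff_nat[THEN iffD1]) auto
      then show False using that by (auto dest: dvd_imp_le)
    qed
    have cover: "t i \<in> X \<union> ?s ` X" if "Suc i < q" for i using te[OF that] tl[of i] e by blast
    have par: "t i \<in> X \<longleftrightarrow> even i" if "i < 2 * r" for i
      using that
    proof (induction i)
      case 0
      have "t 0 \<notin> ?s ` X" unfolding t0 by (rule nX[OF eq(1,2)])
      then show ?case using cover[of 0] q1 r by auto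
    next
      case (Suc i)
      then have IH: "t i \<in> X \<longleftrightarrow> even i" by simp
      show ?case
      proof (cases "even i")
        case True
        then have "t (Suc i) \<in> ?s ` X" using IH tS by simp
        then show ?thesis using disj True by auto
      next
        case False
        then have "t (Suc i) \<notin> ?s ` X" unfolding tS using IH tl by (intro nX) auto
        then show ?thesis using cover[of "Suc i"] Suc.prems q1 False by auto
      qed
    qed
    have "rotate (Suc e) v ! i \<in> A \<longleftrightarrow> even i" if "i < 2 * r" for i
    proof -
      have "rotate (Suc e) v ! i = v ! t i" using idx[of i "Suc e"] that q1 by (simp add: t_def)
      then show ?thesis using par[OF that] inX cover[of i] that q1 by simp
    qed
    then show ?thesis using False eq(1) by (intro exI[of _ "Suc e"]) auto
  qed
qed

context circ
begin

lemma card_cycs_le_pat: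
  assumes q: "q = 2 * r \<or> q = 2 * r + 1" and r: "2 \<le> r"
  shows "card (cycs q adj) \<le> card {v \<in> cycs q adj. ecount (\<lambda>x y. x \<in> big m \<and> y \<notin> big m) v \<le> r - 1} +
    (if q = 2 * r then 2 else q) * card (pat q r m)"
proof -
  let ?B = "{v \<in> cycs q adj. ecount (\<lambda>x y. x \<in> big m \<and> y \<notin> big m) v \<le> r - 1}"
  let ?c = "if q = 2 * r then 2 else q"
  let ?G = "(\<lambda>(k, w). rotate (q - k) w) ` ((if q = 2 * r then {..1} else {1..q}) \<times> pat q r m)"
  have "cycs q adj \<subseteq> ?B \<union> ?G"
  proof
    fix v assume v: "v \<in> cycs q adj"
    show "v \<in> ?B \<union> ?G"
    proof (cases "ecount (\<lambda>x y. x \<in> big m \<and> y \<notin> big m) v \<le> r - 1")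
      case False
      then have tr: "r \<le> ecount (\<lambda>x y. x \<in> big m \<and> y \<notin> big m) v" by simp
      have l: "length v = q" using cycsD(1)[OF v] .
      obtain k0 where k0: "k0 \<le> (if q = 2 * r then 1 else q)" "\<forall>i<2 * r. rotate k0 v ! i \<in> big m \<longleftrightarrow> even i"
        using transitions_pattern[OF l q r tr] by blast
      define k where "k = (if q \<noteq> 2 * r \<and> k0 = 0 then q else k0)"
      have rk: "rotate k v = rotate k0 v" using l by (simp add: k_def)
      have k: "k \<in> (if q = 2 * r then {..1} else {1..q})" "k \<le> q"
        using k0(1) q r by (auto simp: k_def)
      have "rotate k v \<in> pat q r m" using v k0(2) unfolding rk pat_def by (simp add: cycs_def cyc_rotate)
      moreover have "v = rotate (q - k) (rotate k v)" using rotate_back[of k v] k l by simp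
      ultimately have "v \<in> ?G" using k(1) by (intro image_eqI[of _ _ "(k, rotate k v)"]) auto
      then show ?thesis by blast
    qed (use v in simp)
  qed
  moreover have "finite (?B \<union> ?G)" using fin_cycs fin_pat by auto
  ultimately have "card (cycs q adj) \<le> card (?B \<union> ?G)" by (intro card_mono)
  also have "\<dots> \<le> card ?B + card ?G" by (rule card_Un_le)
  also have "card ?G \<le> card ((if q = 2 * r then {..1} else {1..q}) \<times> pat q r m)"
    using fin_pat by (intro card_image_le) auto
  also have "\<dots> = ?c * card (pat q r m)" by (simp add: card_cartesian_product)
  finally show ?thesis by simp
qed

end

section \<open>Falling factorials\<close>

text \<open>The falling factorial on natural numbers, which vanishes if \<open>n < k\<close>.\<close>

fun ffact :: "nat \<Rightarrow> nat \<Rightarrow> nat" where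
  "ffact n 0 = 1"
| "ffact n (Suc k) = n * ffact (n - 1) k"

definition dlists :: "'a set \<Rightarrow> nat \<Rightarrow> 'a list set" where
  "dlists A k = {us. length us = k \<and> distinct us \<and> set us \<subseteq> A}"

lemma fin_dlists [simp]: "finite A \<Longrightarrow> finite (dlists A k)"
  by (rule finite_subset[OF _ finite_lists_length_eq[of A k]]) (auto simp: dlists_def)

lemma card_dlists: "finite A \<Longrightarrow> card (dlists A k) = ffact (card A) k"
proof (induction k arbitrary: A)
  case 0
  have "dlists A 0 = {[]}" by (auto simp: dlists_def)
  then show ?case by simp
next
  case (Suc k)
  have "dlists A (Suc k) = (\<lambda>(x, xs). x # xs) ` Sigma A (\<lambda>x. dlists (A - {x}) k)"
  proof
    show "dlists A (Suc k) \<subseteq> (\<lambda>(x, xs). x # xs) ` Sigma A (\<lambda>x. dlists (A - {x}) k)"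
    proof
      fix ys assume "ys \<in> dlists A (Suc k)"
      then show "ys \<in> (\<lambda>(x, xs). x # xs) ` Sigma A (\<lambda>x. dlists (A - {x}) k)"
        by (cases ys) (auto simp: dlists_def image_iff)
    qed
  qed (auto simp: dlists_def)
  moreover have "inj_on (\<lambda>(x, xs). x # xs) (Sigma A (\<lambda>x. dlists (A - {x}) k))" by (auto simp: inj_on_def)
  ultimately have "card (dlists A (Suc k)) = card (Sigma A (\<lambda>x. dlists (A - {x}) k))"
    by (simp add: card_image)
  also have "\<dots> = (\<Sum>x\<in>A. card (dlists (A - {x}) k))" using Suc.prems by (intro card_SigmaI) auto
  also have "\<dots> = (\<Sum>x\<in>A. ffact (card A - 1) k)"
    by (rule sum.cong) (use Suc in auto)
  finally show ?case by simp
qed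

lemma ffact_Suc: "ffact n (Suc k) = ffact n k * (n - k)"
proof (induction k arbitrary: n)
  case (Suc k)
  have "ffact n (Suc (Suc k)) = n * ffact (n - 1) (Suc k)" by (rule ffact.simps(2))
  also have "\<dots> = n * (ffact (n - 1) k * (n - 1 - k))" by (simp only: Suc[of "n - 1"])
  also have "\<dots> = ffact n (Suc k) * (n - Suc k)" by simp
  finally show ?case .
qed simp

lemma ffact_pos: "k \<le> n \<Longrightarrow> 0 < ffact n k"
  by (induction k arbitrary: n) auto

lemma list_with_last:
  assumes "finite X" "p \<in> X" "1 \<le> k" "k \<le> card X"
  obtains us where "us \<in> dlists X k" "last us = p"
proof -
  have "k - 1 \<le> card (X - {p})" using assms by simp
  then have "0 < card (dlists (X - {p}) (k - 1))" using assms(1) ffact_pos by (simp add: card_dlists)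
  then obtain us where "us \<in> dlists (X - {p}) (k - 1)" by (metis card_gt_0_iff ex_in_conv)
  then show ?thesis using that[of "us @ [p]"] assms by (auto simp: dlists_def)
qed

lemma ffact_zero: "n < k \<Longrightarrow> ffact n k = 0"
proof (induction k arbitrary: n)
  case (Suc k) then show ?case by (cases n) auto
qed simp

lemma ffact_mono: "n \<le> n' \<Longrightarrow> ffact n k \<le> ffact n' k"
  by (induction k arbitrary: n n') (auto intro!: mult_le_mono)

lemma ffact_strict: "n < n' \<Longrightarrow> 1 \<le> k \<Longrightarrow> k \<le> n' \<Longrightarrow> ffact n k < ffact n' k"
proof (cases k)
  case (Suc j)
  assume a: "n < n'" "k \<le> n'"
  have "ffact n k \<le> n * ffact (n' - 1) j" unfolding Suc using a ffact_mono[of "n - 1" "n' - 1" j] by simp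
  also have "\<dots> < n' * ffact (n' - 1) j" using a ffact_pos[of j "n' - 1"] Suc by auto
  finally show ?thesis by (simp add: Suc)
qed simp

section \<open>Chains of cliques\<close>

text \<open>Consecutive vertices of \<open>us\<close> lie in a common set of the list \<open>Ts\<close>, in the given order. The sets are thought of as
  cliques.\<close>

fun chain :: "'a list \<Rightarrow> 'a set list \<Rightarrow> bool" where
  "chain [u] [] = True"
| "chain (u # v # us) (T # Ts) = (u \<in> T \<and> v \<in> T \<and> chain (v # us) Ts)"
| "chain _ _ = False"

lemma chain_nth:
  "chain us Ts \<longleftrightarrow> length us = Suc (length Ts) \<and> (\<forall>k<length Ts. us ! k \<in> Ts ! k \<and> us ! Suc k \<in> Ts ! k)"
proof (induction us Ts rule: chain.induct)
  case (2 u v us T Ts)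
  have "(\<forall>k<length (T # Ts). (u # v # us) ! k \<in> (T # Ts) ! k \<and> (u # v # us) ! Suc k \<in> (T # Ts) ! k) \<longleftrightarrow>
    u \<in> T \<and> v \<in> T \<and> (\<forall>k<length Ts. (v # us) ! k \<in> Ts ! k \<and> (v # us) ! Suc k \<in> Ts ! k)"
    by (auto simp: less_Suc_eq_0_disj)
  then show ?case unfolding chain.simps 2 by auto
qed auto

text \<open>The elements of a clique that are not yet visited are inserted between the two consecutive vertices that the clique
  contributes.\<close>

lemma chain_extend:
  assumes "chain us Ts" "distinct us" "\<forall>T\<in>set Ts. finite T" "set us \<inter> F = {}"
  shows "\<exists>w. distinct w \<and> w \<noteq> [] \<and> hd w = hd us \<and> last w = last us \<and>
    set w = (set us \<union> \<Union>(set Ts)) - F \<and> successively (\<lambda>p p'. \<exists>T\<in>set Ts. p \<in> T \<and> p' \<in> T) w"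
  using assms
proof (induction us Ts arbitrary: F rule: chain.induct)
  case (1 u)
  then show ?case by (intro exI[of _ "[u]"]) auto
next
  case (2 u v us T Ts)
  have pre: "chain (v # us) Ts" "distinct (v # us)" "\<forall>T\<in>set Ts. finite T" "set (v # us) \<inter> insert u F = {}"
    using 2 by auto
  obtain w where w: "distinct w" "w \<noteq> []" "hd w = hd (v # us)" "last w = last (v # us)"
    "set w = (set (v # us) \<union> \<Union>(set Ts)) - insert u F"
    "successively (\<lambda>p p'. \<exists>T\<in>set Ts. p \<in> T \<and> p' \<in> T) w"
    using 2(1)[OF pre] by blast
  obtain es where es: "set es = T - F - {u} - set w" "distinct es"
    using 2(4) finite_distinct_list[of "T - F - {u} - set w"] by auto
  let ?R = "\<lambda>p p'. \<exists>T\<in>set (T # Ts). p \<in> T \<and> p' \<in> T"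
  have Tuv: "u \<in> T" "v \<in> T" using 2 by auto
  have s1: "successively ?R w" by (rule successively_mono[OF w(6)]) auto
  have in_T: "set xs \<subseteq> T \<Longrightarrow> successively ?R xs" for xs
    by (auto simp: successively_conv_nth)
  show ?case
  proof (intro exI[of _ "u # es @ w"] conjI)
    show "distinct (u # es @ w)" using es w by auto
    show "set (u # es @ w) = (set (u # v # us) \<union> \<Union>(set (T # Ts))) - F"
      using es w(5) 2(5) Tuv by auto
    show "last (u # es @ w) = last (u # v # us)" using w by simp
    have "last (u # es) \<in> T" using es(1) Tuv(1) by (cases es rule: rev_cases) auto
    then have "?R (last (u # es)) (hd w)" using Tuv(2) w(3) by auto
    moreover have "successively ?R (u # es)" by (rule in_T) (use es Tuv in auto)
    ultimately have "successively ?R ((u # es) @ w)" using s1 successively_append_iff by blast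
    then show "successively ?R (u # es @ w)" by simp
  qed auto
qed auto

section \<open>Paths between two neighbourhoods\<close>

lemma successively_rotate_to:
  assumes "successively E c" "E (last c) (hd c)" "u \<in> set c" "distinct c"
  shows "\<exists>c'. distinct c' \<and> set c' = set c \<and> length c' = length c \<and> successively E c' \<and> c' \<noteq> [] \<and> hd c' = u"
proof -
  obtain xs ys where c: "c = xs @ u # ys" using assms(3) by (meson split_list)
  show ?thesis
  proof (intro exI[of _ "u # ys @ xs"] conjI)
    show "successively E (u # ys @ xs)"
    proof (cases "xs = []")
      case True then show ?thesis using assms(1) c by simp
    next
      case False
      have "successively E (u # ys)" "successively E xs" using assms(1) c by (auto simp: successively_append_iff)
      moreover have "E (last (u # ys)) (hd xs)" using assms(2) c False by simp
      ultimately have "successively E ((u # ys) @ xs)" using successively_append_iff False by blast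
      then show ?thesis by simp
    qed
  qed (use assms c in auto)
qed

lemma successively_rev_sym:
  assumes "\<And>x y. E x y \<Longrightarrow> E y x" "successively E p"
  shows "successively E (rev p)"
proof -
  have "successively (\<lambda>x y. E y x) p" by (rule successively_mono[OF assms(2)]) (use assms(1) in blast)
  then show ?thesis by simp
qed

context ugraph
begin

text \<open>The part of the graph that is relevant for adjacent pairs in \<open>X \<times> Y\<close>.\<close>

definition eab :: "'a set \<Rightarrow> 'a set \<Rightarrow> 'a \<Rightarrow> 'a \<Rightarrow> bool" where
  "eab X Y u v \<longleftrightarrow> adj u v \<and> (u \<in> X \<and> v \<in> Y \<or> u \<in> Y \<and> v \<in> X)"

definition arcs :: "'a set \<Rightarrow> 'a set \<Rightarrow> ('a \<times> 'a) set" where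
  "arcs X Y = {(x, y). x \<in> X \<and> y \<in> Y \<and> adj x y}"

lemma fin_arcs [simp]: "finite (arcs X Y)"
proof (rule finite_subset)
  show "arcs X Y \<subseteq> V \<times> V" using adj_V adj_V2 by (auto simp: arcs_def)
qed (use finV in simp)

lemma eab_sym: "eab X Y u v \<Longrightarrow> eab X Y v u"
  using adj_sym by (auto simp: eab_def)

lemma eab_swap: "eab Y X = eab X Y"
  by (intro ext) (auto simp: eab_def)

definition eabpath :: "'a set \<Rightarrow> 'a set \<Rightarrow> 'a list \<Rightarrow> bool" where
  "eabpath X Y p \<longleftrightarrow> p \<noteq> [] \<and> distinct p \<and> successively (eab X Y) p \<and> set p \<subseteq> X \<union> Y"

lemma eabpath_rev: "eabpath X Y p \<Longrightarrow> eabpath X Y (rev p)"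
  unfolding eabpath_def using successively_rev_sym[of "eab X Y" p] eab_sym by auto

lemma eab_in: "eab X Y u v \<Longrightarrow> u \<in> X \<union> Y \<and> v \<in> X \<union> Y"
  by (auto simp: eab_def)

lemma eabpath_Cons:
  assumes "eabpath X Y p" "eab X Y w (hd p)" "w \<notin> set p"
  shows "eabpath X Y (w # p)"
proof -
  have "successively (eab X Y) (w # p)" using assms by (simp add: eabpath_def successively_Cons)
  then show ?thesis using assms eab_in[OF assms(2)] by (simp add: eabpath_def)
qed

text \<open>Sets of vertices that lie in few pairs can be removed without lowering the average. Otherwise consider a longest path;
  all neighbours of its ends lie on it. If both ends belong to the same side only, dropping one of them gives a path that
  is long enough by the degree of that end. If the ends are on different sides and the path is too short, crossing
  neighbours of the ends give a cycle on its vertices. By maximality these form a component, which is too small to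
  contain many pairs and can be removed.\<close>

lemma long_path_between_aux:
  assumes "1 \<le> k" "X \<subseteq> V" "Y \<subseteq> V" "(k - 1) * card (X \<union> Y) < card (arcs X Y)"
  shows "\<exists>p. eabpath X Y p \<and> hd p \<in> X \<and> last p \<in> Y \<and> k < length p"
  using assms
proof (induction "card (X \<union> Y)" arbitrary: X Y rule: less_induct)
  case less
  let ?E = "eab X Y"
  have finXY: "finite (X \<union> Y)" using less.prems finV by (meson finite_subset le_sup_iff)
  have fE: "finite {w. ?E v w}" for v
    by (rule finite_subset[OF _ finV]) (auto simp: eab_def dest: adj_V2)
  have reduce: ?case if R: "R \<noteq> {}" "R \<subseteq> X \<union> Y"
    and few: "card {(x, y) \<in> arcs X Y. x \<in> R \<or> y \<in> R} \<le> (k - 1) * card R" for R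
  proof -
    have finR: "finite R" using R(2) finXY finite_subset by blast
    have U: "(X - R) \<union> (Y - R) = (X \<union> Y) - R" by auto
    have c: "card ((X - R) \<union> (Y - R)) = card (X \<union> Y) - card R"
      unfolding U by (rule card_Diff_subset[OF finR R(2)])
    have cR: "0 < card R" "card R \<le> card (X \<union> Y)"
      using R(1) finR card_mono[OF finXY R(2)] by (auto simp: card_gt_0_iff)
    have eqa: "arcs (X - R) (Y - R) = arcs X Y - {(x, y) \<in> arcs X Y. x \<in> R \<or> y \<in> R}"
      by (auto simp: arcs_def)
    have fK: "finite {(x, y) \<in> arcs X Y. x \<in> R \<or> y \<in> R}"
      by (rule finite_subset[OF _ fin_arcs[of X Y]]) auto
    have subK: "{(x, y) \<in> arcs X Y. x \<in> R \<or> y \<in> R} \<subseteq> arcs X Y" by auto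
    have "card (arcs (X - R) (Y - R)) = card (arcs X Y) - card {(x, y) \<in> arcs X Y. x \<in> R \<or> y \<in> R}"
      unfolding eqa by (rule card_Diff_subset[OF fK subK])
    moreover have "(k - 1) * card ((X - R) \<union> (Y - R)) = (k - 1) * card (X \<union> Y) - (k - 1) * card R"
      unfolding c by (simp add: diff_mult_distrib2)
    moreover have "(k - 1) * card R \<le> (k - 1) * card (X \<union> Y)" using cR by simp
    ultimately have "(k - 1) * card ((X - R) \<union> (Y - R)) < card (arcs (X - R) (Y - R))"
      using less.prems(4) few by linarith
    moreover have "card ((X - R) \<union> (Y - R)) < card (X \<union> Y)" using c cR by simp
    ultimately obtain p where p: "eabpath (X - R) (Y - R) p" "hd p \<in> X - R" "last p \<in> Y - R" "k < length p"
      using less.hyps[of "X - R" "Y - R"] less.prems by blast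
    have "successively ?E p"
      using p(1) unfolding eabpath_def by (auto intro: successively_mono simp: eab_def)
    then have "eabpath X Y p" using p(1) by (auto simp: eabpath_def)
    then show ?case using p by blast
  qed
  let ?wd = "\<lambda>v. card {(x, y) \<in> arcs X Y. x \<in> {v} \<or> y \<in> {v}}"
  show ?case
  proof (cases "\<exists>v\<in>X \<union> Y. ?wd v \<le> k - 1")
    case True
    then show ?thesis using reduce[of "{v}" for v] by force
  next
    case False
    then have wd: "k \<le> ?wd v" if "v \<in> X \<union> Y" for v using that less.prems(1) by force
    have wd2: "?wd v \<le> 2 * card {w. ?E v w}" for v
    proof -
      have "{(x, y) \<in> arcs X Y. x \<in> {v} \<or> y \<in> {v}} \<subseteq> Pair v ` {w. ?E v w} \<union> (\<lambda>w. (w, v)) ` {w. ?E v w}"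
        using adj_sym by (auto simp: arcs_def eab_def)
      then have "?wd v \<le> card (Pair v ` {w. ?E v w} \<union> (\<lambda>w. (w, v)) ` {w. ?E v w})"
        using fE by (intro card_mono) auto
      also have "\<dots> \<le> card (Pair v ` {w. ?E v w}) + card ((\<lambda>w. (w, v)) ` {w. ?E v w})" by (rule card_Un_le)
      also have "\<dots> \<le> card {w. ?E v w} + card {w. ?E v w}" using fE by (intro add_mono card_image_le) auto
      finally show ?thesis by simp
    qed
    obtain p where p: "eabpath X Y p" and mx: "\<And>p'. eabpath X Y p' \<Longrightarrow> length p' \<le> length p"
    proof -
      have "arcs X Y \<noteq> {}" using less.prems(4) by auto
      then obtain x where "x \<in> X" by (auto simp: arcs_def)
      then have "eabpath X Y [x]" by (simp add: eabpath_def)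
      moreover have "length p' < Suc (card (X \<union> Y))" if "eabpath X Y p'" for p'
        using that card_mono[OF finXY, of "set p'"] distinct_card[of p'] by (auto simp: eabpath_def)
      ultimately show ?thesis
        using that ex_has_greatest_nat[of "eabpath X Y" "[x]" length "Suc (card (X \<union> Y))"] by blast
    qed
    let ?m = "length p"
    define a where "a = hd p"
    define b where "b = last p"
    have pd: "p \<noteq> []" "distinct p" "successively ?E p" "set p \<subseteq> X \<union> Y" using p by (auto simp: eabpath_def)
    have ab: "a = p ! 0" "b = p ! (?m - 1)" "a \<in> set p" "b \<in> set p"
      using pd(1) by (auto simp: a_def b_def hd_conv_nth last_conv_nth)
    have Na: "w \<in> set p" if "?E a w" for w
    proof (rule ccontr)
      assume "w \<notin> set p"
      then have "eabpath X Y (w # p)"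
        using eabpath_Cons[OF p] eab_sym[OF that] by (simp add: a_def)
      then show False using mx[of "w # p"] by simp
    qed
    have Nb: "w \<in> set p" if "?E b w" for w
    proof (rule ccontr)
      assume "w \<notin> set p"
      then have "eabpath X Y (w # rev p)"
        using eabpath_Cons[OF eabpath_rev[OF p]] eab_sym[OF that] pd(1) by (simp add: b_def hd_rev)
      then show False using mx[of "w # rev p"] by simp
    qed
    have nloop: "\<not> ?E v v" for v using adj_irrefl by (simp add: eab_def)
    have abXY: "a \<in> X \<union> Y" "b \<in> X \<union> Y" using ab pd(4) by auto
    have one_sided: "\<exists>p'. eabpath P Q p' \<and> hd p' \<in> Q \<and> last p' \<in> P \<and> k < length p'"
      if PQ: "(P, Q) = (X, Y) \<or> (P, Q) = (Y, X)" and aP: "a \<in> P" "a \<notin> Q" "b \<in> P" "b \<notin> Q" for P Q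
    proof -
      have Epq: "eab P Q = ?E" using PQ eab_swap by auto
      have sub: "{w. ?E a w} \<subseteq> set p - {a, b}"
        using Na nloop aP PQ by (auto simp: eab_def)
      have "?wd a \<le> card {w. ?E a w}"
      proof -
        define h where "h = (\<lambda>w. if (P, Q) = (X, Y) then (a, w) else (w, a))"
        have "{(x, y) \<in> arcs X Y. x \<in> {a} \<or> y \<in> {a}} \<subseteq> h ` {w. ?E a w}"
        proof
          fix z assume "z \<in> {(x, y) \<in> arcs X Y. x \<in> {a} \<or> y \<in> {a}}"
          then obtain x y where z: "z = (x, y)" "x \<in> X" "y \<in> Y" "adj x y" "x = a \<or> y = a"
            by (auto simp: arcs_def)
          show "z \<in> h ` {w. ?E a w}"
          proof (cases "(P, Q) = (X, Y)")
            case True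
            then have "x = a" using z aP by auto
            then show ?thesis using z True by (auto simp: h_def eab_def)
          next
            case False
            then have PQ': "(P, Q) = (Y, X)" using PQ by blast
            then have "y = a" using z aP by auto
            then show ?thesis using z False adj_sym by (auto simp: h_def eab_def)
          qed
        qed
        then show ?thesis using card_mono[OF finite_imageI[OF fE[of a]]] card_image_le[OF fE[of a]] le_trans by meson
      qed
      then have kle: "k \<le> card (set p - {a, b})"
        using wd[OF abXY(1)] card_mono[OF _ sub] by simp
      moreover have neab: "a \<noteq> b"
      proof
        assume "a = b"
        then have "?m = 1" using pd ab nth_eq_iff_index_eq[of p 0 "?m - 1"] by (cases p) auto
        then have e: "set p - {a, b} = {}" using ab pd by (cases p) auto
        have "card (set p - {a, b}) = 0" by (simp only: e card.empty)
        then show False using kle less.prems(1) by linarith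
      qed
      moreover have "card (set p - {a, b}) = ?m - 2"
        using ab pd neab distinct_card[of p] by (subst card_Diff_subset) auto
      ultimately have m: "k + 2 \<le> ?m" using less.prems(1) by simp
      then obtain c p' where pc: "p = a # c # p'" using a_def by (cases p; cases "tl p") auto
      have "?E a c" using pd(3) pc by simp
      then have "c \<in> Q" using aP PQ by (auto simp: eab_def)
      moreover have "last (c # p') = b" using pc b_def by simp
      moreover have "P \<union> Q = X \<union> Y" using PQ by auto
      then have "eabpath P Q (c # p')" using pd pc unfolding eabpath_def Epq by simp
      ultimately show ?thesis using m pc aP by (intro exI[of _ "c # p'"]) auto
    qed
    consider "a \<in> X \<and> b \<in> Y \<or> a \<in> Y \<and> b \<in> X" | "a \<in> X" "a \<notin> Y" "b \<in> X" "b \<notin> Y"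
      | "a \<in> Y" "a \<notin> X" "b \<in> Y" "b \<notin> X" using abXY by blast
    then show ?thesis
    proof cases
      case 2
      then obtain p' where "eabpath X Y p'" "hd p' \<in> Y" "last p' \<in> X" "k < length p'" using one_sided[of X Y] by blast
      moreover then have "p' \<noteq> []" by auto
      ultimately show ?thesis using eabpath_rev[of X Y p'] by (intro exI[of _ "rev p'"]) (auto simp: hd_rev last_rev)
    next
      case 3
      then obtain p' where "eabpath Y X p'" "hd p' \<in> X" "last p' \<in> Y" "k < length p'" using one_sided[of Y X] by blast
      then show ?thesis by (intro exI[of _ p']) (auto simp: eabpath_def eab_swap)
    next
      case 1
      show ?thesis
      proof (cases "k < ?m")
        case True
        then show ?thesis using 1 p eabpath_rev[OF p] pd(1)
          by (metis a_def b_def hd_rev last_rev length_rev)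
      next
        case False
        define I where "I = {i. i < ?m - 1 \<and> ?E a (p ! Suc i)}"
        define J where "J = {i. i < ?m - 1 \<and> ?E b (p ! i)}"
        have cI: "card {w. ?E a w} \<le> card I"
        proof -
          have "{w. ?E a w} \<subseteq> (\<lambda>i. p ! Suc i) ` I"
          proof
            fix w assume w: "w \<in> {w. ?E a w}"
            then obtain j where j: "j < ?m" "w = p ! j" using Na by (metis in_set_conv_nth mem_Collect_eq)
            moreover have "j \<noteq> 0"
            proof
              assume "j = 0"
              then have "w = a" using j(2) ab(1) by simp
              then show False using w nloop[of a] by simp
            qed
            ultimately show "w \<in> (\<lambda>i. p ! Suc i) ` I" using w by (intro image_eqI[of _ _ "j - 1"]) (auto simp: I_def)
          qed
          moreover have "finite I" by (simp add: I_def)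
          ultimately show ?thesis by (intro surj_card_le)
        qed
        have cJ: "card {w. ?E b w} \<le> card J"
        proof -
          have "{w. ?E b w} \<subseteq> (\<lambda>i. p ! i) ` J"
          proof
            fix w assume w: "w \<in> {w. ?E b w}"
            then obtain j where j: "j < ?m" "w = p ! j" using Nb by (metis in_set_conv_nth mem_Collect_eq)
            moreover have "j \<noteq> ?m - 1"
            proof
              assume "j = ?m - 1"
              then have "w = b" using j(2) ab(2) by simp
              then show False using w nloop[of b] by simp
            qed
            ultimately show "w \<in> (\<lambda>i. p ! i) ` J" using w by (intro image_eqI[of _ _ j]) (auto simp: J_def)
          qed
          moreover have "finite J" by (simp add: J_def)
          ultimately show ?thesis by (intro surj_card_le)
        qed
        have "?m \<le> card I + card J"
          using False wd[OF abXY(1)] wd[OF abXY(2)] wd2[of a] wd2[of b] cI cJ by linarith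
        moreover have "card (I \<union> J) \<le> ?m - 1" by (rule order_trans[OF card_mono[of "{..<?m - 1}"]]) (auto simp: I_def J_def)
        moreover have "0 < ?m" using pd by simp
        moreover have "finite I" "finite J" by (simp_all add: I_def J_def)
        ultimately have "I \<inter> J \<noteq> {}" using card_Un_disjoint[of I J] by linarith
        then obtain i where i: "i < ?m - 1" "?E a (p ! Suc i)" "?E b (p ! i)" by (auto simp: I_def J_def)
        define c where "c = take (Suc i) p @ rev (drop (Suc i) p)"
        have st: "set (take (Suc i) p) \<union> set (drop (Suc i) p) = set p"
          by (metis append_take_drop_id set_append)
        have sd: "set (take (Suc i) p) \<inter> set (drop (Suc i) p) = {}"
          by (rule set_take_disj_set_drop_if_distinct[OF pd(2)]) simp
        have set_c: "set c = set p" "distinct c" "length c = ?m"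
          using pd(2) st sd by (simp_all add: c_def)
        have lt: "last (take (Suc i) p) = p ! i" using i by (simp add: take_Suc_conv_app_nth)
        have hr: "hd (rev (drop (Suc i) p)) = b" using i pd(1) by (simp add: hd_rev b_def)
        have lr: "last (rev (drop (Suc i) p)) = p ! Suc i" using i by (simp add: last_rev hd_drop_conv_nth)
        have sp: "successively ?E (take (Suc i) p)" "successively ?E (drop (Suc i) p)"
          using pd(3) by (metis append_take_drop_id successively_append_iff)+
        have sc: "successively ?E c"
          unfolding c_def successively_append_iff lt hr
          using sp successively_rev_sym[of ?E, OF eab_sym sp(2)] i(3) eab_sym by auto
        have cl: "?E (last c) (hd c)"
          using lr i pd(1) eab_sym[OF i(2)] by (simp add: c_def a_def)
        have closed: "w \<in> set p" if "u \<in> set p" "?E u w" for u w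
        proof (rule ccontr)
          assume w: "w \<notin> set p"
          have uc: "u \<in> set c" using set_c(1) \<open>u \<in> set p\<close> by simp
          obtain c' where c': "distinct c'" "set c' = set c" "length c' = length c" "successively ?E c'" "c' \<noteq> []" "hd c' = u"
            using successively_rotate_to[OF sc cl uc set_c(2)] by blast
          have "eabpath X Y c'" using c' set_c pd(4) by (simp add: eabpath_def)
          then have "eabpath X Y (w # c')"
            using eabpath_Cons[of X Y c' w] c' w set_c eab_sym[OF \<open>?E u w\<close>] by simp
          then show False using mx[of "w # c'"] c' set_c by simp
        qed
        have "{(x, y) \<in> arcs X Y. x \<in> set p \<or> y \<in> set p} \<subseteq> (SIGMA x:set p. set p - {x})"
        proof
          fix z assume "z \<in> {(x, y) \<in> arcs X Y. x \<in> set p \<or> y \<in> set p}"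
          then obtain x y where z: "z = (x, y)" "x \<in> X" "y \<in> Y" "adj x y" "x \<in> set p \<or> y \<in> set p" by (auto simp: arcs_def)
          then have "?E x y" "?E y x" using adj_sym by (auto simp: eab_def)
          then have "x \<in> set p" "y \<in> set p" using closed z(5) by blast+
          then show "z \<in> (SIGMA x:set p. set p - {x})" using z adj_irrefl by auto
        qed
        then have "card {(x, y) \<in> arcs X Y. x \<in> set p \<or> y \<in> set p} \<le> card (SIGMA x:set p. set p - {x})"
          by (intro card_mono) auto
        also have "\<dots> = (\<Sum>x\<in>set p. card (set p - {x}))" by (rule card_SigmaI) auto
        also have "\<dots> = (\<Sum>x\<in>set p. card (set p) - 1)" by (rule sum.cong) auto
        also have "\<dots> = card (set p) * (card (set p) - 1)" by simp
        also have "\<dots> \<le> card (set p) * (k - 1)"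
          using False distinct_card[OF pd(2)] by (intro mult_le_mono) auto
        finally have "card {(x, y) \<in> arcs X Y. x \<in> set p \<or> y \<in> set p} \<le> (k - 1) * card (set p)"
          by (simp add: mult.commute)
        then show ?thesis by (intro reduce[of "set p"]) (use pd in auto)
      qed
    qed
  qed
qed

text \<open>The labelled version of the Erdos--Gallai bound. It turns too many completions of a chain into an outside path
  of a prescribed length, and the chain then closes to a cycle that is too long. Shortening a longer path leaves two
  possible lengths because its end must lie in \<open>Y\<close>.\<close>

lemma long_path_between:
  assumes "1 \<le> k" "X \<subseteq> V" "Y \<subseteq> V" "(k - 1) * card (X \<union> Y) < card (arcs X Y)"
  shows "\<exists>p. distinct p \<and> successively adj p \<and> set p \<subseteq> X \<union> Y \<and> hd p \<in> X \<and> last p \<in> Y \<and>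
    (length p = k + 1 \<or> length p = k + 2)"
proof -
  obtain p where p: "eabpath X Y p" "hd p \<in> X" "last p \<in> Y" "k < length p"
    using long_path_between_aux[OF assms] by blast
  then have pd: "p \<noteq> []" "distinct p" "successively (eab X Y) p" "set p \<subseteq> X \<union> Y" by (auto simp: eabpath_def)
  have pre: "distinct (take j p) \<and> successively adj (take j p) \<and> set (take j p) \<subseteq> X \<union> Y \<and>
     hd (take j p) \<in> X \<and> last (take j p) = p ! (j - 1) \<and> length (take j p) = j" if j: "0 < j" "j \<le> length p" for j
  proof -
    have "successively (eab X Y) (take j p)" using pd(3) by (metis append_take_drop_id successively_append_iff)
    then have "successively adj (take j p)" by (rule successively_mono) (auto simp: eab_def)
    moreover have "last (take j p) = p ! (j - 1)" using j by (cases j) (auto simp: take_Suc_conv_app_nth)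
    moreover have "set (take j p) \<subseteq> X \<union> Y" using pd(4) set_take_subset by fast
    ultimately show ?thesis using j pd p(2) by (simp add: min_def)
  qed
  have "p ! k \<in> X \<union> Y" using pd(4) p(4) nth_mem by blast
  show ?thesis
  proof (cases "p ! k \<in> Y")
    case True
    then show ?thesis using pre[of "k + 1"] p(4) by (intro exI[of _ "take (k + 1) p"]) auto
  next
    case False
    then have "Suc k \<noteq> length p" using p(3) pd(1) by (metis diff_Suc_1 last_conv_nth)
    then have l: "Suc k < length p" using p(4) by simp
    then have "eab X Y (p ! k) (p ! Suc k)" using pd(3) by (simp add: successively_conv_nth)
    then have "p ! Suc k \<in> Y" using False by (auto simp: eab_def)
    then show ?thesis using pre[of "k + 2"] l by (intro exI[of _ "take (k + 2) p"]) auto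
  qed
qed

end

section \<open>Closing a chain of frequent neighbourhoods to a long cycle\<close>

context circ
begin

definition cm :: "'a set \<Rightarrow> 'a \<Rightarrow> 'a \<Rightarrow> 'a set" where
  "cm Z p p' = {y \<in> Z. adj y p \<and> adj y p'}"

text \<open>Each step of \<open>w\<close> is subdivided by a common neighbour. There are so many of them that they can be chosen distinct and
  outside \<open>F\<close>.\<close>

lemma lift:
  assumes "Z \<subseteq> V" "set w \<inter> Z = {}" "distinct w" "w \<noteq> []"
    "successively (\<lambda>p p'. C \<le> card (cm Z p p')) w" "finite F" "card F + 2 * length w \<le> C"
  shows "\<exists>P. distinct P \<and> successively adj P \<and> P \<noteq> [] \<and> hd P = hd w \<and> last P = last w \<and>
    length P = 2 * length w - 1 \<and> set P \<subseteq> set w \<union> (Z - F)"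
  using assms
proof (induction w rule: induct_list012)
  case (2 p)
  then show ?case by (intro exI[of _ "[p]"]) auto
next
  case (3 p p' w)
  obtain P where P: "distinct P" "successively adj P" "P \<noteq> []" "hd P = hd (p' # w)" "last P = last (p' # w)"
    "length P = 2 * length (p' # w) - 1" "set P \<subseteq> set (p' # w) \<union> (Z - F)"
    using 3 by auto
  have "card (F \<union> set P) \<le> card F + card (set P)" by (rule card_Un_le)
  also have "\<dots> = card F + length P" using P(1) distinct_card by metis
  also have "\<dots> < C" using P(6) 3(9) by simp
  also have "C \<le> card (cm Z p p')" using 3(7) by simp
  finally have "card (F \<union> set P) < card (cm Z p p')" .
  then have "\<not> cm Z p p' \<subseteq> F \<union> set P"
    using card_mono[of "F \<union> set P" "cm Z p p'"] 3(8) by auto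
  then obtain y where y: "y \<in> Z" "adj y p" "adj y p'" "y \<notin> F" "y \<notin> set P" by (auto simp: cm_def)
  have "distinct (p # y # P)" using P y 3(4,5) by auto
  moreover have "successively adj (p # y # P)"
    using P(2,3,4) y adj_sym by (cases P) auto
  ultimately show ?case using P y by (intro exI[of _ "p # y # P"]) auto
qed simp

text \<open>Subdividing \<open>w\<close> and returning along \<open>Q\<close> gives a cycle with \<open>2|w| - 1 + |Q|\<close> vertices.\<close>

lemma close:
  assumes "Z \<subseteq> V" "set w \<inter> Z = {}" "distinct w" "w \<noteq> []"
    "successively (\<lambda>p p'. C \<le> card (cm Z p p')) w" "length Q + 2 * length w \<le> C"
    and Q: "distinct Q" "successively adj Q" "Q \<noteq> []" "set Q \<inter> set w = {}" "adj (last w) (hd Q)" "adj (last Q) (hd w)"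
    and len: "4 \<le> 2 * length w + length Q"
  shows "2 * length w + length Q \<le> L + 1"
proof -
  have "card (set Q) + 2 * length w \<le> C" using assms(6) Q(1) distinct_card by metis
  then obtain P where P: "distinct P" "successively adj P" "P \<noteq> []" "hd P = hd w" "last P = last w"
    "length P = 2 * length w - 1" "set P \<subseteq> set w \<union> (Z - set Q)"
    using lift[OF assms(1-5), of "set Q"] by blast
  have "cyc adj (P @ Q)"
    unfolding cyc_def
  proof (intro conjI)
    show "3 \<le> length (P @ Q)" using P(6) len by simp
    show "distinct (P @ Q)" using P Q by auto
    show "successively adj (P @ Q)" using P Q by (simp add: successively_append_iff)
    show "adj (last (P @ Q)) (hd (P @ Q))" using P Q by simp
  qed
  then have "length (P @ Q) \<le> L" by (rule circ)
  then show ?thesis using P(6) assms(4) by (cases w) auto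
qed

text \<open>Two small vertices with the same big neighbours are twins. All but boundedly many small vertices have at least \<open>C\<close> twins.\<close>

definition heavy :: "nat \<Rightarrow> nat \<Rightarrow> 'a \<Rightarrow> bool" where
  "heavy m C x \<longleftrightarrow> x \<in> V - big m \<and> C \<le> card {y \<in> V - big m. nb y \<inter> big m = nb x \<inter> big m}"

lemma heavy_cm:
  assumes "heavy m C x" "p \<in> nb x \<inter> big m" "p' \<in> nb x \<inter> big m"
  shows "C \<le> card (cm (V - big m) p p')"
proof -
  have "{y \<in> V - big m. nb y \<inter> big m = nb x \<inter> big m} \<subseteq> cm (V - big m) p p'"
    using assms by (auto simp: cm_def nb_def)
  then have "card {y \<in> V - big m. nb y \<inter> big m = nb x \<inter> big m} \<le> card (cm (V - big m) p p')"
    using finV by (intro card_mono) (auto simp: cm_def)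
  then show ?thesis using assms(1) by (simp add: heavy_def)
qed

lemma twin_avoiding:
  assumes "heavy m C x" "finite F" "card F < C"
  obtains y where "y \<in> V - big m" "nb y \<inter> big m = nb x \<inter> big m" "y \<notin> F"
proof -
  have "\<not> {y \<in> V - big m. nb y \<inter> big m = nb x \<inter> big m} \<subseteq> F"
  proof
    assume "{y \<in> V - big m. nb y \<inter> big m = nb x \<inter> big m} \<subseteq> F"
    then have "card {y \<in> V - big m. nb y \<inter> big m = nb x \<inter> big m} \<le> card F"
      by (rule card_mono[OF assms(2)])
    then show False using assms(1,3) by (simp add: heavy_def)
  qed
  then obtain y where "y \<in> {y \<in> V - big m. nb y \<inter> big m = nb x \<inter> big m}" "y \<notin> F" by blast
  then show ?thesis using that[of y] by simp
qed

end

text \<open>The small vertices at all places of an alternating list except the last one are fixed to heavy vertices \<open>xs\<close>. The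
  bound on \<open>C\<close> leaves room for avoiding any cycle under construction.\<close>

locale tuple = circ +
  fixes m C :: nat and xs :: "'a list" and r :: nat
  assumes heavy_xs: "\<And>x. x \<in> set xs \<Longrightarrow> heavy m C x"
    and len_xs: "length xs = r - 1"
    and r2: "2 \<le> r" and rL: "r \<le> L"
    and C_large: "8 * L + 20 \<le> C"
    and m_pos: "0 < m"
begin

abbreviation "A \<equiv> big m"
abbreviation "B \<equiv> V - big m"
abbreviation "n \<equiv> card V"

text \<open>The big neighbours of a heavy vertex behave like a clique: any two of them have many common neighbours.\<close>

definition Ts :: "'a set list" where "Ts = map (\<lambda>x. nb x \<inter> A) xs"

definition U :: "'a set" where "U = \<Union>(set Ts)"

text \<open>The lists of big vertices that alternate with \<open>xs\<close>.\<close>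

definition M :: "'a list set" where "M = {us. distinct us \<and> chain us Ts}"

lemma U_A: "U \<subseteq> A" by (auto simp: U_def Ts_def)

lemma fin_U [simp]: "finite U" using U_A fin_big finite_subset by blast

lemma fin_Ts: "\<forall>T\<in>set Ts. finite T" by (auto simp: Ts_def)

lemma Ts_ne: "Ts \<noteq> []" "length Ts = r - 1" using len_xs r2 by (auto simp: Ts_def)

lemma Ts_cm: "T \<in> set Ts \<Longrightarrow> p \<in> T \<Longrightarrow> p' \<in> T \<Longrightarrow> C \<le> card (cm B p p')"
proof -
  assume a: "T \<in> set Ts" "p \<in> T" "p' \<in> T"
  then obtain x where x: "x \<in> set xs" "T = nb x \<inter> A" by (auto simp: Ts_def)
  show "C \<le> card (cm B p p')" by (rule heavy_cm[OF heavy_xs[OF x(1)]]) (use a x in auto)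
qed

lemma M_dlists: "M \<subseteq> dlists U r"
proof
  fix us assume "us \<in> M"
  then have us: "distinct us" "length us = Suc (length Ts)" "\<And>k. k < length Ts \<Longrightarrow> us ! k \<in> Ts ! k \<and> us ! Suc k \<in> Ts ! k"
    by (auto simp: M_def chain_nth)
  have "us ! i \<in> U" if i: "i < length us" for i
  proof (cases "i < length Ts")
    case True
    then show ?thesis using us(3)[OF True] by (auto simp: U_def)
  next
    case False
    moreover have "0 < length Ts" using Ts_ne(1) by simp
    ultimately have "i = Suc (length Ts - 1)" "length Ts - 1 < length Ts" using i us(2) by linarith+
    then show ?thesis using us(3) nth_mem unfolding U_def by blast
  qed
  then have "set us \<subseteq> U" by (auto simp: in_set_conv_nth)
  then show "us \<in> dlists U r" using us Ts_ne r2 by (auto simp: dlists_def)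
qed

lemma M_D:
  assumes "us \<in> M"
  shows "distinct us" "length us = r" "set us \<subseteq> U" "us \<noteq> []" "hd us \<in> U" "last us \<in> U" "hd us \<noteq> last us"
    "hd us \<in> hd Ts"
proof -
  show d: "distinct us" "length us = r" "set us \<subseteq> U" using assms M_dlists by (auto simp: dlists_def)
  show ne: "us \<noteq> []" using d r2 by auto
  then show "hd us \<in> U" "last us \<in> U" using d by auto
  have "us ! 0 \<noteq> us ! (r - 1)" using d r2 by (subst nth_eq_iff_index_eq) auto
  then show "hd us \<noteq> last us" using ne d by (simp add: hd_conv_nth last_conv_nth)
  have "0 < length Ts" using Ts_ne(1) by simp
  then have "us ! 0 \<in> Ts ! 0" using assms unfolding M_def chain_nth by blast
  then show "hd us \<in> hd Ts" using Ts_ne(1) ne by (simp add: hd_conv_nth)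
qed

lemma fin_M [simp]: "finite M" using M_dlists fin_dlists[OF fin_U] finite_subset by blast

lemma card_M: "card M \<le> ffact (card U) r"
  using card_mono[OF fin_dlists[OF fin_U] M_dlists] card_dlists[OF fin_U] by simp

text \<open>The chain through \<open>us\<close> can absorb all of \<open>U\<close>, so it closes with any path between its ends
  to a cycle that visits all of \<open>U\<close>.\<close>

lemma spanning_list:
  assumes "us \<in> M" "F \<inter> set us = {}"
  obtains w where "distinct w" "w \<noteq> []" "hd w = hd us" "last w = last us" "set w = U - F" "set w \<inter> B = {}"
    "successively (\<lambda>p p'. C \<le> card (cm B p p')) w" "length w = card (U - F)"
proof -
  have us: "chain us Ts" "distinct us" using assms(1) by (auto simp: M_def)
  obtain w where w: "distinct w" "w \<noteq> []" "hd w = hd us" "last w = last us"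
    "set w = (set us \<union> \<Union>(set Ts)) - F" "successively (\<lambda>p p'. \<exists>T\<in>set Ts. p \<in> T \<and> p' \<in> T) w"
    using chain_extend[OF us fin_Ts, of F] assms(2) by blast
  have sw: "set w = U - F" using w(5) M_D(3)[OF assms(1)] by (auto simp: U_def)
  have "successively (\<lambda>p p'. C \<le> card (cm B p p')) w"
    by (rule successively_mono[OF w(6)]) (use Ts_cm in blast)
  moreover have "set w \<inter> B = {}" using sw U_A by auto
  moreover have "length w = card (U - F)" using distinct_card[OF w(1)] sw by simp
  ultimately show ?thesis using that w sw by blast
qed

text \<open>The set \<open>F\<close> serves to leave out vertices of \<open>U\<close> that are used by \<open>Q\<close>.\<close>

lemma close_chain:
  assumes us: "us \<in> M" "F \<inter> set us = {}"
    and Q: "distinct Q" "successively adj Q" "Q \<noteq> []" "set Q \<inter> (U - F) = {}" "adj (last us) (hd Q)" "adj (last Q) (hd us)"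
    and len: "length Q \<le> 2 * L + 2"
  shows "2 * card (U - F) + length Q \<le> L + 1"
proof -
  have bound: "2 * card (U - F') + length Q \<le> L + 1"
    if F': "F \<subseteq> F'" "F' \<inter> set us = {}" "card (U - F') \<le> r + L + 2" for F'
  proof -
    obtain w where w: "distinct w" "w \<noteq> []" "hd w = hd us" "last w = last us" "set w = U - F'" "set w \<inter> B = {}"
      "successively (\<lambda>p p'. C \<le> card (cm B p p')) w" "length w = card (U - F')"
      using spanning_list[OF us(1) F'(2)] .
    have "set us \<subseteq> U - F'" using F'(2) M_D(3)[OF us(1)] by auto
    then have "r \<le> card (U - F')" using card_mono[of "U - F'" "set us"] distinct_card[of us] M_D(1,2)[OF us(1)] by auto
    then have "4 \<le> 2 * length w + length Q" using w(8) r2 by simp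
    moreover have "length Q + 2 * length w \<le> C" using w(8) F'(3) len C_large rL by simp
    moreover have "set Q \<inter> set w = {}" using Q(4) F'(1) w(5) by auto
    ultimately have "2 * length w + length Q \<le> L + 1"
      using Q w by (intro close[of B w C Q]) auto
    then show ?thesis using w(8) by simp
  qed
  show ?thesis
  proof (cases "card (U - F) \<le> r + L + 2")
    case True
    then show ?thesis using bound[of F] us(2) by blast
  next
    case False
    have "set us \<subseteq> U - F" using us(2) M_D(3)[OF us(1)] by auto
    moreover have "card (set us) = r" using distinct_card M_D(1,2)[OF us(1)] by metis
    ultimately obtain W where W: "set us \<subseteq> W" "W \<subseteq> U - F" "card W = r + L + 2"
      using exists_subset_between[of "set us" "r + L + 2" "U - F"] False by auto
    have "U - (U - W) = W" using W(2) by auto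
    then have "2 * card W + length Q \<le> L + 1" using bound[of "F \<union> (U - W)"] us(2) W by (auto simp: Un_Diff Diff_Un Int_absorb1 Int_absorb2 subset_iff double_diff)
    then show ?thesis using W(3) by simp
  qed
qed

section \<open>Even cycles\<close>

text \<open>A completion adds the last small vertex, which is adjacent to both ends of the chain.\<close>

definition cpl_even :: "('a list \<times> 'a) set" where
  "cpl_even = {(us, x). us \<in> M \<and> x \<in> B \<and> adj (last us) x \<and> adj x (hd us)}"

definition full :: "'a set" where "full = {x \<in> V. U \<subseteq> nb x}"

text \<open>The vertices outside \<open>full\<close> each lose one against the value \<open>t\<close>.\<close>

lemma sum_full:
  "(\<Sum>x\<in>V. if U \<subseteq> nb x then t else t - 1) + (n - card full) = t * n" if "1 \<le> (t::nat)"
proof -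
  have f: "finite full" "full \<subseteq> V" using finV by (auto simp: full_def)
  have "(\<Sum>x\<in>V. if U \<subseteq> nb x then t else t - 1) = (\<Sum>x\<in>full. t) + (\<Sum>x\<in>V - full. t - 1)"
  proof -
    have "(\<Sum>x\<in>V. if U \<subseteq> nb x then t else t - 1) = (\<Sum>x\<in>V - full. if U \<subseteq> nb x then t else t - 1) + (\<Sum>x\<in>full. if U \<subseteq> nb x then t else t - 1)"
      by (rule sum.subset_diff[OF f(2) finV])
    also have "(\<Sum>x\<in>full. if U \<subseteq> nb x then t else t - 1) = (\<Sum>x\<in>full. t)" by (rule sum.cong) (auto simp: full_def)
    also have "(\<Sum>x\<in>V - full. if U \<subseteq> nb x then t else t - 1) = (\<Sum>x\<in>V - full. t - 1)"
      by (rule sum.cong) (auto simp: full_def)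
    finally show ?thesis by simp
  qed
  also have "\<dots> = card full * t + (n - card full) * (t - 1)"
    using f by (simp add: card_Diff_subset)
  finally have s1: "(\<Sum>x\<in>V. if U \<subseteq> nb x then t else t - 1) = card full * t + (n - card full) * (t - 1)" .
  have s2: "(n - card full) * (t - 1) + (n - card full) = (n - card full) * t"
    using that by (cases t) simp_all
  have "(\<Sum>x\<in>V. if U \<subseteq> nb x then t else t - 1) + (n - card full) = card full * t + (n - card full) * t"
    unfolding s1 using s2 by linarith
  also have "\<dots> = (card full + (n - card full)) * t" by (rule add_mult_distrib[symmetric])
  also have "\<dots> = t * n" using card_mono[OF finV f(2)] by simp
  finally show ?thesis .
qed

text \<open>A completion closes the chain with a single outside vertex, whence \<open>|U| \<le> a\<close>. If \<open>|U| = a\<close>, a vertex that misses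
  some \<open>p\<close> in \<open>U\<close> does not complete the chains with end \<open>p\<close>. If \<open>|U| < a\<close>, there are too few chains.\<close>

lemma even_stability:
  assumes a: "a = L div 2" "r \<le> a"
  shows "card U = a \<and> card cpl_even + (n - card full) \<le> ffact a r * n \<or> card cpl_even + n \<le> ffact a r * n"
proof -
  have fl1: "1 \<le> ffact a r" using ffact_pos[OF a(2)] by simp
  have sub: "cpl_even \<subseteq> M \<times> V" by (auto simp: cpl_even_def)
  have fin: "finite cpl_even" by (rule finite_subset[OF sub]) (use finV in simp)
  have s: "card U \<le> a" if "(us, x) \<in> cpl_even" for us x
  proof -
    have "2 * card (U - {}) + length [x] \<le> L + 1"
      by (rule close_chain[of us]) (use that U_A L2 in \<open>auto simp: cpl_even_def\<close>)
    then show ?thesis using a(1) by simp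
  qed
  show ?thesis
  proof (cases "card U = a")
    case True
    have "card cpl_even \<le> (\<Sum>x\<in>V. card {us. (us, x) \<in> cpl_even})"
    proof -
      have "cpl_even \<subseteq> (\<Union>x\<in>V. (\<lambda>us. (us, x)) ` {us. (us, x) \<in> cpl_even})" using sub by auto
      moreover have fx: "finite {us. (us, x) \<in> cpl_even}" for x
        by (rule finite_subset[OF _ fin_M]) (auto simp: cpl_even_def)
      ultimately have "card cpl_even \<le> card (\<Union>x\<in>V. (\<lambda>us. (us, x)) ` {us. (us, x) \<in> cpl_even})"
        using finV by (intro card_mono) auto
      also have "\<dots> \<le> (\<Sum>x\<in>V. card ((\<lambda>us. (us, x)) ` {us. (us, x) \<in> cpl_even}))" by (rule card_UN_le[OF finV])
      also have "\<dots> \<le> (\<Sum>x\<in>V. card {us. (us, x) \<in> cpl_even})" by (rule sum_mono) (rule card_image_le[OF fx])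
      finally show ?thesis .
    qed
    also have "\<dots> \<le> (\<Sum>x\<in>V. if U \<subseteq> nb x then ffact a r else ffact a r - 1)"
    proof (rule sum_mono)
      fix x
      show "card {us. (us, x) \<in> cpl_even} \<le> (if U \<subseteq> nb x then ffact a r else ffact a r - 1)"
      proof (cases "U \<subseteq> nb x")
        case True
        have "{us. (us, x) \<in> cpl_even} \<subseteq> M" by (auto simp: cpl_even_def)
        then have "card {us. (us, x) \<in> cpl_even} \<le> card M" by (rule card_mono[OF fin_M])
        then show ?thesis using card_M \<open>card U = a\<close> True by simp
      next
        case False
        then obtain p where p: "p \<in> U" "\<not> adj x p" by (auto simp: nb_def)
        obtain u0 where u0: "u0 \<in> dlists U r" "last u0 = p"
          using list_with_last[OF fin_U p(1), of r] a(2) r2 \<open>card U = a\<close> by auto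
        have "{us. (us, x) \<in> cpl_even} \<subseteq> dlists U r - {u0}"
          using M_dlists u0 p adj_sym by (auto simp: cpl_even_def)
        then have "card {us. (us, x) \<in> cpl_even} \<le> card (dlists U r - {u0})" by (rule card_mono[rotated]) simp
        also have "\<dots> = ffact a r - 1" using u0 \<open>card U = a\<close> by (simp add: card_dlists)
        finally show ?thesis using False by simp
      qed
    qed
    finally show ?thesis using sum_full[OF fl1] True by linarith
  next
    case False
    have "card cpl_even \<le> ffact (a - 1) r * n"
    proof (cases "cpl_even = {}")
      case False
      then have "card U \<le> a" using s by auto
      then have "card U \<le> a - 1" using \<open>card U \<noteq> a\<close> by simp
      then have "card M \<le> ffact (a - 1) r" using card_M ffact_mono le_trans by blast
      moreover have "card cpl_even \<le> card M * n"
        using card_mono[OF _ sub] finV by (simp add: card_cartesian_product)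
      ultimately show ?thesis using le_trans mult_le_mono1 by blast
    qed simp
    moreover have "ffact (a - 1) r + 1 \<le> ffact a r" using ffact_strict[of "a - 1" a r] a r2 by simp
    then have "(ffact (a - 1) r + 1) * n \<le> ffact a r * n" by (rule mult_le_mono1)
    ultimately show ?thesis by simp
  qed
qed

section \<open>Odd cycles\<close>

text \<open>A completion adds the last small vertex and one more vertex, which may lie in \<open>U\<close>, be another big vertex, or be small.\<close>

definition cpl_odd :: "('a list \<times> 'a \<times> 'a) set" where
  "cpl_odd = {(us, x, z). us \<in> M \<and> x \<in> B \<and> z \<in> V \<and> adj (last us) x \<and> adj x z \<and> adj z (hd us) \<and> z \<notin> set us}"

lemma cpl_oddD:
  assumes "(us, x, z) \<in> cpl_odd"
  shows "us \<in> M" "x \<in> B" "z \<in> V" "adj (last us) x" "adj x z" "adj z (hd us)" "z \<notin> set us" "x \<notin> U" "x \<noteq> z"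
  using assms U_A adj_irrefl by (auto simp: cpl_odd_def)

lemma fin_cpl_odd [simp]: "finite cpl_odd"
proof (rule finite_subset)
  show "cpl_odd \<subseteq> M \<times> V \<times> V" by (auto simp: cpl_odd_def)
qed (use finV in simp)

lemma odd_outside:
  assumes "(us, x, z) \<in> cpl_odd" "z \<notin> U"
  shows "2 * card U + 1 \<le> L"
proof -
  note D = cpl_oddD[OF assms(1)]
  have "2 * card (U - {}) + length [x, z] \<le> L + 1"
    by (rule close_chain[OF D(1)]) (use D assms(2) L2 in auto)
  then show ?thesis by simp
qed

lemma odd_inside:
  assumes "(us, x, z) \<in> cpl_odd" "z \<in> U"
  shows "2 * card U \<le> L + 1"
proof -
  note D = cpl_oddD[OF assms(1)]
  have "2 * card (U - {z}) + length [x, z] \<le> L + 1"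
    by (rule close_chain[OF D(1)]) (use D assms(2) L2 in auto)
  moreover have "card (U - {z}) = card U - 1" "1 \<le> card U"
    using assms(2) card_gt_0_iff[of U] by auto
  ultimately show ?thesis by simp
qed

text \<open>Otherwise there is an outside path with at least \<open>L - 2|U| + 2\<close> vertices between neighbours of the two ends.\<close>

lemma card_arcs_outside:
  assumes "us \<in> M" "2 * card U \<le> L"
  shows "card (arcs (nb (last us) - U) (nb (hd us) - U)) \<le> (L - 2 * card U) * card ((nb (last us) - U) \<union> (nb (hd us) - U))"
proof (rule ccontr)
  let ?X = "nb (last us) - U" and ?Y = "nb (hd us) - U" and ?k = "L - 2 * card U + 1"
  assume "\<not> ?thesis"
  then have "(?k - 1) * card (?X \<union> ?Y) < card (arcs ?X ?Y)" by simp
  then obtain p where p: "distinct p" "successively adj p" "set p \<subseteq> ?X \<union> ?Y" "hd p \<in> ?X" "last p \<in> ?Y"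
    "length p = ?k + 1 \<or> length p = ?k + 2"
    using long_path_between[of ?k ?X ?Y] nb_sub by auto
  have "2 * card (U - {}) + length p \<le> L + 1"
  proof (rule close_chain[OF assms(1)])
    show "adj (last us) (hd p)" using p(4) by (simp add: nb_def)
    show "adj (last p) (hd us)" using p(5) adj_sym by (simp add: nb_def)
    show "length p \<le> 2 * L + 2" using p(6) L2 by auto
    show "p \<noteq> []" using p(6) by auto
  qed (use p in auto)
  then show False using p(6) assms(2) by auto
qed

text \<open>The last vertex \<open>z\<close> is one of the unused vertices of \<open>U\<close>, or \<open>(x, z)\<close> is an outside pair.\<close>

lemma card_cpl_odd_le:
  assumes "2 * card U \<le> L"
  shows "card cpl_odd \<le> ffact (card U) r * ((card U - r) + (L - 2 * card U)) * n"
proof -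
  let ?W = "\<lambda>us. V \<times> (U - set us) \<union> arcs (nb (last us) - U) (nb (hd us) - U)"
  let ?b = "((card U - r) + (L - 2 * card U)) * n"
  have sub: "cpl_odd \<subseteq> Sigma M ?W"
  proof
    fix t assume "t \<in> cpl_odd"
    then obtain us x z where t: "t = (us, x, z)" "(us, x, z) \<in> cpl_odd" by (cases t) auto
    note D = cpl_oddD[OF t(2)]
    show "t \<in> Sigma M ?W"
      using D adj_sym adj_V by (cases "z \<in> U") (auto simp: t(1) arcs_def nb_def)
  qed
  have "card (?W us) \<le> ?b" if "us \<in> M" for us
  proof -
    have "card (?W us) \<le> card (V \<times> (U - set us)) + card (arcs (nb (last us) - U) (nb (hd us) - U))"
      by (rule card_Un_le)
    moreover have "card (V \<times> (U - set us)) = n * (card U - r)"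
      using M_D[OF that] distinct_card[of us] by (simp add: card_cartesian_product card_Diff_subset)
    moreover have "card (arcs (nb (last us) - U) (nb (hd us) - U)) \<le> (L - 2 * card U) * n"
    proof -
      have "card ((nb (last us) - U) \<union> (nb (hd us) - U)) \<le> n"
        by (rule card_mono[OF finV]) (use nb_sub in blast)
      then show ?thesis using card_arcs_outside[OF that assms] le_trans mult_le_mono2 by blast
    qed
    ultimately show ?thesis by (simp add: algebra_simps)
  qed
  then have "(\<Sum>us\<in>M. card (?W us)) \<le> (\<Sum>us\<in>M. ?b)" by (rule sum_mono)
  moreover have "card (Sigma M ?W) = (\<Sum>us\<in>M. card (?W us))"
    using finV by (intro card_SigmaI) auto
  moreover have "card cpl_odd \<le> card (Sigma M ?W)"
    using finV by (intro card_mono[OF _ sub]) auto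
  ultimately have "card cpl_odd \<le> card M * ?b" by simp
  also have "\<dots> \<le> ffact (card U) r * ?b" by (rule mult_le_mono1[OF card_M])
  finally show ?thesis by (simp add: mult.assoc)
qed

end

text \<open>Each step from \<open>s\<close> to \<open>s + 1\<close> gains more in the falling factorial than the additional term \<open>r\<close> allows for.\<close>

lemma ffact_gap:
  assumes "r \<le> s"
  shows "ffact s r * (s + j - r + j * r) \<le> ffact (s + j) r * (s + j - r)"
proof (induction j)
  case (Suc j)
  define X where "X = ffact (s + j) r"
  define Y where "Y = ffact s r"
  define D where "D = s + j - r"
  have YX: "Y \<le> X" unfolding X_def Y_def by (rule ffact_mono) simp
  then obtain e where e: "X = Y + e" using le_Suc_ex by blast
  have "Y * (D + j * r) \<le> X * D" using Suc by (simp add: X_def Y_def D_def)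
  then have De: "Y * (j * r) \<le> e * D" by (simp add: e algebra_simps)
  have "e * D \<le> e * (s + j + 1)" by (rule mult_le_mono2) (simp add: D_def)
  with De have "Y * (j * r) \<le> e * (s + j + 1)" by (rule le_trans)
  then have "Y * (s + j + 1 + j * r) \<le> X * (s + j + 1)" by (simp add: e algebra_simps)
  also have "X * (s + j + 1) = ffact (s + j + 1) r * (s + j + 1 - r)"
  proof -
    have "ffact (s + j + 1) (Suc r) = (s + j + 1) * ffact (s + j) r" by simp
    moreover have "ffact (s + j + 1) (Suc r) = ffact (s + j + 1) r * (s + j + 1 - r)" by (rule ffact_Suc)
    ultimately show ?thesis by (simp add: X_def mult.commute)
  qed
  finally have f: "Y * (s + j + 1 + j * r) \<le> ffact (s + j + 1) r * (s + j + 1 - r)" .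
  have e: "s + Suc j - r + Suc j * r = s + j + 1 + j * r" "s + Suc j = s + j + 1" using assms by simp_all
  show ?case unfolding Y_def[symmetric] e(1) unfolding e(2) by (rule f)
qed simp

text \<open>The case \<open>r = 2\<close>, \<open>s = a - 1\<close>, \<open>L\<close> odd is excluded because there both sides agree up to the summand \<open>1\<close>.\<close>

lemma ffact_combined:
  assumes "2 \<le> r" "r + 1 \<le> a" "s < a" "L = 2 * a \<or> L = 2 * a + 1" "\<not> (r = 2 \<and> s = a - 1 \<and> odd L)"
  shows "ffact s r * ((s - r) + (L - 2 * s)) + 1 \<le> ffact a (Suc r)"
proof (cases "s < r")
  case True
  then show ?thesis using ffact_zero[OF True] ffact_pos[of "Suc r" a] assms(2) by simp
next
  case False
  define j where "j = a - s"
  have a: "a = s + j" "1 \<le> j" using assms(3) by (auto simp: j_def)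
  have p: "0 < ffact s r" using False ffact_pos by simp
  have "(s - r) + (L - 2 * s) < s + j - r + j * r"
  proof (cases "even L")
    case True
    then have "L - 2 * s = 2 * j" using assms(4) a by auto
    moreover have "j * 2 \<le> j * r" using assms(1) by simp
    ultimately show ?thesis using False a(2) by linarith
  next
    case odd: False
    then have l: "L - 2 * s = 2 * j + 1" using assms(4) a by auto
    have "j + 1 < j * r"
    proof (cases "j = 1")
      case True
      then have "r \<noteq> 2" using assms(5) odd a by auto
      then show ?thesis using True assms(1) by simp
    next
      case False
      then have "j + 1 < j * 2" using a(2) by simp
      also have "j * 2 \<le> j * r" using assms(1) by simp
      finally show ?thesis .
    qed
    then show ?thesis using l False by linarith
  qed
  then have "ffact s r * ((s - r) + (L - 2 * s)) < ffact s r * (s + j - r + j * r)" using p by simp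
  also have "\<dots> \<le> ffact (s + j) r * (s + j - r)" by (rule ffact_gap) (use False in simp)
  also have "\<dots> = ffact a (Suc r)" by (simp only: ffact_Suc a(1))
  finally show ?thesis by simp
qed

context tuple
begin

definition inU :: "'a \<Rightarrow> ('a list \<times> 'a) set" where
  "inU x = {(us, z). (us, x, z) \<in> cpl_odd \<and> z \<in> U}"

lemma inU_lists: "(\<lambda>(us, z). z # us) ` inU x \<subseteq> {l \<in> dlists U (Suc r). hd l \<in> nb x \<and> last l \<in> nb x}"
proof
  fix l assume "l \<in> (\<lambda>(us, z). z # us) ` inU x"
  then obtain us z where l: "l = z # us" "(us, x, z) \<in> cpl_odd" "z \<in> U" by (auto simp: inU_def)
  note D = cpl_oddD[OF l(2)]
  note E = M_D[OF D(1)]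
  show "l \<in> {l \<in> dlists U (Suc r). hd l \<in> nb x \<and> last l \<in> nb x}"
    using l D E adj_sym by (auto simp: dlists_def nb_def)
qed

lemma card_inU: "card (inU x) = card ((\<lambda>(us, z). z # us) ` inU x)" "finite (inU x)"
proof -
  have "inj_on (\<lambda>(us, z). z # us) (inU x)" by (auto simp: inj_on_def)
  then show "card (inU x) = card ((\<lambda>(us, z). z # us) ` inU x)" by (simp add: card_image)
  show "finite (inU x)"
    by (rule finite_subset[of _ "M \<times> U"]) (auto simp: inU_def dest: cpl_oddD)
qed

lemma card_inU_le:
  assumes "Suc r \<le> card U"
  shows "card (inU x) \<le> (if U \<subseteq> nb x then ffact (card U) (Suc r) else ffact (card U) (Suc r) - 1)"
proof (cases "U \<subseteq> nb x")
  case True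
  have "card (inU x) \<le> card (dlists U (Suc r))"
    unfolding card_inU(1) by (rule card_mono) (use inU_lists in auto)
  then show ?thesis using True by (simp add: card_dlists)
next
  case False
  then obtain p where p: "p \<in> U" "p \<notin> nb x" by blast
  obtain u0 where u0: "u0 \<in> dlists U (Suc r)" "last u0 = p"
    using list_with_last[OF fin_U p(1), of "Suc r"] assms by auto
  have "(\<lambda>(us, z). z # us) ` inU x \<subseteq> dlists U (Suc r) - {u0}" using inU_lists u0 p by blast
  then have "card (inU x) \<le> card (dlists U (Suc r) - {u0})"
    unfolding card_inU(1) by (rule card_mono[rotated]) simp
  also have "\<dots> = ffact (card U) (Suc r) - 1" using u0 by (simp add: card_dlists)
  finally show ?thesis using False by simp
qed

lemma card_cpl_odd_sum:
  assumes "\<And>us x z. (us, x, z) \<in> cpl_odd \<Longrightarrow> z \<in> U"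
  shows "card cpl_odd \<le> (\<Sum>x\<in>V. card (inU x))"
proof -
  have "cpl_odd \<subseteq> (\<Union>x\<in>V. (\<lambda>(us, z). (us, x, z)) ` inU x)"
  proof
    fix t assume "t \<in> cpl_odd"
    then obtain us x z where t: "t = (us, x, z)" "(us, x, z) \<in> cpl_odd" by (cases t) auto
    then have "(us, z) \<in> inU x" "x \<in> V" using assms cpl_oddD[OF t(2)] by (auto simp: inU_def)
    then show "t \<in> (\<Union>x\<in>V. (\<lambda>(us, z). (us, x, z)) ` inU x)" using t(1) by force
  qed
  then have "card cpl_odd \<le> card (\<Union>x\<in>V. (\<lambda>(us, z). (us, x, z)) ` inU x)"
    by (rule card_mono[rotated]) (use finV card_inU(2) in auto)
  also have "\<dots> \<le> (\<Sum>x\<in>V. card ((\<lambda>(us, z). (us, x, z)) ` inU x))" by (rule card_UN_le[OF finV])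
  also have "\<dots> \<le> (\<Sum>x\<in>V. card (inU x))" by (rule sum_mono) (rule card_image_le[OF card_inU(2)])
  finally show ?thesis .
qed

lemma odd_stability_small:
  assumes a: "L = 2 * a \<or> L = 2 * a + 1" "r + 1 \<le> a" "card U < a" "\<not> (r = 2 \<and> card U = a - 1 \<and> odd L)"
  shows "card cpl_odd + n \<le> ffact a (Suc r) * n"
proof -
  have "card cpl_odd \<le> ffact (card U) r * ((card U - r) + (L - 2 * card U)) * n"
    by (rule card_cpl_odd_le) (use a in auto)
  then have "card cpl_odd + n \<le> (ffact (card U) r * ((card U - r) + (L - 2 * card U)) + 1) * n" by simp
  also have "\<dots> \<le> ffact a (Suc r) * n" by (rule mult_le_mono1[OF ffact_combined[OF r2 a(2,3,1,4)]])
  finally show ?thesis .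
qed

text \<open>If \<open>|U| \<ge> a\<close>, there is no room for a path with two vertices outside \<open>U\<close>, so the additional vertex lies in \<open>U\<close>. The
  argument then is the same as for even cycles.\<close>

lemma odd_stability_even:
  assumes a: "L = 2 * a" "r + 1 \<le> a"
  shows "card U = a \<and> card cpl_odd + (n - card full) \<le> ffact a (Suc r) * n \<or> card cpl_odd + n \<le> ffact a (Suc r) * n"
proof (cases "card U < a")
  case True
  then show ?thesis using odd_stability_small[of a] a by simp
next
  case False
  have pos: "1 \<le> ffact a (Suc r)" using ffact_pos[of "Suc r" a] a(2) by simp
  have zU: "z \<in> U" if "(us, x, z) \<in> cpl_odd" for us x z
    using odd_outside[OF that] False a by (cases "z \<in> U") auto
  show ?thesis
  proof (cases "cpl_odd = {}")
    case True
    have "1 * n \<le> ffact a (Suc r) * n" by (rule mult_le_mono1[OF pos])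
    then show ?thesis using True by simp
  next
    case ne: False
    then obtain us x z where "(us, x, z) \<in> cpl_odd" by auto
    then have "card U = a" using odd_inside zU False a by fastforce
    moreover have "card cpl_odd \<le> (\<Sum>x\<in>V. if U \<subseteq> nb x then ffact a (Suc r) else ffact a (Suc r) - 1)"
      using card_cpl_odd_sum[OF zU] sum_mono[of V "\<lambda>x. card (inU x)" "\<lambda>x. if U \<subseteq> nb x then ffact a (Suc r) else ffact a (Suc r) - 1"]
        card_inU_le \<open>card U = a\<close> a(2) by force
    ultimately show ?thesis using sum_full[OF pos] by linarith
  qed
qed

end

section \<open>Chains closed by a single non-adjacent pair\<close>

lemma rotate_eqD:
  assumes "rotate k x = rotate k y" "length x = length y"
  shows "x = y"
proof (cases "x = []")
  case False
  let ?N = "length x"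
  have k: "k mod ?N \<le> ?N" using False by (simp add: less_imp_le)
  have "rotate (k mod ?N) x = rotate (k mod ?N) y"
    using assms by (metis rotate_conv_mod)
  then show ?thesis using rotate_back[of "k mod ?N" x] rotate_back[of "k mod ?N" y] k assms(2) by metis
qed (use assms in simp)

lemma mod_cancel_add:
  fixes N :: nat
  assumes "(k + i) mod N = (k' + i) mod N"
  shows "k mod N = k' mod N"
proof -
  have "(int k + int i) mod int N = (int k' + int i) mod int N"
    using assms by (metis of_nat_add of_nat_mod)
  then have "int k mod int N = int k' mod int N" by (metis add_diff_cancel_right' mod_diff_left_eq)
  then show ?thesis by (metis of_nat_eq_iff of_nat_mod)
qed

lemma zero_index:
  assumes "2 \<le> (N::nat)"
  shows "\<exists>i<N. (k + i) mod N = 0 \<and> (k + Suc i mod N) mod N = 1"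
proof (intro exI conjI)
  let ?i = "(N - k mod N) mod N"
  show "?i < N" using assms by simp
  have "k mod N \<le> N" using assms by (simp add: less_imp_le)
  then have e: "k mod N + (N - k mod N) = N" by simp
  have "(k + ?i) mod N = (k mod N + (N - k mod N)) mod N" by (simp only: mod_simps)
  then show z: "(k + ?i) mod N = 0" unfolding e by simp
  have "(k + Suc ?i mod N) mod N = Suc ((k + ?i) mod N) mod N" by (simp only: mod_simps add_Suc_right)
  also have "\<dots> = Suc 0 mod N" unfolding z ..
  also have "\<dots> = 1" using assms by simp
  finally show "(k + Suc ?i mod N) mod N = 1" .
qed

text \<open>Around such a list, the pair of its first two entries is the only consecutive pair not contained in a common set.
  So the \<open>2(r + 1)\<close> rotations and reflections of the lists in \<open>Val\<close> are pairwise different.\<close>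

lemma dihedral_bound:
  fixes Ts :: "'a set list"
  assumes fin: "finite U0" and r: "2 \<le> r" and Ts: "length Ts = r - 1"
    and Val: "\<And>l. l \<in> Val \<Longrightarrow> l \<in> dlists U0 (Suc r) \<and> chain (tl l) Ts \<and> last l \<in> P \<and> hd l \<in> P \<and> l ! 1 \<notin> P \<and>
      \<not> (\<exists>T\<in>set Ts. l ! 0 \<in> T \<and> l ! 1 \<in> T)"
  shows "2 * Suc r * card Val \<le> ffact (card U0) (Suc r)"
proof -
  let ?N = "Suc r"
  define G where "G = (\<lambda>p p'. \<exists>T\<in>insert P (set Ts). p \<in> T \<and> p' \<in> T)"
  have Gs: "G p p' \<longleftrightarrow> G p' p" for p p' by (auto simp: G_def)
  have len: "length l = ?N" "distinct l" if "l \<in> Val" for l using Val[OF that] by (auto simp: dlists_def)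
  have Ts0: "0 < length Ts" using r Ts by simp
  have n0: "\<not> G (l ! 0) (l ! 1)" if "l \<in> Val" for l using Val[OF that] by (auto simp: G_def)
  have g1: "l ! 1 \<in> Ts ! 0" if "l \<in> Val" for l
  proof -
    have "tl l ! 0 \<in> Ts ! 0" using Val[OF that] Ts0 unfolding chain_nth by blast
    then show ?thesis using len(1)[OF that] by (cases l) auto
  qed
  have gi: "G (l ! i) (l ! (Suc i mod ?N))" if l: "l \<in> Val" and i: "i < ?N" "i \<noteq> 0" for l i
  proof (cases "i = r")
    case True
    have "l \<noteq> []" using len(1)[OF l] by auto
    then have "l ! r \<in> P" "l ! 0 \<in> P" using Val[OF l] len(1)[OF l] by (auto simp: last_conv_nth hd_conv_nth)
    then show ?thesis using True by (auto simp: G_def)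
  next
    case False
    then have i': "i - 1 < length Ts" "Suc i < ?N" using i Ts by auto
    then have "tl l ! (i - 1) \<in> Ts ! (i - 1) \<and> tl l ! Suc (i - 1) \<in> Ts ! (i - 1)"
      using Val[OF l] unfolding chain_nth by blast
    moreover have "tl l ! j = l ! Suc j" for j using len(1)[OF l] by (cases l) auto
    moreover have "Suc (i - 1) = i" using i(2) by simp
    ultimately have "l ! i \<in> Ts ! (i - 1)" "l ! Suc i \<in> Ts ! (i - 1)" by simp_all
    moreover have "Ts ! (i - 1) \<in> set Ts" using i'(1) by simp
    ultimately have "G (l ! i) (l ! Suc i)" unfolding G_def by blast
    moreover have "Suc i mod ?N = Suc i" using i'(2) by simp
    ultimately show ?thesis by simp
  qed
  have idx: "rotate k l ! i = l ! ((k + i) mod ?N)" if "i < ?N" "length l = ?N" for k l i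
    using that by (simp add: nth_rotate)
  have zero: "\<exists>i<?N. (k + i) mod ?N = 0 \<and> (k + Suc i mod ?N) mod ?N = 1" for k
    by (rule zero_index) (use r in simp)
  have key1: "l1 = l2 \<and> k mod ?N = k' mod ?N"
    if l: "l1 \<in> Val" "l2 \<in> Val" and eq: "rotate k l1 = rotate k' l2" for l1 l2 k k'
  proof -
    obtain i where i: "i < ?N" "(k + i) mod ?N = 0" "(k + Suc i mod ?N) mod ?N = 1" using zero[of k] by (elim exE conjE)
    have si: "Suc i mod ?N < ?N" by simp
    have "l1 ! 0 = rotate k l1 ! i" using idx[OF i(1) len(1)[OF l(1)], of k] unfolding i(2) by (rule sym)
    also have "\<dots> = l2 ! ((k' + i) mod ?N)" unfolding eq by (rule idx[OF i(1) len(1)[OF l(2)]])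
    finally have a: "l1 ! 0 = l2 ! ((k' + i) mod ?N)" .
    have "l1 ! 1 = rotate k l1 ! (Suc i mod ?N)" using idx[OF si len(1)[OF l(1)], of k] unfolding i(3) by (rule sym)
    also have "\<dots> = l2 ! ((k' + Suc i mod ?N) mod ?N)" unfolding eq by (rule idx[OF si len(1)[OF l(2)]])
    also have "(k' + Suc i mod ?N) mod ?N = Suc ((k' + i) mod ?N) mod ?N" by (simp only: mod_simps add_Suc_right)
    finally have b: "l1 ! 1 = l2 ! (Suc ((k' + i) mod ?N) mod ?N)" .
    have "(k' + i) mod ?N = 0"
    proof (rule ccontr)
      assume "(k' + i) mod ?N \<noteq> 0"
      then have "G (l1 ! 0) (l1 ! 1)" unfolding a b by (intro gi[OF l(2)]) auto
      then show False using n0[OF l(1)] by simp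
    qed
    then have m: "(k' + i) mod ?N = (k + i) mod ?N" using i(2) by simp
    have kk: "k mod ?N = k' mod ?N" by (rule mod_cancel_add[OF m[symmetric]])
    have "rotate k l1 = rotate k l2"
    proof -
      have "rotate k l2 = rotate (k mod ?N) l2" using len(1)[OF l(2)] by (metis rotate_conv_mod)
      also have "\<dots> = rotate (k' mod ?N) l2" by (simp only: kk)
      also have "\<dots> = rotate k' l2" using len(1)[OF l(2)] by (metis rotate_conv_mod)
      finally show ?thesis using eq by simp
    qed
    then have "l1 = l2" by (rule rotate_eqD) (simp add: len(1)[OF l(1)] len(1)[OF l(2)])
    with kk show ?thesis by blast
  qed
  have key2: False if l: "l1 \<in> Val" "l2 \<in> Val" and eq: "rotate k l1 = rotate k' (rev l2)" for l1 l2 k k'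
  proof -
    have lr: "length (rev l2) = ?N" using len(1)[OF l(2)] by simp
    obtain i where i: "i < ?N" "(k + i) mod ?N = 0" "(k + Suc i mod ?N) mod ?N = 1" using zero[of k] by (elim exE conjE)
    have si: "Suc i mod ?N < ?N" by simp
    define t where "t = (k' + i) mod ?N"
    have t: "t < ?N" by (simp add: t_def)
    have "l1 ! 0 = rotate k l1 ! i" using idx[OF i(1) len(1)[OF l(1)], of k] unfolding i(2) by (rule sym)
    also have "\<dots> = rev l2 ! t" unfolding eq t_def by (rule idx[OF i(1) lr])
    also have "\<dots> = l2 ! (r - t)" using t len(1)[OF l(2)] by (simp add: rev_nth)
    finally have a: "l1 ! 0 = l2 ! (r - t)" .
    have "l1 ! 1 = rotate k l1 ! (Suc i mod ?N)" using idx[OF si len(1)[OF l(1)], of k] unfolding i(3) by (rule sym)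
    also have "\<dots> = rev l2 ! ((k' + Suc i mod ?N) mod ?N)" unfolding eq by (rule idx[OF si lr])
    also have "(k' + Suc i mod ?N) mod ?N = Suc t mod ?N" unfolding t_def by (simp only: mod_simps add_Suc_right)
    also have "rev l2 ! (Suc t mod ?N) = l2 ! (r - Suc t mod ?N)" using len(1)[OF l(2)] by (simp add: rev_nth)
    finally have b: "l1 ! 1 = l2 ! (r - Suc t mod ?N)" .
    have ng: "\<not> G (l2 ! (r - t)) (l2 ! (r - Suc t mod ?N))" using n0[OF l(1)] a b by simp
    have "Suc t = r"
    proof (rule ccontr)
      assume ne: "Suc t \<noteq> r"
      show False
      proof (cases "t = r")
        case True
        then have "G (l2 ! r) (l2 ! 0)" using gi[OF l(2), of r] r by simp
        then show False using ng True Gs by simp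
      next
        case False
        then have "Suc t mod ?N = Suc t" using t by simp
        moreover have "G (l2 ! (r - Suc t)) (l2 ! (Suc (r - Suc t) mod ?N))"
          by (rule gi[OF l(2)]) (use t ne False in auto)
        moreover have "Suc (r - Suc t) mod ?N = r - t" using t False by simp
        ultimately show False using ng Gs by simp
      qed
    qed
    then have "r - t = 1" "r - Suc t mod ?N = 0" by auto
    then have "l1 ! 0 \<in> Ts ! 0" "l1 ! 1 \<in> Ts ! 0" using a g1 l by auto
    then show False using Val[OF l(1)] Ts0 nth_mem by blast
  qed
  define f where "f = (\<lambda>(l, k, b). rotate k (if b then rev l else l :: 'a list))"
  have "inj_on f (Val \<times> {..<?N} \<times> UNIV)"
  proof (rule inj_onI)
    fix t1 t2 assume t: "t1 \<in> Val \<times> {..<?N} \<times> UNIV" "t2 \<in> Val \<times> {..<?N} \<times> UNIV" and eq: "f t1 = f t2"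
    obtain l1 k1 b1 l2 k2 b2 where tt: "t1 = (l1, k1, b1)" "t2 = (l2, k2, b2)" by (cases t1, cases t2) auto
    have l: "l1 \<in> Val" "l2 \<in> Val" "k1 < ?N" "k2 < ?N" using t tt by auto
    show "t1 = t2"
    proof (cases b1; cases b2)
      assume "\<not> b1" "\<not> b2"
      then show ?thesis using key1[OF l(1,2), of k1 k2] eq l tt by (simp add: f_def)
    next
      assume "b1" "\<not> b2"
      then show ?thesis using key2[OF l(2,1), of k2 k1] eq tt by (simp add: f_def)
    next
      assume "\<not> b1" "b2"
      then show ?thesis using key2[OF l(1,2), of k1 k2] eq tt by (simp add: f_def)
    next
      assume b: "b1" "b2"
      then have "rotate k1 (rev l1) = rotate k2 (rev l2)" using eq tt by (simp add: f_def)
      then have "rotate (?N - k1 mod ?N) l1 = rotate (?N - k2 mod ?N) l2"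
        unfolding rotate_rev using len(1)[OF l(1)] len(1)[OF l(2)] by simp
      then have "l1 = l2 \<and> (?N - k1 mod ?N) mod ?N = (?N - k2 mod ?N) mod ?N" by (rule key1[OF l(1,2)])
      then have e: "l1 = l2" "(?N - k1) mod ?N = (?N - k2) mod ?N" using l(3,4) by auto
      have "k1 = k2" using e(2) l(3,4) by (cases "k1 = 0"; cases "k2 = 0") auto
      then show ?thesis using e b tt by simp
    qed
  qed
  moreover have "f ` (Val \<times> {..<?N} \<times> UNIV) \<subseteq> dlists U0 ?N"
  proof
    fix y assume "y \<in> f ` (Val \<times> {..<?N} \<times> UNIV)"
    then obtain l k b where y: "l \<in> Val" "y = rotate k (if b then rev l else l)" by (auto simp: f_def)
    have "set (if b then rev l else l) = set l" "distinct (if b then rev l else l)" "length (if b then rev l else l) = ?N"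
      using len[OF y(1)] by auto
    then show "y \<in> dlists U0 ?N" using Val[OF y(1)] y(2) by (auto simp: dlists_def)
  qed
  ultimately have "card (Val \<times> {..<?N} \<times> (UNIV :: bool set)) \<le> card (dlists U0 ?N)"
    using fin by (intro card_inj_on_le) auto
  then show ?thesis using card_dlists[OF fin] by (simp add: card_cartesian_product algebra_simps)
qed

lemma dihedral_strict:
  assumes "2 * Suc r * v \<le> ffact (a + 1) (Suc r)" "r + 1 \<le> a" "2 \<le> r"
  shows "v + 1 \<le> ffact a (Suc r)"
proof (rule ccontr)
  assume "\<not> ?thesis"
  then have v: "ffact a r * (a - r) \<le> v" unfolding ffact_Suc by simp
  have "2 * Suc r * (ffact a r * (a - r)) \<le> 2 * Suc r * v" by (rule mult_le_mono2[OF v])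
  also have "\<dots> \<le> (a + 1) * ffact a r" using assms(1) by simp
  finally have "2 * Suc r * (ffact a r * (a - r)) \<le> (a + 1) * ffact a r" .
  then have "ffact a r * (2 * Suc r * (a - r)) \<le> ffact a r * (a + 1)" by (simp only: ac_simps)
  moreover have "0 < ffact a r" using assms(2) by (intro ffact_pos) simp
  ultimately have le: "2 * Suc r * (a - r) \<le> a + 1" using nat_mult_le_cancel1 by blast
  obtain i where i: "a = r + Suc i" using assms(2) by (metis Suc_eq_plus1 add_Suc_shift less_eqE)
  have "2 * Suc r * Suc i = 2 * Suc r + 2 * Suc r * i" by simp
  moreover have "i \<le> 2 * Suc r * i" by simp
  ultimately show False using le i assms(3) by simp
qed

section \<open>Two classes without neighbouring positions\<close>

text \<open>Shifting \<open>Q\<close> by one makes it disjoint from \<open>P\<close> within \<open>{..a}\<close>, so \<open>|P| + |Q| \<le> a + 1\<close>, and equality forces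
  \<open>P = Q\<close>. The left hand side is \<open>(|P| + |Q|) (|P| + |Q| - 1)\<close> minus the pairs inside \<open>Q\<close> and minus terms for
  common elements.\<close>

lemma positions_aux:
  fixes P Q :: "nat set"
  assumes a: "3 \<le> a" and sub: "P \<subseteq> {..<a}" "Q \<subseteq> {..<a}"
    and na: "\<And>k. k \<in> P \<Longrightarrow> Suc k \<notin> Q" "\<And>k. k \<in> Q \<Longrightarrow> Suc k \<notin> P"
    and ne: "P \<noteq> {}" "Q \<noteq> {}"
  shows "card P * (card P - 1) + card {(i, j). i \<noteq> j \<and> (i \<in> P \<and> j \<in> Q \<or> i \<in> Q \<and> j \<in> P)} < a * (a - 1)"
proof -
  let ?R = "{(i, j). i \<noteq> j \<and> (i \<in> P \<and> j \<in> Q \<or> i \<in> Q \<and> j \<in> P)}"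
  define \<alpha> \<beta> \<gamma> where "\<alpha> = card P" and "\<beta> = card Q" and "\<gamma> = card (P \<inter> Q)"
  have fin: "finite P" "finite Q" using sub finite_subset by auto
  have pos: "1 \<le> \<alpha>" "1 \<le> \<beta>" using ne fin unfolding \<alpha>_def \<beta>_def
    by (simp_all add: Suc_le_eq card_gt_0_iff)
  have R: "card ?R + \<gamma> + \<gamma> * \<gamma> = 2 * \<alpha> * \<beta>"
  proof -
    have U: "P \<times> Q \<union> Q \<times> P = ?R \<union> (\<lambda>i. (i, i)) ` (P \<inter> Q)" by auto
    have I: "(P \<times> Q) \<inter> (Q \<times> P) = (P \<inter> Q) \<times> (P \<inter> Q)" by auto
    have fR: "finite ?R" by (rule finite_subset[of _ "(P \<union> Q) \<times> (P \<union> Q)"]) (use fin in auto)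
    have "card (?R \<union> (\<lambda>i. (i, i)) ` (P \<inter> Q)) = card ?R + card ((\<lambda>i. (i, i)) ` (P \<inter> Q))"
      by (rule card_Un_disjoint) (use fR fin in auto)
    also have "card ((\<lambda>i. (i, i)) ` (P \<inter> Q)) = \<gamma>" unfolding \<gamma>_def by (rule card_image) (auto simp: inj_on_def)
    finally have "card (P \<times> Q \<union> Q \<times> P) = card ?R + \<gamma>" unfolding U .
    moreover have "card (P \<times> Q) + card (Q \<times> P) = card (P \<times> Q \<union> Q \<times> P) + card ((P \<times> Q) \<inter> (Q \<times> P))"
      using fin by (intro card_Un_Int) auto
    moreover have "card ((P \<times> Q) \<inter> (Q \<times> P)) = \<gamma> * \<gamma>" unfolding I \<gamma>_def by (rule card_cartesian_product)
    ultimately show ?thesis by (simp add: card_cartesian_product \<alpha>_def \<beta>_def mult.commute[of "card Q"])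
  qed
  have disj: "P \<inter> Suc ` Q = {}" "Q \<inter> Suc ` P = {}" using na by auto
  have cs: "card (Suc ` Q) = \<beta>" "card (Suc ` P) = \<alpha>" by (auto simp: card_image \<alpha>_def \<beta>_def)
  have cPQ: "card (P \<union> Suc ` Q) = \<alpha> + \<beta>" "card (Q \<union> Suc ` P) = \<alpha> + \<beta>"
    using card_Un_disjoint[OF fin(1) _ disj(1)] card_Un_disjoint[OF fin(2) _ disj(2)] fin cs
    by (auto simp: \<alpha>_def \<beta>_def)
  have subs: "P \<union> Suc ` Q \<subseteq> {..a}" "Q \<union> Suc ` P \<subseteq> {..a}" using sub by auto
  have le: "\<alpha> + \<beta> \<le> a + 1" using card_mono[OF _ subs(1)] cPQ(1) by simp
  have key: "\<alpha> * (\<alpha> - 1) + 2 * \<alpha> * \<beta> + \<beta> * (\<beta> - 1) = (\<alpha> + \<beta>) * (\<alpha> + \<beta> - 1)"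
    using pos by (cases \<alpha>; cases \<beta>) (auto simp: algebra_simps)
  consider "\<alpha> + \<beta> < a" | "\<alpha> + \<beta> = a" | "\<alpha> + \<beta> = a + 1" using le by linarith
  then show ?thesis
  proof cases
    case 1
    have "(\<alpha> + \<beta>) * (\<alpha> + \<beta> - 1) \<le> (a - 1) * (a - 1)" using 1 by (intro mult_le_mono) auto
    also have "\<dots> < a * (a - 1)" using a by simp
    finally show ?thesis using key R unfolding \<alpha>_def[symmetric] by linarith
  next
    case 2
    then have e: "\<alpha> * (\<alpha> - 1) + card ?R + \<gamma> + \<gamma> * \<gamma> + \<beta> * (\<beta> - 1) = a * (a - 1)" using key R by simp
    show ?thesis
    proof (cases "\<gamma> = 0 \<and> \<beta> = 1")
      case False
      then have "0 < \<gamma> + \<beta> * (\<beta> - 1)" using pos by auto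
      then show ?thesis using e unfolding \<alpha>_def[symmetric] by linarith
    next
      case True
      then obtain x where Q: "Q = {x}" by (auto simp: \<beta>_def card_1_singleton_iff)
      have "P \<inter> Q = {}" using True fin by (simp add: \<gamma>_def)
      then have "P \<union> Q = {..<a}"
        using 2 card_Un_disjoint[OF fin] sub by (intro card_subset_eq) (auto simp: \<alpha>_def \<beta>_def)
      then have P: "y \<in> P" if "y < a" "y \<noteq> x" for y using that Q by blast
      have xa: "x < a" using sub Q by auto
      show ?thesis
      proof (cases "Suc x < a")
        case True
        then show ?thesis using P[of "Suc x"] na(2)[of x] Q by auto
      next
        case False
        then have "Suc (x - 1) = x" using xa a by simp
        then show ?thesis using P[of "x - 1"] na(1)[of "x - 1"] Q xa a by auto
      qed
    qed
  next
    case 3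
    have all: "P \<union> Suc ` Q = {..a}" "Q \<union> Suc ` P = {..a}"
      using card_subset_eq[OF finite_atMost subs(1)] card_subset_eq[OF finite_atMost subs(2)] cPQ 3 by auto
    have PQ: "k \<in> P \<longleftrightarrow> k \<in> Q" if "k \<le> a" for k
      using that
    proof (induction k)
      case 0
      have "0 \<in> P \<union> Suc ` Q" "0 \<in> Q \<union> Suc ` P" unfolding all by simp_all
      then show ?case by auto
    next
      case (Suc k)
      then have IH: "k \<in> P \<longleftrightarrow> k \<in> Q" by simp
      have "Suc k \<in> P \<union> Suc ` Q" "Suc k \<in> Q \<union> Suc ` P" unfolding all using Suc.prems by simp_all
      then show ?case using IH na by auto
    qed
    then have "P = Q" using sub by (auto simp: subset_iff)
    then have e: "\<alpha> = \<beta>" "\<gamma> = \<beta>" by (auto simp: \<alpha>_def \<beta>_def \<gamma>_def)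
    have "2 \<le> \<beta>" using 3 e a by linarith
    then obtain b where "\<beta> = 2 + b" using le_Suc_ex by blast
    then have b: "\<beta> = b + 2" by simp
    have a': "a = 2 * b + 3" using 3 e b by simp
    have "card ?R + (b + 2) + (b + 2) * (b + 2) = 2 * (b + 2) * (b + 2)" using R e b by simp
    then have "card ?R = (b + 2) * (b + 1)" by (simp add: algebra_simps)
    then show ?thesis unfolding \<alpha>_def[symmetric] using e b a' by (simp add: algebra_simps)
  qed
qed

text \<open>The list will be a spanning list of \<open>U\<close>, where \<open>P\<close> are the neighbours of a vertex \<open>x\<close> and \<open>Q\<close> those of its small
  neighbours.\<close>

lemma positions:
  assumes a: "3 \<le> length w" and d: "distinct w" and sub: "P \<subseteq> set w" "Q \<subseteq> set w"
    and na: "\<And>i. Suc i < length w \<Longrightarrow> \<not> (w ! i \<in> P \<and> w ! Suc i \<in> Q) \<and> \<not> (w ! i \<in> Q \<and> w ! Suc i \<in> P)"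
    and ne: "P \<noteq> {}" "Q \<noteq> {}"
  shows "card P * (card P - 1) + card {(u, v). u \<noteq> v \<and> (u \<in> P \<and> v \<in> Q \<or> u \<in> Q \<and> v \<in> P)} <
    length w * (length w - 1)"
proof -
  let ?I = "\<lambda>X. {i. i < length w \<and> w ! i \<in> X}"
  have im: "(!) w ` ?I X = X" if "X \<subseteq> set w" for X
    using that by (auto simp: in_set_conv_nth image_iff subset_iff)
  have inj: "inj_on ((!) w) {..<length w}" using d by (auto simp: inj_on_def nth_eq_iff_index_eq)
  have cP: "card (?I P) = card P"
  proof -
    have "inj_on ((!) w) (?I P)" using inj by (auto simp: inj_on_def)
    then have "card ((!) w ` ?I P) = card (?I P)" by (rule card_image)
    then show ?thesis using im[OF sub(1)] by simp
  qed
  let ?R = "{(i, j). i \<noteq> j \<and> (i \<in> ?I P \<and> j \<in> ?I Q \<or> i \<in> ?I Q \<and> j \<in> ?I P)}"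
  let ?S = "{(u, v). u \<noteq> v \<and> (u \<in> P \<and> v \<in> Q \<or> u \<in> Q \<and> v \<in> P)}"
  have fR: "finite ?R" by (rule finite_subset[of _ "{..<length w} \<times> {..<length w}"]) auto
  have "?S \<subseteq> (\<lambda>(i, j). (w ! i, w ! j)) ` ?R"
  proof
    fix t assume "t \<in> ?S"
    then obtain u v where t: "t = (u, v)" "u \<noteq> v" "u \<in> P \<and> v \<in> Q \<or> u \<in> Q \<and> v \<in> P" by auto
    then have "u \<in> set w" "v \<in> set w" using sub by auto
    then obtain i j where "i < length w" "u = w ! i" "j < length w" "v = w ! j" by (auto simp: in_set_conv_nth)
    then show "t \<in> (\<lambda>(i, j). (w ! i, w ! j)) ` ?R" using t by (intro image_eqI[of _ _ "(i, j)"]) auto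
  qed
  then have "card ?S \<le> card ?R" by (rule surj_card_le[OF fR])
  moreover have "card (?I P) * (card (?I P) - 1) + card ?R < length w * (length w - 1)"
  proof (rule positions_aux[OF a])
    have "?I X \<noteq> {}" if X: "X \<subseteq> set w" "X \<noteq> {}" for X
    proof
      assume "?I X = {}"
      then have "(!) w ` ?I X = {}" by (simp only: image_empty)
      then show False using im[OF X(1)] X(2) by simp
    qed
    then show "?I P \<noteq> {}" "?I Q \<noteq> {}" using ne sub by blast+
    show "Suc k \<notin> ?I Q" if "k \<in> ?I P" for k using na[of k] that by auto
    show "Suc k \<notin> ?I P" if "k \<in> ?I Q" for k using na[of k] that by auto
  qed auto
  ultimately show ?thesis using cP by simp
qed

lemma card_dlists_ends:
  assumes "finite X" "2 \<le> k" "R \<subseteq> {(u, v). u \<in> X \<and> v \<in> X \<and> u \<noteq> v}"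
  shows "card {l \<in> dlists X k. (last l, hd l) \<in> R} \<le> card R * ffact (card X - 2) (k - 2)"
proof -
  let ?D = "{l \<in> dlists X k. (last l, hd l) \<in> R}"
  let ?S = "Sigma R (\<lambda>(u, v). dlists (X - {u, v}) (k - 2))"
  have fR: "finite R" by (rule finite_subset[OF assms(3)], rule finite_subset[of _ "X \<times> X"]) (use assms(1) in auto)
  have sub: "?D \<subseteq> (\<lambda>((u, v), l). v # l @ [u]) ` ?S"
  proof
    fix l assume l: "l \<in> ?D"
    then have L: "length l = k" "distinct l" "set l \<subseteq> X" "(last l, hd l) \<in> R" by (auto simp: dlists_def)
    obtain v l1 where lv: "l = v # l1" using L(1) assms(2) by (cases l) auto
    then have l1: "l = v # l1" "l1 \<noteq> []" using L(1) assms(2) by auto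
    then obtain l2 u where l2: "l1 = l2 @ [u]" by (metis rev_exhaust)
    have "((u, v), l2) \<in> ?S" using L l1 l2 by (auto simp: dlists_def)
    then show "l \<in> (\<lambda>((u, v), l). v # l @ [u]) ` ?S" using l1 l2 by force
  qed
  have fS: "finite ?S" using fR assms(1) by (intro finite_SigmaI) auto
  have "card ?D \<le> card ?S" by (rule surj_card_le[OF fS sub])
  also have "\<dots> = (\<Sum>(u, v)\<in>R. card (dlists (X - {u, v}) (k - 2)))"
    using fR assms(1) by (subst card_SigmaI) (auto simp: case_prod_beta)
  also have "\<dots> \<le> (\<Sum>(u, v)\<in>R. ffact (card X - 2) (k - 2))"
  proof (rule sum_mono)
    fix t assume t: "t \<in> R"
    obtain u v where tt: "t = (u, v)" by (cases t)
    have "card (X - {u, v}) = card X - 2"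
      using t tt assms(1,3) by (subst card_Diff_subset) auto
    then show "(case t of (u, v) \<Rightarrow> card (dlists (X - {u, v}) (k - 2))) \<le> (case t of (u, v) \<Rightarrow> ffact (card X - 2) (k - 2))"
      using assms(1) tt by (simp add: card_dlists)
  qed
  finally show ?thesis by simp
qed

section \<open>Odd cycles when the circumference is odd\<close>

context tuple
begin

definition small_pairs :: "'a \<Rightarrow> 'a \<Rightarrow> ('a \<times> 'a) set" where
  "small_pairs p p' = arcs (nb p \<inter> B) (nb p' \<inter> B)"

lemma card_nb_B: "x \<in> B \<Longrightarrow> card (nb x) \<le> n div m"
  using card_nb_small m_pos by auto

text \<open>Small vertices have few neighbours, so forbidding boundedly many of them costs few pairs.\<close>

lemma card_arcs_avoid:
  assumes "X \<subseteq> B" "Y \<subseteq> B" "finite F"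
  shows "card (arcs X Y) \<le> card (arcs (X - F) (Y - F)) + 2 * card F * (n div m)"
proof -
  let ?T = "\<Union>x\<in>F \<inter> B. Pair x ` nb x \<union> (\<lambda>y. (y, x)) ` nb x"
  have "arcs X Y \<subseteq> arcs (X - F) (Y - F) \<union> ?T"
    using assms adj_sym by (auto simp: arcs_def nb_def)
  then have "card (arcs X Y) \<le> card (arcs (X - F) (Y - F) \<union> ?T)"
    by (rule card_mono[rotated]) (use assms(3) in auto)
  also have "\<dots> \<le> card (arcs (X - F) (Y - F)) + card ?T" by (rule card_Un_le)
  also have "card ?T \<le> (\<Sum>x\<in>F \<inter> B. card (Pair x ` nb x \<union> (\<lambda>y. (y, x)) ` nb x))"
    by (rule card_UN_le) (use assms(3) in simp)
  also have "\<dots> \<le> (\<Sum>x\<in>F \<inter> B. 2 * (n div m))"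
  proof (rule sum_mono)
    fix x assume x: "x \<in> F \<inter> B"
    have "card (Pair x ` nb x \<union> (\<lambda>y. (y, x)) ` nb x) \<le> card (Pair x ` nb x) + card ((\<lambda>y. (y, x)) ` nb x)"
      by (rule card_Un_le)
    also have "\<dots> \<le> card (nb x) + card (nb x)" by (intro add_mono card_image_le) auto
    also have "\<dots> \<le> 2 * (n div m)" using card_nb_B[of x] x by simp
    finally show "card (Pair x ` nb x \<union> (\<lambda>y. (y, x)) ` nb x) \<le> 2 * (n div m)" .
  qed
  also have "\<dots> = card (F \<inter> B) * (2 * (n div m))" by simp
  also have "\<dots> \<le> card F * (2 * (n div m))" using assms(3) by (intro mult_le_mono1 card_mono) auto
  finally show ?thesis by (simp add: algebra_simps)
qed

lemma small_pairs_avoid: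
  assumes "finite F" "2 * card F * (n div m) < card (small_pairs p p')"
  obtains x y where "(x, y) \<in> small_pairs p p'" "x \<notin> F" "y \<notin> F"
proof -
  have "card (small_pairs p p') \<le> card (arcs (nb p \<inter> B - F) (nb p' \<inter> B - F)) + 2 * card F * (n div m)"
    unfolding small_pairs_def by (rule card_arcs_avoid) (use assms(1) in auto)
  then have "arcs (nb p \<inter> B - F) (nb p' \<inter> B - F) \<noteq> {}" using assms(2) by auto
  then show ?thesis using that by (auto simp: small_pairs_def arcs_def)
qed

lemma small_pairs_D:
  assumes "(x, y) \<in> small_pairs p p'"
  shows "x \<in> B" "y \<in> B" "adj p x" "adj x y" "adj y p'" "x \<noteq> y" "x \<notin> U" "y \<notin> U"
  using assms U_A adj_sym adj_irrefl by (auto simp: small_pairs_def arcs_def nb_def)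

subsection \<open>The chain spans more vertices than the extremal core\<close>

text \<open>Here \<open>|U| = a + 1\<close>, so the chain cannot close with a single vertex avoiding \<open>U\<close>, nor with a path that also returns
  through a common neighbour. Hence the pair formed by the additional vertex and the first vertex of the chain is
  exceptional in the cyclic order, and \<open>dihedral_bound\<close> applies.\<close>

lemma odd_stability_large:
  assumes a: "L = 2 * a + 1" "r + 1 \<le> a" "a < card U"
  shows "card cpl_odd + n \<le> ffact a (Suc r) * n"
proof (cases "cpl_odd = {}")
  case True
  have "1 \<le> ffact a (Suc r)" using ffact_pos[of "Suc r" a] a(2) by simp
  then have "1 * n \<le> ffact a (Suc r) * n" by (rule mult_le_mono1)
  then show ?thesis using True by simp
next
  case False
  have zU: "z \<in> U" if "(us, x, z) \<in> cpl_odd" for us x z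
    using odd_outside[OF that] a by (cases "z \<in> U") auto
  obtain us x z where "(us, x, z) \<in> cpl_odd" using False by auto
  then have s: "card U = a + 1" using odd_inside zU a by fastforce
  have "card (inU x) + 1 \<le> ffact a (Suc r)" for x
  proof (rule dihedral_strict[OF _ a(2) r2])
    have "2 * Suc r * card ((\<lambda>(us, z). z # us) ` inU x) \<le> ffact (card U) (Suc r)"
    proof (rule dihedral_bound[OF fin_U r2 Ts_ne(2)])
      fix l assume l: "l \<in> (\<lambda>(us, z). z # us) ` inU x"
      then obtain us z where lz: "l = z # us" "(us, x, z) \<in> cpl_odd" "z \<in> U" by (auto simp: inU_def)
      note D = cpl_oddD[OF lz(2)]
      note E = M_D[OF D(1)]
      have l1: "l ! 1 = hd us" using lz(1) E(4) by (simp add: hd_conv_nth)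
      have L0: "l \<in> dlists U (Suc r) \<and> hd l \<in> nb x \<and> last l \<in> nb x" using l inU_lists[of x] by blast
      have ch: "chain (tl l) Ts" using D(1) lz(1) by (simp add: M_def)
      have "hd us \<notin> nb x"
      proof
        assume h: "hd us \<in> nb x"
        have "2 * card (U - {}) + length [x] \<le> L + 1"
          by (rule close_chain[OF D(1)]) (use D h in \<open>auto simp: nb_def\<close>)
        then show False using s a by simp
      qed
      moreover have "\<not> (\<exists>T\<in>set Ts. l ! 0 \<in> T \<and> l ! 1 \<in> T)"
      proof
        assume "\<exists>T\<in>set Ts. l ! 0 \<in> T \<and> l ! 1 \<in> T"
        then have "C \<le> card (cm B z (hd us))" using Ts_cm lz(1) l1 by auto
        then have "1 < card (cm B z (hd us))" using C_large by simp
        then have "\<not> cm B z (hd us) \<subseteq> {x}" using card_mono[of "{x}" "cm B z (hd us)"] by auto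
        then obtain y where y: "y \<in> B" "adj y z" "adj y (hd us)" "y \<noteq> x" by (auto simp: cm_def)
        have yU: "y \<notin> U" "y \<noteq> z" using y(1,2) U_A adj_irrefl by auto
        have "2 * card (U - {z}) + length [x, z, y] \<le> L + 1"
          by (rule close_chain[OF D(1)]) (use D y yU adj_sym L2 in auto)
        then show False using s a lz(3) by simp
      qed
      ultimately show "l \<in> dlists U (Suc r) \<and> chain (tl l) Ts \<and> last l \<in> nb x \<and> hd l \<in> nb x \<and> l ! 1 \<notin> nb x \<and>
        \<not> (\<exists>T\<in>set Ts. l ! 0 \<in> T \<and> l ! 1 \<in> T)"
        using L0 ch l1 by simp
    qed
    then show "2 * Suc r * card (inU x) \<le> ffact (a + 1) (Suc r)" unfolding card_inU(1) s .
  qed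
  then have "(\<Sum>x\<in>V. card (inU x) + 1) \<le> (\<Sum>x\<in>V. ffact a (Suc r))" by (rule sum_mono)
  moreover have "(\<Sum>x\<in>V. card (inU x) + 1) = (\<Sum>x\<in>V. card (inU x)) + n" by (simp only: sum.distrib) simp
  moreover have "(\<Sum>x\<in>V. ffact a (Suc r)) = ffact a (Suc r) * n" by (simp only: sum_constant mult.commute of_nat_id)
  ultimately have "(\<Sum>x\<in>V. card (inU x)) + n \<le> ffact a (Suc r) * n" by linarith
  moreover have "card cpl_odd \<le> (\<Sum>x\<in>V. card (inU x))" by (rule card_cpl_odd_sum) (rule zU)
  ultimately show ?thesis by linarith
qed

subsection \<open>Five-cycles and a core that is one vertex too small\<close>

text \<open>In this case the count of outside pairs alone only gives the extremal number. If it is nearly attained, then for each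
  pair of ends there are nearly \<open>3n\<close> outside pairs, which provide outside paths with at least four vertices between
  any two vertices of \<open>U\<close>. Two disjoint ones, joined at a vertex \<open>v\<close>, replace the detour through \<open>v\<close> and make a cycle that
  is too long.\<close>

lemma five_cycles:
  assumes a: "L = 2 * a + 1" "3 \<le> a" "r = 2" "card U = a - 1" and m: "100 \<le> m"
  shows "4 * card cpl_odd + n \<le> 4 * (ffact a 3 * n)"
proof (rule ccontr)
  assume "\<not> ?thesis"
  then have big: "4 * (ffact a 3 * n) < 4 * card cpl_odd + n" by simp
  obtain T where T: "Ts = [T]" using Ts_ne a(3) by (cases Ts) auto
  have UT: "U = T" by (simp add: U_def T)
  have Mpair: "[u, v] \<in> M" if "u \<in> U" "v \<in> U" "u \<noteq> v" for u v
    using that by (simp add: M_def T UT)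
  have Mform: "\<exists>u v. us = [u, v] \<and> u \<in> U \<and> v \<in> U \<and> u \<noteq> v" if "us \<in> M" for us
  proof -
    have "length us = 2" "distinct us" "set us \<subseteq> U" using M_D[OF that] a(3) by auto
    then show ?thesis by (cases us; cases "tl us") auto
  qed
  let ?X = "\<lambda>us. nb (last us) - U" and ?Y = "\<lambda>us. nb (hd us) - U"
  define D where "D = (\<lambda>us. {(x, z) \<in> arcs (?X us) (?Y us). x \<in> B})"
  have Lk: "L - 2 * card U = 3" "2 * card U \<le> L" using a by auto
  have cXY: "card (?X us \<union> ?Y us) \<le> n" for us by (rule card_mono[OF finV]) (use nb_sub in blast)
  have arcs3: "card (arcs (?X us) (?Y us)) \<le> 3 * n" if "us \<in> M" for us
    using card_arcs_outside[OF that Lk(2)] cXY[of us] unfolding Lk(1) by (meson le_trans mult_le_mono2)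
  have finD: "finite (D us)" for us unfolding D_def by (rule finite_subset[OF _ fin_arcs]) auto
  have D3: "card (D us) \<le> 3 * n" if "us \<in> M" for us
  proof -
    have "D us \<subseteq> arcs (?X us) (?Y us)" by (auto simp: D_def)
    then show ?thesis using card_mono[OF fin_arcs] arcs3[OF that] le_trans by blast
  qed
  let ?W = "\<lambda>us. V \<times> (U - set us) \<union> D us"
  have cW: "card (?W us) \<le> (a - 3) * n + card (D us)" if "us \<in> M" for us
  proof -
    have "card (?W us) \<le> card (V \<times> (U - set us)) + card (D us)" by (rule card_Un_le)
    moreover have "card (U - set us) = a - 3"
      using M_D[OF that] distinct_card[of us] a by (simp add: card_Diff_subset)
    ultimately show ?thesis by (simp add: card_cartesian_product mult.commute)
  qed
  \<comment> \<open>since the total is nearly extremal, no single chain can be far from its maximum\<close>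
  have Dbig: "11 * n < 4 * card (D us0)" if us0: "us0 \<in> M" for us0
  proof -
    have sub: "cpl_odd \<subseteq> Sigma M ?W"
    proof
      fix t assume "t \<in> cpl_odd"
      then obtain us x z where t: "t = (us, x, z)" "(us, x, z) \<in> cpl_odd" by (cases t) auto
      note E = cpl_oddD[OF t(2)]
      show "t \<in> Sigma M ?W"
        using E adj_sym adj_V by (cases "z \<in> U") (auto simp: t(1) D_def arcs_def nb_def)
    qed
    have "card cpl_odd \<le> card (Sigma M ?W)"
      by (rule card_mono[OF _ sub]) (use finV finD in auto)
    also have "\<dots> = (\<Sum>us\<in>M. card (?W us))" by (rule card_SigmaI) (use finV finD in auto)
    also have "\<dots> = card (?W us0) + (\<Sum>us\<in>M - {us0}. card (?W us))" by (rule sum.remove[OF fin_M us0])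
    also have "(\<Sum>us\<in>M - {us0}. card (?W us)) \<le> (\<Sum>us\<in>M - {us0}. a * n)"
    proof (rule sum_mono)
      fix us assume "us \<in> M - {us0}"
      then have "card (?W us) \<le> (a - 3) * n + 3 * n" using cW[of us] D3[of us] by simp
      also have "\<dots> = a * n" using a(2) by (simp flip: add_mult_distrib)
      finally show "card (?W us) \<le> a * n" .
    qed
    also have "(\<Sum>us\<in>M - {us0}. a * n) = (card M - 1) * (a * n)" using us0 by simp
    also have "card (?W us0) \<le> (a - 3) * n + card (D us0)" by (rule cW[OF us0])
    finally have c1: "card cpl_odd \<le> (a - 3) * n + card (D us0) + (card M - 1) * (a * n)" by simp
    have M1: "1 \<le> card M" using us0 fin_M by (metis One_nat_def Suc_leI card_gt_0_iff empty_iff)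
    have cM: "card M * a \<le> ffact a 3"
    proof -
      have "card M \<le> (a - 1) * (a - 2)" using card_M unfolding a(3,4) by (simp add: numeral_2_eq_2)
      then have "card M * a \<le> (a - 1) * (a - 2) * a" by (rule mult_le_mono1)
      also have "(a - 1) * (a - 2) * a = ffact a 3"
      proof -
        have "a - 2 = a - 1 - 1" by simp
        then show ?thesis by (simp add: numeral_3_eq_3)
      qed
      finally show ?thesis .
    qed
    have "(a - 3) * n + 3 * n + (card M - 1) * (a * n) = card M * a * n"
    proof -
      have "(a - 3) * n + 3 * n = a * n" using a(2) by (simp flip: add_mult_distrib)
      moreover have "a * n + (card M - 1) * (a * n) = card M * (a * n)" using M1 by (cases "card M") auto
      ultimately show ?thesis by simp
    qed
    also have "\<dots> \<le> ffact a 3 * n" by (rule mult_le_mono1[OF cM])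
    finally have c2: "(a - 3) * n + 3 * n + (card M - 1) * (a * n) \<le> ffact a 3 * n" .
    show ?thesis using c1 c2 big by linarith
  qed
  \<comment> \<open>both directions nearly attain \<open>3 * n\<close>, so few pairs have a big second vertex\<close>
  have BBbig: "5 * n < 2 * card (small_pairs v u)" if uv: "u \<in> U" "v \<in> U" "u \<noteq> v" for u v
  proof -
    let ?us = "[u, v]" and ?us' = "[v, u]"
    have M2: "?us \<in> M" "?us' \<in> M" using Mpair uv by auto
    let ?A1 = "{(x, z) \<in> arcs (?X ?us) (?Y ?us). z \<notin> B}"
    have fA1: "finite ?A1" by (rule finite_subset[OF _ fin_arcs[of "?X ?us" "?Y ?us"]]) auto
    have "prod.swap ` ?A1 \<subseteq> arcs (?X ?us') (?Y ?us') - D ?us'"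
      using adj_sym by (auto simp: arcs_def D_def)
    then have "card (prod.swap ` ?A1) \<le> card (arcs (?X ?us') (?Y ?us') - D ?us')"
      by (rule card_mono[rotated]) simp
    also have "\<dots> = card (arcs (?X ?us') (?Y ?us')) - card (D ?us')"
      by (rule card_Diff_subset[OF finD]) (auto simp: D_def)
    also have "card (prod.swap ` ?A1) = card ?A1" by (rule card_image) simp
    finally have A1: "4 * card ?A1 \<le> n" using arcs3[OF M2(2)] Dbig[OF M2(2)] by linarith
    have "D ?us \<subseteq> small_pairs v u \<union> ?A1" by (auto simp: D_def small_pairs_def arcs_def)
    then have "card (D ?us) \<le> card (small_pairs v u \<union> ?A1)"
      by (rule card_mono[rotated]) (use fA1 in \<open>simp add: small_pairs_def\<close>)
    also have "\<dots> \<le> card (small_pairs v u) + card ?A1" by (rule card_Un_le)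
    finally show ?thesis using A1 Dbig[OF M2(1)] by linarith
  qed
  \<comment> \<open>avoiding \<open>F\<close> costs at most \<open>12 * (n div m)\<close> pairs, so more than \<open>2 * n\<close> remain\<close>
  have path: "\<exists>p. distinct p \<and> successively adj p \<and> set p \<subseteq> B - F \<and> hd p \<in> nb v \<and> last p \<in> nb u \<and> (length p = 4 \<or> length p = 5)"
    if uv: "u \<in> U" "v \<in> U" "u \<noteq> v" and F: "finite F" "card F \<le> 6" for u v F
  proof -
    let ?P = "nb v \<inter> B - F" and ?Q = "nb u \<inter> B - F"
    have "card (small_pairs v u) \<le> card (arcs ?P ?Q) + 2 * card F * (n div m)"
      unfolding small_pairs_def by (rule card_arcs_avoid) (use F in auto)
    moreover have "2 * card F * (n div m) \<le> 12 * (n div m)" using F(2) by simp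
    moreover have "100 * (n div m) \<le> n"
      using mult_le_mono1[OF m, of "n div m"] times_div_less_eq_dividend[of m n] by linarith
    ultimately have "2 * n < card (arcs ?P ?Q)" using BBbig[OF uv] by linarith
    moreover have "card (?P \<union> ?Q) \<le> n" by (rule card_mono[OF finV]) auto
    ultimately have lt: "(3 - 1) * card (?P \<union> ?Q) < card (arcs ?P ?Q)" by simp
    obtain p where "distinct p" "successively adj p" "set p \<subseteq> ?P \<union> ?Q" "hd p \<in> ?P" "last p \<in> ?Q"
      "length p = 3 + 1 \<or> length p = 3 + 2"
      using long_path_between[of 3 ?P ?Q, OF _ _ _ lt] by auto
    then show ?thesis by (intro exI[of _ p]) auto
  qed
  have "2 \<le> card U" using a by simp
  then obtain u v where uv: "u \<in> U" "v \<in> U" "u \<noteq> v"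
    by (metis card_le_Suc0_iff_eq fin_U not_less_eq_eq numeral_2_eq_2)
  obtain w where w: "w \<in> U" "w \<noteq> v" "card U = 2 \<Longrightarrow> w = u" "card U \<noteq> 2 \<Longrightarrow> w \<noteq> u"
  proof (cases "card U = 2")
    case True then show ?thesis using that uv by auto
  next
    case False
    then have "card U \<noteq> card {u, v}" using uv by simp
    then have "U \<noteq> {u, v}" by (rule contrapos_nn) (rule arg_cong)
    then obtain w where "w \<in> U" "w \<noteq> u" "w \<noteq> v" using uv by auto
    then show ?thesis using that False by auto
  qed
  obtain p where p: "distinct p" "successively adj p" "set p \<subseteq> B - {}" "hd p \<in> nb u" "last p \<in> nb v" "length p = 4 \<or> length p = 5"
    using path[OF uv(2,1), of "{}"] uv(3) by auto
  have "card (set p) \<le> 6" using p(1,6) distinct_card[of p] by auto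
  then obtain p' where p': "distinct p'" "successively adj p'" "set p' \<subseteq> B - set p" "hd p' \<in> nb v" "last p' \<in> nb w" "length p' = 4 \<or> length p' = 5"
    using path[OF w(1) uv(2) w(2), of "set p"] by auto
  let ?Q = "p @ v # p'"
  have ne: "p \<noteq> []" "p' \<noteq> []" using p(6) p'(6) by auto
  have vA: "v \<notin> B" "u \<notin> B" "w \<notin> B" using uv w U_A by auto
  have Q: "distinct ?Q" "successively adj ?Q" "adj u (hd ?Q)" "adj (last ?Q) w" "set ?Q \<subseteq> insert v B" "9 \<le> length ?Q" "length ?Q \<le> 11"
  proof -
    have j: "adj (last p) v" "adj v (hd p')" using p(5) p'(4) adj_sym by (simp_all add: nb_def)
    have "v \<notin> set p" "v \<notin> set p'" "set p \<inter> set p' = {}" using p(3) p'(3) vA(1) by blast+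
    then show "distinct ?Q" using p(1) p'(1) by simp
    show "successively adj ?Q"
      using p(2) p'(2) ne j by (simp add: successively_append_iff successively_Cons)
    show "adj u (hd ?Q)" using p(4) ne by (simp add: nb_def)
    show "adj (last ?Q) w" using p'(5) ne adj_sym by (simp add: nb_def)
    show "set ?Q \<subseteq> insert v B" using p(3) p'(3) by auto
    show "9 \<le> length ?Q" "length ?Q \<le> 11" using p(6) p'(6) by auto
  qed
  show False
  proof (cases "card U = 2")
    case True
    then have "w = u" using w by simp
    then have "cyc adj (u # ?Q)"
      using Q uv(3) vA ne by (auto simp: cyc_def successively_Cons)
    then have "length (u # ?Q) \<le> L" by (rule circ)
    then show False using Q(6) True a by simp
  next
    case False
    then have wu: "[w, u] \<in> M" using Mpair w uv by auto
    have "2 * card (U - {v}) + length ?Q \<le> L + 1"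
    proof (rule close_chain[OF wu])
      show "set ?Q \<inter> (U - {v}) = {}" using Q(5) U_A by auto
      show "length ?Q \<le> 2 * L + 2" using Q(7) a by linarith
    qed (use Q uv w False in auto)
    moreover have "card (U - {v}) = a - 2" using uv a by simp
    ultimately show False using Q(6) a by linarith
  qed
qed

end

context tuple
begin

subsection \<open>The chain spans exactly as many vertices as the extremal core\<close>

definition small_ends :: "'a \<Rightarrow> 'a \<Rightarrow> 'a set" where "small_ends p p' = fst ` small_pairs p p' \<union> snd ` small_pairs p p'"

lemma fin_small_pairs [simp]: "finite (small_pairs p p')" by (simp add: small_pairs_def)

lemma small_ends_B: "small_ends p p' \<subseteq> B" by (auto simp: small_ends_def small_pairs_def arcs_def)

lemma fin_small_ends [simp]: "finite (small_ends p p')" by (simp add: small_ends_def)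

definition big_completions :: "'a \<Rightarrow> ('a list \<times> 'a) set" where
  "big_completions x = {(us, z). (us, x, z) \<in> cpl_odd \<and> z \<in> A}"

text \<open>A completion by a small additional vertex is charged to both of its small vertices.\<close>

definition ch :: "'a \<Rightarrow> 'a list set" where "ch x = {us \<in> M. x \<in> small_ends (last us) (hd us)}"

text \<open>Pairs of ends with so few outside pairs that their removal is negligible. For all others an outside pair can be chosen
  that avoids any two vertices.\<close>

definition thin :: "'a set" where
  "thin = (\<Union>(p, p')\<in>{(p, p') \<in> U \<times> U. card (small_pairs p p') \<le> 4 * (n div m)}. small_ends p p')"

definition light :: "'a set" where "light = {x \<in> B. \<not> heavy m C x}"

lemma card_small_ends: "card (small_ends p p') \<le> 2 * card (small_pairs p p')"
proof -
  have "card (small_ends p p') \<le> card (fst ` small_pairs p p') + card (snd ` small_pairs p p')" unfolding small_ends_def by (rule card_Un_le)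
  also have "\<dots> \<le> card (small_pairs p p') + card (small_pairs p p')" by (intro add_mono card_image_le) auto
  finally show ?thesis by simp
qed

lemma card_thin: "card thin \<le> 8 * (card U * card U) * (n div m)"
proof -
  let ?I = "{(p, p') \<in> U \<times> U. card (small_pairs p p') \<le> 4 * (n div m)}"
  have fI: "finite ?I" by (rule finite_subset[of _ "U \<times> U"]) auto
  have "card thin \<le> (\<Sum>t\<in>?I. card (case t of (p, p') \<Rightarrow> small_ends p p'))"
    unfolding thin_def by (rule card_UN_le[OF fI])
  also have "\<dots> \<le> (\<Sum>t\<in>?I. 8 * (n div m))"
  proof (rule sum_mono)
    fix t assume t: "t \<in> ?I"
    obtain p p' where tt: "t = (p, p')" by (cases t)
    have "card (small_ends p p') \<le> 2 * card (small_pairs p p')" by (rule card_small_ends)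
    also have "\<dots> \<le> 8 * (n div m)" using t tt by simp
    finally show "card (case t of (p, p') \<Rightarrow> small_ends p p') \<le> 8 * (n div m)" using tt by simp
  qed
  also have "\<dots> = card ?I * (8 * (n div m))" by simp
  also have "\<dots> \<le> (card U * card U) * (8 * (n div m))"
  proof (rule mult_le_mono1)
    have "card ?I \<le> card (U \<times> U)" by (rule card_mono) auto
    then show "card ?I \<le> card U * card U" by (simp add: card_cartesian_product)
  qed
  finally show ?thesis by simp
qed

lemma big_completions_finite [simp]: "finite (big_completions x)"
  by (rule finite_subset[of _ "M \<times> A"]) (auto simp: big_completions_def dest: cpl_oddD)

lemma ch_finite [simp]: "finite (ch x)" by (simp add: ch_def)

text \<open>By the Erdos--Gallai bound, the outside pairs for given ends are not more numerous than the vertices they cover.\<close>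

lemma card_cpl_odd_charge:
  assumes BBle: "\<And>us. us \<in> M \<Longrightarrow> card (small_pairs (last us) (hd us)) \<le> card (small_ends (last us) (hd us))"
  shows "card cpl_odd \<le> (\<Sum>x\<in>V. card (big_completions x) + card (ch x))"
proof -
  let ?PA = "\<Union>x\<in>V. (\<lambda>(us, z). (us, x, z)) ` big_completions x"
  let ?PB = "Sigma M (\<lambda>us. small_pairs (last us) (hd us))"
  have "cpl_odd \<subseteq> ?PA \<union> ?PB"
  proof
    fix t assume "t \<in> cpl_odd"
    then obtain us x z where t: "t = (us, x, z)" "(us, x, z) \<in> cpl_odd" by (cases t) auto
    note D = cpl_oddD[OF t(2)]
    show "t \<in> ?PA \<union> ?PB"
    proof (cases "z \<in> A")
      case True
      then have "(us, z) \<in> big_completions x" "x \<in> V" using t D by (auto simp: big_completions_def)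
      then show ?thesis using t(1) by force
    next
      case False
      then show ?thesis using t(1) D adj_sym by (auto simp: small_pairs_def arcs_def nb_def)
    qed
  qed
  then have "card cpl_odd \<le> card (?PA \<union> ?PB)" by (rule card_mono[rotated]) (use finV in auto)
  also have "\<dots> \<le> card ?PA + card ?PB" by (rule card_Un_le)
  also have "card ?PA \<le> (\<Sum>x\<in>V. card ((\<lambda>(us, z). (us, x, z)) ` big_completions x))" by (rule card_UN_le[OF finV])
  also have "\<dots> \<le> (\<Sum>x\<in>V. card (big_completions x))" by (rule sum_mono) (rule card_image_le, simp)
  also have "card ?PB = (\<Sum>us\<in>M. card (small_pairs (last us) (hd us)))" by (rule card_SigmaI) auto
  also have "\<dots> \<le> (\<Sum>us\<in>M. card (small_ends (last us) (hd us)))" by (rule sum_mono) (rule BBle)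
  also have "\<dots> = card (Sigma M (\<lambda>us. small_ends (last us) (hd us)))" by (rule card_SigmaI[symmetric]) auto
  also have "\<dots> \<le> card (Sigma V ch)"
  proof (rule surj_card_le)
    show "Sigma M (\<lambda>us. small_ends (last us) (hd us)) \<subseteq> prod.swap ` Sigma V ch"
    proof
      fix t assume t: "t \<in> Sigma M (\<lambda>us. small_ends (last us) (hd us))"
      obtain us x where tt: "t = (us, x)" by (cases t)
      then have "(x, us) \<in> Sigma V ch" using t small_ends_B by (auto simp: ch_def)
      then show "t \<in> prod.swap ` Sigma V ch" using tt by force
    qed
  qed (use finV in auto)
  also have "\<dots> = (\<Sum>x\<in>V. card (ch x))" by (rule card_SigmaI) (use finV in auto)
  finally show ?thesis by (simp add: sum.distrib)
qed

context
  fixes a :: nat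
  assumes L: "L = 2 * a + 1" and ra: "r + 1 \<le> a" and cU: "card U = a"
begin

text \<open>Otherwise there is a path with at least three vertices between the ends, which is too long when \<open>|U| = a\<close>.\<close>

lemma card_small_pairs_le:
  assumes "us \<in> M"
  shows "card (small_pairs (last us) (hd us)) \<le> card (small_ends (last us) (hd us))"
proof (rule ccontr)
  let ?X = "fst ` small_pairs (last us) (hd us)" and ?Y = "snd ` small_pairs (last us) (hd us)"
  assume "\<not> ?thesis"
  moreover have "small_pairs (last us) (hd us) \<subseteq> arcs ?X ?Y" by (force simp: arcs_def small_pairs_def)
  then have "card (small_pairs (last us) (hd us)) \<le> card (arcs ?X ?Y)" by (rule card_mono[OF fin_arcs])
  ultimately have lt: "(2 - 1) * card (?X \<union> ?Y) < card (arcs ?X ?Y)" by (simp add: small_ends_def)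
  have "?X \<subseteq> V" "?Y \<subseteq> V" by (auto simp: small_pairs_def arcs_def)
  then obtain p where p: "distinct p" "successively adj p" "set p \<subseteq> ?X \<union> ?Y" "hd p \<in> ?X" "last p \<in> ?Y"
    "length p = 2 + 1 \<or> length p = 2 + 2"
    using long_path_between[of 2 ?X ?Y, OF _ _ _ lt] by auto
  have "2 * card (U - {}) + length p \<le> L + 1"
  proof (rule close_chain[OF assms])
    show "p \<noteq> []" using p(6) by auto
    show "adj (last us) (hd p)" using p(4) by (auto simp: small_pairs_def arcs_def nb_def)
    show "adj (last p) (hd us)" using p(5) adj_sym by (auto simp: small_pairs_def arcs_def nb_def)
    have "set p \<subseteq> B" using p(3) small_ends_B[of "last us" "hd us"] by (auto simp: small_ends_def)
    then show "set p \<inter> (U - {}) = {}" using U_A by auto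
    show "length p \<le> 2 * L + 2" using p(6) L2 by auto
  qed (use p in auto)
  then show False using p(6) cU L by auto
qed

text \<open>A big neighbour \<open>z0\<close> of \<open>x\<close> outside \<open>U\<close> can be reached from any neighbour of \<open>x\<close> through a twin of \<open>x\<close>. Any further way
  to leave \<open>U\<close> then combines with the path \<open>x\<close>, \<open>z0\<close>, twin to an excessive cycle. So \<open>x\<close> is not charged, \<open>z0\<close> is
  unique, and the lists in \<open>insert z0 U\<close> have exactly one non-adjacent consecutive pair, as \<open>dihedral_bound\<close> requires.\<close>

lemma outside_type:
  assumes h: "heavy m C x" and z0: "(us0, z0) \<in> big_completions x" "z0 \<notin> U"
  shows "ch x = {}" and "card (big_completions x) + 1 \<le> ffact a (Suc r)"
proof -
  have D0: "(us0, x, z0) \<in> cpl_odd" "z0 \<in> A" using z0 by (auto simp: big_completions_def)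
  note D = cpl_oddD[OF D0(1)]
  have xz0: "z0 \<in> nb x \<inter> A" using D D0 by (simp add: nb_def)
  have twin: "\<exists>x'. x' \<in> B \<and> x' \<notin> F \<and> (\<forall>p\<in>nb x \<inter> A. adj x' p \<and> adj p x')" if F: "finite F" "card F \<le> 3" for F
  proof -
    have lt: "card F < C" using F(2) C_large by linarith
    obtain x' where x': "x' \<in> B" "nb x' \<inter> A = nb x \<inter> A" "x' \<notin> F"
      using twin_avoiding[OF h F(1) lt] by blast
    then show ?thesis using adj_sym by (intro exI[of _ x']) (auto simp: nb_def)
  qed
  \<comment> \<open>the excursion \<open>x\<close>, \<open>z0\<close>, twin of \<open>x\<close> would close the chain\<close>
  have hd_nb: False if us: "us \<in> M" "last us \<in> nb x" "hd us \<in> nb x" for us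
  proof -
    have ends: "last us \<in> A" "hd us \<in> A" using M_D[OF us(1)] U_A by auto
    obtain x' where x': "x' \<in> B" "x' \<notin> {x}" "\<forall>p\<in>nb x \<inter> A. adj x' p \<and> adj p x'" using twin[of "{x}"] by auto
    have "2 * card (U - {}) + length [x, z0, x'] \<le> L + 1"
    proof (rule close_chain[OF us(1)])
      show "distinct [x, z0, x']" using x' D xz0 U_A by auto
      show "successively adj [x, z0, x']" using D x'(3) xz0 by auto
      show "set [x, z0, x'] \<inter> (U - {}) = {}" using D z0(2) x'(1) U_A by auto
      show "adj (last us) (hd [x, z0, x'])" using us(2) adj_sym by (simp add: nb_def)
      show "adj (last [x, z0, x']) (hd us)" using x'(3) us(3) ends by simp
    qed (use L2 in auto)
    then show False using cU L by simp
  qed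
  show "ch x = {}"
  proof (rule equals0I)
    fix us assume "us \<in> ch x"
    then have us: "us \<in> M" "x \<in> small_ends (last us) (hd us)" by (auto simp: ch_def)
    have ends: "last us \<in> A" "hd us \<in> A" using M_D[OF us(1)] U_A by auto
    from us(2) consider y where "(x, y) \<in> small_pairs (last us) (hd us)" | y where "(y, x) \<in> small_pairs (last us) (hd us)"
      by (auto simp: small_ends_def)
    then show False
    proof cases
      case (1 y)
      note E = small_pairs_D[OF 1]
      obtain x' where x': "x' \<in> B" "x' \<notin> {x, y}" "\<forall>p\<in>nb x \<inter> A. adj x' p \<and> adj p x'"
        using twin[of "{x, y}"] card_insert_le_m1[of 2 "{y}" x] by auto
      have "2 * card (U - {}) + length [x', z0, x, y] \<le> L + 1"
      proof (rule close_chain[OF us(1)])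
        show "distinct [x', z0, x, y]" using x' D xz0 E by auto
        show "successively adj [x', z0, x, y]" using D x'(3) xz0 E adj_sym by auto
        show "set [x', z0, x, y] \<inter> (U - {}) = {}" using D z0(2) x'(1) U_A E by auto
        show "adj (last us) (hd [x', z0, x, y])" using x'(3) E(3) ends adj_sym by (auto simp: nb_def)
        show "adj (last [x', z0, x, y]) (hd us)" using E by simp
      qed (use L2 in auto)
      then show False using cU L by simp
    next
      case (2 y)
      note E = small_pairs_D[OF 2]
      obtain x' where x': "x' \<in> B" "x' \<notin> {x, y}" "\<forall>p\<in>nb x \<inter> A. adj x' p \<and> adj p x'"
        using twin[of "{x, y}"] card_insert_le_m1[of 2 "{y}" x] by auto
      have "2 * card (U - {}) + length [y, x, z0, x'] \<le> L + 1"
      proof (rule close_chain[OF us(1)])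
        show "distinct [y, x, z0, x']" using x' D xz0 E by auto
        show "successively adj [y, x, z0, x']" using D x'(3) xz0 E by auto
        show "set [y, x, z0, x'] \<inter> (U - {}) = {}" using D z0(2) x'(1) U_A E by auto
        show "adj (last us) (hd [y, x, z0, x'])" using E by simp
        show "adj (last [y, x, z0, x']) (hd us)" using x'(3) E ends by (auto simp: nb_def)
      qed (use L2 in auto)
      then show False using cU L by simp
    qed
  qed
  have only: "z = z0" if z: "z \<in> nb x \<inter> A" "z \<notin> U" for z
  proof (rule ccontr)
    assume ne: "z \<noteq> z0"
    obtain x' where x': "x' \<in> B" "x' \<notin> {x}" "\<forall>p\<in>nb x \<inter> A. adj x' p \<and> adj p x'" using twin[of "{x}"] by auto
    have l: "last us0 \<in> nb x \<inter> A" using D M_D[OF D(1)] U_A adj_sym by (auto simp: nb_def)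
    have "2 * card (U - {}) + length [x', z, x, z0] \<le> L + 1"
    proof (rule close_chain[OF D(1)])
      show "distinct [x', z, x, z0]" using x' D xz0 z ne by auto
      show "successively adj [x', z, x, z0]" using D x'(3) z adj_sym by (auto simp: nb_def)
      show "set [x', z, x, z0] \<inter> (U - {}) = {}" using D z0(2) x'(1) U_A z by auto
      show "adj (last us0) (hd [x', z, x, z0])" using x'(3) l by simp
      show "adj (last [x', z, x, z0]) (hd us0)" using D by simp
    qed (use L2 in auto)
    then show False using cU L by simp
  qed
  have inj: "inj_on (\<lambda>(us, z). z # us) (big_completions x)" by (auto simp: inj_on_def)
  have "2 * Suc r * card ((\<lambda>(us, z). z # us) ` big_completions x) \<le> ffact (card (insert z0 U)) (Suc r)"
  proof (rule dihedral_bound[OF _ r2 Ts_ne(2)])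
    fix l assume "l \<in> (\<lambda>(us, z). z # us) ` big_completions x"
    then obtain us z where l: "l = z # us" "(us, x, z) \<in> cpl_odd" "z \<in> A" by (auto simp: big_completions_def)
    note E = cpl_oddD[OF l(2)]
    note F = M_D[OF E(1)]
    have zn: "z \<in> nb x \<inter> A" using E l(3) by (simp add: nb_def)
    have zU: "z \<in> insert z0 U" using only[OF zn] by auto
    have ln: "last us \<in> nb x" using E adj_sym by (simp add: nb_def)
    have l1: "l ! 1 = hd us" using l(1) F(4) by (simp add: hd_conv_nth)
    have hn: "hd us \<notin> nb x" using hd_nb[OF E(1) ln] by blast
    have "\<not> (\<exists>T\<in>set Ts. z \<in> T \<and> hd us \<in> T)"
    proof
      assume "\<exists>T\<in>set Ts. z \<in> T \<and> hd us \<in> T"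
      then have Cl: "C \<le> card (cm B z (hd us))" and zU': "z \<in> U" using Ts_cm by (auto simp: U_def)
      obtain x' where x': "x' \<in> B" "x' \<notin> {x}" "\<forall>p\<in>nb x \<inter> A. adj x' p \<and> adj p x'" using twin[of "{x}"] by auto
      have "card {x, x'} < card (cm B z (hd us))"
        using Cl C_large card_insert_le_m1[of 2 "{x'}" x] by simp
      then have "\<not> cm B z (hd us) \<subseteq> {x, x'}" using card_mono[of "{x, x'}" "cm B z (hd us)"] by auto
      then obtain y where y: "y \<in> B" "adj y z" "adj y (hd us)" "y \<noteq> x" "y \<noteq> x'" by (auto simp: cm_def)
      have "2 * card (U - {z}) + length [x, z0, x', z, y] \<le> L + 1"
      proof (rule close_chain[OF E(1)])
        show "{z} \<inter> set us = {}" using E by simp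
        show "distinct [x, z0, x', z, y]" using x' D xz0 zU' z0(2) y zn U_A E by auto
        show "successively adj [x, z0, x', z, y]" using D x'(3) xz0 zn y adj_sym by auto
        show "set [x, z0, x', z, y] \<inter> (U - {z}) = {}" using D z0(2) x'(1) U_A y E by auto
        show "adj (last us) (hd [x, z0, x', z, y])" using E by simp
        show "adj (last [x, z0, x', z, y]) (hd us)" using y by simp
      qed (use L2 in auto)
      then show False using cU L zU' ra by simp
    qed
    moreover have "l \<in> dlists (insert z0 U) (Suc r)" using l(1) E(7) F zU by (auto simp: dlists_def)
    moreover have "chain (tl l) Ts" using l(1) E(1) by (simp add: M_def)
    ultimately show "l \<in> dlists (insert z0 U) (Suc r) \<and> chain (tl l) Ts \<and> last l \<in> nb x \<and> hd l \<in> nb x \<and> l ! 1 \<notin> nb x \<and>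
        \<not> (\<exists>T\<in>set Ts. l ! 0 \<in> T \<and> l ! 1 \<in> T)"
      using l(1) ln zn hn l1 F(4) by simp
  qed simp
  moreover have "card (insert z0 U) = a + 1" using z0(2) cU by simp
  ultimately have "2 * Suc r * card (big_completions x) \<le> ffact (a + 1) (Suc r)" using card_image[OF inj] by simp
  then show "card (big_completions x) + 1 \<le> ffact a (Suc r)" by (rule dihedral_strict[OF _ ra r2])
qed

text \<open>Along a spanning list \<open>w\<close> of \<open>U\<close>, no neighbour of \<open>x\<close> is followed or preceded by a neighbour of a small
  neighbour of \<open>x\<close>: otherwise the outside pair there and another one closing the list give two excursions of two vertices
  each, and \<open>2a + 2\<close> vertices in total. Then \<open>positions\<close> bounds the pairs of ends.\<close>

lemma charged_type:
  assumes xth: "x \<notin> thin" and inU: "\<And>us z. (us, z) \<in> big_completions x \<Longrightarrow> z \<in> U" and us1: "us1 \<in> ch x"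
  shows "card (big_completions x) + card (ch x) + 1 \<le> ffact a (Suc r)"
proof -
  define P where "P = nb x \<inter> U"
  define Q where "Q = (\<Union>y\<in>nb x \<inter> B. nb y) \<inter> U"
  define R where "R = {(u, v). u \<noteq> v \<and> (u \<in> P \<and> v \<in> Q \<or> u \<in> Q \<and> v \<in> P)}"
  have PQ: "u \<in> P \<and> v \<in> Q \<or> u \<in> Q \<and> v \<in> P" if uv: "x \<in> small_ends u v" "u \<in> U" "v \<in> U" for u v
  proof -
    from uv(1) consider y where "(x, y) \<in> small_pairs u v" | y where "(y, x) \<in> small_pairs u v" by (auto simp: small_ends_def)
    then show ?thesis
    proof cases
      case (1 y)
      note E = small_pairs_D[OF 1]
      have "u \<in> P" "y \<in> nb x \<inter> B" "v \<in> nb y" using E uv adj_sym by (auto simp: P_def nb_def)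
      then show ?thesis using uv(3) by (auto simp: Q_def)
    next
      case (2 y)
      note E = small_pairs_D[OF 2]
      have "v \<in> P" "y \<in> nb x \<inter> B" "u \<in> nb y" using E uv adj_sym by (auto simp: P_def nb_def)
      then show ?thesis using uv(2) by (auto simp: Q_def)
    qed
  qed
  have us1M: "us1 \<in> M" "x \<in> small_ends (last us1) (hd us1)" using us1 by (auto simp: ch_def)
  have xB: "x \<in> B" using us1M(2) small_ends_B by blast
  obtain x1 y1 where xy1: "(x1, y1) \<in> small_pairs (last us1) (hd us1)" using us1M(2) by (auto simp: small_ends_def)
  note E1 = small_pairs_D[OF xy1]
  have ne: "P \<noteq> {}" "Q \<noteq> {}" using PQ[OF us1M(2)] M_D[OF us1M(1)] by auto
  obtain w where w: "distinct w" "w \<noteq> []" "hd w = hd us1" "last w = last us1" "set w = U - {}" "set w \<inter> B = {}"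
      "successively (\<lambda>p p'. C \<le> card (cm B p p')) w" "length w = card (U - {})"
    using spanning_list[OF us1M(1), of "{}"] by auto
  have la: "length w = a" using w(8) cU by simp
  have na: "\<not> x \<in> small_ends (w ! i) (w ! Suc i)" if i: "Suc i < a" for i
  proof
    assume xX: "x \<in> small_ends (w ! i) (w ! Suc i)"
    have wU: "w ! i \<in> U" "w ! Suc i \<in> U" using w(5) la i nth_mem[of i w] nth_mem[of "Suc i" w] by auto
    have "4 * (n div m) < card (small_pairs (w ! i) (w ! Suc i))"
    proof (rule ccontr)
      assume "\<not> ?thesis"
      then have "x \<in> thin" using wU xX unfolding thin_def by (intro UN_I[of "(w ! i, w ! Suc i)"]) auto
      then show False using xth by simp
    qed
    moreover have "card {x1, y1} = 2" using E1(6) by simp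
    ultimately obtain x2 y2 where xy2: "(x2, y2) \<in> small_pairs (w ! i) (w ! Suc i)" "x2 \<notin> {x1, y1}" "y2 \<notin> {x1, y1}"
      using small_pairs_avoid[of "{x1, y1}" "w ! i" "w ! Suc i"] by auto
    note E2 = small_pairs_D[OF xy2(1)]
    let ?w1 = "take (Suc i) w" and ?w2 = "drop (Suc i) w"
    have wd: "set ?w1 \<inter> set ?w2 = {}" by (rule set_take_disj_set_drop_if_distinct[OF w(1)]) simp
    have sub: "set ?w1 \<subseteq> set w" "set ?w2 \<subseteq> set w" by (rule set_take_subset, rule set_drop_subset)
    have succ: "successively (\<lambda>p p'. C \<le> card (cm B p p')) ?w1" "successively (\<lambda>p p'. C \<le> card (cm B p p')) ?w2"
      using w(7) by (metis append_take_drop_id successively_append_iff)+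
    have aL: "2 * a \<le> L" using L by simp
    have "card {x1, y1, x2, y2} \<le> 4" by (simp add: card_insert_if)
    then have c4: "card {x1, y1, x2, y2} + 2 * length ?w1 \<le> C" using la i aL C_large by simp
    obtain P' where P': "distinct P'" "successively adj P'" "P' \<noteq> []" "hd P' = hd ?w1" "last P' = last ?w1"
      "length P' = 2 * length ?w1 - 1" "set P' \<subseteq> set ?w1 \<union> (B - {x1, y1, x2, y2})"
      using lift[of B ?w1 C "{x1, y1, x2, y2}", OF _ _ _ _ succ(1) _ c4] w(1,2,6) sub(1) by auto
    let ?Q = "x1 # y1 # P' @ [x2, y2]"
    have h1: "hd ?w1 = hd us1" using w(2,3) by (cases w) auto
    have l1: "last ?w1 = w ! i" using i la by (simp add: take_Suc_conv_app_nth)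
    have h2: "hd ?w2 = w ! Suc i" using i la by (simp add: hd_drop_conv_nth)
    have l2: "last ?w2 = last us1" using i la w(4) by simp
    have len: "length ?Q = 2 * i + 5" "length ?w2 = a - Suc i" "?w2 \<noteq> []" using P'(6) i la by auto
    have notw: "x1 \<notin> set w" "y1 \<notin> set w" "x2 \<notin> set w" "y2 \<notin> set w" using E1 E2 w(5) by auto
    have "2 * length ?w2 + length ?Q \<le> L + 1"
    proof (rule close[of B ?w2 C ?Q])
      show "set ?w2 \<inter> B = {}" using w(6) sub(2) by blast
      show "length ?Q + 2 * length ?w2 \<le> C" using len i aL C_large by simp
      show "distinct ?Q" using P'(1,7) E1(6) E2(6) xy2(2,3) notw sub(1) by auto
      show "successively adj ?Q"
        using P'(2,3,4,5) E1 E2 h1 l1 by (auto simp: successively_append_iff successively_Cons hd_append)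
      show "set ?Q \<inter> set ?w2 = {}" using P'(7) wd notw sub(2) w(6) by auto
      show "adj (last ?w2) (hd ?Q)" using l2 E1 by simp
      show "adj (last ?Q) (hd ?w2)" using h2 E2 by simp
      show "4 \<le> 2 * length ?w2 + length ?Q" using len by simp
    qed (use w(1) succ(2) len in auto)
    then show False using len i L by simp
  qed
  have pos: "card P * (card P - 1) + card R < a * (a - 1)"
    unfolding R_def la[symmetric]
  proof (rule positions)
    show "3 \<le> length w" using la ra r2 by simp
    show "P \<subseteq> set w" "Q \<subseteq> set w" using w(5) by (auto simp: P_def Q_def)
    fix i assume i: "Suc i < length w"
    have "x \<in> small_ends (w ! i) (w ! Suc i)" if "w ! i \<in> P \<and> w ! Suc i \<in> Q \<or> w ! i \<in> Q \<and> w ! Suc i \<in> P"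
      using that
    proof
      assume "w ! i \<in> P \<and> w ! Suc i \<in> Q"
      then obtain y where "(x, y) \<in> small_pairs (w ! i) (w ! Suc i)"
        using xB adj_sym by (auto simp: P_def Q_def small_pairs_def arcs_def nb_def)
      then show ?thesis unfolding small_ends_def by force
    next
      assume "w ! i \<in> Q \<and> w ! Suc i \<in> P"
      then obtain y where "(y, x) \<in> small_pairs (w ! i) (w ! Suc i)"
        using xB adj_sym by (auto simp: P_def Q_def small_pairs_def arcs_def nb_def)
      then show ?thesis unfolding small_ends_def by force
    qed
    then show "\<not> (w ! i \<in> P \<and> w ! Suc i \<in> Q) \<and> \<not> (w ! i \<in> Q \<and> w ! Suc i \<in> P)"
      using na[of i] i la by auto
  qed (use w ne in auto)
  let ?R' = "{(u, v). u \<in> P \<and> v \<in> P \<and> u \<noteq> v}"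
  have PU: "P \<subseteq> U" "Q \<subseteq> U" "finite P" by (auto simp: P_def Q_def)
  have cR': "card ?R' \<le> card P * (card P - 1)"
  proof -
    have "?R' = Sigma P (\<lambda>u. P - {u})" by auto
    then have "card ?R' = (\<Sum>u\<in>P. card (P - {u}))" using PU(3) by (simp add: card_SigmaI)
    also have "\<dots> = (\<Sum>u\<in>P. card P - 1)" using PU(3) by (intro sum.cong) auto
    finally show ?thesis by simp
  qed
  have cI: "card (big_completions x) \<le> card ?R' * ffact (a - 2) (Suc r - 2)"
  proof -
    have inj: "inj_on (\<lambda>(us, z). z # us) (big_completions x)" by (auto simp: inj_on_def)
    have sub: "(\<lambda>(us, z). z # us) ` big_completions x \<subseteq> {l \<in> dlists U (Suc r). (last l, hd l) \<in> ?R'}"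
    proof
      fix l assume "l \<in> (\<lambda>(us, z). z # us) ` big_completions x"
      then obtain us z where l: "l = z # us" "(us, x, z) \<in> cpl_odd" "(us, z) \<in> big_completions x" by (auto simp: big_completions_def)
      note E = cpl_oddD[OF l(2)]
      note F = M_D[OF E(1)]
      have "last us \<noteq> z" using E(7) F(4) by (metis last_in_set)
      then show "l \<in> {l \<in> dlists U (Suc r). (last l, hd l) \<in> ?R'}"
        using l inU[OF l(3)] E F adj_sym by (auto simp: dlists_def P_def nb_def)
    qed
    have "card (big_completions x) = card ((\<lambda>(us, z). z # us) ` big_completions x)" using card_image[OF inj] by simp
    also have "\<dots> \<le> card {l \<in> dlists U (Suc r). (last l, hd l) \<in> ?R'}" by (rule card_mono[OF _ sub]) simp
    also have "\<dots> \<le> card ?R' * ffact (card U - 2) (Suc r - 2)"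
      by (rule card_dlists_ends) (use r2 PU in auto)
    finally show ?thesis unfolding cU .
  qed
  have cc: "card (ch x) \<le> card R * ffact (a - 2) (r - 2)"
  proof -
    have "ch x \<subseteq> {l \<in> dlists U r. (last l, hd l) \<in> R}"
    proof
      fix us assume "us \<in> ch x"
      then have us: "us \<in> M" "x \<in> small_ends (last us) (hd us)" by (auto simp: ch_def)
      note F = M_D[OF us(1)]
      show "us \<in> {l \<in> dlists U r. (last l, hd l) \<in> R}"
        using PQ[OF us(2) F(6,5)] F(7) us(1) M_dlists by (auto simp: R_def)
    qed
    then have "card (ch x) \<le> card {l \<in> dlists U r. (last l, hd l) \<in> R}" by (rule card_mono[rotated]) simp
    also have "\<dots> \<le> card R * ffact (card U - 2) (r - 2)"
      by (rule card_dlists_ends) (use r2 PU in \<open>auto simp: R_def\<close>)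
    finally show ?thesis unfolding cU .
  qed
  define F where "F = ffact (a - 2) (r - 2)"
  have s1: "Suc (r - 2) = Suc r - 2" "a - 2 - (r - 2) = a - r" using r2 ra by auto
  have F1: "ffact (a - 2) (Suc r - 2) = F * (a - r)" using ffact_Suc[of "a - 2" "r - 2"] unfolding s1 F_def .
  have F0: "0 < F" unfolding F_def using ra by (intro ffact_pos) simp
  have ar: "1 \<le> a - r" using ra by simp
  have tot: "ffact a (Suc r) = a * (a - 1) * (F * (a - r))"
  proof -
    have "Suc r = Suc (Suc (Suc r - 2))" using r2 by simp
    then have "ffact a (Suc r) = ffact a (Suc (Suc (Suc r - 2)))" by simp
    also have "\<dots> = a * ((a - 1) * ffact (a - 1 - 1) (Suc r - 2))" by simp
    also have "a - 1 - 1 = a - 2" by simp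
    finally show ?thesis using F1 by (simp add: mult.assoc)
  qed
  have "card (big_completions x) + card (ch x) \<le> card P * (card P - 1) * (F * (a - r)) + card R * (F * (a - r))"
  proof (rule add_mono)
    show "card (big_completions x) \<le> card P * (card P - 1) * (F * (a - r))"
      using cI mult_le_mono1[OF cR', of "F * (a - r)"] unfolding F1 by linarith
    have "F * 1 \<le> F * (a - r)" using ar by (rule mult_le_mono2)
    then have "F \<le> F * (a - r)" by simp
    then have "card R * F \<le> card R * (F * (a - r))" by (rule mult_le_mono2)
    then show "card (ch x) \<le> card R * (F * (a - r))" using cc unfolding F_def[symmetric] by (rule le_trans[rotated])
  qed
  also have "\<dots> = (card P * (card P - 1) + card R) * (F * (a - r))" by (rule add_mult_distrib[symmetric])
  also have "\<dots> < a * (a - 1) * (F * (a - r))" using pos F0 ar by simp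
  finally show ?thesis unfolding tot by simp
qed

text \<open>A heavy \<open>x\<close> that is not thin either has a big neighbour outside \<open>U\<close>, or is charged, or has only completions within
  \<open>U\<close>. In each case its contribution is at most that of a vertex adjacent to all of \<open>U\<close>.\<close>

lemma odd_core:
  shows "card cpl_odd + (n - card full) \<le>
    ffact a (Suc r) * n + (8 * (a * a) * (n div m) * ffact a r + card light * (ffact a r * (card A + 1)))"
proof -
  define t where "t = ffact a (Suc r)"
  have t1: "1 \<le> t" unfolding t_def using ffact_pos[of "Suc r" a] ra by simp
  define g where "g = (\<lambda>x. if U \<subseteq> nb x then t else t - 1)"
  define c2 where "c2 = ffact a r * (card A + 1)"
  have chM: "card (ch x) \<le> ffact a r" for x
    using card_mono[OF fin_M, of "ch x"] card_M unfolding cU by (auto simp: ch_def)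
  have bound: "card (big_completions x) + card (ch x) \<le> g x + (if x \<in> thin then ffact a r else 0) + (if x \<in> light then c2 else 0)" for x
  proof -
    have g1: "t - 1 \<le> g x" by (simp add: g_def)
    consider "x \<notin> B" | "x \<in> light" | us0 z0 where "heavy m C x" "(us0, z0) \<in> big_completions x" "z0 \<notin> U"
      | "heavy m C x" "\<And>us z. (us, z) \<in> big_completions x \<Longrightarrow> z \<in> U" by (auto simp: light_def)
    then show ?thesis
    proof cases
      case 1
      then have "big_completions x = {}" "ch x = {}" using small_ends_B by (auto simp: big_completions_def ch_def dest: cpl_oddD)
      then show ?thesis by simp
    next
      case 2
      have "big_completions x \<subseteq> M \<times> A" by (auto simp: big_completions_def dest: cpl_oddD)
      then have "card (big_completions x) \<le> card (M \<times> A)" by (rule card_mono[rotated]) simp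
      also have "\<dots> \<le> ffact a r * card A" using card_M unfolding cU by (simp add: card_cartesian_product)
      finally show ?thesis using chM[of x] 2 by (simp add: c2_def)
    next
      case 3
      then show ?thesis using outside_type[OF 3] g1 by (simp add: t_def)
    next
      case 4
      then have "big_completions x = inU x" using U_A by (auto simp: big_completions_def inU_def)
      moreover have "card (inU x) \<le> g x" using card_inU_le[of x] ra unfolding cU g_def t_def by linarith
      ultimately have ig: "card (big_completions x) \<le> g x" by simp
      show ?thesis
      proof (cases "ch x = {}")
        case True
        then show ?thesis using ig by simp
      next
        case False
        then obtain us1 where us1: "us1 \<in> ch x" by blast
        show ?thesis
        proof (cases "x \<in> thin")
          case True
          then show ?thesis using ig chM[of x] by simp
        next
          case False
          then have "card (big_completions x) + card (ch x) + 1 \<le> t" unfolding t_def by (rule charged_type[OF _ 4(2) us1])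
          then show ?thesis using g1 by simp
        qed
      qed
    qed
  qed
  have "thin \<subseteq> B" using small_ends_B by (auto simp: thin_def)
  then have fth: "finite thin" "thin \<subseteq> V" using finV finite_subset by auto
  have fli: "finite light" "light \<subseteq> V" using finV by (auto simp: light_def)
  have "card cpl_odd \<le> (\<Sum>x\<in>V. card (big_completions x) + card (ch x))" by (rule card_cpl_odd_charge[OF card_small_pairs_le])
  also have "\<dots> \<le> (\<Sum>x\<in>V. g x + (if x \<in> thin then ffact a r else 0) + (if x \<in> light then c2 else 0))"
    by (rule sum_mono) (rule bound)
  also have "\<dots> = (\<Sum>x\<in>V. g x) + (\<Sum>x\<in>V. if x \<in> thin then ffact a r else 0) + (\<Sum>x\<in>V. if x \<in> light then c2 else 0)"
    by (simp only: sum.distrib)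
  also have "(\<Sum>x\<in>V. if x \<in> thin then ffact a r else 0) = card thin * ffact a r"
    using fth finV by (simp add: sum.If_cases Int_absorb1)
  also have "(\<Sum>x\<in>V. if x \<in> light then c2 else 0) = card light * c2"
    using fli finV by (simp add: sum.If_cases Int_absorb1)
  finally have "card cpl_odd \<le> (\<Sum>x\<in>V. g x) + card thin * ffact a r + card light * c2" .
  moreover have "(\<Sum>x\<in>V. g x) + (n - card full) = t * n" unfolding g_def by (rule sum_full[OF t1])
  moreover have "card thin * ffact a r \<le> 8 * (a * a) * (n div m) * ffact a r"
    using card_thin unfolding cU by (rule mult_le_mono1)
  ultimately show ?thesis unfolding t_def[symmetric] c2_def[symmetric] by linarith
qed

end

text \<open>The factor \<open>4\<close> in the second alternative is the price of \<open>five_cycles\<close>; elsewhere a full \<open>n\<close> is gained.\<close>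

lemma odd_stability:
  assumes a: "a = L div 2" "r + 1 \<le> a" and m: "100 \<le> m"
  shows "card U = a \<and> card cpl_odd + (n - card full) \<le>
      ffact a (Suc r) * n + (8 * (a * a) * (n div m) * ffact a r + card light * (ffact a r * (card A + 1)))
    \<or> 4 * card cpl_odd + n \<le> 4 * (ffact a (Suc r) * n)"
proof (cases "even L")
  case True
  then have "L = 2 * a" using a(1) by simp
  then show ?thesis using odd_stability_even[of a] a(2) by auto
next
  case False
  then have L: "L = 2 * a + 1" using a(1) by simp
  consider "a < card U" | "card U = a" | "card U < a" "\<not> (r = 2 \<and> card U = a - 1)" | "r = 2" "card U = a - 1"
    by linarith
  then show ?thesis
  proof cases
    case 1 then show ?thesis using odd_stability_large[OF L a(2)] by linarith
  next
    case 2 then show ?thesis using odd_core[OF L a(2)] by blast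
  next
    case 3
    have "card cpl_odd + n \<le> ffact a (Suc r) * n" by (rule odd_stability_small) (use L a 3 in auto)
    then show ?thesis by linarith
  next
    case 4
    have "4 * card cpl_odd + n \<le> 4 * (ffact a 3 * n)" by (rule five_cycles) (use L a 4 m in auto)
    moreover have "Suc r = 3" using 4 by simp
    ultimately show ?thesis by simp
  qed
qed

end

section \<open>Fibres of the alternating pattern\<close>

context circ
begin

definition lightv :: "nat \<Rightarrow> nat \<Rightarrow> 'a set" where
  "lightv m C = {x \<in> V - big m. \<not> heavy m C x}"

text \<open>There are \<open>2 ^ card (big m)\<close> classes of twins, and a class with a light vertex has fewer than \<open>C\<close> elements.\<close>

lemma card_lightv: "card (lightv m C) \<le> 2 ^ card (big m) * C"
proof -
  have fin: "finite (lightv m C)" using finV by (simp add: lightv_def)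
  let ?P = "\<lambda>T. {x \<in> lightv m C. nb x \<inter> big m = T}"
  have "lightv m C \<subseteq> \<Union>(?P ` Pow (big m))"
  proof
    fix x assume "x \<in> lightv m C"
    then have "x \<in> ?P (nb x \<inter> big m)" by simp
    moreover have "nb x \<inter> big m \<in> Pow (big m)" by simp
    ultimately show "x \<in> \<Union>(?P ` Pow (big m))" by (rule UN_I[rotated])
  qed
  then have "card (lightv m C) \<le> card (\<Union>(?P ` Pow (big m)))"
    by (rule card_mono[rotated]) (intro finite_UN_I finite_subset[OF _ fin], use fin_big in \<open>simp_all\<close>)
  also have "\<dots> \<le> (\<Sum>T\<in>Pow (big m). card (?P T))" by (rule card_UN_le) simp
  also have "\<dots> \<le> (\<Sum>T\<in>Pow (big m). C)"
  proof (rule sum_mono)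
    fix T
    show "card {x \<in> lightv m C. nb x \<inter> big m = T} \<le> C"
    proof (cases "{x \<in> lightv m C. nb x \<inter> big m = T} = {}")
      case False
      then obtain x where x: "x \<in> lightv m C" "nb x \<inter> big m = T" by blast
      have "{x \<in> lightv m C. nb x \<inter> big m = T} \<subseteq> {y \<in> V - big m. nb y \<inter> big m = nb x \<inter> big m}"
        using x(2) by (auto simp: lightv_def)
      then have "card {x \<in> lightv m C. nb x \<inter> big m = T} \<le> card {y \<in> V - big m. nb y \<inter> big m = nb x \<inter> big m}"
        by (rule card_mono[rotated]) (use finV in simp)
      also have "\<dots> \<le> C" using x(1) by (auto simp: lightv_def heavy_def)
      finally show ?thesis .
    next
      case True
      show ?thesis unfolding True by simp
    qed
  qed
  finally show ?thesis by (simp add: card_Pow)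
qed

definition odds :: "nat \<Rightarrow> 'a list \<Rightarrow> 'a list" where
  "odds r v = map (\<lambda>i. v ! (2 * i + 1)) [0..<r - 1]"

definition evens :: "nat \<Rightarrow> 'a list \<Rightarrow> 'a list" where
  "evens r v = map (\<lambda>i. v ! (2 * i)) [0..<r]"

definition fibre :: "nat \<Rightarrow> nat \<Rightarrow> nat \<Rightarrow> 'a list \<Rightarrow> 'a list set" where
  "fibre q r m xs = {v \<in> pat q r m. odds r v = xs}"

lemma cycs_wrap: "v \<in> cycs q adj \<Longrightarrow> adj (v ! (q - 1)) (v ! 0)"
proof -
  assume v: "v \<in> cycs q adj"
  then have "v \<noteq> []" using cycsD(1,2)[OF v] by auto
  moreover have "adj (last v) (hd v)" using v by (simp add: cycs_def cyc_def)
  ultimately show ?thesis using cycsD(1)[OF v] by (simp add: last_conv_nth hd_conv_nth)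
qed

lemma pat_eqI:
  assumes q: "q = 2 * r \<or> q = 2 * r + 1" and vw: "v \<in> pat q r m" "w \<in> pat q r m"
    and e: "odds r v = odds r w" "evens r v = evens r w" "v ! (2 * r - 1) = w ! (2 * r - 1)" "v ! (2 * r mod q) = w ! (2 * r mod q)"
  shows "v = w"
proof (rule nth_equalityI)
  have l: "length v = q" "length w = q" using vw cycsD(1) by (auto simp: pat_def)
  then show "length v = length w" by simp
  fix i assume "i < length v"
  then have i: "i < q" using l by simp
  have o: "v ! (2 * j + 1) = w ! (2 * j + 1)" if "j < r - 1" for j
    using arg_cong[OF e(1), of "\<lambda>l. l ! j"] that by (simp add: odds_def)
  have ev: "v ! (2 * j) = w ! (2 * j)" if "j < r" for j
    using arg_cong[OF e(2), of "\<lambda>l. l ! j"] that by (simp add: evens_def)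
  show "v ! i = w ! i"
  proof (cases "i < 2 * r")
    case True
    show ?thesis
    proof (cases "even i")
      case True
      then show ?thesis using ev[of "i div 2"] \<open>i < 2 * r\<close> by auto
    next
      case False
      then obtain j where j: "i = 2 * j + 1" by (metis oddE)
      show ?thesis
      proof (cases "j < r - 1")
        case True then show ?thesis using o j by simp
      next
        case False
        then have "i = 2 * r - 1" using j \<open>i < 2 * r\<close> by linarith
        then show ?thesis using e(3) by simp
      qed
    qed
  next
    case False
    then have "q = 2 * r + 1" "i = 2 * r" using q i by auto
    then show ?thesis using e(4) by simp
  qed
qed

lemma patD:
  assumes q: "q = 2 * r \<or> q = 2 * r + 1" "2 \<le> r" and v: "v \<in> pat q r m"
  shows "v \<in> cycs q adj" "\<And>j. j < r \<Longrightarrow> v ! (2 * j) \<in> big m" "\<And>j. j < r \<Longrightarrow> v ! (2 * j + 1) \<in> V - big m"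
    "adj (v ! (2 * r - 1)) (v ! (2 * r mod q))" "adj (v ! (2 * r - 2)) (v ! (2 * r - 1))"
    "v ! (2 * r - 1) \<in> V - big m"
proof -
  show c: "v \<in> cycs q adj" using v by (simp add: pat_def)
  note D = cycsD[OF c]
  have p: "v ! i \<in> big m \<longleftrightarrow> even i" if "i < 2 * r" for i using v that by (simp add: pat_def)
  show "v ! (2 * j) \<in> big m" if "j < r" for j using p[of "2 * j"] that by simp
  show o: "v ! (2 * j + 1) \<in> V - big m" if "j < r" for j using p[of "2 * j + 1"] D(4)[of "2 * j + 1"] that q by auto
  have s: "Suc (2 * r - 1) = 2 * r" "Suc (2 * r - 2) = 2 * r - 1" using q(2) by auto
  show "adj (v ! (2 * r - 1)) (v ! (2 * r mod q))"
    using q(1)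
  proof
    assume "q = 2 * r" then show ?thesis using cycs_wrap[OF c] by simp
  next
    assume "q = 2 * r + 1" then show ?thesis using D(5)[of "2 * r - 1"] q(2) s by simp
  qed
  show "adj (v ! (2 * r - 2)) (v ! (2 * r - 1))" using D(5)[of "2 * r - 2"] q s by auto
  have "2 * (r - 1) + 1 = 2 * r - 1" using q(2) by auto
  then show "v ! (2 * r - 1) \<in> V - big m" using o[of "r - 1"] q(2) by simp
qed

text \<open>Only the last two vertices are free, and they are adjacent. For even \<open>q\<close> the second of them is the first entry of the list.\<close>

lemma card_fibre_crude:
  assumes q: "q = 2 * r \<or> q = 2 * r + 1" "2 \<le> r" and K: "card (big m) \<le> K"
  shows "card (fibre q r m xs) \<le> K ^ r * (2 * L * card V)"
proof -
  let ?f = "\<lambda>v. (evens r v, v ! (2 * r - 1), v ! (2 * r mod q))"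
  let ?T = "{us. set us \<subseteq> big m \<and> length us = r} \<times> {(x, y). adj x y}"
  have inj: "inj_on ?f (fibre q r m xs)"
  proof (rule inj_onI)
    fix v w assume vw: "v \<in> fibre q r m xs" "w \<in> fibre q r m xs" "?f v = ?f w"
    show "v = w" by (rule pat_eqI[OF q(1)]) (use vw in \<open>auto simp: fibre_def\<close>)
  qed
  have sub: "?f ` fibre q r m xs \<subseteq> ?T"
  proof
    fix t assume "t \<in> ?f ` fibre q r m xs"
    then obtain v where v: "v \<in> pat q r m" "t = ?f v" by (auto simp: fibre_def)
    note D = patD[OF q v(1)]
    have "set (evens r v) \<subseteq> big m" using D(2) by (auto simp: evens_def)
    then show "t \<in> ?T" using D(4) by (simp add: v(2) evens_def)
  qed
  have "card (fibre q r m xs) = card (?f ` fibre q r m xs)" by (rule card_image[OF inj, symmetric])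
  also have "\<dots> \<le> card ?T"
    by (rule card_mono[OF _ sub]) (use card_arcs(1) finite_lists_length_eq[OF fin_big] in simp)
  also have "\<dots> = card (big m) ^ r * card {(x, y). adj x y}"
    by (simp add: card_cartesian_product card_lists_length_eq)
  also have "\<dots> \<le> K ^ r * (2 * L * card V)" by (intro mult_le_mono power_mono K card_arcs(2)) simp
  finally show ?thesis .
qed

text \<open>Fibres over lists with a light entry are negligible because there are boundedly many light vertices.\<close>

lemma card_pat_le:
  assumes q: "q = 2 * r \<or> q = 2 * r + 1" "2 \<le> r" and K: "card (big m) \<le> K" and lb: "card (lightv m C) \<le> lb"
    and k: "\<And>xs. length xs = r - 1 \<Longrightarrow> (\<And>x. x \<in> set xs \<Longrightarrow> heavy m C x) \<Longrightarrow> D * card (fibre q r m xs) \<le> \<kappa>"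
  shows "D * card (pat q r m) \<le> card V ^ (r - 1) * \<kappa> + D * (card V ^ (r - 1) * (r * lb * (K ^ r * (2 * L))))"
proof -
  let ?n = "card V"
  define X where "X = {xs. set xs \<subseteq> V \<and> length xs = r - 1}"
  define Y where "Y = {xs \<in> X. \<exists>i<r - 1. xs ! i \<in> lightv m C}"
  define E where "E = K ^ r * (2 * L * ?n)"
  have finX: "finite X" unfolding X_def by (rule finite_lists_length_eq[OF finV])
  have cX: "card X = ?n ^ (r - 1)" unfolding X_def by (rule card_lists_length_eq[OF finV])
  have fY: "finite Y" using finX by (simp add: Y_def)
  have mem: "odds r v \<in> X" if v: "v \<in> pat q r m" for v
    using patD(3)[OF q v] by (auto simp: X_def odds_def)
  have each: "D * card (fibre q r m xs) \<le> \<kappa> + (if xs \<in> Y then D * E else 0)" if xs: "xs \<in> X" for xs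
  proof (cases "xs \<in> Y")
    case True
    then show ?thesis using card_fibre_crude[OF q K, of xs] by (simp add: E_def trans_le_add2)
  next
    case False
    show ?thesis
    proof (cases "fibre q r m xs = {}")
      case ne: False
      then obtain v where v: "v \<in> pat q r m" "odds r v = xs" by (auto simp: fibre_def)
      have "heavy m C x" if x: "x \<in> set xs" for x
      proof -
        obtain i where i: "i < r - 1" "x = xs ! i" using x xs by (auto simp: X_def in_set_conv_nth)
        have "x = v ! (2 * i + 1)" using i v(2) by (auto simp: odds_def)
        then have "x \<in> V - big m" using patD(3)[OF q v(1), of i] i by simp
        then show ?thesis using False i xs by (auto simp: Y_def lightv_def)
      qed
      then show ?thesis using k[of xs] xs False by (simp add: X_def)
    qed simp
  qed
  have cY: "card Y \<le> r * (lb * ?n ^ (r - 2))"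
  proof -
    let ?Z = "\<lambda>i. {xs. length xs = r - 1 \<and> (\<forall>k<r - 1. xs ! k \<in> (if k = i then lightv m C else V))}"
    have Z: "finite (?Z i) \<and> card (?Z i) \<le> lb * ?n ^ (r - 2)" if i: "i < r - 1" for i
    proof -
      have "finite (?Z i) \<and> card (?Z i) \<le> (\<Prod>k<r - 1. if k = i then lb else ?n)"
        by (rule card_lists_step[of "r - 1" "\<lambda>k _. if k = i then lightv m C else V"])
          (use finV lb in \<open>auto simp: lightv_def\<close>)
      moreover have "(\<Prod>k<r - 1. if k = i then lb else ?n) = lb * ?n ^ (r - 2)"
      proof -
        have "(\<Prod>k<r - 1. if k = i then lb else ?n) = lb * (\<Prod>k\<in>{..<r - 1} - {i}. if k = i then lb else ?n)"
          using i by (subst prod.remove[of _ i]) auto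
        also have "(\<Prod>k\<in>{..<r - 1} - {i}. if k = i then lb else ?n) = (\<Prod>k\<in>{..<r - 1} - {i}. ?n)"
          by (rule prod.cong) auto
        also have "\<dots> = ?n ^ (r - 2)" using i by (simp add: numeral_2_eq_2)
        finally show ?thesis .
      qed
      ultimately show ?thesis by simp
    qed
    have "Y \<subseteq> (\<Union>i<r - 1. ?Z i)"
    proof
      fix xs assume "xs \<in> Y"
      then obtain i where i: "i < r - 1" "xs ! i \<in> lightv m C" "length xs = r - 1" "set xs \<subseteq> V"
        by (auto simp: Y_def X_def)
      have "xs \<in> ?Z i" using i nth_mem[of _ xs] by auto
      then show "xs \<in> (\<Union>i<r - 1. ?Z i)" using i(1) by blast
    qed
    then have "card Y \<le> card (\<Union>i<r - 1. ?Z i)" by (rule card_mono[rotated]) (use Z in auto)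
    also have "\<dots> \<le> (\<Sum>i<r - 1. card (?Z i))" by (rule card_UN_le) simp
    also have "\<dots> \<le> (\<Sum>i<r - 1. lb * ?n ^ (r - 2))" by (rule sum_mono) (use Z in auto)
    also have "\<dots> = (r - 1) * (lb * ?n ^ (r - 2))" by simp
    also have "\<dots> \<le> r * (lb * ?n ^ (r - 2))" by (rule mult_le_mono1) simp
    finally show ?thesis .
  qed
  have "pat q r m = (\<Union>xs\<in>X. fibre q r m xs)" using mem by (auto simp: fibre_def)
  then have "card (pat q r m) \<le> (\<Sum>xs\<in>X. card (fibre q r m xs))"
    using card_UN_le[OF finX, of "fibre q r m"] by simp
  then have "D * card (pat q r m) \<le> (\<Sum>xs\<in>X. D * card (fibre q r m xs))" by (simp add: sum_distrib_left[symmetric])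
  also have "\<dots> \<le> (\<Sum>xs\<in>X. \<kappa> + (if xs \<in> Y then D * E else 0))" by (rule sum_mono) (rule each)
  also have "\<dots> = card X * \<kappa> + (\<Sum>xs\<in>X. if xs \<in> Y then D * E else 0)" by (simp add: sum.distrib)
  also have "(\<Sum>xs\<in>X. if xs \<in> Y then D * E else 0) = card (X \<inter> Y) * (D * E)"
    using finX by (simp add: sum.If_cases)
  also have "X \<inter> Y = Y" by (auto simp: Y_def)
  also have "card Y * (D * E) \<le> r * (lb * ?n ^ (r - 2)) * (D * E)" by (rule mult_le_mono1[OF cY])
  also have "r * (lb * ?n ^ (r - 2)) * (D * E) = D * (?n ^ (r - 1) * (r * lb * (K ^ r * (2 * L))))"
  proof -
    have "r - 1 = Suc (r - 2)" using q(2) by simp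
    then have "?n ^ (r - 1) = ?n * ?n ^ (r - 2)" by (simp only: power_Suc)
    then show ?thesis by (simp add: E_def)
  qed
  finally show ?thesis by (simp add: cX)
qed

end

context tuple
begin

lemma fibre_evens_M:
  assumes q: "q = 2 * r \<or> q = 2 * r + 1" and v: "v \<in> fibre q r m xs"
  shows "evens r v \<in> M" "last (evens r v) = v ! (2 * r - 2)" "hd (evens r v) = v ! 0"
    "set (evens r v) \<subseteq> (!) v ` {..<2 * r}"
proof -
  have vp: "v \<in> pat q r m" "odds r v = xs" using v by (auto simp: fibre_def)
  note P = patD[OF q r2 vp(1)]
  note D = cycsD[OF P(1)]
  show l: "last (evens r v) = v ! (2 * r - 2)" "hd (evens r v) = v ! 0"
    using r2 by (auto simp: evens_def last_map hd_map right_diff_distrib')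
  show "set (evens r v) \<subseteq> (!) v ` {..<2 * r}" by (auto simp: evens_def)
  have "distinct (evens r v)"
    unfolding evens_def distinct_map using D(1,3) q
    by (auto simp: inj_on_def nth_eq_iff_index_eq)
  moreover have "chain (evens r v) Ts"
    unfolding chain_nth
  proof (intro conjI allI impI)
    show "length (evens r v) = Suc (length Ts)" using r2 Ts_ne(2) by (simp add: evens_def)
    fix k assume k: "k < length Ts"
    then have k': "k < r - 1" using Ts_ne(2) by simp
    have "xs ! k = v ! (2 * k + 1)" using k' vp(2) by (auto simp: odds_def)
    then have T: "Ts ! k = nb (v ! (2 * k + 1)) \<inter> A" using k' len_xs by (simp add: Ts_def)
    have a1: "adj (v ! (2 * k)) (v ! (2 * k + 1))" using D(5)[of "2 * k"] k' q by auto
    have a2: "adj (v ! (2 * k + 1)) (v ! (2 * k + 2))" using D(5)[of "2 * k + 1"] k' q by auto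
    have b1: "v ! (2 * k) \<in> A" using P(2)[of k] k' by simp
    have b2: "v ! (2 * k + 2) \<in> A" using P(2)[of "Suc k"] k' by simp
    have "k < r" "Suc k < r" using k' by simp_all
    then have e: "evens r v ! k = v ! (2 * k)" "evens r v ! Suc k = v ! (2 * k + 2)"
      by (simp_all add: evens_def del: upt_Suc)
    show "evens r v ! k \<in> Ts ! k" "evens r v ! Suc k \<in> Ts ! k"
      unfolding e T using a1 a2 b1 b2 adj_sym by (simp_all add: nb_def)
  qed
  ultimately show "evens r v \<in> M" by (simp add: M_def)
qed

lemma card_fibre_even: "card (fibre (2 * r) r m xs) \<le> card cpl_even"
proof -
  let ?f = "\<lambda>v. (evens r v, v ! (2 * r - 1))"
  have q: "2 * r = 2 * r \<or> 2 * r = 2 * r + 1" by simp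
  have inj: "inj_on ?f (fibre (2 * r) r m xs)"
  proof (rule inj_onI)
    fix v w assume vw: "v \<in> fibre (2 * r) r m xs" "w \<in> fibre (2 * r) r m xs" "?f v = ?f w"
    show "v = w"
    proof (rule pat_eqI[OF q])
      have "hd (evens r v) = hd (evens r w)" using vw(3) by simp
      then show "v ! (2 * r mod (2 * r)) = w ! (2 * r mod (2 * r))"
        using fibre_evens_M(3)[OF q vw(1)] fibre_evens_M(3)[OF q vw(2)] by simp
    qed (use vw in \<open>auto simp: fibre_def\<close>)
  qed
  have sub: "?f ` fibre (2 * r) r m xs \<subseteq> cpl_even"
  proof
    fix t assume "t \<in> ?f ` fibre (2 * r) r m xs"
    then obtain v where v: "v \<in> fibre (2 * r) r m xs" "t = ?f v" by auto
    have vp: "v \<in> pat (2 * r) r m" using v by (simp add: fibre_def)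
    note P = patD[OF q r2 vp]
    show "t \<in> cpl_even"
      using fibre_evens_M[OF q v(1)] P(4,5,6) by (simp add: v(2) cpl_even_def)
  qed
  have "finite cpl_even" by (rule finite_subset[of _ "M \<times> V"]) (use finV in \<open>auto simp: cpl_even_def\<close>)
  then show ?thesis using card_mono[OF _ sub] card_image[OF inj] by simp
qed

lemma card_fibre_odd: "card (fibre (2 * r + 1) r m xs) \<le> card cpl_odd"
proof -
  let ?f = "\<lambda>v. (evens r v, v ! (2 * r - 1), v ! (2 * r))"
  have q: "2 * r + 1 = 2 * r \<or> 2 * r + 1 = 2 * r + 1" by simp
  have inj: "inj_on ?f (fibre (2 * r + 1) r m xs)"
  proof (rule inj_onI)
    fix v w assume vw: "v \<in> fibre (2 * r + 1) r m xs" "w \<in> fibre (2 * r + 1) r m xs" "?f v = ?f w"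
    show "v = w" by (rule pat_eqI[OF q]) (use vw in \<open>auto simp: fibre_def\<close>)
  qed
  have sub: "?f ` fibre (2 * r + 1) r m xs \<subseteq> cpl_odd"
  proof
    fix t assume "t \<in> ?f ` fibre (2 * r + 1) r m xs"
    then obtain v where v: "v \<in> fibre (2 * r + 1) r m xs" "t = ?f v" by auto
    have vp: "v \<in> pat (2 * r + 1) r m" using v by (simp add: fibre_def)
    note P = patD[OF q r2 vp]
    note D = cycsD[OF P(1)]
    have w: "adj (v ! (2 * r)) (v ! 0)" using cycs_wrap[OF P(1)] by simp
    have "v ! (2 * r) \<notin> (!) v ` {..<2 * r}" using D(1,3) by (auto simp: nth_eq_iff_index_eq)
    then have "v ! (2 * r) \<notin> set (evens r v)" using fibre_evens_M(4)[OF q v(1)] by blast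
    then show "t \<in> cpl_odd"
      using fibre_evens_M[OF q v(1)] P(4,5,6) w D(4)[of "2 * r"] by (simp add: v(2) cpl_odd_def)
  qed
  show ?thesis using card_mono[OF fin_cpl_odd sub] card_image[OF inj] by simp
qed

end

section \<open>Alternating cycles of the extremal graph\<close>

text \<open>The places \<open>0, 2, \<dots>, 2r - 2\<close> are filled from \<open>xs\<close>, all others from \<open>ss\<close>. If \<open>q = 2r + 1\<close>, the last two entries both
  come from \<open>ss\<close>.\<close>

definition alt :: "nat \<Rightarrow> nat \<Rightarrow> 'a list \<Rightarrow> 'a list \<Rightarrow> 'a list" where
  "alt q r xs ss = map (\<lambda>i. if even i \<and> i < 2 * r then xs ! (i div 2) else ss ! (i div 2)) [0..<q]"

lemma length_alt [simp]: "length (alt q r xs ss) = q"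
  by (simp add: alt_def)

lemma alt_nth: "i < q \<Longrightarrow> alt q r xs ss ! i = (if even i \<and> i < 2 * r then xs ! (i div 2) else ss ! (i div 2))"
  by (simp add: alt_def)

lemma div2_less:
  fixes i r :: nat
  assumes "q = 2 * r \<or> q = 2 * r + 1" "i < q" "\<not> (even i \<and> i < 2 * r)"
  shows "i div 2 < q - r"
proof (cases "i = 2 * r")
  case True then show ?thesis using assms by auto
next
  case False
  then have "i < 2 * r" using assms(1,2) by linarith
  then have "i div 2 < r" by (simp add: less_mult_imp_div_less mult.commute)
  moreover have "r \<le> q - r" using assms(1) by auto
  ultimately show ?thesis by linarith
qed

lemma alt_in:
  assumes q: "q = 2 * r \<or> q = 2 * r + 1" and xs: "xs \<in> dlists (V - S) r" and ss: "ss \<in> dlists S (q - r)" and i: "i < q"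
  shows "alt q r xs ss ! i \<in> (if even i \<and> i < 2 * r then V - S else S)"
proof (cases "even i \<and> i < 2 * r")
  case True
  then have "i div 2 < r" by (simp add: less_mult_imp_div_less mult.commute)
  then have "xs ! (i div 2) \<in> set xs" using xs by (simp add: dlists_def)
  then have "xs ! (i div 2) \<in> V - S" using xs by (auto simp: dlists_def)
  then show ?thesis using True i by (simp add: alt_nth)
next
  case False
  have "i div 2 < q - r" by (rule div2_less[OF q i False])
  then have "ss ! (i div 2) \<in> set ss" using ss by (simp add: dlists_def)
  then have "ss ! (i div 2) \<in> S" using ss by (auto simp: dlists_def)
  then show ?thesis unfolding alt_nth[OF i] if_not_P[OF False] .
qed

lemma alt_cyc:
  assumes q: "q = 2 * r \<or> q = 2 * r + 1" "2 \<le> r" and xs: "xs \<in> dlists (V - S) r" and ss: "ss \<in> dlists S (q - r)"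
    and SV: "S \<subseteq> V"
  shows "alt q r xs ss \<in> cycs q (hadj V S e)"
proof -
  let ?v = "alt q r xs ss"
  note A = alt_in[OF q(1) xs ss]
  have dist: "?v ! i \<noteq> ?v ! j" if ij: "i < q" "j < q" "i \<noteq> j" for i j
  proof (cases "(even i \<and> i < 2 * r) = (even j \<and> j < 2 * r)")
    case False
    then show ?thesis using A[OF ij(1)] A[OF ij(2)] by (auto split: if_splits)
  next
    case same: True
    show ?thesis
    proof (cases "even i \<and> i < 2 * r")
      case True
      then have j: "even j \<and> j < 2 * r" using same by simp
      have d: "i div 2 \<noteq> j div 2" using True j ij(3) by (metis dvd_mult_div_cancel)
      have "i div 2 < r" "j div 2 < r" using True j by (simp_all add: less_mult_imp_div_less mult.commute)
      then have "xs ! (i div 2) \<noteq> xs ! (j div 2)" using d xs by (simp add: dlists_def nth_eq_iff_index_eq)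
      then show ?thesis using True j ij by (simp add: alt_nth)
    next
      case False
      then have j: "\<not> (even j \<and> j < 2 * r)" using same by simp
      have l: "i div 2 < q - r" "j div 2 < q - r" using div2_less[OF q(1) ij(1) False] div2_less[OF q(1) ij(2) j] by simp_all
      have d: "i div 2 \<noteq> j div 2"
      proof
        assume e: "i div 2 = j div 2"
        have "odd i \<or> i = 2 * r" "odd j \<or> j = 2 * r" using False j ij q(1) by auto
        moreover have "i < 2 * r + 1" "j < 2 * r + 1" using ij q(1) by auto
        ultimately show False using e ij(3) by (elim disjE) (auto elim!: oddE)
      qed
      then have "ss ! (i div 2) \<noteq> ss ! (j div 2)" using l d ss by (simp add: dlists_def nth_eq_iff_index_eq)
      then show ?thesis unfolding alt_nth[OF ij(1)] alt_nth[OF ij(2)] if_not_P[OF False] if_not_P[OF j] .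
    qed
  qed
  have "cyc (hadj V S e) ?v"
    unfolding cyc_nth length_alt
  proof (intro conjI allI impI)
    show "3 \<le> q" using q by auto
    show "distinct ?v" unfolding distinct_conv_nth using dist by simp
    fix i assume i: "i < q"
    let ?j = "Suc i mod q"
    have j: "?j < q" "i \<noteq> ?j" using i q by (auto simp: mod_Suc)
    have "?v ! i \<in> S \<or> ?v ! ?j \<in> S"
    proof (cases "even i \<and> i < 2 * r")
      case True
      then have "Suc i < 2 * r" by (auto elim!: evenE)
      moreover have "?j = Suc i" using q(1) \<open>Suc i < 2 * r\<close> by auto
      ultimately have "\<not> (even ?j \<and> ?j < 2 * r)" using True by simp
      then have "?v ! ?j \<in> S" using A[OF j(1)] by (simp only: if_False)
      then show ?thesis ..
    next
      case False
      have "?v ! i \<in> S" using A[OF i] unfolding if_not_P[OF False] .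
      then show ?thesis ..
    qed
    moreover have "?v ! i \<in> V" "?v ! ?j \<in> V" using A[OF i] A[OF j(1)] SV by (auto split: if_splits)
    ultimately show "hadj V S e (?v ! i) (?v ! ?j)" using dist[OF i j] by (auto simp: hadj_def)
  qed
  then show ?thesis by (simp add: cycs_def)
qed

lemma alt_inj:
  assumes q: "q = 2 * r \<or> q = 2 * r + 1" "2 \<le> r" and l: "length xs = r" "length xs' = r" "length ss = q - r" "length ss' = q - r"
    and e: "alt q r xs ss = alt q r xs' ss'"
  shows "xs = xs'" "ss = ss'"
proof -
  have n: "alt q r xs ss ! i = alt q r xs' ss' ! i" for i using e by simp
  show "xs = xs'"
  proof (rule nth_equalityI)
    fix i assume "i < length xs"
    then have "2 * i < q" "2 * i < 2 * r" using l q by auto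
    then show "xs ! i = xs' ! i" using n[of "2 * i"] by (simp add: alt_nth)
  qed (use l in simp)
  show "ss = ss'"
  proof (rule nth_equalityI)
    fix i assume "i < length ss"
    then have i: "i < q - r" using l by simp
    show "ss ! i = ss' ! i"
    proof (cases "i < r")
      case True
      then have "2 * i + 1 < q" using q(1) by auto
      then show ?thesis using n[of "2 * i + 1"] by (simp add: alt_nth)
    next
      case False
      then have "q = 2 * r + 1" "i = r" using i q(1) by auto
      then show ?thesis using n[of "2 * r"] by (simp add: alt_nth)
    qed
  qed (use l in simp)
qed

text \<open>For odd \<open>q\<close> the only consecutive core vertices are the last two, so rotations of alternating lists are distinct.\<close>

lemma alt_SS:
  assumes q: "q = 2 * r + 1" "2 \<le> r" and xs: "xs \<in> dlists (V - S) r" and ss: "ss \<in> dlists S (q - r)"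
    and i: "i < q" "alt q r xs ss ! i \<in> S" "alt q r xs ss ! (Suc i mod q) \<in> S"
  shows "i = 2 * r - 1"
proof -
  have q': "q = 2 * r \<or> q = 2 * r + 1" using q by simp
  note A = alt_in[OF q' xs ss]
  have j: "Suc i mod q < q" using q by simp
  have a: "\<not> (even i \<and> i < 2 * r)" using A[OF i(1)] i(2) by (auto split: if_splits)
  have b: "\<not> (even (Suc i mod q) \<and> Suc i mod q < 2 * r)" using A[OF j] i(3) by (auto split: if_splits)
  have "i \<noteq> 2 * r" using b q by auto
  then have il: "i < 2 * r" "odd i" using a i(1) q by auto
  then have "Suc i mod q = Suc i" using q(1) by simp
  then show ?thesis using b il by simp
qed

lemma finite_cycs_hadj:
  assumes "finite V"
  shows "finite (cycs q (hadj V S e))"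
proof (rule finite_subset)
  show "cycs q (hadj V S e) \<subseteq> {vs. set vs \<subseteq> V \<and> length vs = q}"
  proof
    fix vs assume "vs \<in> cycs q (hadj V S e)"
    then have vs: "cyc (hadj V S e) vs" "length vs = q" by (auto simp: cycs_def)
    have "x \<in> V" if x: "x \<in> set vs" for x
    proof -
      obtain i where i: "i < length vs" "x = vs ! i" using x by (metis in_set_conv_nth)
      have "hadj V S e (vs ! i) (vs ! (Suc i mod length vs))" using vs(1) i(1) unfolding cyc_nth by blast
      then show ?thesis using i(2) by (simp add: hadj_def)
    qed
    then show "vs \<in> {vs. set vs \<subseteq> V \<and> length vs = q}" using vs(2) by auto
  qed
qed (rule finite_lists_length_eq[OF assms])

text \<open>For even \<open>q\<close> the alternating lists start outside the core or, rotated once, in it; for odd \<open>q\<close> all \<open>q\<close> rotations are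
  different.\<close>

lemma card_hadj_lower:
  fixes V :: "'a set"
  assumes q: "q = 2 * r \<or> q = 2 * r + 1" "2 \<le> r" and V: "finite V" "S \<subseteq> V"
  shows "(if q = 2 * r then 2 else q) * (ffact (card (V - S)) r * ffact (card S) (q - r)) \<le> card (cycs q (hadj V S e))"
proof -
  let ?H = "hadj V S e"
  let ?D = "dlists (V - S) r \<times> dlists S (q - r)"
  let ?c = "if q = 2 * r then 2 else q"
  let ?f = "\<lambda>(k, xs, ss). rotate k (alt q r xs ss)"
  have finS: "finite S" using V finite_subset by blast
  have q0: "0 < q" using q by auto
  have len: "length xs = r" "length ss = q - r" if "(xs, ss) \<in> ?D" for xs ss using that by (auto simp: dlists_def)
  have finC: "finite (cycs q ?H)" by (rule finite_cycs_hadj[OF V(1)])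
  have kk: "k = k'" if k: "k < ?c" "k' < ?c" and D: "(xs, ss) \<in> ?D" "(xs', ss') \<in> ?D"
    and e: "rotate k (alt q r xs ss) = rotate k' (alt q r xs' ss')" for k k' xs ss xs' ss'
  proof -
    have DD: "xs \<in> dlists (V - S) r" "ss \<in> dlists S (q - r)" "xs' \<in> dlists (V - S) r" "ss' \<in> dlists S (q - r)"
      using D by auto
    have nth: "alt q r xs ss ! ((k + i) mod q) = alt q r xs' ss' ! ((k' + i) mod q)" if "i < q" for i
      using arg_cong[OF e, of "\<lambda>l. l ! i"] that by (simp add: nth_rotate)
    show ?thesis
    proof (cases "q = 2 * r")
      case True
      have "alt q r xs ss ! (k mod q) = alt q r xs' ss' ! (k' mod q)" using nth[of 0] q0 by simp
      moreover have "k < 2" "k' < 2" "2 < q" using k True q(2) by auto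
      moreover have "alt q r xs ss ! k \<in> (if even k \<and> k < 2 * r then V - S else S)"
        "alt q r xs' ss' ! k' \<in> (if even k' \<and> k' < 2 * r then V - S else S)"
        using alt_in[OF q(1) DD(1,2), of k] alt_in[OF q(1) DD(3,4), of k'] \<open>k < 2\<close> \<open>k' < 2\<close> \<open>2 < q\<close> by auto
      ultimately have "(even k \<and> k < 2 * r) = (even k' \<and> k' < 2 * r)" by (auto split: if_splits)
      then have "even k = even k'" using \<open>k < 2\<close> \<open>k' < 2\<close> q(2) by auto
      then show ?thesis using \<open>k < 2\<close> \<open>k' < 2\<close> by (cases k; cases k') auto
    next
      case False
      then have qo: "q = 2 * r + 1" using q(1) by simp
      have kq: "k < q" "k' < q" using k False by auto
      let ?i = "(2 * r - 1 + (q - k)) mod q"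
      have i: "?i < q" using q0 by simp
      have p: "(k + ?i) mod q = 2 * r - 1" "(k + Suc ?i mod q) mod q = 2 * r"
      proof -
        have "(k + ?i) mod q = (2 * r - 1 + q) mod q" using kq by (simp add: mod_simps)
        also have "\<dots> = (2 * r - 1) mod q" by (rule mod_add_self2)
        also have "\<dots> = 2 * r - 1" by (rule mod_less) (use qo in simp)
        finally show "(k + ?i) mod q = 2 * r - 1" .
        have "(k + Suc ?i mod q) mod q = (k + Suc (2 * r - 1 + (q - k))) mod q" by (simp add: mod_simps)
        also have "k + Suc (2 * r - 1 + (q - k)) = 2 * r + q" using kq q(2) by simp
        also have "(2 * r + q) mod q = 2 * r mod q" by (rule mod_add_self2)
        also have "\<dots> = 2 * r" by (rule mod_less) (use qo in simp)
        finally show "(k + Suc ?i mod q) mod q = 2 * r" .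
      qed
      have S1: "alt q r xs' ss' ! ((k' + ?i) mod q) \<in> S"
        using nth[OF i] p(1) alt_in[OF q(1) DD(1,2), of "2 * r - 1"] q(2) qo by simp
      have S2: "alt q r xs' ss' ! ((k' + Suc ?i mod q) mod q) \<in> S"
        using nth[of "Suc ?i mod q"] p(2) alt_in[OF q(1) DD(1,2), of "2 * r"] q0 qo by simp
      have "(k' + Suc ?i mod q) mod q = Suc ((k' + ?i) mod q) mod q" by (simp add: mod_simps)
      then have "(k' + ?i) mod q = 2 * r - 1"
        using alt_SS[OF qo q(2) DD(3,4), of "(k' + ?i) mod q"] S1 S2 q0 by simp
      then have "k mod q = k' mod q" using mod_cancel_add[of k ?i q k'] p(1) by simp
      then show ?thesis using kq by simp
    qed
  qed
  have inj: "inj_on ?f ({..<?c} \<times> ?D)"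
  proof (rule inj_onI)
    fix t t' assume t: "t \<in> {..<?c} \<times> ?D" "t' \<in> {..<?c} \<times> ?D" "?f t = ?f t'"
    obtain k xs ss k' xs' ss' where tt: "t = (k, xs, ss)" "t' = (k', xs', ss')" by (cases t, cases t')
    have D: "(xs, ss) \<in> ?D" "(xs', ss') \<in> ?D" "k < ?c" "k' < ?c" using t tt by auto
    have e: "rotate k (alt q r xs ss) = rotate k' (alt q r xs' ss')" using t(3) tt by simp
    have "k = k'" by (rule kk[OF D(3,4,1,2) e])
    then have "alt q r xs ss = alt q r xs' ss'" using rotate_eqD[of k "alt q r xs ss" "alt q r xs' ss'"] e by simp
    then have "xs = xs' \<and> ss = ss'" using alt_inj[OF q] len[OF D(1)] len[OF D(2)] by blast
    then show "t = t'" using tt \<open>k = k'\<close> by simp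
  qed
  have sub: "?f ` ({..<?c} \<times> ?D) \<subseteq> cycs q ?H"
  proof
    fix v assume "v \<in> ?f ` ({..<?c} \<times> ?D)"
    then obtain k xs ss where v: "v = rotate k (alt q r xs ss)" "xs \<in> dlists (V - S) r" "ss \<in> dlists S (q - r)" by auto
    have "alt q r xs ss \<in> cycs q ?H" by (rule alt_cyc[OF q v(2,3) V(2)])
    then show "v \<in> cycs q ?H" by (simp add: v(1) cycs_def cyc_rotate)
  qed
  have "?c * (ffact (card (V - S)) r * ffact (card S) (q - r)) = card ({..<?c} \<times> ?D)"
    using V(1) finS by (simp add: card_cartesian_product card_dlists)
  also have "\<dots> = card (?f ` ({..<?c} \<times> ?D))" by (rule card_image[OF inj, symmetric])
  also have "\<dots> \<le> card (cycs q ?H)" by (rule card_mono[OF finC sub])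
  finally show ?thesis .
qed

section \<open>The stability theorem\<close>

text \<open>The falling factorial has the same leading term as the power.\<close>

lemma power_le_ffact: "n ^ r \<le> ffact (n - a) r + r * (a + r) * n ^ (r - 1)"
proof (induction r)
  case (Suc r)
  show ?case
  proof (cases "r = 0")
    case False
    then have p: "n ^ r = n * n ^ (r - 1)" by (cases r) simp_all
    have "n ^ Suc r = n ^ r * n" by simp
    also have "\<dots> \<le> (ffact (n - a) r + r * (a + r) * n ^ (r - 1)) * n" by (rule mult_le_mono1[OF Suc])
    also have "\<dots> = ffact (n - a) r * n + r * (a + r) * n ^ r" by (simp add: p algebra_simps)
    also have "ffact (n - a) r * n \<le> ffact (n - a) r * (n - a - r) + ffact (n - a) r * (a + r)"
      unfolding add_mult_distrib2[symmetric] by (rule mult_le_mono2) simp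
    also have "ffact (n - a) r \<le> n ^ r"
    proof -
      have "ffact k j \<le> k ^ j" for k j
      proof (induction j arbitrary: k)
        case (Suc j)
        have "ffact (k - 1) j \<le> k ^ j" using Suc[of k] ffact_mono[of "k - 1" k j] by simp
        then show ?case by simp
      qed simp
      then have "ffact (n - a) r \<le> (n - a) ^ r" .
      also have "\<dots> \<le> n ^ r" by (rule power_mono) auto
      finally show ?thesis .
    qed
    then have "ffact (n - a) r * (a + r) \<le> n ^ r * (a + r)" by (rule mult_le_mono1)
    finally have f: "n ^ Suc r \<le> ffact (n - a) (Suc r) + ((a + r) * n ^ r + r * (a + r) * n ^ r)"
      unfolding ffact_Suc by (simp add: algebra_simps)
    have "(a + r) * n ^ r + r * (a + r) * n ^ r = (Suc r * (a + r)) * n ^ r" by (simp add: algebra_simps)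
    also have "\<dots> \<le> (Suc r * (a + Suc r)) * n ^ r" by (intro mult_le_mono1 mult_le_mono2) simp
    finally show ?thesis using f by simp
  qed simp
qed simp

context tuple
begin

text \<open>If no set of \<open>a\<close> vertices is almost completely joined to the rest, each fibre over heavy vertices falls short of the
  extremal value by at least \<open>n / D\<close>, apart from the error terms of \<open>odd_stability\<close>.\<close>

lemma fibre_gain:
  assumes q: "q = 2 * r \<and> r \<le> a \<or> q = 2 * r + 1 \<and> r + 1 \<le> a" and a: "a = L div 2" and D: "4 \<le> D" and m: "100 \<le> m"
    and K: "card (big m) \<le> K" and lb: "card (lightv m C) \<le> lb"
    and uns: "\<And>S. S \<subseteq> V \<Longrightarrow> card S = a \<Longrightarrow> n < D * card {x \<in> V. \<exists>s\<in>S. \<not> adj x s}"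
  shows "D * card (fibre q r m xs) + n \<le>
    D * (ffact a (q - r) * n) + D * (8 * (a * a) * ffact a r * (n div m) + lb * (ffact a r * (K + 1)))"
proof -
  let ?err = "8 * (a * a) * ffact a r * (n div m) + lb * (ffact a r * (K + 1))"
  have fv: "finite V" "full \<subseteq> V" using finV by (auto simp: full_def)
  have Uc: "n \<le> D * (n - card full)" if "card U = a"
  proof -
    have "{x \<in> V. \<exists>s\<in>U. \<not> adj x s} = V - full" by (auto simp: full_def nb_def)
    moreover have "n < D * card {x \<in> V. \<exists>s\<in>U. \<not> adj x s}"
      by (rule uns[OF _ that]) (use U_A big_sub in blast)
    ultimately show ?thesis using card_Diff_subset[OF finite_subset[OF fv(2,1)] fv(2)] by simp
  qed
  from q show ?thesis
  proof
    assume e: "q = 2 * r \<and> r \<le> a"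
    have "card (fibre q r m xs) \<le> card cpl_even" using card_fibre_even e by simp
    then have c: "D * card (fibre q r m xs) \<le> D * card cpl_even" by (rule mult_le_mono2)
    have qr: "q - r = r" using e by simp
    from even_stability[OF a] e
    have "card U = a \<and> card cpl_even + (n - card full) \<le> ffact a r * n \<or> card cpl_even + n \<le> ffact a r * n" by blast
    then have "D * card cpl_even + n \<le> D * (ffact a r * n)"
    proof
      assume x: "card U = a \<and> card cpl_even + (n - card full) \<le> ffact a r * n"
      then have "D * (card cpl_even + (n - card full)) \<le> D * (ffact a r * n)" using mult_le_mono2 by blast
      then show ?thesis using Uc x unfolding add_mult_distrib2 by linarith
    next
      assume "card cpl_even + n \<le> ffact a r * n"
      then have "D * (card cpl_even + n) \<le> D * (ffact a r * n)" by (rule mult_le_mono2)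
      moreover have "1 * n \<le> D * n" by (rule mult_le_mono1) (use D in simp)
      ultimately show ?thesis unfolding add_mult_distrib2 by linarith
    qed
    then show ?thesis using c unfolding qr by linarith
  next
    assume e: "q = 2 * r + 1 \<and> r + 1 \<le> a"
    have "card (fibre q r m xs) \<le> card cpl_odd" using card_fibre_odd e by simp
    then have c: "D * card (fibre q r m xs) \<le> D * card cpl_odd" by (rule mult_le_mono2)
    have qr: "q - r = Suc r" using e by simp
    define t where "t = ffact a (Suc r) * n"
    define err' where "err' = 8 * (a * a) * (n div m) * ffact a r + card light * (ffact a r * (card A + 1))"
    have "light = lightv m C" by (auto simp: light_def lightv_def)
    then have "card light * (ffact a r * (card A + 1)) \<le> lb * (ffact a r * (K + 1))"
      by (intro mult_le_mono) (use lb K in auto)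
    then have er: "D * err' \<le> D * ?err" unfolding err'_def by (intro mult_le_mono2 add_mono) (simp_all add: ac_simps)
    from odd_stability[OF a _ m] e
    have "card U = a \<and> card cpl_odd + (n - card full) \<le> t + err' \<or> 4 * card cpl_odd + n \<le> 4 * t"
      unfolding t_def err'_def by blast
    then have "D * card cpl_odd + n \<le> D * t + D * err'"
    proof
      assume x: "card U = a \<and> card cpl_odd + (n - card full) \<le> t + err'"
      then have "D * (card cpl_odd + (n - card full)) \<le> D * (t + err')" using mult_le_mono2 by blast
      then show ?thesis using Uc x unfolding add_mult_distrib2 by linarith
    next
      assume x: "4 * card cpl_odd + n \<le> 4 * t"
      then have "card cpl_odd \<le> t" by linarith
      then obtain j where j: "t = card cpl_odd + j" using le_Suc_ex by blast
      then have "n \<le> 4 * j" using x by simp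
      also have "\<dots> \<le> D * j" by (rule mult_le_mono1[OF D])
      finally show ?thesis unfolding j add_mult_distrib2 by linarith
    qed
    then show ?thesis using c er unfolding qr t_def[symmetric] by linarith
  qed
qed

end

text \<open>All errors are at most \<open>\<alpha> n\<^sup>r / m + O(n\<^bsup>r-1\<^esup>)\<close> where \<open>\<alpha>\<close> does not depend on \<open>m\<close>. So \<open>m\<close> is chosen
  first such that they consume at most half of the gain, and \<open>n\<close> afterwards.\<close>

lemma stability:
  assumes q: "q = 2 * r \<and> r \<le> a \<or> q = 2 * r + 1 \<and> r + 1 \<le> a" "2 \<le> r" and a: "a = L div 2" and D: "4 \<le> D"
  shows "\<exists>n0. \<forall>(V :: 'a set) adj. circ V adj L \<longrightarrow> n0 \<le> card V \<longrightarrow>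
    (if q = 2 * r then 2 else q) * (ffact (card V - a) r * ffact a (q - r)) \<le> card (cycs q adj) \<longrightarrow>
    (\<exists>S\<subseteq>V. card S = a \<and> D * card {x \<in> V. \<exists>s\<in>S. \<not> adj x s} \<le> card V)"
proof -
  define c where "c = (if q = 2 * r then 2 else q)"
  define \<tau> where "\<tau> = ffact a (q - r)"
  define f1 where "f1 = 2 * (q + 1) * (2 ^ q * q * L ^ q)"
  define e1 where "e1 = 8 * (a * a) * ffact a r"
  define \<alpha> where "\<alpha> = D * (f1 + c * e1)"
  \<comment> \<open>all terms with \<open>n div m\<close> together are at most \<open>\<alpha> * (n div m)\<close>, hence at most \<open>n / 2\<close>\<close>
  define m where "m = 2 * \<alpha> + 100"
  define K where "K = 2 * L * m"
  define C where "C = 8 * L + 20"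
  define lb where "lb = 2 ^ K * C"
  define f2 where "f2 = 2 * (q + 1) * (L ^ q + 2 ^ q * ((K + 1) * L) ^ q)"
  define e2 where "e2 = lb * (ffact a r * (K + 1))"
  define l2 where "l2 = r * lb * (K ^ r * (2 * L))"
  define g where "g = r * (a + r)"
  define \<beta> where "\<beta> = D * (f2 + c * e2 + c * l2 + c * \<tau> * g)"
  have q': "q = 2 * r \<or> q = 2 * r + 1" "q \<le> 2 * r + 1" using q by auto
  have c1: "1 \<le> c" unfolding c_def using q by auto
  have rL: "r \<le> L" using q a by auto
  have m100: "100 \<le> m" "0 < m" by (auto simp: m_def)
  show ?thesis
  proof (rule exI[of _ "2 * \<beta> + 1"], intro allI impI)
    fix V :: "'a set" and adj
    assume ci: "circ V adj L" and n0: "2 * \<beta> + 1 \<le> card V"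
      and many: "(if q = 2 * r then 2 else q) * (ffact (card V - a) r * ffact a (q - r)) \<le> card (cycs q adj)"
    interpret circ V adj L by (rule ci)
    let ?n = "card V"
    define d where "d = ?n div m"
    define N where "N = ?n ^ (r - 1)"
    define F where "F = ffact (?n - a) r"
    have npos: "0 < ?n" using n0 by simp
    show "\<exists>S\<subseteq>V. card S = a \<and> D * card {x \<in> V. \<exists>s\<in>S. \<not> adj x s} \<le> ?n"
    proof (rule ccontr)
      assume "\<not> ?thesis"
      then have uns: "?n < D * card {x \<in> V. \<exists>s\<in>S. \<not> adj x s}" if "S \<subseteq> V" "card S = a" for S
        using that by (simp add: not_le)
      have K: "card (big m) \<le> K" unfolding K_def by (rule card_big[OF npos])
      have lb: "card (lightv m C) \<le> lb"
      proof -
        have "card (lightv m C) \<le> 2 ^ card (big m) * C" by (rule card_lightv)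
        also have "\<dots> \<le> 2 ^ K * C" by (intro mult_le_mono1 power_increasing K) simp
        finally show ?thesis by (simp add: lb_def)
      qed
      define \<kappa> where "\<kappa> = D * (\<tau> * ?n) + D * (e1 * d + e2) - ?n"
      have tau1: "1 \<le> \<tau>" unfolding \<tau>_def using ffact_pos[of "q - r" a] q by auto
      have Dt: "?n \<le> D * (\<tau> * ?n)"
      proof -
        have "1 * ?n \<le> (D * \<tau>) * ?n" by (rule mult_le_mono1) (use D tau1 in simp)
        then show ?thesis by (simp add: mult.assoc)
      qed
      have kn: "\<kappa> + ?n = D * (\<tau> * ?n) + D * (e1 * d + e2)" unfolding \<kappa>_def using Dt by linarith
      have fibs: "D * card (fibre q r m xs) \<le> \<kappa>" if xs: "length xs = r - 1" "\<And>x. x \<in> set xs \<Longrightarrow> heavy m C x" for xs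
      proof -
        interpret tuple V adj L m C xs r
          by unfold_locales (use xs q(2) rL m100 in \<open>auto simp: C_def\<close>)
        have "D * card (fibre q r m xs) + ?n \<le> D * (\<tau> * ?n) + D * (e1 * d + e2)"
          unfolding \<tau>_def e1_def d_def e2_def by (rule fibre_gain[OF q(1) a D m100(1) K lb uns])
        then show ?thesis unfolding \<kappa>_def by linarith
      qed
      have pat: "D * card (pat q r m) \<le> N * \<kappa> + D * (N * l2)"
        unfolding N_def l2_def by (rule card_pat_le[OF q'(1) q(2) K lb fibs])
      define few where "few = card {v \<in> cycs q adj. ecount (\<lambda>x y. x \<in> big m \<and> y \<notin> big m) v \<le> r - 1}"
      have fewle: "few \<le> N * (f1 * d + f2)"
      proof -
        have "few \<le> 2 * (q + 1) * (2 ^ q * q * (L ^ q * (N * d)) + L ^ q * ?n + 2 ^ q * (((K + 1) * L) ^ q * N))"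
          unfolding few_def N_def d_def by (rule card_few_transitions[OF q'(2) q(2) m100(2) npos K])
        also have "\<dots> \<le> 2 * (q + 1) * (2 ^ q * q * (L ^ q * (N * d)) + L ^ q * N + 2 ^ q * (((K + 1) * L) ^ q * N))"
        proof -
          have "?n ^ 1 \<le> N" unfolding N_def by (rule power_increasing) (use q(2) npos in auto)
          then have "?n \<le> N" by simp
          then show ?thesis by (intro mult_le_mono2 add_mono order_refl)
        qed
        also have "\<dots> = N * (f1 * d + f2)" by (simp only: f1_def f2_def algebra_simps)
        finally show ?thesis .
      qed
      have cy: "card (cycs q adj) \<le> few + c * card (pat q r m)"
        unfolding few_def c_def by (rule card_cycs_le_pat[OF q'(1) q(2)])
      have many': "c * (F * \<tau>) \<le> card (cycs q adj)" using many by (simp only: c_def F_def \<tau>_def)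
      have pw: "?n * N \<le> F + g * N"
      proof -
        have "r = Suc (r - 1)" using q(2) by simp
        then have "?n * N = ?n ^ r" unfolding N_def by (metis power_Suc)
        then show ?thesis using power_le_ffact[of ?n r a] by (simp add: F_def g_def N_def)
      qed
      have Npos: "0 < N" using npos by (simp add: N_def)
      have k1: "D * (c * (F * \<tau>)) \<le> D * few + c * (N * \<kappa> + D * (N * l2))"
      proof -
        have "D * (c * (F * \<tau>)) \<le> D * (few + c * card (pat q r m))" by (rule mult_le_mono2) (rule le_trans[OF many' cy])
        also have "\<dots> = D * few + c * (D * card (pat q r m))" by (simp add: algebra_simps)
        also have "\<dots> \<le> D * few + c * (N * \<kappa> + D * (N * l2))" by (intro add_mono mult_le_mono2 pat order_refl)
        finally show ?thesis .
      qed
      have k2: "D * (c * (?n * N * \<tau>)) \<le> D * (c * (F * \<tau>)) + D * (c * (g * N * \<tau>))"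
      proof -
        have "D * (c * (?n * N * \<tau>)) \<le> D * (c * ((F + g * N) * \<tau>))" by (intro mult_le_mono2 mult_le_mono1 pw)
        then show ?thesis by (simp add: algebra_simps)
      qed
      have k3: "c * (N * \<kappa>) + c * (N * ?n) = c * (N * (D * (\<tau> * ?n))) + c * (N * (D * (e1 * d + e2)))"
        unfolding add_mult_distrib2[symmetric] kn ..
      have k4: "D * few \<le> D * (N * (f1 * d + f2))" by (rule mult_le_mono2[OF fewle])
      have e5: "D * (c * (?n * N * \<tau>)) = c * (N * (D * (\<tau> * ?n)))" by (simp add: ac_simps)
      have e6: "c * (N * \<kappa> + D * (N * l2)) = c * (N * \<kappa>) + c * (D * (N * l2))" by (simp add: add_mult_distrib2)
      have k5: "c * (N * ?n) \<le> D * (N * (f1 * d + f2)) + c * (N * (D * (e1 * d + e2))) + c * (D * (N * l2)) + D * (c * (g * N * \<tau>))"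
        using k1 k2 k3 k4 unfolding e5 e6 by linarith
      also have "\<dots> = N * (\<alpha> * d + \<beta>)" unfolding \<alpha>_def \<beta>_def by (simp add: algebra_simps)
      finally have "c * (N * ?n) \<le> N * (\<alpha> * d + \<beta>)" .
      moreover have "N * ?n \<le> c * (N * ?n)" using c1 by simp
      ultimately have "N * ?n \<le> N * (\<alpha> * d + \<beta>)" by linarith
      then have "?n \<le> \<alpha> * d + \<beta>" using Npos by simp
      moreover have "2 * (\<alpha> * d) \<le> ?n"
      proof -
        have "2 * \<alpha> * d \<le> m * d" by (rule mult_le_mono1) (simp add: m_def)
        also have "\<dots> \<le> ?n" unfolding d_def by simp
        finally show ?thesis by simp
      qed
      ultimately show False using n0 by linarith
    qed
  qed
qed

text \<open>With \<open>m = 1\<close> no vertex is big, so every closed list has few transitions.\<close>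

lemma (in circ) card_cycs_crude:
  assumes q: "q = 2 * r \<or> q = 2 * r + 1" "2 \<le> r"
  shows "card (cycs q adj) \<le> 2 * (q + 1) * (2 ^ q * q * L ^ q + L ^ q + 2 ^ q * L ^ q) * card V ^ r"
proof (cases "card V = 0")
  case True
  then have "cycs q adj = {}" using V_pos by fastforce
  then show ?thesis by simp
next
  case False
  let ?n = "card V"
  have npos: "0 < ?n" using False by simp
  have big1: "big 1 = {}"
  proof -
    have "card (nb v) < card V" if "v \<in> V" for v
    proof (rule psubset_card_mono[OF finV])
      show "nb v \<subset> V" using nb_sub that adj_irrefl by (auto simp: nb_def)
    qed
    then show ?thesis by (fastforce simp: big_def)
  qed
  moreover have "\<exists>i<2 * r. even i" by (rule exI[of _ 0]) (use q(2) in simp)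
  ultimately have p: "pat q r 1 = {}" by (simp add: pat_def)
  have "card (cycs q adj) \<le> card {v \<in> cycs q adj. ecount (\<lambda>x y. x \<in> big 1 \<and> y \<notin> big 1) v \<le> r - 1} + 0"
    using card_cycs_le_pat[OF q, of 1] unfolding p by simp
  also have "\<dots> \<le> 2 * (q + 1) * (2 ^ q * q * (L ^ q * (?n ^ (r - 1) * (?n div 1))) + L ^ q * ?n +
      2 ^ q * (((0 + 1) * L) ^ q * ?n ^ (r - 1)))"
    using card_few_transitions[of q r 1 0] q npos big1 by auto
  also have "\<dots> \<le> 2 * (q + 1) * (2 ^ q * q * (L ^ q * ?n ^ r) + L ^ q * ?n ^ r + 2 ^ q * (L ^ q * ?n ^ r))"
  proof -
    have r: "r = Suc (r - 1)" using q(2) by simp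
    have "?n ^ (r - 1) * ?n = ?n ^ r" by (subst r) simp
    moreover have "?n ^ 1 \<le> ?n ^ r" by (rule power_increasing) (use q npos in auto)
    moreover have "?n ^ (r - 1) \<le> ?n ^ r" by (rule power_increasing) (use npos in auto)
    ultimately show ?thesis by (intro mult_le_mono2 add_mono) auto
  qed
  finally show ?thesis by (simp add: algebra_simps)
qed

section \<open>The graph outside an almost full core\<close>

text \<open>The outcome of the stability theorem: \<open>W\<close> consists of all vertices outside \<open>S\<close> that are adjacent to all of \<open>S\<close>.\<close>

locale core = circ +
  fixes S W :: "'a set" and a :: nat
  assumes SV: "S \<subseteq> V" and cS: "card S = a" and a: "a = L div 2" and a2: "2 \<le> a"
    and WV: "W \<subseteq> V - S" and Wfull: "\<And>w s. w \<in> W \<Longrightarrow> s \<in> S \<Longrightarrow> adj w s"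
    and Wmax: "\<And>x. x \<in> V - S \<Longrightarrow> x \<notin> W \<Longrightarrow> \<exists>s\<in>S. \<not> adj x s"
    and Wlarge: "2 * a + L + 12 \<le> card W"
begin

definition R :: "'a set" where "R = V - S - W"

lemma fin_S [simp]: "finite S" using SV finV finite_subset by blast
lemma fin_W [simp]: "finite W" using WV finV finite_subset by blast
lemma fin_R [simp]: "finite R" using finV by (simp add: R_def)

lemma Wfull': "w \<in> W \<Longrightarrow> s \<in> S \<Longrightarrow> adj s w" using Wfull adj_sym by blast

lemma W_S: "w \<in> W \<Longrightarrow> w \<notin> S \<and> w \<in> V" using WV by blast

lemma cm_W: "p \<in> S \<Longrightarrow> p' \<in> S \<Longrightarrow> cm W p p' = W"
  using Wfull by (auto simp: cm_def)

text \<open>Leaving out the set \<open>X\<close> allows \<open>Q\<close> to pass through \<open>X\<close>.\<close>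

lemma close_core:
  assumes X: "X \<subseteq> S" and u: "u \<in> S - X" "u' \<in> S - X" "u \<noteq> u' \<or> S - X = {u}"
    and Q: "distinct Q" "successively adj Q" "Q \<noteq> []" "set Q \<inter> (S - X) = {}" "adj u (hd Q)" "adj (last Q) u'"
    and len: "2 \<le> length Q" "length Q \<le> L + 10"
  shows "2 * card (S - X) + length Q \<le> L + 1"
proof -
  obtain ws where ws: "distinct ws" "set ws = S - X" "ws \<noteq> []" "hd ws = u'" "last ws = u"
  proof (cases "u = u'")
    case True
    then have "S - X = {u}" using u(3) by simp
    then show ?thesis using that[of "[u]"] True by simp
  next
    case False
    have "\<exists>l. set l = S - X - {u, u'} \<and> distinct l" by (rule finite_distinct_list) simp
    then obtain l where l: "set l = S - X - {u, u'}" "distinct l" by (elim exE conjE)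
    have "distinct (u' # l @ [u])" "set (u' # l @ [u]) = S - X" using l False u(1,2) by auto
    then show ?thesis by (rule that) simp_all
  qed
  have lw: "length ws = card (S - X)" using ws(1,2) distinct_card by metis
  also have "\<dots> \<le> a" using card_mono[of S "S - X"] cS by auto
  finally have la: "length ws \<le> a" .
  have "2 * length ws + length Q \<le> L + 1"
  proof (rule close[of W ws "card W" Q])
    show "W \<subseteq> V" "set ws \<inter> W = {}" using WV ws(2) by auto
    show "successively (\<lambda>p p'. card W \<le> card (cm W p p')) ws"
      unfolding successively_conv_nth
    proof (intro allI impI)
      fix i assume i: "Suc i < length ws"
      then have "ws ! i \<in> set ws" "ws ! Suc i \<in> set ws" by simp_all
      then have "ws ! i \<in> S" "ws ! Suc i \<in> S" using ws(2) by auto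
      then show "card W \<le> card (cm W (ws ! i) (ws ! Suc i))" by (simp add: cm_W)
    qed
    show "length Q + 2 * length ws \<le> card W" using la len(2) Wlarge by linarith
    show "4 \<le> 2 * length ws + length Q"
    proof -
      have "1 \<le> length ws" using ws(3) by (cases ws) auto
      then show ?thesis using len(1) by linarith
    qed
  qed (use ws Q in auto)
  then show ?thesis using lw by simp
qed

lemma short_path:
  assumes u: "u \<in> S" "v \<in> S" "u \<noteq> v"
    and Q: "distinct Q" "successively adj Q" "set Q \<inter> S = {}" "adj u (hd Q)" "adj (last Q) v"
    and len: "2 \<le> length Q" "length Q \<le> L + 10"
  shows "odd L" "length Q = 2"
proof -
  have "2 * card (S - {}) + length Q \<le> L + 1"
    by (rule close_core[where u = u and u' = v]) (use assms in auto)
  then have h: "2 * a + length Q \<le> L + 1" using cS by simp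
  show "odd L" using h a len(1) by presburger
  show "length Q = 2" using h a len(1) by presburger
qed

text \<open>The outer edges that can lie on a cycle through at least two core vertices.\<close>

definition outer_pairs :: "('a \<times> 'a) set" where
  "outer_pairs = {(y, z). y \<in> V - S \<and> z \<in> V - S \<and> adj y z \<and> (\<exists>u\<in>S. \<exists>v\<in>S. u \<noteq> v \<and> adj u y \<and> adj z v)}"

lemma outer_pairs_D:
  assumes "(y, z) \<in> outer_pairs"
  shows "y \<in> V - S" "z \<in> V - S" "adj y z" "y \<noteq> z" "\<exists>u\<in>S. \<exists>v\<in>S. u \<noteq> v \<and> adj u y \<and> adj z v" "(z, y) \<in> outer_pairs"
proof -
  obtain u v where uv: "u \<in> S" "v \<in> S" "u \<noteq> v" "adj u y" "adj z v"
    and yz: "y \<in> V - S" "z \<in> V - S" "adj y z" using assms by (auto simp: outer_pairs_def)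
  show "y \<in> V - S" "z \<in> V - S" "adj y z" by (fact yz)+
  show "y \<noteq> z" using yz(3) adj_irrefl by metis
  show "\<exists>u\<in>S. \<exists>v\<in>S. u \<noteq> v \<and> adj u y \<and> adj z v" using uv by (intro bexI conjI)
  have "v \<noteq> u" "adj v z" "adj y u" "adj z y" using uv yz adj_sym by metis+
  then show "(z, y) \<in> outer_pairs" using uv(1,2) yz(1,2) by (auto simp: outer_pairs_def)
qed

lemma fin_outer_pairs [simp]: "finite outer_pairs"
  by (rule finite_subset[of _ "V \<times> V"]) (use finV in \<open>auto simp: outer_pairs_def\<close>)

lemma outer_pairs_odd: "(y, z) \<in> outer_pairs \<Longrightarrow> L = 2 * a + 1"
proof -
  assume f: "(y, z) \<in> outer_pairs"
  note F = outer_pairs_D[OF f]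
  obtain u v where uv: "u \<in> S" "v \<in> S" "u \<noteq> v" "adj u y" "adj z v" using F(5) by blast
  have "odd L" by (rule short_path(1)[OF uv(1-3), of "[y, z]"]) (use F uv in auto)
  then show ?thesis using a by simp
qed

lemma no_path3:
  assumes "distinct [x, y, z]" "x \<in> V - S" "y \<in> V - S" "z \<in> V - S" "adj x y" "adj y z"
    "u \<in> S" "v \<in> S" "adj u x" "adj z v"
  shows "u = v"
proof (rule ccontr)
  assume "u \<noteq> v"
  then have "length [x, y, z] = 2"
    by (intro short_path(2)[of u v "[x, y, z]"]) (use assms in auto)
  then show False by simp
qed

text \<open>Two edges leaving the same outer vertex force their other ends to share a single neighbour in the core.\<close>

lemma outer_pairs_star:
  assumes f: "(y, z) \<in> outer_pairs" "(y, z') \<in> outer_pairs" "z \<noteq> z'" and p: "p \<in> S" "adj z p" and p': "p' \<in> S" "adj z p' \<or> adj z' p'"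
  shows "p = p'"
proof -
  note F = outer_pairs_D[OF f(1)] note F' = outer_pairs_D[OF f(2)]
  obtain v where v: "v \<in> S" "adj z' v" using F'(5) by blast
  have eq: "x = x'" if "x \<in> S" "x' \<in> S" "adj z x" "adj z' x'" for x x'
    by (rule no_path3[of z y z' x x']) (use F F' f(3) that adj_sym in auto)
  show ?thesis using eq[OF p(1) v(1) p(2) v(2)] eq[OF p'(1) v(1) _ v(2)] eq[OF p(1) p'(1) p(2)] p'(2) by blast
qed

text \<open>Otherwise three outer edges form a path with four vertices or a triangle, and \<open>outer_pairs_star\<close> determines the core neighbours
  of its ends.\<close>

lemma outer_pairs_leaf:
  assumes f: "(y, z) \<in> outer_pairs" "(y, z') \<in> outer_pairs" "z \<noteq> z'" "(z, y') \<in> outer_pairs"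
  shows "y' = y"
proof (rule ccontr)
  assume ne: "y' \<noteq> y"
  note F = outer_pairs_D[OF f(1)] note F' = outer_pairs_D[OF f(2)] note F'' = outer_pairs_D[OF f(4)]
  obtain u v where uv: "u \<in> S" "v \<in> S" "u \<noteq> v" "adj u y" "adj z v" using F(5) by blast
  have zy: "(z, y) \<in> outer_pairs" using F by simp
  have yu: "adj y u" using uv adj_sym by blast
  obtain v' where v': "v' \<in> S" "adj z' v'" using F'(5) by blast
  have e1: "v = v'" by (rule outer_pairs_star[OF f(1,2,3) uv(2,5) v'(1)]) (use v' in simp)
  obtain u' where u': "u' \<in> S" "adj y' u'" using F''(5) by blast
  have e2: "u = u'" by (rule outer_pairs_star[OF zy f(4) ne[symmetric] uv(1) yu u'(1)]) (use u' in simp)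
  show False
  proof (cases "y' = z'")
    case True
    then have "u = v'" using outer_pairs_star[OF zy f(4) ne[symmetric] uv(1) yu v'(1)] v' by simp
    then show False using e1 uv by simp
  next
    case False
    have "length [z', y, z, y'] = 2"
      by (rule short_path(2)[of v u]) (use F F' F'' False ne f(3) uv e1 e2 v' u' adj_sym in auto)
    then show False by simp
  qed
qed

text \<open>If the ends differ, both edges can be placed on one cycle that visits all of \<open>S\<close>, and two excursions of two vertices
  each make it too long.\<close>

lemma outer_pairs_disjoint:
  assumes f: "(y, z) \<in> outer_pairs" "(y', z') \<in> outer_pairs" "{y, z} \<inter> {y', z'} = {}"
    and uv: "u \<in> S" "v \<in> S" "u \<noteq> v" "adj u y" "adj z v"
    and uv': "u' \<in> S" "v' \<in> S" "u' \<noteq> v'" "adj u' y'" "adj z' v'"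
  shows "{u, v} = {u', v'}" and "3 \<le> a"
proof -
  note F = outer_pairs_D[OF f(1)] note F' = outer_pairs_D[OF f(2)]
  have L: "L = 2 * a + 1" by (rule outer_pairs_odd[OF f(1)])
  have d: "y \<noteq> y'" "y \<noteq> z'" "z \<noteq> y'" "z \<noteq> z'" using f(3) by auto
  have c1: "card (S - {v}) = a - 1" using uv(2) cS by simp
  \<comment> \<open>the two edges share the end \<open>v\<close> and their other ends differ, or nothing else is left\<close>
  have share: False if w: "w \<in> S" "w \<noteq> v" "u \<noteq> w \<or> S - {v} = {u}"
    and e: "adj v y1" "adj y1 y2" "adj y2 w" "{y1, y2} = {y', z'}" for w y1 y2
  proof -
    have y12: "y1 \<in> V - S" "y2 \<in> V - S" "y1 \<noteq> y2" "y1 \<notin> {y, z}" "y2 \<notin> {y, z}"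
      using e(4) F' d by (auto simp: doubleton_eq_iff)
    have "2 * card (S - {v}) + length [y, z, v, y1, y2] \<le> L + 1"
      by (rule close_core[where u = u and u' = w]) (use F uv w e(1-3) y12 in auto)
    then show False using c1 L a2 by simp
  qed
  have sym: "adj y' u'" "adj v' z'" "adj z' y'" "adj y' z'" using uv' F'(3) adj_sym by blast+
  \<comment> \<open>the two edges have four different ends\<close>
  have four: False if "{u, v} \<inter> {u', v'} = {}"
  proof -
    obtain w1 where w1: "w1 \<in> W" "w1 \<notin> {y, z, y', z'}"
    proof -
      have "card {y, z, y', z'} \<le> 4" by (simp add: card_insert_if)
      then have "card {y, z, y', z'} < card W" using Wlarge by linarith
      then have "\<not> W \<subseteq> {y, z, y', z'}" using card_mono[of "{y, z, y', z'}" W] by auto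
      then show ?thesis using that by blast
    qed
    have wS: "w1 \<notin> S" "w1 \<in> V" using W_S[OF w1(1)] by auto
    have "2 * card (S - {v, u'}) + length [y, z, v, w1, u', y', z'] \<le> L + 1"
    proof (rule close_core[where u = u and u' = v'])
      show "adj u (hd [y, z, v, w1, u', y', z'])" "adj (last [y, z, v, w1, u', y', z']) v'" using uv uv' by auto
      show "distinct [y, z, v, w1, u', y', z']" using F F' d w1 wS uv uv' that by auto
      show "successively adj [y, z, v, w1, u', y', z']"
        using F(3) F'(3) uv(5) uv'(4) Wfull'[OF w1(1) uv(2)] Wfull[OF w1(1) uv'(1)] by simp
      show "set [y, z, v, w1, u', y', z'] \<inter> (S - {v, u'}) = {}" using F F' wS by auto
    qed (use uv uv' that in auto)
    moreover have "card (S - {v, u'}) = a - 2"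
    proof -
      have "card {v, u'} = 2" using that by auto
      then show ?thesis using card_Diff_subset[of "{v, u'}" S] uv(2) uv'(1) cS by simp
    qed
    ultimately show False using L a2 by simp
  qed
  have flip: "(z, y) \<in> outer_pairs" "{z, y} \<inter> {y', z'} = {}" "adj v z" "adj y u" using F f uv adj_sym by auto
  have share': False if w: "w \<in> S" "w \<noteq> u" "v \<noteq> w \<or> S - {u} = {v}"
    and e: "adj u y1" "adj y1 y2" "adj y2 w" "{y1, y2} = {y', z'}" for w y1 y2
  proof -
    have y12: "y1 \<in> V - S" "y2 \<in> V - S" "y1 \<noteq> y2" "y1 \<notin> {y, z}" "y2 \<notin> {y, z}"
      using e(4) F' d by (auto simp: doubleton_eq_iff)
    have "2 * card (S - {u}) + length [z, y, u, y1, y2] \<le> L + 1"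
      by (rule close_core[where u = v and u' = w]) (use F uv w e(1-3) y12 flip adj_sym in auto)
    moreover have "card (S - {u}) = a - 1" using uv(1) cS by simp
    ultimately show False using L a2 by simp
  qed
  show eq: "{u, v} = {u', v'}"
  proof (rule ccontr)
    assume ne: "{u, v} \<noteq> {u', v'}"
    consider "v = u'" "v' \<noteq> u" | "v = v'" "u' \<noteq> u" | "u = u'" "v' \<noteq> v" | "u = v'" "u' \<noteq> v" | "{u, v} \<inter> {u', v'} = {}"
      using ne by auto
    then show False
    proof cases
      case 1 show False by (rule share[of v' y' z']) (use 1 uv uv' sym in auto)
    next
      case 2 show False by (rule share[of u' z' y']) (use 2 uv uv' sym in auto)
    next
      case 3 show False by (rule share'[of v' y' z']) (use 3 uv uv' sym in auto)
    next
      case 4 show False by (rule share'[of u' z' y']) (use 4 uv uv' sym in auto)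
    qed (rule four)
  qed
  show "3 \<le> a"
  proof (rule ccontr)
    assume "\<not> 3 \<le> a"
    then have "card (S - {v}) = 1" using c1 a2 by simp
    then have one: "S - {v} = {u}" using uv by (metis card_1_singletonE insertE Diff_iff singletonD)
    from eq have "v = u' \<and> u = v' \<or> v = v' \<and> u = u'" by (auto simp: doubleton_eq_iff)
    then show False
    proof
      assume "v = u' \<and> u = v'" then show False using share[of v' y' z'] one uv uv' sym by auto
    next
      assume "v = v' \<and> u = u'" then show False using share[of u' z' y'] one uv uv' sym by auto
    qed
  qed
qed

text \<open>Of two edges that share a vertex, the other end is a leaf with a single core neighbour. If no edge shares a vertex with
  \<open>{y, z}\<close>, compare with the disjoint edge \<open>{e1, e2}\<close>.\<close>

lemma outer_pairs_pendant:
  assumes e: "(e1, e2) \<in> outer_pairs" and f: "(y, z) \<in> outer_pairs" "{y, z} \<noteq> {e1, e2}"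
  shows "\<exists>y' z'. {y', z'} = {y, z} \<and> (y', z') \<in> outer_pairs \<and> y' \<in> R \<and> (\<forall>x. (y', x) \<in> outer_pairs \<longrightarrow> x = z') \<and>
    (\<forall>u\<in>S. \<forall>v\<in>S. u \<noteq> v \<longrightarrow> adj u y' \<longrightarrow> adj z' v \<longrightarrow> (\<forall>s\<in>S. adj y' s \<longrightarrow> s = u \<or> s = v))"
proof -
  \<comment> \<open>\<open>c\<close> lies on two outer edges, so \<open>l\<close> is a leaf\<close>
  have star: "\<exists>y' z'. {y', z'} = {y, z} \<and> (y', z') \<in> outer_pairs \<and> y' \<in> R \<and> (\<forall>x. (y', x) \<in> outer_pairs \<longrightarrow> x = z') \<and>
    (\<forall>u\<in>S. \<forall>v\<in>S. u \<noteq> v \<longrightarrow> adj u y' \<longrightarrow> adj z' v \<longrightarrow> (\<forall>s\<in>S. adj y' s \<longrightarrow> s = u \<or> s = v))"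
    if g: "(c, l) \<in> outer_pairs" "(c, l') \<in> outer_pairs" "l \<noteq> l'" "{c, l} = {y, z}" for c l l'
  proof (intro exI conjI)
    note G = outer_pairs_D[OF g(1)]
    show "{l, c} = {y, z}" using g(4) by (simp add: insert_commute)
    show "(l, c) \<in> outer_pairs" by (rule G)
    show "\<forall>x. (l, x) \<in> outer_pairs \<longrightarrow> x = c" using outer_pairs_leaf[OF g(1,2,3)] by blast
    have one: "p = p'" if "p \<in> S" "adj l p" "p' \<in> S" "adj l p'" for p p'
      by (rule outer_pairs_star[OF g(1-3) that(1-3)]) (use that in simp)
    show "\<forall>u\<in>S. \<forall>v\<in>S. u \<noteq> v \<longrightarrow> adj u l \<longrightarrow> adj c v \<longrightarrow> (\<forall>s\<in>S. adj l s \<longrightarrow> s = u \<or> s = v)"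
      using one adj_sym by blast
    show "l \<in> R"
    proof (rule ccontr)
      assume "l \<notin> R"
      then have lW: "l \<in> W" using G(2) by (auto simp: R_def)
      obtain u v where "u \<in> S" "v \<in> S" "u \<noteq> v" using G(5) by blast
      then show False using one[of u v] Wfull[OF lW] by blast
    qed
  qed
  consider l where "(y, l) \<in> outer_pairs" "l \<noteq> z" | l where "(z, l) \<in> outer_pairs" "l \<noteq> y"
    | "\<And>l. (y, l) \<in> outer_pairs \<Longrightarrow> l = z" "\<And>l. (z, l) \<in> outer_pairs \<Longrightarrow> l = y" by blast
  then show ?thesis
  proof cases
    case (1 l) then show ?thesis using star[of y z l] f(1) by auto
  next
    case (2 l) then show ?thesis using star[of z y l] outer_pairs_D(6)[OF f(1)] by (auto simp: insert_commute)
  next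
    case 3
    note E = outer_pairs_D[OF e]
    have dis: "{y, z} \<inter> {e1, e2} = {}"
    proof (rule ccontr)
      assume "{y, z} \<inter> {e1, e2} \<noteq> {}"
      then consider "y = e1" | "y = e2" | "z = e1" | "z = e2" by blast
      then show False
      proof cases
        case 1 then have "e2 = z" using 3(1) e by blast
        then show False using f(2) 1 by simp
      next
        case 2 then have "e1 = z" using 3(1) E(6) by blast
        then show False using f(2) 2 by (simp add: insert_commute)
      next
        case c: 3 then have "e2 = y" using 3(2) e by blast
        then show False using f(2) c by (simp add: insert_commute)
      next
        case 4 then have "e1 = y" using 3(2) E(6) by blast
        then show False using f(2) 4 by simp
      qed
    qed
    obtain u0 v0 where uv0: "u0 \<in> S" "v0 \<in> S" "u0 \<noteq> v0" "adj u0 e1" "adj e2 v0" using E(5) by blast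
    have pr: "{u, v} = {u0, v0}" if "u \<in> S" "v \<in> S" "u \<noteq> v" "adj u y" "adj z v" for u v
      by (rule outer_pairs_disjoint(1)[OF f(1) e dis that uv0])
    obtain u1 v1 where uv1: "u1 \<in> S" "v1 \<in> S" "u1 \<noteq> v1" "adj u1 y" "adj z v1" using outer_pairs_D(5)[OF f(1)] by blast
    have a3: "3 \<le> a" by (rule outer_pairs_disjoint(2)[OF f(1) e dis uv1 uv0])
    have sub: "s = u0 \<or> s = v0" if s: "s \<in> S" "adj y s" for s
    proof (cases "s = v1")
      case False
      have "{s, v1} = {u0, v0}" by (rule pr[OF s(1) uv1(2) False _ uv1(5)]) (use s adj_sym in blast)
      then show ?thesis by blast
    next
      case True
      then show ?thesis using pr[OF uv1] by blast
    qed
    have yR: "y \<in> R"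
    proof (rule ccontr)
      assume "y \<notin> R"
      then have "y \<in> W" using outer_pairs_D[OF f(1)] by (auto simp: R_def)
      then have "S \<subseteq> {u0, v0}" using sub Wfull by blast
      then have "card S \<le> card {u0, v0}" by (rule card_mono[rotated]) simp
      also have "\<dots> \<le> 2" by (simp add: card_insert_if)
      finally show False using a3 cS by simp
    qed
    have last: "\<forall>u\<in>S. \<forall>v\<in>S. u \<noteq> v \<longrightarrow> adj u y \<longrightarrow> adj z v \<longrightarrow> (\<forall>s\<in>S. adj y s \<longrightarrow> s = u \<or> s = v)"
      using pr sub by blast
    show ?thesis using 3(1) f(1) yR last by blast
  qed
qed

end

text \<open>The extra edge of the extremal graph is placed on an outer edge, if there is one.\<close>

locale finish = core +
  fixes q r :: nat and e0 :: "'a set"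
  assumes q: "q = 2 * r \<and> r \<le> a \<or> q = 2 * r + 1 \<and> r + 1 \<le> a" and r2: "2 \<le> r"
    and e0: "extra_edge L (V - S) e0" and FFe0: "outer_pairs = {} \<or> (\<exists>e1 e2. e0 = {e1, e2} \<and> (e1, e2) \<in> outer_pairs)"
begin

abbreviation "n \<equiv> card V"
abbreviation "Cyc \<equiv> cycs q adj"
abbreviation "Hc \<equiv> cycs q (hadj V S e0)"

lemma q': "q = 2 * r \<or> q = 2 * r + 1" "4 \<le> q" "q \<le> L" "q - r \<le> a"
proof -
  show "q = 2 * r \<or> q = 2 * r + 1" using q by blast
  show "4 \<le> q" using q r2 by auto
  have "2 * a \<le> L" using a by simp
  then show "q \<le> L" using q by auto
  show "q - r \<le> a" using q by auto
qed

lemma CycD: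
  assumes "v \<in> Cyc"
  shows "length v = q" "distinct v" "set v \<subseteq> V" "\<And>i. i < q \<Longrightarrow> v ! i \<in> V" "\<And>i. i < q \<Longrightarrow> adj (v ! i) (v ! (Suc i mod q))"
    "cyc adj v" "\<And>i j. i < q \<Longrightarrow> j < q \<Longrightarrow> v ! i = v ! j \<longleftrightarrow> i = j"
proof -
  have v: "cyc adj v" "length v = q" using assms by (auto simp: cycs_def)
  show "length v = q" "cyc adj v" by (fact v)+
  show "distinct v" using v by (simp add: cyc_def)
  then show "v ! i = v ! j \<longleftrightarrow> i = j" if "i < q" "j < q" for i j using that v(2) by (simp add: nth_eq_iff_index_eq)
  show s: "set v \<subseteq> V" by (rule cyc_sub[OF v(1)])
  show "v ! i \<in> V" if "i < q" for i using that v(2) s nth_mem by blast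
  show "adj (v ! i) (v ! (Suc i mod q))" if "i < q" for i using that v unfolding cyc_nth by simp
qed

lemma Cyc_rotate: "rotate k v \<in> Cyc \<longleftrightarrow> v \<in> Cyc"
  by (simp add: cycs_def cyc_rotate)

subsection \<open>Cycles that avoid almost all of the core\<close>

lemma two_core: obtains u v where "u \<in> S" "v \<in> S" "u \<noteq> v"
proof -
  have "\<not> card S \<le> Suc 0" using cS a2 by simp
  then show ?thesis using that card_le_Suc0_iff_eq[OF fin_S] by blast
qed

text \<open>Two neighbours in \<open>W\<close> would be the ends of a path with three vertices outside \<open>S\<close>.\<close>

lemma W_unique:
  assumes "y \<in> V - S" "w \<in> W" "w' \<in> W" "adj y w" "adj y w'"
  shows "w = w'"
proof (rule ccontr)
  assume ne: "w \<noteq> w'"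
  obtain u v where uv: "u \<in> S" "v \<in> S" "u \<noteq> v" by (rule two_core)
  have "u = v"
  proof (rule no_path3[of w y w' u v])
    show "distinct [w, y, w']" using ne assms(4,5) adj_irrefl by auto
    show "w \<in> V - S" "w' \<in> V - S" using assms WV by auto
    show "adj w y" "adj y w'" using assms adj_sym by blast+
    show "adj u w" "adj w' v" using Wfull' Wfull uv assms by blast+
  qed (use uv assms in auto)
  then show False using uv by simp
qed

definition W1 :: "'a set" where "W1 = {w \<in> W. \<exists>y\<in>R. adj w y}"
definition W2 :: "'a set" where "W2 = {w \<in> W. \<exists>y\<in>W1. adj w y}"
text \<open>A set of size \<open>O(card R)\<close> that supports all cycles with at most one core vertex.\<close>

definition X1 :: "'a set" where "X1 = S \<union> R \<union> W1 \<union> W2"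

lemma card_W_nbrs:
  assumes "Y \<subseteq> V - S"
  shows "card {w \<in> W. \<exists>y\<in>Y. adj w y} \<le> card Y"
proof (rule surj_card_le)
  show "finite Y" using assms finV finite_subset by blast
  show "{w \<in> W. \<exists>y\<in>Y. adj w y} \<subseteq> (\<lambda>y. SOME w. w \<in> W \<and> adj w y) ` Y"
  proof
    fix w assume "w \<in> {w \<in> W. \<exists>y\<in>Y. adj w y}"
    then obtain y where y: "w \<in> W" "y \<in> Y" "adj w y" by blast
    have "(SOME w. w \<in> W \<and> adj w y) = w"
    proof (rule some_equality)
      show "w \<in> W \<and> adj w y" using y by simp
      fix w' assume "w' \<in> W \<and> adj w' y"
      then show "w' = w" using W_unique[of y w' w] y assms adj_sym by blast
    qed
    then show "w \<in> (\<lambda>y. SOME w. w \<in> W \<and> adj w y) ` Y" using y(2) by (intro rev_image_eqI[of y]) simp_all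
  qed
qed

lemma card_X1: "card X1 \<le> a + 3 * card R" "finite X1" "X1 \<subseteq> V"
proof -
  have RV: "R \<subseteq> V - S" by (auto simp: R_def)
  have W1V: "W1 \<subseteq> V - S" using WV by (auto simp: W1_def)
  have "card W1 \<le> card R" unfolding W1_def by (rule card_W_nbrs[OF RV])
  moreover have "card W2 \<le> card W1" unfolding W2_def by (rule card_W_nbrs[OF W1V])
  moreover have "card X1 \<le> card S + card R + card W1 + card W2"
    unfolding X1_def by (meson add_mono card_Un_le le_refl le_trans)
  ultimately show "card X1 \<le> a + 3 * card R" using cS by linarith
  show "X1 \<subseteq> V" using SV RV W1V WV by (auto simp: X1_def W2_def)
  then show "finite X1" using finV finite_subset by blast
qed

definition E1 :: "'a list set" where "E1 = {v \<in> Cyc. card (set v \<inter> S) \<le> 1}"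

text \<open>Such a cycle has no three consecutive vertices outside \<open>S\<close> whose ends are in \<open>W\<close>. So each of its vertices in \<open>W\<close> is next to a
  vertex of \<open>R\<close>, or next to a vertex of \<open>W\<close> that is.\<close>

lemma E1_X1:
  assumes v: "v \<in> E1"
  shows "set v \<subseteq> X1"
proof
  fix p assume p: "p \<in> set v"
  have vC: "v \<in> Cyc" using v by (simp add: E1_def)
  note D = CycD[OF vC]
  show "p \<in> X1"
  proof (cases "p \<in> W")
    case False
    then show ?thesis using p D(3) by (auto simp: X1_def R_def)
  next
    case pW: True
    obtain k where k: "k < q" "v ! k = p" using p D(1) by (auto simp: in_set_conv_nth)
    define w where "w = rotate k v"
    have wC: "w \<in> Cyc" using vC by (simp add: w_def Cyc_rotate)
    note E = CycD[OF wC]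
    have q0: "0 < q" "1 < q" "2 < q" "q - 1 < q" "q - 2 < q" using q'(2) by auto
    have w0: "w ! 0 = p" using k D(1) by (simp add: w_def nth_rotate)
    have "card (set w \<inter> S) \<le> 1" using v by (simp add: w_def E1_def)
    then have one: "i = j" if "i < q" "j < q" "w ! i \<in> S" "w ! j \<in> S" for i j
    proof -
      have fi: "finite (set w \<inter> S)" by simp
      have "w ! i \<in> set w \<inter> S" "w ! j \<in> set w \<inter> S" using that E(1) by auto
      then have "w ! i = w ! j" using \<open>card (set w \<inter> S) \<le> 1\<close> card_le_Suc0_iff_eq[OF fi] by auto
      then show ?thesis using E(7) that by blast
    qed
    have ad: "adj p (w ! 1)" "adj (w ! 1) (w ! 2)" "adj (w ! (q - 1)) p" "adj (w ! (q - 2)) (w ! (q - 1))"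
    proof -
      show "adj p (w ! 1)" using E(5)[of 0] q0 w0 by simp
      have "Suc 1 = 2" by simp
      then show "adj (w ! 1) (w ! 2)" using E(5)[OF q0(2)] q0(3) by (simp only: mod_less)
      have "Suc (q - 1) = q" "Suc (q - 2) = q - 1" using q0 by auto
      then show "adj (w ! (q - 1)) p" "adj (w ! (q - 2)) (w ! (q - 1))"
        using E(5)[OF q0(4)] E(5)[OF q0(5)] w0 q0 by simp_all
    qed
    \<comment> \<open>one neighbour \<open>x\<close> of \<open>p\<close> along the cycle is in the core, so the next two vertices on the other side are not\<close>
    have side: ?thesis if xS: "x \<in> S" and y: "y \<in> V" "y \<notin> S" "adj p y" and z: "z \<in> V" "z \<notin> S" "z \<noteq> p" "adj y z" for x y z
    proof (cases "y \<in> R")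
      case True
      then show ?thesis using pW y by (auto simp: X1_def W1_def)
    next
      case False
      then have yW: "y \<in> W" using y by (auto simp: R_def)
      have "z \<notin> W" using W_unique[of y p z] pW y z adj_sym by blast
      then have "y \<in> W1" using z yW by (auto simp: W1_def R_def)
      then show ?thesis using pW y(3) by (auto simp: X1_def W2_def)
    qed
    have V4: "w ! 1 \<in> V" "w ! 2 \<in> V" "w ! (q - 1) \<in> V" "w ! (q - 2) \<in> V" using E(4) q0 by blast+
    have ne: "w ! 2 \<noteq> p" "w ! (q - 2) \<noteq> p" "w ! 1 \<noteq> w ! (q - 1)"
      using E(7)[OF q0(3,1)] E(7)[OF q0(5,1)] E(7)[OF q0(2,4)] w0 q'(2) by auto
    consider "w ! (q - 1) \<in> S" | "w ! 1 \<in> S" | "w ! (q - 1) \<notin> S" "w ! 1 \<notin> S" by blast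
    then show ?thesis
    proof cases
      case 1
      have "w ! 1 \<notin> S" "w ! 2 \<notin> S" using one[OF q0(2,4) _ 1] one[OF q0(3,4) _ 1] q'(2) by auto
      then show ?thesis using side[OF 1 V4(1) _ ad(1) V4(2) _ ne(1) ad(2)] by blast
    next
      case 2
      have "w ! (q - 1) \<notin> S" "w ! (q - 2) \<notin> S" using one[OF q0(4,2) _ 2] one[OF q0(5,2) _ 2] q'(2) by auto
      then show ?thesis using side[OF 2 V4(3) _ _ V4(4) _ ne(2)] ad(3,4) adj_sym by blast
    next
      case 3
      show ?thesis
      proof (cases "w ! 1 \<in> R \<or> w ! (q - 1) \<in> R")
        case True
        then show ?thesis using pW ad(1,3) adj_sym by (auto simp: X1_def W1_def)
      next
        case False
        then have "w ! 1 \<in> W" "w ! (q - 1) \<in> W" using 3 V4 by (auto simp: R_def)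
        then have "w ! 1 = w ! (q - 1)" using W_unique[of p "w ! 1" "w ! (q - 1)"] W_S[OF pW] ad(1,3) adj_sym by blast
        then show ?thesis using ne(3) by simp
      qed
    qed
  qed
qed

text \<open>The crude bound on the number of closed lists is applied to the subgraph on \<open>X1\<close>.\<close>

lemma card_E1:
  "card E1 \<le> 2 * (q + 1) * (2 ^ q * q * L ^ q + L ^ q + 2 ^ q * L ^ q) * ((a + 3) ^ r * card R ^ r)"
proof (cases "card R = 0")
  case True
  then have "R = {}" by simp
  then have "X1 = S" by (auto simp: X1_def W1_def W2_def)
  have "E1 = {}"
  proof (rule equals0I)
    fix v assume v: "v \<in> E1"
    then have "set v \<subseteq> S" using E1_X1 \<open>X1 = S\<close> by simp
    then have "set v \<inter> S = set v" by blast
    then have "card (set v) \<le> 1" using v by (simp add: E1_def)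
    moreover have "card (set v) = q" using CycD(1,2)[of v] v distinct_card[of v] by (simp add: E1_def)
    ultimately show False using q'(2) by simp
  qed
  then show ?thesis by simp
next
  case False
  let ?adj = "\<lambda>x y. adj x y \<and> x \<in> X1 \<and> y \<in> X1"
  let ?M = "2 * (q + 1) * (2 ^ q * q * L ^ q + L ^ q + 2 ^ q * L ^ q)"
  interpret X: circ X1 ?adj L
  proof unfold_locales
    fix vs assume "cyc ?adj vs"
    then have "cyc adj vs" by (simp add: cyc_nth)
    then show "length vs \<le> L" by (rule circ)
  qed (use card_X1(2) adj_sym adj_irrefl L2 in auto)
  have "E1 \<subseteq> cycs q ?adj"
  proof
    fix v assume v: "v \<in> E1"
    then have vC: "v \<in> Cyc" by (simp add: E1_def)
    note D = CycD[OF vC]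
    have "v ! i \<in> X1" if "i < q" for i using E1_X1[OF v] that D(1) nth_mem by blast
    moreover have "0 < q" using q'(2) by simp
    ultimately show "v \<in> cycs q ?adj"
      using D(1,2,5) q'(2) unfolding cycs_def cyc_nth by simp
  qed
  then have "card E1 \<le> card (cycs q ?adj)" by (rule card_mono[OF X.fin_cycs])
  also have "\<dots> \<le> ?M * card X1 ^ r" by (rule X.card_cycs_crude[OF q'(1) r2])
  also have "\<dots> \<le> ?M * ((a + 3) ^ r * card R ^ r)"
  proof (rule mult_le_mono2)
    have "a * 1 \<le> a * card R" by (rule mult_le_mono2) (use False in linarith)
    then have "card X1 \<le> (a + 3) * card R" using card_X1(1) unfolding add_mult_distrib by linarith
    then have "card X1 ^ r \<le> ((a + 3) * card R) ^ r" by (rule power_mono) simp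
    then show "card X1 ^ r \<le> (a + 3) ^ r * card R ^ r" by (simp add: power_mult_distrib)
  qed
  finally show ?thesis .
qed

subsection \<open>Runs outside the core\<close>

text \<open>The run of outer vertices around the first two entries is bounded by two different core vertices, so \<open>short_path\<close> shows
  that it has no further vertex.\<close>

lemma outer_run:
  assumes w: "w \<in> Cyc" "2 \<le> card (set w \<inter> S)" "w ! 0 \<notin> S" "w ! 1 \<notin> S"
  shows "w ! 2 \<in> S" "w ! (q - 1) \<in> S" "(w ! 0, w ! 1) \<in> outer_pairs"
proof -
  note D = CycD[OF w(1)]
  have "\<exists>x\<in>set w. x \<in> S"
  proof (rule ccontr)
    assume "\<not> ?thesis"
    then have "set w \<inter> S = {}" by blast
    then show False using w(2) by simp
  qed
  from split_list_first_prop[OF this] obtain ys u zs where s1: "w = ys @ u # zs" "u \<in> S" "\<forall>y\<in>set ys. y \<notin> S" by blast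
  have "\<exists>x\<in>set zs. x \<in> S"
  proof (rule ccontr)
    assume "\<not> ?thesis"
    then have "set w \<inter> S = {u}" using s1 by auto
    then show False using w(2) by simp
  qed
  from split_list_last_prop[OF this] obtain ys2 v zs2 where s2: "zs = ys2 @ v # zs2" "v \<in> S" "\<forall>y\<in>set zs2. y \<notin> S" by blast
  have ww: "w = ys @ u # ys2 @ v # zs2" using s1 s2 by simp
  have ly: "2 \<le> length ys"
  proof (rule ccontr)
    assume "\<not> ?thesis"
    then consider "length ys = 0" | "length ys = 1" by linarith
    then show False
    proof cases
      case 1 then show False using w(3) ww s1(2) by simp
    next
      case 2 then show False using w(4) ww s1(2) by (simp add: nth_append)
    qed
  qed
  have succ: "successively adj w" "adj (last w) (hd w)" using D(6) by (simp_all add: cyc_def)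
  have ysne: "ys \<noteq> []" using ly by auto
  let ?Q = "zs2 @ ys"
  have sh: "length ?Q = 2"
  proof (rule short_path(2)[of v u])
    show "v \<noteq> u" using D(2) ww by auto
    show "distinct ?Q" using D(2) ww by auto
    have "successively adj zs2" "successively adj ys" "adj (last ys) u" "zs2 \<noteq> [] \<Longrightarrow> adj v (hd zs2)"
      using succ(1) ysne unfolding ww by (auto simp: successively_append_iff successively_Cons)
    moreover have "zs2 \<noteq> [] \<Longrightarrow> adj (last zs2) (hd ys)" "zs2 = [] \<Longrightarrow> adj v (hd ys)"
      using succ(2) ysne unfolding ww by auto
    ultimately show "successively adj ?Q" "adj v (hd ?Q)" "adj (last ?Q) u"
      using ysne by (cases "zs2 = []"; simp add: successively_append_iff)+
    show "set ?Q \<inter> S = {}" using s1 s2 by auto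
    have "length ?Q \<le> length w" unfolding ww by simp
    then show "length ?Q \<le> L + 10" using D(1) q'(3) by linarith
    show "2 \<le> length ?Q" using ly by simp
  qed (use s1 s2 in auto)
  have "length zs2 = 0" using sh ly unfolding length_append by linarith
  then have z: "zs2 = []" "length ys = 2" using sh by simp_all
  then obtain y z where yz: "ys = [y, z]" by (metis (no_types) One_nat_def Suc_length_conv length_0_conv numeral_2_eq_2)
  have e: "w = y # z # u # ys2 @ [v]" using ww z yz by simp
  have "w ! (q - 1) = v" using D(1) e by (metis last_ConsR last_conv_nth last_snoc list.distinct(1) snoc_eq_iff_butlast)
  then show "w ! (q - 1) \<in> S" using s2(2) by simp
  show "w ! 2 \<in> S" using e s1(2) by simp
  have "y \<in> V" "z \<in> V" using D(3) e by auto
  moreover have "adj y z" "adj z u" "adj v y" using succ e by auto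
  moreover have "v \<noteq> u" using D(2) e by auto
  ultimately have "(y, z) \<in> outer_pairs" using w(3,4) e s1(2) s2(2) by (auto simp: outer_pairs_def)
  then show "(w ! 0, w ! 1) \<in> outer_pairs" using e by simp
qed

end

context finish
begin

subsection \<open>Lists with an exceptional outer edge\<close>

text \<open>The outer edges that are missing in the extremal graph.\<close>

definition exceptional_pairs :: "('a \<times> 'a) set" where "exceptional_pairs = {(y, z) \<in> outer_pairs. {y, z} \<noteq> e0}"

lemma exceptional_pairs_pendant:
  assumes "(y, z) \<in> exceptional_pairs"
  obtains y' z' where "{y', z'} = {y, z}" "(y', z') \<in> outer_pairs" "y' \<in> R" "\<And>x. (y', x) \<in> outer_pairs \<Longrightarrow> x = z'"
    "\<And>u v s. u \<in> S \<Longrightarrow> v \<in> S \<Longrightarrow> u \<noteq> v \<Longrightarrow> adj u y' \<Longrightarrow> adj z' v \<Longrightarrow> s \<in> S \<Longrightarrow> adj y' s \<Longrightarrow> s = u \<or> s = v"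
proof -
  have f: "(y, z) \<in> outer_pairs" "{y, z} \<noteq> e0" using assms by (auto simp: exceptional_pairs_def)
  then obtain e1 e2 where e: "e0 = {e1, e2}" "(e1, e2) \<in> outer_pairs" using FFe0 by blast
  have ne: "{y, z} \<noteq> {e1, e2}" using f(2) e(1) by simp
  from outer_pairs_pendant[OF e(2) f(1) ne] obtain y' z' where P: "{y', z'} = {y, z}" "(y', z') \<in> outer_pairs" "y' \<in> R"
    and P4: "\<forall>x. (y', x) \<in> outer_pairs \<longrightarrow> x = z'"
    and P5: "\<forall>u\<in>S. \<forall>v\<in>S. u \<noteq> v \<longrightarrow> adj u y' \<longrightarrow> adj z' v \<longrightarrow> (\<forall>s\<in>S. adj y' s \<longrightarrow> s = u \<or> s = v)"
    by (elim exE conjE)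
  show ?thesis
  proof (rule that[OF P])
    show "x = z'" if "(y', x) \<in> outer_pairs" for x using P4 that by blast
    show "s = u \<or> s = v" if "u \<in> S" "v \<in> S" "u \<noteq> v" "adj u y'" "adj z' v" "s \<in> S" "adj y' s" for u v s
      using P5 that by metis
  qed
qed

text \<open>Each such edge is determined by its pendant end in \<open>R\<close>.\<close>

lemma card_exceptional_pairs: "card exceptional_pairs \<le> 2 * card R"
proof -
  define p where "p = (\<lambda>y. SOME z. (y, z) \<in> outer_pairs)"
  let ?g = "\<lambda>(y, b). if b then (y, p y) else (p y, y)"
  have "card exceptional_pairs \<le> card (R \<times> (UNIV :: bool set))"
  proof (rule surj_card_le)
    show "finite (R \<times> (UNIV :: bool set))" by simp
    show "exceptional_pairs \<subseteq> ?g ` (R \<times> UNIV)"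
    proof
      fix t assume t: "t \<in> exceptional_pairs"
      obtain y z where yz: "t = (y, z)" by (cases t)
      then have "(y, z) \<in> exceptional_pairs" using t by simp
      then obtain y' z' where P: "{y', z'} = {y, z}" "(y', z') \<in> outer_pairs" "y' \<in> R" "\<And>x. (y', x) \<in> outer_pairs \<Longrightarrow> x = z'"
        by (rule exceptional_pairs_pendant) blast
      have pz: "p y' = z'" unfolding p_def by (rule P(4), rule someI[of _ z'], rule P(2))
      from P(1) have "y = y' \<and> z = z' \<or> y = z' \<and> z = y'" by (auto simp: doubleton_eq_iff)
      then show "t \<in> ?g ` (R \<times> UNIV)"
      proof
        assume "y = y' \<and> z = z'"
        then show ?thesis using yz pz P(3) by (intro rev_image_eqI[of "(y', True)"]) auto
      next
        assume "y = z' \<and> z = y'"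
        then show ?thesis using yz pz P(3) by (intro rev_image_eqI[of "(y', False)"]) auto
      qed
    qed
  qed
  then show ?thesis by (simp add: card_cartesian_product)
qed

lemma card_outer_pairs: "card outer_pairs \<le> 2 * card R + 2"
proof (cases "outer_pairs = {}")
  case False
  then obtain e1 e2 where e: "e0 = {e1, e2}" using FFe0 by blast
  have "outer_pairs \<subseteq> exceptional_pairs \<union> {(e1, e2), (e2, e1)}"
  proof
    fix t assume t: "t \<in> outer_pairs"
    obtain y z where yz: "t = (y, z)" by (cases t)
    show "t \<in> exceptional_pairs \<union> {(e1, e2), (e2, e1)}"
    proof (cases "{y, z} = e0")
      case True
      then show ?thesis using yz unfolding e by (auto simp: doubleton_eq_iff)
    next
      case False
      then show ?thesis using t yz by (simp add: exceptional_pairs_def)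
    qed
  qed
  moreover have "finite exceptional_pairs" by (rule finite_subset[OF _ fin_outer_pairs]) (auto simp: exceptional_pairs_def)
  ultimately have "card outer_pairs \<le> card (exceptional_pairs \<union> {(e1, e2), (e2, e1)})" by (intro card_mono) auto
  also have "\<dots> \<le> card exceptional_pairs + card {(e1, e2), (e2, e1)}" by (rule card_Un_le)
  also have "\<dots> \<le> 2 * card R + 2"
  proof (rule add_mono[OF card_exceptional_pairs])
    have "card {(e1, e2), (e2, e1)} \<le> Suc (card {(e2, e1)})" by (rule card_insert_le_m1) simp_all
    then show "card {(e1, e2), (e2, e1)} \<le> 2" by simp
  qed
  finally show ?thesis .
qed simp

text \<open>The closed lists that are rotated such that an exceptional outer edge comes first.\<close>

definition Z :: "'a list set" where
  "Z = {w \<in> Cyc. (w ! 0, w ! 1) \<in> exceptional_pairs \<and> w ! 2 \<in> S \<and> w ! (q - 1) \<in> S \<and>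
    (\<forall>k. Suc k < q \<longrightarrow> w ! k \<notin> S \<longrightarrow> w ! Suc k \<notin> S \<longrightarrow>
      (w ! k, w ! Suc k) \<in> outer_pairs \<and> (k = 0 \<or> w ! (k - 1) \<in> S))}"

text \<open>A consecutive pair that is not an edge of the extremal graph lies outside the core and is not the extra edge.\<close>

lemma exceptional_rotation:
  assumes v: "v \<in> Cyc" "v \<notin> E1" "v \<notin> Hc"
  shows "\<exists>k<q. rotate k v \<in> Z"
proof -
  note D = CycD[OF v(1)]
  have c2: "2 \<le> card (set v \<inter> S)" using v(1,2) by (simp add: E1_def)
  have run: "w ! k' \<in> S" "w ! Suc k \<notin> S \<Longrightarrow> (w ! k, w ! Suc k) \<in> outer_pairs" 
    if w: "w = rotate j v" and k: "Suc k < q" "w ! k \<notin> S" "w ! Suc k \<notin> S" and k': "k' = (if k = 0 then q - 1 else k - 1)" for w j k k'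
  proof -
    have wC: "w \<in> Cyc" using v(1) w by (simp add: Cyc_rotate)
    have wl: "length w = q" using CycD(1)[OF wC] .
    have "rotate k w \<in> Cyc" using wC by (simp add: Cyc_rotate)
    moreover have "2 \<le> card (set (rotate k w) \<inter> S)" using c2 w by simp
    moreover have n0: "rotate k w ! 0 = w ! k" "rotate k w ! 1 = w ! Suc k"
      using k(1) wl by (simp_all add: nth_rotate)
    ultimately have *: "rotate k w ! (q - 1) \<in> S" "(rotate k w ! 0, rotate k w ! 1) \<in> outer_pairs"
      using outer_run[of "rotate k w"] k by simp_all
    have "(k + (q - 1)) mod q = k'"
    proof (cases "k = 0")
      case False
      then have "k + (q - 1) = (k - 1) + q" using k(1) by simp
      then have "(k + (q - 1)) mod q = (k - 1 + q) mod q" by (rule arg_cong)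
      also have "\<dots> = (k - 1) mod q" by (rule mod_add_self2)
      also have "\<dots> = k'" using k(1) k' False by simp
      finally show ?thesis .
    qed (use k' k in simp)
    then have "rotate k w ! (q - 1) = w ! k'" using wl k(1) by (simp add: nth_rotate)
    then show "w ! k' \<in> S" using *(1) by simp
    show "(w ! k, w ! Suc k) \<in> outer_pairs" using *(2) n0 by simp
  qed
  have "\<not> cyc (hadj V S e0) v" using v(3) D(1) by (simp add: cycs_def)
  then obtain i where i: "i < q" "\<not> hadj V S e0 (v ! i) (v ! (Suc i mod q))"
    using D(1,2) q'(2) unfolding cyc_nth by auto
  have iq: "Suc i mod q < q" "i \<noteq> Suc i mod q" using i(1) q'(2) by (auto simp: mod_Suc)
  have ne: "v ! i \<noteq> v ! (Suc i mod q)" using D(7)[OF i(1) iq(1)] iq(2) by simp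
  have out: "v ! i \<notin> S" "v ! (Suc i mod q) \<notin> S" "{v ! i, v ! (Suc i mod q)} \<noteq> e0"
    using i(2) ne D(4)[OF i(1)] D(4)[OF iq(1)] by (auto simp: hadj_def)
  define w where "w = rotate i v"
  have wC: "w \<in> Cyc" using v(1) by (simp add: w_def Cyc_rotate)
  have w01: "w ! 0 = v ! i" "w ! 1 = v ! (Suc i mod q)" using D(1) i(1) q'(2) by (simp_all add: w_def nth_rotate)
  have cw: "2 \<le> card (set w \<inter> S)" using c2 by (simp add: w_def)
  have o: "w ! 2 \<in> S" "w ! (q - 1) \<in> S" "(w ! 0, w ! 1) \<in> outer_pairs"
    using outer_run[OF wC cw] out w01 by simp_all
  have "w \<in> Z"
    unfolding Z_def mem_Collect_eq
  proof (intro conjI allI impI)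
    show "(w ! 0, w ! 1) \<in> exceptional_pairs" using o(3) out(3) w01 by (simp add: exceptional_pairs_def)
    fix k assume k: "Suc k < q" "w ! k \<notin> S" "w ! Suc k \<notin> S"
    show "(w ! k, w ! Suc k) \<in> outer_pairs" by (rule run(2)[OF w_def k refl k(3)])
    show "k = 0 \<or> w ! (k - 1) \<in> S" using run(1)[OF w_def k refl] by (cases "k = 0") simp_all
  qed (use wC o in auto)
  then show ?thesis using i(1) by (auto simp: w_def)
qed

lemma Z_D:
  assumes "w \<in> Z"
  shows "w \<in> Cyc" "(w ! 0, w ! 1) \<in> exceptional_pairs" "w ! 0 \<notin> S" "w ! 1 \<notin> S" "w ! 2 \<in> S" "w ! (q - 1) \<in> S"
    "\<And>k. Suc k < q \<Longrightarrow> w ! k \<notin> S \<Longrightarrow> w ! Suc k \<notin> S \<Longrightarrow> (w ! k, w ! Suc k) \<in> outer_pairs"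
    "\<And>k. Suc k < q \<Longrightarrow> w ! k \<notin> S \<Longrightarrow> w ! Suc k \<notin> S \<Longrightarrow> k = 0 \<or> w ! (k - 1) \<in> S"
proof -
  show "w \<in> Cyc" and f: "(w ! 0, w ! 1) \<in> exceptional_pairs" and "w ! 2 \<in> S" "w ! (q - 1) \<in> S" using assms by (simp_all add: Z_def)
  have "(w ! 0, w ! 1) \<in> outer_pairs" using f by (simp add: exceptional_pairs_def)
  then show "w ! 0 \<notin> S" "w ! 1 \<notin> S" using outer_pairs_D(1,2) by blast+
  fix k assume k: "Suc k < q" "w ! k \<notin> S" "w ! Suc k \<notin> S"
  then show "(w ! k, w ! Suc k) \<in> outer_pairs" "k = 0 \<or> w ! (k - 1) \<in> S" using assms unfolding Z_def mem_Collect_eq by blast+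
qed

text \<open>The first places of the runs of outer vertices, except for the run at the beginning of the list.\<close>

definition starts :: "nat set \<Rightarrow> nat set" where
  "starts I = {k \<in> {1..<q}. k \<notin> I \<and> k - 1 \<in> I}"

definition Sidx :: "'a list \<Rightarrow> nat set" where "Sidx w = {k. k < q \<and> w ! k \<in> S}"

text \<open>Each run is preceded by a core vertex, and the last core vertex precedes the run at the beginning.\<close>

lemma starts_count:
  assumes w: "w \<in> Z"
  shows "2 * card (starts (Sidx w)) + 2 + card {k \<in> {1..<q}. w ! k \<notin> S \<and> w ! (k - 1) \<notin> S} \<le> q"
    "card (starts (Sidx w)) + 1 \<le> card (Sidx w)"
    "card (starts (Sidx w)) + 1 + card {k \<in> {1..<q}. w ! k \<notin> S \<and> w ! (k - 1) \<notin> S} + card (Sidx w) = q"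
proof -
  note Z = Z_D[OF w]
  let ?I = "Sidx w" and ?sd = "{k \<in> {1..<q}. w ! k \<notin> S \<and> w ! (k - 1) \<notin> S}"
  have q0: "q - 1 < q" using q'(2) by simp
  have st: "k < q" "1 \<le> k" "w ! k \<notin> S" "w ! (k - 1) \<in> S" if "k \<in> starts ?I" for k
    using that by (auto simp: starts_def Sidx_def)
  have fin: "finite ?I" "finite (starts ?I)" "finite ?sd" by (auto simp: Sidx_def starts_def)
  have "{..<q} = {0} \<union> (starts ?I \<union> (?sd \<union> ?I))"
  proof (intro equalityI subsetI)
    fix k assume k: "k \<in> {..<q}"
    show "k \<in> {0} \<union> (starts ?I \<union> (?sd \<union> ?I))"
      using k by (cases "k = 0"; cases "w ! k \<in> S"; cases "w ! (k - 1) \<in> S") (auto simp: starts_def Sidx_def)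
  next
    fix k assume "k \<in> {0} \<union> (starts ?I \<union> (?sd \<union> ?I))"
    then show "k \<in> {..<q}" using q0 by (auto simp: starts_def Sidx_def)
  qed
  then have "q = card ({0} \<union> (starts ?I \<union> (?sd \<union> ?I)))" using card_lessThan[of q] by simp
  also have "\<dots> = card {0 :: nat} + card (starts ?I \<union> (?sd \<union> ?I))"
    by (rule card_Un_disjoint) (use fin Z(3) in \<open>auto simp: starts_def Sidx_def\<close>)
  also have "card (starts ?I \<union> (?sd \<union> ?I)) = card (starts ?I) + card (?sd \<union> ?I)"
    by (rule card_Un_disjoint) (use fin in \<open>auto simp: starts_def Sidx_def\<close>)
  also have "card (?sd \<union> ?I) = card ?sd + card ?I"
    by (rule card_Un_disjoint) (use fin in \<open>auto simp: Sidx_def\<close>)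
  finally have tot: "q = 1 + (card (starts ?I) + (card ?sd + card ?I))" by simp
  have "card (starts ?I) = card ((\<lambda>k. k - 1) ` starts ?I)"
  proof (rule card_image[symmetric], rule inj_onI)
    fix x y assume "x \<in> starts ?I" "y \<in> starts ?I" "x - 1 = y - 1"
    then show "x = y" using st(2)[of x] st(2)[of y] by linarith
  qed
  also have "\<dots> \<le> card (?I - {q - 1})"
  proof (rule card_mono)
    show "(\<lambda>k. k - 1) ` starts ?I \<subseteq> ?I - {q - 1}"
    proof
      fix j assume "j \<in> (\<lambda>k. k - 1) ` starts ?I"
      then obtain k where k: "k \<in> starts ?I" "j = k - 1" by blast
      then show "j \<in> ?I - {q - 1}" using st[OF k(1)] by (auto simp: Sidx_def)
    qed
  qed (use fin in simp)
  also have "\<dots> = card ?I - 1" using Z(6) q0 by (simp add: Sidx_def)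
  finally have "card (starts ?I) \<le> card ?I - 1" .
  moreover have "0 < card ?I"
  proof -
    have "q - 1 \<in> ?I" using Z(6) q0 by (simp add: Sidx_def)
    then show ?thesis using fin(1) card_gt_0_iff by blast
  qed
  ultimately show "card (starts ?I) + 1 \<le> card ?I" by linarith
  then show "2 * card (starts ?I) + 2 + card ?sd \<le> q" using tot by linarith
  show "card (starts ?I) + 1 + card ?sd + card ?I = q" using tot by linarith
qed

text \<open>A list with core places \<open>I\<close> is coded by one pair for each run of outer vertices: the run itself if it has two vertices,
  otherwise its vertex and the core vertex after it. Coding an outer edge as a whole matters because a vertex may lie on
  many outer edges.\<close>

definition codes :: "nat set \<Rightarrow> nat \<Rightarrow> ('a \<times> 'a) set" where
  "codes I k = (if k = 0 then exceptional_pairs else if k \<in> I then (\<lambda>s. (s, s)) ` S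
     else if k - 1 \<in> I then outer_pairs \<union> (V - S) \<times> S else {(undefined, undefined)})"

definition decode :: "nat set \<Rightarrow> ('a \<times> 'a) list \<Rightarrow> nat \<Rightarrow> 'a" where
  "decode I c k = (if k = 0 \<or> k \<in> I \<or> k - 1 \<in> I then fst (c ! k) else snd (c ! (k - 1)))"

lemma card_Z_pattern:
  assumes t: "card R \<le> n" "1 \<le> n" and p: "card (starts I) \<le> p"
  shows "card {w \<in> Z. Sidx w = I} \<le> 2 * card R * ((a + 4) ^ q * n ^ p)"
proof -
  let ?D = "{c. length c = q \<and> (\<forall>k<q. c ! k \<in> codes I k)}"
  define b where "b = (\<lambda>k. if k = 0 then 2 * card R else (a + 4) * (if k \<notin> I \<and> k - 1 \<in> I then n else 1))"
  have q0: "0 < q" using q'(2) by simp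
  have step: "finite (codes I k) \<and> card (codes I k) \<le> b k" for k
  proof -
    have "card exceptional_pairs \<le> 2 * card R" by (rule card_exceptional_pairs)
    moreover have "finite exceptional_pairs" by (rule finite_subset[OF _ fin_outer_pairs]) (auto simp: exceptional_pairs_def)
    moreover have "card ((\<lambda>s. (s, s)) ` S) \<le> a" using card_image_le[OF fin_S, of "\<lambda>s. (s, s)"] cS by simp
    moreover have "card (outer_pairs \<union> (V - S) \<times> S) \<le> (a + 4) * n"
    proof -
      have "card (outer_pairs \<union> (V - S) \<times> S) \<le> card outer_pairs + card ((V - S) \<times> S)" by (rule card_Un_le)
      also have "\<dots> \<le> (2 * card R + 2) + n * a"
      proof (intro add_mono card_outer_pairs)
        have "card (V - S) \<le> n" using card_mono[OF finV, of "V - S"] by blast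
        then show "card ((V - S) \<times> S) \<le> n * a" by (simp add: card_cartesian_product cS)
      qed
      also have "\<dots> \<le> (a + 4) * n" using t by (simp add: algebra_simps)
      finally show ?thesis .
    qed
    ultimately show ?thesis using finV unfolding codes_def b_def by (cases "k = 0"; cases "k \<in> I"; cases "k - 1 \<in> I") auto
  qed
  have fD: "finite ?D \<and> card ?D \<le> (\<Prod>k<q. b k)"
    by (rule card_lists_step[of q "\<lambda>k _. codes I k" b]) (rule step)
  have "card {w \<in> Z. Sidx w = I} \<le> card ?D"
  proof (rule surj_card_le)
    show "finite ?D" using fD by blast
    show "{w \<in> Z. Sidx w = I} \<subseteq> (\<lambda>c. map (decode I c) [0..<q]) ` ?D"
    proof
      fix w assume "w \<in> {w \<in> Z. Sidx w = I}"
      then have w: "w \<in> Z" "Sidx w = I" by auto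
      note Z = Z_D[OF w(1)]
      note D = CycD[OF Z(1)]
      have I: "k \<in> I \<longleftrightarrow> k < q \<and> w ! k \<in> S" for k using w(2) by (auto simp: Sidx_def)
      define c where "c = map (\<lambda>k. if k = 0 then (w ! 0, w ! 1) else if k \<in> I then (w ! k, w ! k)
        else if k - 1 \<in> I then (w ! k, w ! Suc k) else (undefined, undefined)) [0..<q]"
      have ck: "c ! k = (if k = 0 then (w ! 0, w ! 1) else if k \<in> I then (w ! k, w ! k)
        else if k - 1 \<in> I then (w ! k, w ! Suc k) else (undefined, undefined))" if "k < q" for k
        using that by (simp add: c_def)
      have "c \<in> ?D"
      proof (intro CollectI conjI allI impI)
        show "length c = q" by (simp add: c_def)
        fix k assume k: "k < q"
        show "c ! k \<in> codes I k"
        proof (cases "k = 0 \<or> k \<in> I \<or> k - 1 \<notin> I")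
          case True
          then show ?thesis using Z(2) I[of k] unfolding ck[OF k] codes_def by auto
        next
          case False
          then have kk: "k \<noteq> 0" "k \<notin> I" "k - 1 \<in> I" by auto
          have o: "w ! k \<notin> S" using kk(2) k I by simp
          have "k \<noteq> q - 1" using o Z(6) by blast
          then have sk: "Suc k < q" using k by simp
          have "(w ! k, w ! Suc k) \<in> outer_pairs \<union> (V - S) \<times> S"
          proof (cases "w ! Suc k \<in> S")
            case True
            then show ?thesis using o D(4)[OF k] by (intro UnI2 SigmaI DiffI)
          next
            case False
            then show ?thesis by (intro UnI1 Z(7)[OF sk o])
          qed
          then show ?thesis using kk unfolding ck[OF k] codes_def by simp
        qed
      qed
      moreover have "w = map (decode I c) [0..<q]"
      proof (rule nth_equalityI)
        show "length w = length (map (decode I c) [0..<q])" using D(1) by simp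
        fix k assume "k < length w"
        then have k: "k < q" using D(1) by simp
        have "w ! k = decode I c k"
        proof (cases "k = 0 \<or> k \<in> I \<or> k - 1 \<in> I")
          case True
          then show ?thesis unfolding decode_def ck[OF k] by auto
        next
          case False
          then have kk: "k \<noteq> 0" "k \<notin> I" "k - 1 \<notin> I" by auto
          have o: "w ! k \<notin> S" "w ! (k - 1) \<notin> S" using kk k I[of k] I[of "k - 1"] by auto
          have s: "Suc (k - 1) = k" "k - 1 < q" using kk(1) k by auto
          have "k - 1 = 0 \<or> w ! (k - 1 - 1) \<in> S" using Z(8)[of "k - 1"] s k o by simp
          moreover have "k - 1 - 1 < q" using k by simp
          ultimately have "k - 1 = 0 \<or> k - 1 - 1 \<in> I" using I[of "k - 1 - 1"] by blast
          then have "snd (c ! (k - 1)) = w ! Suc (k - 1)"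
            unfolding ck[OF s(2)] using kk(3) by (cases "k - 1 = 0") simp_all
          then have "snd (c ! (k - 1)) = w ! k" unfolding s(1) .
          then show ?thesis unfolding decode_def using False by simp
        qed
        then show "w ! k = map (decode I c) [0..<q] ! k" using k by simp
      qed
      ultimately show "w \<in> (\<lambda>c. map (decode I c) [0..<q]) ` ?D" by (rule rev_image_eqI)
    qed
  qed
  also have "\<dots> \<le> (\<Prod>k<q. b k)" using fD by blast
  also have "\<dots> = b 0 * (\<Prod>k\<in>{..<q} - {0}. b k)" using q0 by (intro prod.remove) auto
  also have "{..<q} - {0} = {1..<q}" by auto
  also have "(\<Prod>k\<in>{1..<q}. b k) \<le> (a + 4) ^ card {1..<q} * n ^ p"
  proof (rule prod_bound_count[of _ _ _ _ "\<lambda>k. k \<notin> I \<and> k - 1 \<in> I"])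
    show "card {k \<in> {1..<q}. k \<notin> I \<and> k - 1 \<in> I} \<le> p" using p by (simp add: starts_def)
  qed (use t in \<open>auto simp: b_def\<close>)
  also have "(a + 4) ^ card {1..<q} \<le> (a + 4) ^ q" by (rule power_increasing) auto
  finally show ?thesis by (simp add: b_def)
qed

text \<open>Lists with at most \<open>r - 2\<close> free places besides the exceptional edge.\<close>

definition Zf :: "'a list set" where "Zf = {w \<in> Z. card (starts (Sidx w)) \<le> r - 2}"
definition Zm :: "'a list set" where "Zm = {w \<in> Z. r - 1 \<le> card (starts (Sidx w))}"

lemma card_Zf:
  assumes t: "card R \<le> n" "1 \<le> n"
  shows "card Zf \<le> 2 ^ q * (2 * card R * ((a + 4) ^ q * n ^ (r - 2)))"
proof -
  let ?P = "{I \<in> Pow {..<q}. card (starts I) \<le> r - 2}"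
  have "Zf \<subseteq> (\<Union>I\<in>?P. {w \<in> Z. Sidx w = I})"
  proof
    fix w assume w: "w \<in> Zf"
    have "Sidx w \<in> Pow {..<q}" by (auto simp: Sidx_def)
    then have "Sidx w \<in> ?P" using w by (simp add: Zf_def)
    moreover have "w \<in> {w' \<in> Z. Sidx w' = Sidx w}" using w by (simp add: Zf_def)
    ultimately show "w \<in> (\<Union>I\<in>?P. {w \<in> Z. Sidx w = I})" by (rule UN_I)
  qed
  moreover have fZ: "finite Z" by (rule finite_subset[OF _ fin_cycs[of q]]) (auto simp: Z_def)
  ultimately have "card Zf \<le> card (\<Union>I\<in>?P. {w \<in> Z. Sidx w = I})" by (intro card_mono) auto
  also have "\<dots> \<le> (\<Sum>I\<in>?P. card {w \<in> Z. Sidx w = I})" by (rule card_UN_le) simp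
  also have "\<dots> \<le> (\<Sum>I\<in>?P. 2 * card R * ((a + 4) ^ q * n ^ (r - 2)))"
    by (rule sum_mono) (use card_Z_pattern[OF t] in auto)
  also have "\<dots> = card ?P * (2 * card R * ((a + 4) ^ q * n ^ (r - 2)))" by simp
  also have "card ?P \<le> 2 ^ q"
  proof -
    have "card ?P \<le> card (Pow {..<q})" by (rule card_mono) auto
    then show ?thesis by (simp add: card_Pow)
  qed
  finally show ?thesis by simp
qed

text \<open>The count of places leaves only one possibility: \<open>q\<close> is odd, there are \<open>r\<close> core vertices, and the exceptional edge is the
  only outer edge.\<close>

lemma Zm_D:
  assumes "w \<in> Zm"
  shows "q = 2 * r + 1" "card (Sidx w) \<le> r" "\<And>k. 2 \<le> k \<Longrightarrow> k < q \<Longrightarrow> w ! k \<notin> S \<Longrightarrow> w ! (k - 1) \<in> S"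
proof -
  have w: "w \<in> Z" and st: "r - 1 \<le> card (starts (Sidx w))" using assms by (auto simp: Zm_def)
  note Z = Z_D[OF w]
  note C = starts_count[OF w]
  let ?sd = "{k \<in> {1..<q}. w ! k \<notin> S \<and> w ! (k - 1) \<notin> S}"
  have sd1: "1 \<in> ?sd" using Z(3,4) q'(2) by simp
  have fsd: "finite ?sd" by simp
  have "card {1::nat} \<le> card ?sd" by (rule card_mono[OF fsd]) (use sd1 in simp)
  then have c1: "1 \<le> card ?sd" by simp
  have r1: "Suc (r - 1) = r" using r2 by simp
  show qq: "q = 2 * r + 1" using C(1) st c1 q'(1) r1 by linarith
  then have sd: "card ?sd = 1" using C(1) st c1 r1 by linarith
  show "card (Sidx w) \<le> r" using C(3) sd qq st r1 by linarith
  fix k assume k: "2 \<le> k" "k < q" "w ! k \<notin> S"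
  show "w ! (k - 1) \<in> S"
  proof (rule ccontr)
    assume "w ! (k - 1) \<notin> S"
    then have "{1, k} \<subseteq> ?sd" using sd1 k by auto
    then have "card {1, k} \<le> card ?sd" by (rule card_mono[OF fsd])
    then show False using sd k(1) by simp
  qed
qed

end

section \<open>Exchanging lists with the extremal graph\<close>

text \<open>Neighbours along the cycle, independently of root and direction.\<close>

definition cn :: "'a list \<Rightarrow> 'a \<Rightarrow> 'a \<Rightarrow> bool" where
  "cn v x y \<longleftrightarrow> (\<exists>i<length v. {x, y} = {v ! i, v ! (Suc i mod length v)})"

lemma cn_sym: "cn v x y \<Longrightarrow> cn v y x"
  by (simp add: cn_def insert_commute)

lemma cn_map:
  assumes "cn (map f v) x y"
  shows "\<exists>p p'. cn v p p' \<and> x = f p \<and> y = f p'"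
proof -
  obtain i where i: "i < length v" "{x, y} = {map f v ! i, map f v ! (Suc i mod length v)}"
    using assms by (auto simp: cn_def)
  have j: "Suc i mod length v < length v" by (rule mod_less_divisor[OF le_less_trans[OF le0 i(1)]])
  let ?p = "v ! i" and ?p' = "v ! (Suc i mod length v)"
  have c: "cn v ?p ?p'" using i(1) by (auto simp: cn_def)
  have "{x, y} = {f ?p, f ?p'}" using i j by simp
  then have "x = f ?p \<and> y = f ?p' \<or> x = f ?p' \<and> y = f ?p" by (auto simp: doubleton_eq_iff)
  then show ?thesis using c cn_sym[OF c] by blast
qed

context finish
begin

lemma cn_Cyc:
  assumes "v \<in> Cyc" "cn v x y"
  shows "adj x y" "x \<in> set v" "y \<in> set v"
proof -
  note D = CycD[OF assms(1)]
  obtain i where i: "i < q" "{x, y} = {v ! i, v ! (Suc i mod q)}" using assms(2) D(1) by (auto simp: cn_def)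
  have j: "Suc i mod q < q" using i(1) by (intro mod_less_divisor) simp
  have "x = v ! i \<and> y = v ! (Suc i mod q) \<or> x = v ! (Suc i mod q) \<and> y = v ! i"
    using i(2) by (auto simp: doubleton_eq_iff)
  moreover have "v ! i \<in> set v" "v ! (Suc i mod q) \<in> set v" using i(1) j D(1) by simp_all
  ultimately show "adj x y" "x \<in> set v" "y \<in> set v" using D(5)[OF i(1)] adj_sym by metis+
qed

text \<open>The situation in which \<open>z\<close> can be exchanged for \<open>s\<close>.\<close>

definition mainp :: "'a list \<Rightarrow> 'a \<Rightarrow> 'a \<Rightarrow> 'a \<Rightarrow> bool" where
  "mainp v y z s \<longleftrightarrow> v \<in> Cyc \<and> y \<in> R \<and> z \<notin> S \<and> (y, z) \<in> outer_pairs \<and> cn v y z \<and>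
     (\<forall>x x'. cn v x x' \<longrightarrow> {x, x'} = {y, z} \<or> x \<in> S \<or> x' \<in> S) \<and>
     (\<forall>x. (y, x) \<in> outer_pairs \<longrightarrow> x = z) \<and> s \<in> S \<and> s \<notin> set v \<and> \<not> adj y s"

definition E3 :: "'a list set" where "E3 = {v \<in> Cyc. \<exists>k<q. rotate k v \<in> Zm}"

lemma rotate_cn:
  assumes l: "length v = q" and c: "cn v x y"
  shows "cn (rotate k v) x y"
proof -
  obtain i where i: "i < q" "{x, y} = {v ! i, v ! (Suc i mod q)}" using c l by (auto simp: cn_def)
  have q0: "0 < q" using q'(2) by simp
  let ?i = "(i + (q - k mod q)) mod q"
  have e: "k mod q \<le> q" using q0 by (simp add: less_imp_le)
  have "(k + ?i) mod q = (k mod q + (i + (q - k mod q))) mod q" by (simp add: mod_simps)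
  also have "k mod q + (i + (q - k mod q)) = i + q" using e by simp
  also have "(i + q) mod q = i mod q" by (rule mod_add_self2)
  finally have a: "(k + ?i) mod q = i" using i(1) by simp
  have "(k + Suc ?i mod q) mod q = Suc ((k + ?i) mod q) mod q" by (simp add: mod_simps)
  then have b: "(k + Suc ?i mod q) mod q = Suc i mod q" using a by simp
  have lt: "?i < q" "Suc ?i mod q < q" using q0 by (intro mod_less_divisor; simp)+
  have "rotate k v ! ?i = v ! i" "rotate k v ! (Suc ?i mod q) = v ! (Suc i mod q)"
    using lt l a b by (simp_all add: nth_rotate)
  then show ?thesis unfolding cn_def using i(2) lt(1) l by (intro exI[of _ ?i]) simp
qed

lemma cn_rotate_iff:
  assumes l: "length v = q"
  shows "cn (rotate k v) x y \<longleftrightarrow> cn v x y"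
proof
  assume c: "cn (rotate k v) x y"
  have q0: "0 < q" using q'(2) by simp
  have e: "k mod q \<le> q" using q0 by (simp add: less_imp_le)
  have "rotate (q - k mod q) (rotate k v) = rotate ((q - k mod q + k) mod q) v"
    using l by (metis rotate_conv_mod rotate_rotate)
  moreover have "(q - k mod q + k) mod q = 0"
  proof -
    have "(q - k mod q + k) mod q = (q - k mod q + k mod q) mod q" by (simp add: mod_simps)
    then show ?thesis using e by simp
  qed
  ultimately have "rotate (q - k mod q) (rotate k v) = v" by simp
  then show "cn v x y" using rotate_cn[OF _ c, of "q - k mod q"] l by simp
qed (rule rotate_cn[OF l])

text \<open>The \<open>r < a\<close> core vertices on the list include all core neighbours of \<open>y\<close>, so an unused core vertex is not adjacent to it.\<close>

lemma E3_mainp: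
  assumes v: "v \<in> E3"
  shows "\<exists>y z s. mainp v y z s"
proof -
  obtain k where vC: "v \<in> Cyc" and k: "rotate k v \<in> Zm" using v by (auto simp: E3_def)
  define w where "w = rotate k v"
  have wm: "w \<in> Zm" using k by (simp add: w_def)
  have wZ: "w \<in> Z" using wm by (simp add: Zm_def)
  note Z = Z_D[OF wZ]
  note M = Zm_D[OF wm]
  note D = CycD[OF Z(1)]
  have lv: "length v = q" using CycD(1)[OF vC] .
  have q0: "0 < q" "1 < q" "q - 1 < q" "Suc (q - 1) = q" using q'(2) by auto
  have sets: "set w = set v" by (simp add: w_def)
  obtain y z where P: "{y, z} = {w ! 0, w ! 1}" "(y, z) \<in> outer_pairs" "y \<in> R" "\<And>x. (y, x) \<in> outer_pairs \<Longrightarrow> x = z"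
    "\<And>u v s. u \<in> S \<Longrightarrow> v \<in> S \<Longrightarrow> u \<noteq> v \<Longrightarrow> adj u y \<Longrightarrow> adj z v \<Longrightarrow> s \<in> S \<Longrightarrow> adj y s \<Longrightarrow> s = u \<or> s = v"
    using Z(2) by (rule exceptional_pairs_pendant) blast
  have cw: "cn w x x' \<longleftrightarrow> cn v x x'" for x x' unfolding w_def by (rule cn_rotate_iff[OF lv])
  have "card (set w \<inter> S) \<le> r"
  proof -
    have "set w \<inter> S \<subseteq> (!) w ` Sidx w" using D(1) by (auto simp: Sidx_def in_set_conv_nth)
    then have "card (set w \<inter> S) \<le> card (Sidx w)" by (rule surj_card_le[rotated]) (simp add: Sidx_def)
    then show ?thesis using M(2) by simp
  qed
  also have "r < a" using q M(1) by auto
  finally have "\<not> S \<subseteq> set w" using cS by (metis inf.absorb_iff2 less_irrefl)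
  then obtain s where s: "s \<in> S" "s \<notin> set w" by blast
  have inw: "w ! (q - 1) \<in> set w" "w ! 2 \<in> set w" using D(1) q'(2) by simp_all
  have ad: "adj (w ! (q - 1)) (w ! 0)" "adj (w ! 1) (w ! 2)"
  proof -
    show "adj (w ! (q - 1)) (w ! 0)" using D(5)[OF q0(3)] q0(4) by simp
    have "Suc 1 mod q = 2" using q'(2) by simp
    then show "adj (w ! 1) (w ! 2)" using D(5)[OF q0(2)] by simp
  qed
  have ne: "w ! (q - 1) \<noteq> w ! 2" using D(7)[OF q0(3), of 2] q'(2) by auto
  have nadj: "\<not> adj y s"
  proof
    assume ys: "adj y s"
    from P(1) have "y = w ! 0 \<and> z = w ! 1 \<or> y = w ! 1 \<and> z = w ! 0" by (auto simp: doubleton_eq_iff)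
    then have "s = w ! (q - 1) \<or> s = w ! 2"
    proof
      assume e: "y = w ! 0 \<and> z = w ! 1"
      show ?thesis by (rule P(5)[OF Z(6,5) ne _ _ s(1) ys]) (use e ad in auto)
    next
      assume e: "y = w ! 1 \<and> z = w ! 0"
      have "s = w ! 2 \<or> s = w ! (q - 1)"
        by (rule P(5)[OF Z(5,6) ne[symmetric] _ _ s(1) ys]) (use e ad adj_sym in auto)
      then show ?thesis by blast
    qed
    then show False using s(2) inw by auto
  qed
  have cyz: "cn w y z"
    unfolding cn_def using P(1) q0(1,2) D(1) by (intro exI[of _ 0]) simp
  have pairs: "{x, x'} = {y, z} \<or> x \<in> S \<or> x' \<in> S" if xx: "cn w x x'" for x x'
  proof -
    obtain i where i: "i < q" "{x, x'} = {w ! i, w ! (Suc i mod q)}" using xx D(1) by (auto simp: cn_def)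
    have "i = 0 \<or> w ! i \<in> S \<or> w ! (Suc i mod q) \<in> S"
    proof (cases "i = 0 \<or> i = q - 1")
      case True
      then show ?thesis using Z(6) by auto
    next
      case False
      then have "2 \<le> Suc i" "Suc i < q" using i(1) by auto
      then show ?thesis using M(3)[of "Suc i"] by auto
    qed
    then show ?thesis
    proof (elim disjE)
      assume "i = 0"
      then show ?thesis using i(2) P(1) q0(2) by simp
    next
      assume "w ! i \<in> S" then show ?thesis using i(2) by (auto simp: doubleton_eq_iff)
    next
      assume "w ! (Suc i mod q) \<in> S" then show ?thesis using i(2) by (auto simp: doubleton_eq_iff)
    qed
  qed
  have "z \<notin> S" using outer_pairs_D(2)[OF P(2)] by simp
  have "mainp v y z s"
    unfolding mainp_def
  proof (intro conjI allI impI)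
    show "cn v y z" using cyz unfolding cw .
    show "{x, x'} = {y, z} \<or> x \<in> S \<or> x' \<in> S" if "cn v x x'" for x x'
      by (rule pairs) (use that in \<open>simp only: cw\<close>)
    show "x = z" if "(y, x) \<in> outer_pairs" for x using that by (rule P(4))
    show "s \<notin> set v" using s(2) unfolding sets .
  qed (fact vC P(2,3) \<open>z \<notin> S\<close> s(1) nadj)+
  then show ?thesis by blast
qed

definition subst :: "'a \<Rightarrow> 'a \<Rightarrow> 'a list \<Rightarrow> 'a list" where
  "subst z s v = map (\<lambda>x. if x = z then s else x) v"

lemma mainp_D:
  assumes "mainp v y z s"
  shows "v \<in> Cyc" "y \<in> R" "z \<notin> S" "(y, z) \<in> outer_pairs" "cn v y z" "s \<in> S" "s \<notin> set v" "\<not> adj y s"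
    "y \<notin> S" "y \<noteq> z" "z \<noteq> s" "y \<noteq> s"
    "\<And>x x'. cn v x x' \<Longrightarrow> {x, x'} = {y, z} \<or> x \<in> S \<or> x' \<in> S" "\<And>x. (y, x) \<in> outer_pairs \<Longrightarrow> x = z"
proof -
  show m: "v \<in> Cyc" "y \<in> R" "z \<notin> S" "(y, z) \<in> outer_pairs" "cn v y z" "s \<in> S" "s \<notin> set v" "\<not> adj y s"
    using assms unfolding mainp_def by blast+
  show "y \<notin> S" "y \<noteq> z" using outer_pairs_D[OF m(4)] by blast+
  then show "z \<noteq> s" "y \<noteq> s" using m(3,6) by auto
  show "{x, x'} = {y, z} \<or> x \<in> S \<or> x' \<in> S" if "cn v x x'" for x x'
    using assms that unfolding mainp_def by blast
  show "x = z" if "(y, x) \<in> outer_pairs" for x using assms that unfolding mainp_def by blast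
qed

text \<open>After the substitution all consecutive pairs meet the core. The only such pair with an outer vertex that is not an edge of
  the graph is \<open>{y, s}\<close>, and the other neighbour of \<open>s\<close> along the cycle is a core vertex.\<close>

lemma subst_Hc:
  assumes m: "mainp v y z s"
  shows "subst z s v \<in> Hc" "cn (subst z s v) y s"
    "\<And>x x'. cn (subst z s v) x x' \<Longrightarrow> x \<notin> S \<Longrightarrow> \<not> adj x x' \<Longrightarrow> x = y \<and> x' = s"
    "\<And>x'. cn (subst z s v) s x' \<Longrightarrow> x' \<notin> S \<Longrightarrow> x' = y"
proof -
  let ?f = "\<lambda>x. if x = z then s else x"
  note P = mainp_D[OF m]
  note D = CycD[OF P(1)]
  have inj: "inj_on ?f (set v)" using P(7) by (auto simp: inj_on_def)
  have fV: "?f x \<in> V" if "x \<in> set v" for x using that D(3) P(6) SV by auto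
  have "cyc (hadj V S e0) (subst z s v)"
    unfolding cyc_nth
  proof (intro conjI allI impI)
    show "3 \<le> length (subst z s v)" using D(1) q'(2) by (simp add: subst_def)
    show "distinct (subst z s v)" using D(2) inj by (simp add: subst_def distinct_map)
    fix i assume "i < length (subst z s v)"
    then have i: "i < q" using D(1) by (simp add: subst_def)
    have j: "Suc i mod q < q" "i \<noteq> Suc i mod q" using i q'(2) by (auto simp: mod_Suc)
    let ?p = "v ! i" and ?p' = "v ! (Suc i mod q)"
    have mem: "?p \<in> set v" "?p' \<in> set v" using i j D(1) by simp_all
    have ne: "?f ?p \<noteq> ?f ?p'" using inj_onD[OF inj _ mem] D(7)[OF i j(1)] j(2) by blast
    have c: "cn v ?p ?p'" unfolding cn_def using i D(1) by (intro exI[of _ i]) simp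
    have "?f ?p \<in> S \<or> ?f ?p' \<in> S"
      using P(13)[OF c] P(3,6) by (auto simp: doubleton_eq_iff)
    then have "hadj V S e0 (?f ?p) (?f ?p')" using ne fV[OF mem(1)] fV[OF mem(2)] unfolding hadj_def by blast
    then show "hadj V S e0 (subst z s v ! i) (subst z s v ! (Suc i mod length (subst z s v)))"
      using i j D(1) by (simp add: subst_def)
  qed
  then show "subst z s v \<in> Hc" using D(1) by (simp add: cycs_def subst_def)
  show "cn (subst z s v) y s"
  proof -
    obtain i where i: "i < q" "{y, z} = {v ! i, v ! (Suc i mod q)}" using P(5) D(1) by (auto simp: cn_def)
    have j: "Suc i mod q < q" using i(1) by (intro mod_less_divisor) simp
    have "{?f y, ?f z} = ?f ` {y, z}" by (simp only: image_insert image_empty)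
    also have "\<dots> = ?f ` {v ! i, v ! (Suc i mod q)}" by (rule arg_cong[OF i(2)])
    also have "\<dots> = {?f (v ! i), ?f (v ! (Suc i mod q))}" by (simp only: image_insert image_empty)
    finally have "{?f y, ?f z} = {?f (v ! i), ?f (v ! (Suc i mod q))}" .
    moreover have "?f y = y" "?f z = s" using P(10) by simp_all
    ultimately have "{y, s} = {?f (v ! i), ?f (v ! (Suc i mod q))}" by (simp only:)
    then show ?thesis unfolding cn_def subst_def using i(1) j D(1) by (intro exI[of _ i]) simp
  qed
  show "x = y \<and> x' = s" if x: "cn (subst z s v) x x'" "x \<notin> S" "\<not> adj x x'" for x x'
  proof -
    from cn_map[OF x(1)[unfolded subst_def]] obtain p p' where p: "cn v p p'" "x = ?f p" "x' = ?f p'"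
      by (elim exE conjE)
    have pz: "p \<noteq> z" using p(2) x(2) P(6) by auto
    then have xp: "x = p" using p(2) by simp
    have pz': "p' = z"
    proof (rule ccontr)
      assume "p' \<noteq> z"
      then show False using p xp x(3) cn_Cyc(1)[OF P(1) p(1)] by simp
    qed
    have "{p, z} = {y, z}" using P(13)[OF p(1)] pz' P(3) x(2) xp by blast
    then show ?thesis using pz xp p(3) pz' by (auto simp: doubleton_eq_iff)
  qed
  show "x' = y" if x: "cn (subst z s v) s x'" "x' \<notin> S" for x'
  proof -
    from cn_map[OF x(1)[unfolded subst_def]] obtain p p' where p: "cn v p p'" "s = ?f p" "x' = ?f p'"
      by (elim exE conjE)
    have "p \<noteq> s" using cn_Cyc(2)[OF P(1) p(1)] P(7) by blast
    then have pz: "p = z" using p(2) by metis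
    have "p' \<noteq> z" using p(3) x(2) P(6) by auto
    then have xp: "x' = p'" using p(3) by simp
    have "{z, p'} = {y, z}" using P(13)[OF p(1)] pz P(3) x(2) xp by blast
    then show ?thesis using xp \<open>p' \<noteq> z\<close> by (auto simp: doubleton_eq_iff)
  qed
qed

definition \<Phi> :: "'a list \<Rightarrow> 'a list" where
  "\<Phi> v = (SOME c. \<exists>y z s. mainp v y z s \<and> c = subst z s v)"

lemma \<Phi>_mainp:
  assumes "v \<in> E3"
  obtains y z s where "mainp v y z s" "\<Phi> v = subst z s v"
proof -
  have "\<exists>c y z s. mainp v y z s \<and> c = subst z s v" using E3_mainp[OF assms] by blast
  then have "\<exists>y z s. mainp v y z s \<and> \<Phi> v = subst z s v" unfolding \<Phi>_def by (rule someI_ex)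
  then show ?thesis using that by blast
qed

text \<open>The pair \<open>{y, s}\<close> can be read off from the image, and \<open>z\<close> is the only outer partner of \<open>y\<close>.\<close>

lemma inj_\<Phi>: "inj_on \<Phi> E3"
proof (rule inj_onI)
  fix v v' assume v: "v \<in> E3" "v' \<in> E3" "\<Phi> v = \<Phi> v'"
  obtain y z s where m: "mainp v y z s" "\<Phi> v = subst z s v" by (rule \<Phi>_mainp[OF v(1)])
  obtain y' z' s' where m': "mainp v' y' z' s'" "\<Phi> v' = subst z' s' v'" by (rule \<Phi>_mainp[OF v(2)])
  note P = mainp_D[OF m(1)] note P' = mainp_D[OF m'(1)]
  have e: "subst z s v = subst z' s' v'" using v(3) m(2) m'(2) by simp
  have "cn (subst z' s' v') y s" using subst_Hc(2)[OF m(1)] e by simp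
  then have ys: "y = y'" "s = s'" using subst_Hc(3)[OF m'(1) _ P(9,8)] by blast+
  have "(y', z) \<in> outer_pairs" using P(4) ys by simp
  then have zz: "z = z'" by (rule P'(14))
  have back_subst: "map (\<lambda>x. if x = s then z else x) (subst z s u) = u" if "s \<notin> set u" for u
    unfolding subst_def map_map by (rule map_idI) (use that in auto)
  have "v = map (\<lambda>x. if x = s then z else x) (subst z s v)" using back_subst[OF P(7)] by simp
  also have "\<dots> = map (\<lambda>x. if x = s then z else x) (subst z s v')" using e ys zz by simp
  also have "\<dots> = v'" using back_subst[of v'] P'(7) ys by simp
  finally show "v = v'" .
qed

subsection \<open>The comparison\<close>

definition pick :: "'a \<Rightarrow> 'a list" where
  "pick y = (SOME ss. ss \<in> dlists S (q - r) \<and> \<not> adj y (hd ss))"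

lemma pick:
  assumes "y \<in> R"
  shows "pick y \<in> dlists S (q - r)" "\<not> adj y (pick y ! 0)"
proof -
  obtain s where s: "s \<in> S" "\<not> adj y s" using Wmax[of y] assms by (auto simp: R_def)
  have len: "1 \<le> q - r" "q - r \<le> card S" using q'(1,4) r2 cS by auto
  obtain us where us: "us \<in> dlists S (q - r)" "last us = s" by (rule list_with_last[OF fin_S s(1) len])
  have "rev us \<in> dlists S (q - r)" using us(1) by (simp add: dlists_def)
  moreover have "us \<noteq> []" using us(1) len(1) by (auto simp: dlists_def)
  then have "hd (rev us) = s" using us(2) by (simp add: hd_rev)
  ultimately have "\<exists>ss. ss \<in> dlists S (q - r) \<and> \<not> adj y (hd ss)" using s(2) by (intro exI[of _ "rev us"]) simp
  then have p: "pick y \<in> dlists S (q - r) \<and> \<not> adj y (hd (pick y))" unfolding pick_def by (rule someI_ex)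
  then show "pick y \<in> dlists S (q - r)" by simp
  have "pick y \<noteq> []" using p len(1) by (auto simp: dlists_def)
  then show "\<not> adj y (pick y ! 0)" using p by (simp add: hd_conv_nth)
qed

text \<open>Each of these lists uses the missing edge between its first two entries.\<close>

definition base :: "'a list set" where
  "base = (\<lambda>(y, ws). alt q r (y # ws) (pick y)) ` (R \<times> dlists W (r - 1))"

lemma base_D:
  assumes "c \<in> base"
  shows "c \<in> Hc" "c ! 0 \<in> R" "c ! 1 \<in> S" "c ! 2 \<in> W" "\<not> adj (c ! 0) (c ! 1)" "cn c (c ! 0) (c ! 1)" "cn c (c ! 1) (c ! 2)"
proof -
  obtain y ws where c: "c = alt q r (y # ws) (pick y)" "y \<in> R" "ws \<in> dlists W (r - 1)" using assms by (auto simp: base_def)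
  note p = pick[OF c(2)]
  have yw: "y # ws \<in> dlists (V - S) r"
    using c(2,3) WV r2 by (auto simp: dlists_def R_def)
  show H: "c \<in> Hc" unfolding c(1) by (rule alt_cyc[OF q'(1) r2 yw p(1) SV])
  have l: "length c = q" by (simp add: c(1))
  have q0: "0 < q" "1 < q" "2 < q" using q'(2) by auto
  have c0: "c ! 0 = y" using q0 r2 by (simp add: c(1) alt_nth)
  have c1: "c ! 1 = pick y ! 0" using q0 r2 by (simp add: c(1) alt_nth)
  have c2: "c ! 2 = ws ! 0" using q0 r2 by (simp add: c(1) alt_nth)
  show "c ! 0 \<in> R" using c0 c(2) by simp
  have "0 < length (pick y)" using p(1) q'(1) r2 by (auto simp: dlists_def)
  then have "pick y ! 0 \<in> set (pick y)" by simp
  then show "c ! 1 \<in> S" using p(1) c1 by (auto simp: dlists_def)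
  have "0 < length ws" using c(3) r2 by (auto simp: dlists_def)
  then have "ws ! 0 \<in> set ws" by simp
  then show "c ! 2 \<in> W" using c(3) c2 by (auto simp: dlists_def)
  show "\<not> adj (c ! 0) (c ! 1)" using p(2) c0 c1 by simp
  show "cn c (c ! 0) (c ! 1)" unfolding cn_def using l q0 by (intro exI[of _ 0]) simp
  have s1: "Suc 1 mod q = 2" using q0 by simp
  show "cn c (c ! 1) (c ! 2)"
    unfolding cn_def
  proof (intro exI[of _ 1] conjI)
    show "1 < length c" using l q0 by simp
    show "{c ! 1, c ! 2} = {c ! 1, c ! (Suc 1 mod length c)}" unfolding l s1 ..
  qed
qed

lemma card_base: "card base = card R * ffact (card W) (r - 1)"
proof -
  have "inj_on (\<lambda>(y, ws). alt q r (y # ws) (pick y)) (R \<times> dlists W (r - 1))"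
  proof (rule inj_onI)
    fix t t' assume t: "t \<in> R \<times> dlists W (r - 1)" "t' \<in> R \<times> dlists W (r - 1)"
      "(\<lambda>(y, ws). alt q r (y # ws) (pick y)) t = (\<lambda>(y, ws). alt q r (y # ws) (pick y)) t'"
    obtain y ws y' ws' where tt: "t = (y, ws)" "t' = (y', ws')" by (cases t, cases t')
    have l: "length (y # ws) = r" "length (y' # ws') = r" "length (pick y) = q - r" "length (pick y') = q - r"
      using t(1,2) r2 pick(1)[of y] pick(1)[of y'] unfolding tt by (auto simp: dlists_def)
    have e: "alt q r (y # ws) (pick y) = alt q r (y' # ws') (pick y')" using t(3) by (simp add: tt)
    have "y # ws = y' # ws'" by (rule alt_inj(1)[OF q'(1) r2 l e])
    then show "t = t'" by (simp add: tt)
  qed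
  then have "card base = card (R \<times> dlists W (r - 1))" unfolding base_def by (rule card_image)
  then show ?thesis by (simp add: card_cartesian_product card_dlists)
qed

lemma fin_Hc: "finite Hc" by (rule finite_cycs_hadj[OF finV])

text \<open>In a list of \<open>base\<close>, the core vertex that is not adjacent to its neighbour \<open>c ! 0\<close> has an outer vertex on its other side, in
  contrast to \<open>subst_Hc\<close>.\<close>

lemma gains: "base \<union> \<Phi> ` E3 \<subseteq> Hc - Cyc" "base \<inter> \<Phi> ` E3 = {}"
proof -
  have b: "c \<in> Hc - Cyc" if c: "c \<in> base" for c
  proof -
    note B = base_D[OF c]
    have "c \<notin> Cyc" using cn_Cyc(1)[of c "c ! 0" "c ! 1"] B(5,6) by blast
    then show ?thesis using B(1) by simp
  qed
  have p: "\<Phi> v \<in> Hc - Cyc" if v: "v \<in> E3" for v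
  proof -
    obtain y z s where m: "mainp v y z s" "\<Phi> v = subst z s v" by (rule \<Phi>_mainp[OF v])
    have "subst z s v \<notin> Cyc" using cn_Cyc(1)[of "subst z s v" y s] subst_Hc(2)[OF m(1)] mainp_D(8)[OF m(1)] by blast
    then show ?thesis using subst_Hc(1)[OF m(1)] m(2) by simp
  qed
  show "base \<union> \<Phi> ` E3 \<subseteq> Hc - Cyc" using b p by blast
  show "base \<inter> \<Phi> ` E3 = {}"
  proof (rule equals0I)
    fix c assume "c \<in> base \<inter> \<Phi> ` E3"
    then obtain v where c: "c \<in> base" "v \<in> E3" "c = \<Phi> v" by blast
    note B = base_D[OF c(1)]
    obtain y z s where m: "mainp v y z s" "\<Phi> v = subst z s v" by (rule \<Phi>_mainp[OF c(2)])
    have cs: "c = subst z s v" using c(3) m(2) by simp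
    have "c ! 0 \<notin> S" "c ! 2 \<notin> S" using B(2,4) W_S by (auto simp: R_def)
    have "cn (subst z s v) (c ! 0) (c ! 1)" using B(6) unfolding cs[symmetric] .
    from subst_Hc(3)[OF m(1) this \<open>c ! 0 \<notin> S\<close> B(5)] have e: "c ! 0 = y" "c ! 1 = s" by simp_all
    have "cn c s (c ! 2)" using B(7) unfolding e(2) .
    then have "cn (subst z s v) s (c ! 2)" unfolding cs[symmetric] .
    then have "c ! 2 = y" using \<open>c ! 2 \<notin> S\<close> by (rule subst_Hc(4)[OF m(1)])
    then show False using B(2,4) e(1) by (auto simp: R_def)
  qed
qed

text \<open>The lists of the main type cancel against their images under \<open>\<Phi>\<close>, and \<open>base\<close> pays for the others.\<close>

lemma Cyc_le_Hc:
  assumes small: "card E1 + q * card Zf \<le> card R * ffact (card W) (r - 1)"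
  shows "card Cyc \<le> card Hc"
proof -
  have fC: "finite Cyc" by (rule fin_cycs)
  have fE: "finite E1" "finite E3" "finite Zf"
    using fC by (auto simp: E1_def E3_def Zf_def Z_def)
  let ?Rot = "(\<lambda>(k, w). rotate (q - k) w) ` ({..<q} \<times> Zf)"
  have "Cyc - Hc \<subseteq> E1 \<union> (?Rot \<union> E3)"
  proof
    fix v assume v: "v \<in> Cyc - Hc"
    show "v \<in> E1 \<union> (?Rot \<union> E3)"
    proof (cases "v \<in> E1")
      case False
      then obtain k where k: "k < q" "rotate k v \<in> Z" using exceptional_rotation[of v] v by blast
      show ?thesis
      proof (cases "rotate k v \<in> Zm")
        case True
        then show ?thesis using v k(1) by (auto simp: E3_def)
      next
        case nm: False
        then have "rotate k v \<in> Zf" using k(2) by (auto simp: Zf_def Zm_def)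
        moreover have "v = rotate (q - k) (rotate k v)"
          using rotate_back[of k v] k(1) CycD(1)[of v] v by simp
        ultimately have "v \<in> ?Rot" using k(1) by (intro rev_image_eqI[of "(k, rotate k v)"]) auto
        then show ?thesis by blast
      qed
    qed blast
  qed
  then have "card (Cyc - Hc) \<le> card (E1 \<union> (?Rot \<union> E3))" by (rule card_mono[rotated]) (use fE in simp)
  also have "\<dots> \<le> card E1 + card (?Rot \<union> E3)" by (rule card_Un_le)
  also have "card (?Rot \<union> E3) \<le> card ?Rot + card E3" by (rule card_Un_le)
  also have "card ?Rot \<le> card ({..<q} \<times> Zf)" by (rule card_image_le) (use fE in simp)
  also have "\<dots> = q * card Zf" by (simp add: card_cartesian_product)
  finally have "card (Cyc - Hc) \<le> card E1 + q * card Zf + card E3" by simp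
  also have "\<dots> \<le> card base + card (\<Phi> ` E3)" unfolding card_base card_image[OF inj_\<Phi>] using small by simp
  also have "\<dots> = card (base \<union> \<Phi> ` E3)"
  proof (rule card_Un_disjoint[symmetric])
    show "finite base" using gains(1) fin_Hc finite_subset by blast
    show "finite (\<Phi> ` E3)" using fE by simp
  qed (rule gains(2))
  also have "\<dots> \<le> card (Hc - Cyc)" by (rule card_mono[OF _ gains(1)]) (use fin_Hc in simp)
  finally have le: "card (Cyc - Hc) \<le> card (Hc - Cyc)" .
  have "card Cyc = card (Cyc - Hc) + card (Cyc \<inter> Hc)"
    using card_Diff_subset_Int[of Cyc Hc] fC card_mono[OF fC, of "Cyc \<inter> Hc"] by simp
  moreover have "card Hc = card (Hc - Cyc) + card (Cyc \<inter> Hc)"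
    using card_Diff_subset_Int[of Hc Cyc] fin_Hc card_mono[OF fin_Hc, of "Cyc \<inter> Hc"] fC by (simp add: Int_commute)
  ultimately show ?thesis using le by linarith
qed

end

section \<open>The extremal number\<close>

lemma power_le_fl':
  assumes "n \<le> 4 * (w - k)"
  shows "n ^ k \<le> 4 ^ k * ffact w k"
  using assms
proof (induction k)
  case (Suc k)
  have "n \<le> 4 * (w - k)" using Suc.prems by simp
  then have "n ^ k \<le> 4 ^ k * ffact w k" by (rule Suc.IH)
  then have "n ^ k * n \<le> (4 ^ k * ffact w k) * (4 * (w - k))" by (rule mult_le_mono) (use Suc.prems in simp)
  then show ?case unfolding ffact_Suc by (simp add: ac_simps)
qed simp

text \<open>A graph with fewer closed lists than the alternating lists of the extremal graph needs no argument. Otherwise \<open>stability\<close>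
  applies with \<open>D\<close> so large that \<open>O(t\<^sup>r)\<close> lists are at most half of \<open>base\<close>; the other half is for the lists
  of order \<open>t n\<^bsup>r-2\<^esup>\<close>.\<close>

lemma core_bound:
  fixes q r a L :: nat
  assumes q: "q = 2 * r \<and> r \<le> a \<or> q = 2 * r + 1 \<and> r + 1 \<le> a" and r2: "2 \<le> r" and a: "a = L div 2"
  shows "\<exists>n0. \<forall>(V :: 'a set) adj. circ V adj L \<longrightarrow> n0 \<le> card V \<longrightarrow>
    card (cycs q adj) \<le> card (cycs q (gadj (extremal_graph (card V) L)))"
proof -
  define M where "M = 2 * (q + 1) * (2 ^ q * q * L ^ q + L ^ q + 2 ^ q * L ^ q) * (a + 3) ^ r"
  define c2 where "c2 = q * 2 ^ q * 2 * (a + 4) ^ q"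
  define P4 where "P4 = (4 :: nat) ^ (r - 1)"
  \<comment> \<open>\<open>M\<close> is the constant for \<open>E1\<close>; \<open>P4\<close> is lost when a falling factorial replaces a power of \<open>n\<close>\<close>
  define D where "D = 2 * P4 * M + 8"
  obtain n1 where n1: "\<And>(V :: 'a set) adj. circ V adj L \<Longrightarrow> n1 \<le> card V \<Longrightarrow>
    (if q = 2 * r then 2 else q) * (ffact (card V - a) r * ffact a (q - r)) \<le> card (cycs q adj) \<Longrightarrow>
    (\<exists>S\<subseteq>V. card S = a \<and> D * card {x \<in> V. \<exists>s\<in>S. \<not> adj x s} \<le> card V)"
    using stability[OF q r2 a, of D, where ?'a = 'a] by (auto simp: D_def)
  have qq: "q = 2 * r \<or> q = 2 * r + 1" using q by blast
  have a2: "2 \<le> a" using q r2 by auto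
  define n0 where "n0 = n1 + 8 * (2 * a + L + 12 + r) + 2 * P4 * c2 + 8"
  show ?thesis
  proof (rule exI[of _ n0], intro allI impI)
    fix V :: "'a set" and adj
    assume ci: "circ V adj L" and n0: "n0 \<le> card V"
    interpret circ V adj L by (rule ci)
    let ?n = "card V" and ?H = "card (cycs q (gadj (extremal_graph (card V) L)))"
    have hadj: "card (cycs q (hadj V S e)) = ?H" if "S \<subseteq> V" "card S = a" "extra_edge L (V - S) e" for S e
      by (rule card_cycs_hadj[OF finV refl that(1) _ that(3)]) (use that a n0 in \<open>auto simp: n0_def\<close>)
    have ex_edge: "\<exists>e. extra_edge L (V - S) e" if "S \<subseteq> V" "card S = a" for S
    proof (cases "even L")
      case True then show ?thesis by (intro exI[of _ "{}"]) (simp add: extra_edge_def)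
    next
      case False
      have "finite S" using that(1) finV finite_subset by blast
      then have "card (V - S) = ?n - a" using that by (simp add: card_Diff_subset)
      then have "2 \<le> card (V - S)" using n0 by (simp add: n0_def)
      then obtain e where "e \<subseteq> V - S" "card e = 2" by (metis obtain_subset_with_card_n)
      then show ?thesis using False by (intro exI[of _ e]) (simp add: extra_edge_def)
    qed
    show "card (cycs q adj) \<le> ?H"
    proof (cases "(if q = 2 * r then 2 else q) * (ffact (?n - a) r * ffact a (q - r)) \<le> card (cycs q adj)")
      case False
      have "a \<le> ?n" using n0 by (simp add: n0_def)
      then obtain S where S: "S \<subseteq> V" "card S = a" by (metis obtain_subset_with_card_n)
      obtain e where e: "extra_edge L (V - S) e" using ex_edge[OF S] by blast
      have "finite S" using S(1) finV finite_subset by blast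
      then have "card (V - S) = ?n - a" using S by (simp add: card_Diff_subset)
      then have "(if q = 2 * r then 2 else q) * (ffact (?n - a) r * ffact a (q - r)) \<le> card (cycs q (hadj V S e))"
        using card_hadj_lower[OF qq r2 finV S(1), of e] S(2) by simp
      then show ?thesis using False hadj[OF S e] by linarith
    next
      case True
      have "n1 \<le> ?n" using n0 by (simp add: n0_def)
      then obtain S where S: "S \<subseteq> V" "card S = a" and few: "D * card {x \<in> V. \<exists>s\<in>S. \<not> adj x s} \<le> ?n"
        using n1[OF ci _ True] by blast
      define W where "W = {w \<in> V - S. \<forall>s\<in>S. adj w s}"
      define R where "R = V - S - W"
      have fS: "finite S" "finite W" "finite R" using S(1) finV finite_subset by (auto simp: W_def R_def)
      have R_sub: "R \<subseteq> {x \<in> V. \<exists>s\<in>S. \<not> adj x s}" by (auto simp: R_def W_def)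
      have cR: "card R \<le> card {x \<in> V. \<exists>s\<in>S. \<not> adj x s}" by (rule card_mono[OF _ R_sub]) (use finV in simp)
      have DR: "D * card R \<le> ?n" using mult_le_mono2[OF cR, of D] few by linarith
      have R8: "8 * card R \<le> ?n"
      proof -
        have "8 * card R \<le> D * card R" by (rule mult_le_mono1) (simp add: D_def)
        then show ?thesis using DR by linarith
      qed
      have tot: "?n = a + card W + card R"
      proof -
        have "V = S \<union> (W \<union> R)" using S(1) by (auto simp: W_def R_def)
        then have "?n = card (S \<union> (W \<union> R))" by simp
        also have "\<dots> = card S + card (W \<union> R)"
          by (rule card_Un_disjoint) (use fS in \<open>auto simp: W_def R_def\<close>)
        also have "card (W \<union> R) = card W + card R"
          by (rule card_Un_disjoint) (use fS in \<open>auto simp: R_def\<close>)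
        finally show ?thesis using S(2) by simp
      qed
      have nbig: "8 * (2 * a + L + 12 + r) \<le> ?n" "2 * P4 * c2 \<le> ?n" "1 \<le> ?n" using n0 by (simp_all add: n0_def)
      note Rdef = R_def
      have Wl: "2 * a + L + 12 \<le> card W"
      proof -
        have "16 * a + 8 * L + 96 \<le> ?n" using nbig(1) by simp
        then show ?thesis using tot R8 by linarith
      qed
      interpret core V adj L S W a
      proof
        show "S \<subseteq> V" "card S = a" by (fact S)+
        show "a = L div 2" "2 \<le> a" by (fact a, fact a2)
        show "W \<subseteq> V - S" by (auto simp: W_def)
        show "adj w s" if "w \<in> W" "s \<in> S" for w s using that by (simp add: W_def)
        show "\<exists>s\<in>S. \<not> adj x s" if "x \<in> V - S" "x \<notin> W" for x using that by (simp add: W_def)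
        show "2 * a + L + 12 \<le> card W" by (fact Wl)
      qed
      have Req: "core.R V S W = R"
        unfolding R_def by (rule Rdef[symmetric])
      obtain e0 where e0: "extra_edge L (V - S) e0" "outer_pairs = {} \<or> (\<exists>e1 e2. e0 = {e1, e2} \<and> (e1, e2) \<in> outer_pairs)"
      proof (cases "outer_pairs = {}")
        case True
        then show ?thesis using that ex_edge[OF S] by blast
      next
        case False
        then obtain e1 e2 where e: "(e1, e2) \<in> outer_pairs" by auto
        have "extra_edge L (V - S) {e1, e2}"
          using outer_pairs_D[OF e] outer_pairs_odd[OF e] by (simp add: extra_edge_def)
        then show ?thesis using that[of "{e1, e2}"] e by blast
      qed
      interpret finish V adj L S W a q r e0
        by unfold_locales (use q r2 e0 in auto)
      define t where "t = card R"
      define N where "N = ?n ^ (r - 1)"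
      define F where "F = ffact (card W) (r - 1)"
      have r1: "r = Suc (r - 1)" "r - 1 = Suc (r - 2)" using r2 by simp_all
      have E: "2 * P4 * card E1 \<le> t * N"
      proof -
        have "card E1 \<le> M * t ^ r" using card_E1 unfolding Req M_def t_def by (simp add: mult.assoc)
        then have "2 * P4 * card E1 \<le> 2 * P4 * (M * t ^ r)" by (rule mult_le_mono2)
        also have "\<dots> \<le> D * t ^ r" by (simp add: D_def algebra_simps)
        also have "\<dots> = t * ((D * t) * t ^ (r - 2))"
        proof -
          have "t ^ r = t * (t * t ^ (r - 2))" using r1 by (metis power_Suc)
          then show ?thesis by (simp add: ac_simps)
        qed
        also have "\<dots> \<le> t * (?n * ?n ^ (r - 2))"
        proof (intro mult_le_mono2 mult_le_mono power_mono)
          show "D * t \<le> ?n" using DR by (simp add: t_def)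
          show "t \<le> ?n" using tot by (simp add: t_def)
        qed simp
        also have "?n * ?n ^ (r - 2) = N" unfolding N_def using r1 by (metis power_Suc)
        finally show ?thesis .
      qed
      have Zb: "2 * P4 * (q * card Zf) \<le> t * N"
      proof -
        have "card Zf \<le> 2 ^ q * (2 * t * ((a + 4) ^ q * ?n ^ (r - 2)))"
          using card_Zf[of] tot nbig(3) unfolding Req t_def by simp
        then have "2 * P4 * (q * card Zf) \<le> 2 * P4 * (q * (2 ^ q * (2 * t * ((a + 4) ^ q * ?n ^ (r - 2)))))"
          by (intro mult_le_mono2)
        also have "\<dots> = t * ((2 * P4 * c2) * ?n ^ (r - 2))" by (simp add: c2_def ac_simps)
        also have "\<dots> \<le> t * (?n * ?n ^ (r - 2))" by (intro mult_le_mono2 mult_le_mono1 nbig(2))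
        also have "?n * ?n ^ (r - 2) = N" unfolding N_def using r1 by (metis power_Suc)
        finally show ?thesis .
      qed
      have NF: "N \<le> P4 * F" unfolding N_def P4_def F_def
      proof (rule power_le_fl')
        have "16 * a + 8 * r \<le> ?n" using nbig(1) by simp
        then have "?n + 4 * (r - 1) \<le> 4 * card W" using tot R8 by linarith
        then show "?n \<le> 4 * (card W - (r - 1))" by (simp add: diff_mult_distrib2)
      qed
      have P4pos: "0 < P4" by (simp add: P4_def)
      have "2 * P4 * (card E1 + q * card Zf) \<le> 2 * (t * N)" using E Zb by (simp add: add_mult_distrib2)
      also have "\<dots> \<le> 2 * (t * (P4 * F))" by (intro mult_le_mono2 NF)
      also have "\<dots> = 2 * P4 * (t * F)" by simp
      finally have "card E1 + q * card Zf \<le> t * F" using P4pos by simp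
      then have "card Cyc \<le> card Hc" by (intro Cyc_le_Hc) (simp add: Req t_def F_def)
      then show ?thesis using hadj[OF S e0(1)] by simp
    qed
  qed
qed

lemma extremal_number:
  assumes q: "q = 2 * r \<and> r \<le> L div 2 \<or> q = 2 * r + 1 \<and> r + 1 \<le> L div 2" and r2: "2 \<le> r"
  shows "\<exists>n0. \<forall>n\<ge>n0. gen_ex n (cycle_graph q) (cycles_ge (L + 1)) = num_copies (cycle_graph q) (extremal_graph n L)"
proof -
  obtain n0 where n0: "\<And>(V :: nat set) adj. circ V adj L \<Longrightarrow> n0 \<le> card V \<Longrightarrow>
    card (cycs q adj) \<le> card (cycs q (gadj (extremal_graph (card V) L)))"
    using core_bound[OF q r2 refl, where ?'a = nat] by blast
  have L2: "2 \<le> L" "3 \<le> q" using q r2 by auto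
  show ?thesis
  proof (rule exI[of _ "n0 + L div 2 + 2"], intro allI impI)
    fix n assume n: "n0 + L div 2 + 2 \<le> n"
    show "gen_ex n (cycle_graph q) (cycles_ge (L + 1)) = num_copies (cycle_graph q) (extremal_graph n L)"
    proof (rule gen_ex_eq[OF L2(2,1)])
      show "L div 2 + 2 \<le> n" using n by simp
      fix G :: "nat sgraph"
      assume G: "simple_graph G" "card (verts G) = n" "\<And>vs. cyc (gadj G) vs \<Longrightarrow> length vs \<le> L"
      have "circ (verts G) (gadj G) L"
      proof
        show "finite (verts G)" using G(1) by (simp add: simple_graph_def)
        show "gadj G v u" if "gadj G u v" for u v using that gadj_sym[of G] by simp
        show "\<not> gadj G v v" for v using simple_graph_gadj(3)[OF G(1), of v v] by blast
        show "u \<in> verts G" if "gadj G u v" for u v by (rule simple_graph_gadj(1)[OF G(1) that])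
      qed (use G(3) L2 in auto)
      then show "card (cycs q (gadj G)) \<le> card (cycs q (gadj (extremal_graph n L)))"
        using n0[of "verts G" "gadj G"] G(2) n by simp
    qed
  qed
qed

theorem theorem1p2:
  fixes q L :: nat
  shows
    "(4 \<le> q \<and> q < L \<longrightarrow>
        (\<exists>n0. \<forall>n\<ge>n0. gen_ex n (cycle_graph q) (cycles_ge (L + 1)) =
                      num_copies (cycle_graph q) (extremal_graph n L))) \<and>
     (6 \<le> q \<and> even q \<and> L = q \<longrightarrow>
        (\<exists>n0. \<forall>n\<ge>n0. gen_ex n (cycle_graph q) (cycles_ge (L + 1)) =
                      num_copies (cycle_graph q) (extremal_graph n L)))"
proof (intro conjI impI)
  assume q: "4 \<le> q \<and> q < L"
  show "\<exists>n0. \<forall>n\<ge>n0. gen_ex n (cycle_graph q) (cycles_ge (L + 1)) = num_copies (cycle_graph q) (extremal_graph n L)"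
    by (rule extremal_number[of q "q div 2"]) (use q in presburger)+
next
  assume q: "6 \<le> q \<and> even q \<and> L = q"
  show "\<exists>n0. \<forall>n\<ge>n0. gen_ex n (cycle_graph q) (cycles_ge (L + 1)) = num_copies (cycle_graph q) (extremal_graph n L)"
    by (rule extremal_number[of q "q div 2"]) (use q in presburger)+
qed

end
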